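(* Let $d,N\in\mathbb{N}$ and $\beta\in(0,\infty)$. Let $V:\mathbb{R}\to[-b,\infty)$, $b\in[0,\infty)$, be continuously differentiable and symmetric ($V(-r)=V(r)$ for all $r$) with $\int_{\mathbb{R}}\exp(-V(r))\,dr<\infty$, and suppose that $\mathbb{V}'(x,\cdot)\in L^2(\mathcal{X};\mu)$ for all $x\in D$. Then $$\mathcal{E}(F,G):=\sum_{\varnothing\neq B\subset D}\ \sum_{x\in B}\int_{\Omega_B}\partial_xF\,\partial_xG\,d\mu_B,\qquad F,G\in\mathcal{D}=C_c^2(\mathcal{X}),$$ is a densely defined, positive definite (i.e. $\mathcal{E}(F,F)\ge0$), symmetric bilinear form which is closable on $L^2(\mathcal{X};\mu)$. Its closure $(\mathcal{E},D(\mathcal{E}))$ is a recurrent, hence in particular conservative, strongly local, strongly regular, symmetric Dirichlet form on $L^2(\mathcal{X};\mu)$.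
   Context: Setting (dynamical wetting model): $D:=\{1,\dots,N\}^d\subset\mathbb{Z}^d$, $\partial D:=\{x\in\mathbb{Z}^d\setminus D: |x-y|=1\text{ for some }y\in D\}$, $\overline D:=D\cup\partial D$. The space of interfaces is $\mathcal{X}:=[0,\infty)^D$; each $\phi\in\mathcal{X}$ is extended by $\phi(x)=0$ for $x\in\partial D$. The Hamiltonian is $H^V(\phi)=\frac12\sum_{x,y\in\overline D,\,|x-y|=1}V(\phi(x)-\phi(y))$, and $\mathbb{V}'(x,\phi):=\sum_{y\in\overline D,\,|x-y|=1}V'(\phi(x)-\phi(y))$ for $x\in D$. The density is $\varrho(\phi)=Z^{-1}\exp(-H^V(\phi))$ and $\mu$ is the probability measure on $\mathcal{X}$ given by $d\mu(\phi)=\varrho(\phi)\prod_{x\in D}\big(\beta\,d\delta_0(x)+d\phi_+(x)\big)$, where $d\phi_+(x)$ and $\delta_0(x)$ are Lebesgue measure on $[0,\infty)$ and the Dirac measure at $0$ in the coordinate $x$, and $Z$ is the normalizing constant. For $B\subset D$, $\Omega_B:=\{\phi\in\mathcal{X}:\phi(x)>0\text{ for }x\in B,\ \phi(x)=0\text{ for }x\in D\setminus B\}$ and $\mu_B$ is the restriction of $\mu$ to $\Omega_B$. $C_c^2(\mathcal{X})$ is the set of functions $F:\mathcal{X}\to\mathbb{R}$ with compact support in $\mathcal{X}$ that are twice continuously differentiable on $(0,\infty)^D$ and whose partial derivatives of order $\le2$ extend continuously to $\mathcal{X}$; $\partial_x$ is the partial derivative with respect to $\phi(x)$. A regular Dirichlet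 form $(\mathcal{G},D(\mathcal{G}))$ on $L^2(\mathcal{X};\mu)$ is called strongly regular if the topology induced by the intrinsic metric $d(\phi,\psi)=\sup\{F(\phi)-F(\psi): F\in D(\mathcal{G})\cap C_c^0(\mathcal{X}),\ \tfrac12\nu_{\langle F\rangle}\le\mu\}$ coincides with the Euclidean topology on $\mathcal{X}$. Here $C^0_c(\mathcal{X})$ is the set of continuous compactly supported functions on $\mathcal{X}$; $\nu_{\langle F\rangle}$ is the energy measure of $F$, determined by $\int G\,d\nu_{\langle F\rangle}=2\mathcal{G}(FG,F)-\mathcal{G}(F^2,G)$ for $G\in D(\mathcal{G})\cap C^0_c(\mathcal{X})$; and $\tfrac12\nu_{\langle F\rangle}\le\mu$ means that $\nu_{\langle F\rangle}$ is absolutely continuous with respect to $\mu$ with Radon–Nikodym derivative a.e. at most $2$. *)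

theory Defs
  imports "HOL-Analysis.Analysis"
begin

section \<open>Symmetric forms on \<open>L\<^sup>2\<close>\<close>

text \<open>
  Elements of \<open>L\<^sup>2(M)\<close> are represented by square-integrable functions, not by their classes, so
  equality in \<open>L\<^sup>2\<close> is equality almost everywhere.  A form is a pair of a domain \<open>D\<close> (a set of
  such functions) and a map \<open>E\<close>, of which only the values on \<open>D\<close> matter.
\<close>

definition L2 :: "'a measure \<Rightarrow> ('a \<Rightarrow> real) set" where
  "L2 M = {f \<in> borel_measurable M. integrable M (\<lambda>x. (f x)\<^sup>2)}"

definition l2_inner :: "'a measure \<Rightarrow> ('a \<Rightarrow> real) \<Rightarrow> ('a \<Rightarrow> real) \<Rightarrow> real" where
  "l2_inner M f g = (\<integral>x. f x * g x \<partial>M)"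

definition l2_norm :: "'a measure \<Rightarrow> ('a \<Rightarrow> real) \<Rightarrow> real" where
  "l2_norm M f = sqrt (l2_inner M f f)"

type_synonym 'a form = "('a \<Rightarrow> real) \<Rightarrow> ('a \<Rightarrow> real) \<Rightarrow> real"

definition densely_defined :: "'a measure \<Rightarrow> ('a \<Rightarrow> real) set \<Rightarrow> bool" where
  "densely_defined M D \<longleftrightarrow>
     D \<subseteq> L2 M \<and> (\<forall>f\<in>L2 M. \<forall>\<epsilon>>0. \<exists>g\<in>D. l2_norm M (\<lambda>x. f x - g x) < \<epsilon>)"

text \<open>The last conjunct says that \<open>E\<close> is well defined on the classes of functions in \<open>D\<close>.\<close>

definition bilinear_form :: "'a measure \<Rightarrow> ('a \<Rightarrow> real) set \<Rightarrow> 'a form \<Rightarrow> bool" where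
  "bilinear_form M D E \<longleftrightarrow>
     D \<subseteq> L2 M \<and> (\<lambda>_. 0) \<in> D \<and>
     (\<forall>f\<in>D. \<forall>g\<in>D. (\<lambda>x. f x + g x) \<in> D) \<and>
     (\<forall>f\<in>D. \<forall>c. (\<lambda>x. c * f x) \<in> D) \<and>
     (\<forall>f\<in>D. \<forall>g\<in>D. \<forall>h\<in>D. E (\<lambda>x. f x + g x) h = E f h + E g h) \<and>
     (\<forall>f\<in>D. \<forall>g\<in>D. \<forall>h\<in>D. E h (\<lambda>x. f x + g x) = E h f + E h g) \<and>
     (\<forall>f\<in>D. \<forall>g\<in>D. \<forall>c. E (\<lambda>x. c * f x) g = c * E f g \<and> E f (\<lambda>x. c * g x) = c * E f g) \<and>
     (\<forall>f\<in>D. \<forall>f'\<in>D. \<forall>g\<in>D. \<forall>g'\<in>D.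
        (AE x in M. f x = f' x) \<longrightarrow> (AE x in M. g x = g' x) \<longrightarrow> E f g = E f' g')"

definition symmetric_form :: "('a \<Rightarrow> real) set \<Rightarrow> 'a form \<Rightarrow> bool" where
  "symmetric_form D E \<longleftrightarrow> (\<forall>f\<in>D. \<forall>g\<in>D. E f g = E g f)"

definition positive_definite_form :: "('a \<Rightarrow> real) set \<Rightarrow> 'a form \<Rightarrow> bool" where
  "positive_definite_form D E \<longleftrightarrow> (\<forall>f\<in>D. E f f \<ge> 0)"

definition E_alpha :: "'a measure \<Rightarrow> 'a form \<Rightarrow> real \<Rightarrow> 'a form" where
  "E_alpha M E \<alpha> f g = E f g + \<alpha> * l2_inner M f g"

definition form_Cauchy :: "'a form \<Rightarrow> (nat \<Rightarrow> 'a \<Rightarrow> real) \<Rightarrow> bool" where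
  "form_Cauchy E F \<longleftrightarrow>
     (\<forall>\<epsilon>>0. \<exists>n0. \<forall>m\<ge>n0. \<forall>n\<ge>n0. E (\<lambda>x. F m x - F n x) (\<lambda>x. F m x - F n x) < \<epsilon>)"

definition closable :: "'a measure \<Rightarrow> ('a \<Rightarrow> real) set \<Rightarrow> 'a form \<Rightarrow> bool" where
  "closable M D E \<longleftrightarrow>
     (\<forall>F. (\<forall>n. F n \<in> D) \<longrightarrow> form_Cauchy E F \<longrightarrow> (\<lambda>n. l2_norm M (F n)) \<longlonglongrightarrow> 0 \<longrightarrow>
        (\<lambda>n. E (F n) (F n)) \<longlonglongrightarrow> 0)"

definition closed_form :: "'a measure \<Rightarrow> ('a \<Rightarrow> real) set \<Rightarrow> 'a form \<Rightarrow> bool" where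
  "closed_form M D E \<longleftrightarrow>
     (\<forall>F. (\<forall>n. F n \<in> D) \<longrightarrow> form_Cauchy (E_alpha M E 1) F \<longrightarrow>
        (\<exists>f\<in>D. (\<lambda>n. E_alpha M E 1 (\<lambda>x. F n x - f x) (\<lambda>x. F n x - f x)) \<longlonglongrightarrow> 0))"

definition approximates ::
  "'a measure \<Rightarrow> ('a \<Rightarrow> real) set \<Rightarrow> 'a form \<Rightarrow> (nat \<Rightarrow> 'a \<Rightarrow> real) \<Rightarrow> ('a \<Rightarrow> real) \<Rightarrow> bool" where
  "approximates M D E F f \<longleftrightarrow>
     (\<forall>n. F n \<in> D) \<and> form_Cauchy E F \<and> (\<lambda>n. l2_norm M (\<lambda>x. F n x - f x)) \<longlonglongrightarrow> 0"

definition closure_domain :: "'a measure \<Rightarrow> ('a \<Rightarrow> real) set \<Rightarrow> 'a form \<Rightarrow> ('a \<Rightarrow> real) set" where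
  "closure_domain M D E = {f \<in> L2 M. \<exists>F. approximates M D E F f}"

definition closure_form :: "'a measure \<Rightarrow> ('a \<Rightarrow> real) set \<Rightarrow> 'a form \<Rightarrow> 'a form" where
  "closure_form M D E f g =
     (THE c. \<forall>F G. approximates M D E F f \<longrightarrow> approximates M D E G g \<longrightarrow>
        (\<lambda>n. E (F n) (G n)) \<longlonglongrightarrow> c)"


section \<open>Dirichlet forms\<close>

text \<open>The third conjunct: \<open>D\<close> is a union of classes modulo almost everywhere equality.\<close>

definition symmetric_Dirichlet_form ::
  "'a measure \<Rightarrow> ('a \<Rightarrow> real) set \<Rightarrow> 'a form \<Rightarrow> bool" where
  "symmetric_Dirichlet_form M D E \<longleftrightarrow>
     bilinear_form M D E \<and> densely_defined M D \<and>
     (\<forall>f\<in>D. \<forall>g\<in>L2 M. (AE x in M. f x = g x) \<longrightarrow> g \<in> D) \<and>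
     symmetric_form D E \<and> positive_definite_form D E \<and> closed_form M D E \<and>
     (\<forall>f\<in>D. (\<lambda>x. min (max (f x) 0) 1) \<in> D \<and>
        E (\<lambda>x. min (max (f x) 0) 1) (\<lambda>x. min (max (f x) 0) 1) \<le> E f f)"

definition resolvent ::
  "'a measure \<Rightarrow> ('a \<Rightarrow> real) set \<Rightarrow> 'a form \<Rightarrow> real \<Rightarrow> ('a \<Rightarrow> real) \<Rightarrow> 'a \<Rightarrow> real" where
  "resolvent M D E \<alpha> f =
     (SOME u. u \<in> D \<and> (\<forall>g\<in>D. E_alpha M E \<alpha> u g = l2_inner M f g))"

text \<open>
  \<open>semigroup_value M D E t f u\<close> says \<open>T\<^sub>t f = u\<close> in \<open>L\<^sup>2(M)\<close>, where \<open>(T\<^sub>t)\<close> is the strongly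
  continuous contraction semigroup associated with the closed form \<open>(E, D)\<close>.  It is obtained from
  the resolvent \<open>(G\<^sub>\<alpha>)\<close> by Hille's exponential formula: \<open>T\<^sub>t f\<close> is the \<open>L\<^sup>2\<close>-limit of \<open>(\<alpha> G\<^sub>\<alpha>)\<^sup>n f\<close>
  with \<open>\<alpha> = n / t\<close>.
\<close>

definition semigroup_value ::
  "'a measure \<Rightarrow> ('a \<Rightarrow> real) set \<Rightarrow> 'a form \<Rightarrow> real \<Rightarrow> ('a \<Rightarrow> real) \<Rightarrow> ('a \<Rightarrow> real) \<Rightarrow> bool" where
  "semigroup_value M D E t f u \<longleftrightarrow> f \<in> L2 M \<and> u \<in> L2 M \<and>
     (\<lambda>n. l2_norm M (\<lambda>x.
        ((\<lambda>g y. real (Suc n) / t * resolvent M D E (real (Suc n) / t) g y) ^^ Suc n) f x - u x))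
     \<longlonglongrightarrow> 0"

text \<open>\<open>T\<^sub>t 1 = 1\<close> for all \<open>t > 0\<close>.  Only meant for finite measures, where \<open>1 \<in> L\<^sup>2(M)\<close>.\<close>

definition conservative :: "'a measure \<Rightarrow> ('a \<Rightarrow> real) set \<Rightarrow> 'a form \<Rightarrow> bool" where
  "conservative M D E \<longleftrightarrow> (\<forall>t>0. semigroup_value M D E t (\<lambda>_. 1) (\<lambda>_. 1))"

text \<open>
  The potential \<open>G f\<close>, the limit of \<open>G\<^sub>\<alpha> f\<close> as \<open>\<alpha>\<close> decreases to \<open>0\<close> (equivalently, the integral of
  \<open>T\<^sub>t f\<close> over \<open>t\<close> in \<open>(0,\<infinity>)\<close>), for nonnegative \<open>f \<in> L\<^sup>1(M)\<close>.  Such \<open>f\<close> need not be in \<open>L\<^sup>2(M)\<close>, but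
  its truncations are; for a Dirichlet form, \<open>G\<^sub>\<alpha> (min f k)\<close> is nonnegative, increasing in \<open>k\<close>, and
  decreasing in \<open>\<alpha>\<close>, so that both limits are suprema.
\<close>

definition potential ::
  "'a measure \<Rightarrow> ('a \<Rightarrow> real) set \<Rightarrow> 'a form \<Rightarrow> ('a \<Rightarrow> real) \<Rightarrow> 'a \<Rightarrow> ennreal" where
  "potential M D E f x =
     (SUP n. SUP k. ennreal (resolvent M D E (1 / real (Suc n)) (\<lambda>y. min (f y) (real k)) x))"

definition recurrent :: "'a measure \<Rightarrow> ('a \<Rightarrow> real) set \<Rightarrow> 'a form \<Rightarrow> bool" where
  "recurrent M D E \<longleftrightarrow>
     (\<forall>f. integrable M f \<longrightarrow> (AE x in M. f x \<ge> 0) \<longrightarrow>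
        (AE x in M. potential M D E f x = 0 \<or> potential M D E f x = \<infinity>))"


section \<open>Dirichlet forms on topological spaces\<close>

text \<open>Functions on the space \<open>T\<close> are total; their values off the carrier are irrelevant.\<close>

definition compact_support :: "'a topology \<Rightarrow> ('a \<Rightarrow> real) \<Rightarrow> bool" where
  "compact_support T f \<longleftrightarrow> compactin T (T closure_of {x \<in> topspace T. f x \<noteq> 0})"

definition Cc :: "'a topology \<Rightarrow> ('a \<Rightarrow> real) set" where
  "Cc T = {f. continuous_map T euclideanreal f \<and> compact_support T f}"

text \<open>The support of the measure with density \<open>f\<close>; it depends only on the class of \<open>f\<close>.\<close>

definition ae_support :: "'a topology \<Rightarrow> 'a measure \<Rightarrow> ('a \<Rightarrow> real) \<Rightarrow> 'a set" where
  "ae_support T M f = topspace T - \<Union>{U. openin T U \<and> (AE x in M. x \<in> U \<longrightarrow> f x = 0)}"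

definition strongly_local ::
  "'a topology \<Rightarrow> 'a measure \<Rightarrow> ('a \<Rightarrow> real) set \<Rightarrow> 'a form \<Rightarrow> bool" where
  "strongly_local T M D E \<longleftrightarrow>
     (\<forall>f\<in>D. \<forall>g\<in>D. compactin T (ae_support T M f) \<longrightarrow> compactin T (ae_support T M g) \<longrightarrow>
        (\<exists>U c. openin T U \<and> ae_support T M f \<subseteq> U \<and> (AE x in M. x \<in> U \<longrightarrow> g x = c)) \<longrightarrow>
        E f g = 0)"

text \<open>
  Regularity presupposes a locally compact separable metrizable space carrying a Radon measure of
  full support.
\<close>

definition regular_Dirichlet_form ::
  "'a topology \<Rightarrow> 'a measure \<Rightarrow> ('a \<Rightarrow> real) set \<Rightarrow> 'a form \<Rightarrow> bool" where
  "regular_Dirichlet_form T M D E \<longleftrightarrow>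
     locally_compact_space T \<and> separable_space T \<and> metrizable_space T \<and>
     space M = topspace T \<and> sets M = sigma_sets (topspace T) {U. openin T U} \<and>
     (\<forall>K. compactin T K \<longrightarrow> emeasure M K < \<infinity>) \<and>
     (\<forall>U. openin T U \<longrightarrow> U \<noteq> {} \<longrightarrow> emeasure M U > 0) \<and>
     symmetric_Dirichlet_form M D E \<and>
     (\<forall>f\<in>D. \<forall>\<epsilon>>0. \<exists>g \<in> D \<inter> Cc T. E_alpha M E 1 (\<lambda>x. f x - g x) (\<lambda>x. f x - g x) < \<epsilon>) \<and>
     (\<forall>f\<in>Cc T. \<forall>\<epsilon>>0. \<exists>g \<in> D \<inter> Cc T. \<forall>x\<in>topspace T. \<bar>f x - g x\<bar> < \<epsilon>)"

definition energy_measure ::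
  "'a topology \<Rightarrow> 'a measure \<Rightarrow> ('a \<Rightarrow> real) set \<Rightarrow> 'a form \<Rightarrow> ('a \<Rightarrow> real) \<Rightarrow> 'a measure \<Rightarrow> bool" where
  "energy_measure T M D E f \<nu> \<longleftrightarrow>
     space \<nu> = space M \<and> sets \<nu> = sets M \<and>
     (\<forall>g \<in> D \<inter> Cc T. integrable \<nu> g \<and>
        (\<integral>x. g x \<partial>\<nu>) = 2 * E (\<lambda>x. f x * g x) f - E (\<lambda>x. (f x)\<^sup>2) g)"

definition intrinsic_metric ::
  "'a topology \<Rightarrow> 'a measure \<Rightarrow> ('a \<Rightarrow> real) set \<Rightarrow> 'a form \<Rightarrow> 'a \<Rightarrow> 'a \<Rightarrow> ereal" where
  "intrinsic_metric T M D E x y =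
     Sup {ereal (f x - f y) | f. f \<in> D \<inter> Cc T \<and>
        (\<exists>\<nu>. energy_measure T M D E f \<nu> \<and> absolutely_continuous M \<nu> \<and>
             (AE z in M. RN_deriv M \<nu> z \<le> 2))}"

definition strongly_regular ::
  "'a topology \<Rightarrow> 'a measure \<Rightarrow> ('a \<Rightarrow> real) set \<Rightarrow> 'a form \<Rightarrow> bool" where
  "strongly_regular T M D E \<longleftrightarrow>
     regular_Dirichlet_form T M D E \<and>
     (\<forall>U. openin T U \<longleftrightarrow> U \<subseteq> topspace T \<and>
        (\<forall>x\<in>U. \<exists>\<epsilon>>0. \<forall>y\<in>topspace T. intrinsic_metric T M D E x y < ereal \<epsilon> \<longrightarrow> y \<in> U))"


section \<open>The dynamical wetting model\<close>

definition lattice_box :: "nat \<Rightarrow> (int ^ 'd) set" where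
  "lattice_box N = {x. \<forall>i. 1 \<le> x $ i \<and> x $ i \<le> int N}"

definition adjacent :: "int ^ 'd \<Rightarrow> int ^ 'd \<Rightarrow> bool" where
  "adjacent x y \<longleftrightarrow> norm (\<chi> i. real_of_int (x $ i - y $ i)) = 1"

definition box_boundary :: "nat \<Rightarrow> (int ^ 'd) set" where
  "box_boundary N = {x. x \<notin> lattice_box N \<and> (\<exists>y \<in> lattice_box N. adjacent x y)}"

definition box_closure :: "nat \<Rightarrow> (int ^ 'd) set" where
  "box_closure N = lattice_box N \<union> box_boundary N"

text \<open>
  An interface is an extensional function (\<open>undefined\<close> off \<open>lattice_box N\<close>), as in the library's product
  measures and product topologies; \<open>extend0\<close> realises the boundary condition.
\<close>

type_synonym 'd interface = "int ^ 'd \<Rightarrow> real"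

definition interfaces :: "nat \<Rightarrow> 'd::finite interface set" where
  "interfaces N = (\<Pi>\<^sub>E x\<in>lattice_box N. {0..})"

definition interface_topology :: "nat \<Rightarrow> 'd::finite interface topology" where
  "interface_topology N = product_topology (\<lambda>_. top_of_set {0..}) (lattice_box N)"

definition extend0 :: "nat \<Rightarrow> 'd::finite interface \<Rightarrow> 'd interface" where
  "extend0 N \<phi> x = (if x \<in> lattice_box N then \<phi> x else 0)"

definition hamiltonian :: "(real \<Rightarrow> real) \<Rightarrow> nat \<Rightarrow> 'd::finite interface \<Rightarrow> real" where
  "hamiltonian V N \<phi> =
     1 / 2 * (\<Sum>(x, y) \<in> {(x, y). x \<in> box_closure N \<and> y \<in> box_closure N \<and> adjacent x y}.
        V (extend0 N \<phi> x - extend0 N \<phi> y))"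

definition interaction_deriv :: "(real \<Rightarrow> real) \<Rightarrow> nat \<Rightarrow> int ^ 'd::finite \<Rightarrow> 'd interface \<Rightarrow> real" where
  "interaction_deriv V N x \<phi> =
     (\<Sum>y \<in> {y \<in> box_closure N. adjacent x y}. deriv V (extend0 N \<phi> x - extend0 N \<phi> y))"

text \<open>The measure \<open>\<beta> \<delta>\<^sub>0 + d\<phi>\<^sub>+\<close> on \<open>[0,\<infinity>)\<close>.\<close>

definition site_measure :: "real \<Rightarrow> real measure" where
  "site_measure \<beta> =
     measure_of {0..} (sets (restrict_space borel {0..}))
       (\<lambda>A. ennreal \<beta> * indicator A 0 + emeasure lborel A)"

definition reference_measure :: "real \<Rightarrow> nat \<Rightarrow> 'd::finite interface measure" where
  "reference_measure \<beta> N = (\<Pi>\<^sub>M x\<in>lattice_box N. site_measure \<beta>)"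

definition wetting_measure ::
  "(real \<Rightarrow> real) \<Rightarrow> real \<Rightarrow> nat \<Rightarrow> 'd::finite interface measure" where
  "wetting_measure V \<beta> N =
     (let R = reference_measure \<beta> N;
          Z = (\<integral>\<^sup>+\<phi>. ennreal (exp (- hamiltonian V N \<phi>)) \<partial>R)
      in density R (\<lambda>\<phi>. ennreal (exp (- hamiltonian V N \<phi>)) / Z))"

definition Omega :: "nat \<Rightarrow> (int ^ 'd) set \<Rightarrow> 'd::finite interface set" where
  "Omega N B = {\<phi> \<in> interfaces N. (\<forall>x\<in>B. \<phi> x > 0) \<and> (\<forall>x \<in> lattice_box N - B. \<phi> x = 0)}"

definition pd :: "int ^ 'd::finite \<Rightarrow> ('d interface \<Rightarrow> real) \<Rightarrow> 'd interface \<Rightarrow> real" where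
  "pd x F \<phi> = deriv (\<lambda>t. F (\<phi>(x := t))) (\<phi> x)"

text \<open>
  The zeroth-order condition (continuous extension of \<open>F\<close> itself) amounts to continuity of \<open>F\<close> on
  the whole space.  Note that \<open>Omega N (lattice_box N)\<close> is the open orthant, and that continuity of the
  derivatives there follows from the existence of continuous extensions.
\<close>

definition Cc2 :: "nat \<Rightarrow> ('d::finite interface \<Rightarrow> real) set" where
  "Cc2 N = {F \<in> Cc (interface_topology N).
     (\<forall>x \<in> lattice_box N.
        (\<forall>\<phi> \<in> Omega N (lattice_box N). (\<lambda>t. F (\<phi>(x := t))) differentiable at (\<phi> x)) \<and>
        (\<exists>g. continuous_map (interface_topology N) euclideanreal g \<and>
             (\<forall>\<phi> \<in> Omega N (lattice_box N). g \<phi> = pd x F \<phi>))) \<and>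
     (\<forall>x \<in> lattice_box N. \<forall>y \<in> lattice_box N.
        (\<forall>\<phi> \<in> Omega N (lattice_box N). (\<lambda>t. pd x F (\<phi>(y := t))) differentiable at (\<phi> y)) \<and>
        (\<exists>g. continuous_map (interface_topology N) euclideanreal g \<and>
             (\<forall>\<phi> \<in> Omega N (lattice_box N). g \<phi> = pd y (pd x F) \<phi>)))}"

text \<open>
  On \<open>Omega N B\<close> with \<open>x \<in> B\<close> the coordinate \<open>\<phi> x\<close> is positive, so \<open>pd x F\<close> is a genuine two-sided
  derivative within the space of interfaces; for \<open>F \<in> Cc2 N\<close> it exists there and agrees with the
  continuous extension of \<open>pd x F\<close> from the open orthant.
\<close>

definition wetting_form ::
  "(real \<Rightarrow> real) \<Rightarrow> real \<Rightarrow> nat \<Rightarrow> 'd::finite interface form" where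
  "wetting_form V \<beta> N F G =
     (\<Sum>B \<in> Pow (lattice_box N) - {{}}. \<Sum>x\<in>B.
        (\<integral>\<phi>. pd x F \<phi> * pd x G \<phi> \<partial>restrict_space (wetting_measure V \<beta> N) (Omega N B)))"

end

theory Submission
  imports Defs
begin

text \<open>
  Write the form as \<open>\<Sum>\<^sub>x \<langle>G\<^sub>x F, G\<^sub>x H\<rangle>\<close>, where \<open>G\<^sub>x F\<close> is \<open>\<partial>\<^sub>x F\<close> on \<open>\<phi> x > 0\<close> and \<open>0\<close> on \<open>\<phi> x = 0\<close>.  Integrating by
  parts in the coordinate \<open>x\<close> against functions \<open>\<eta> / \<rho>\<close> with \<open>\<eta>\<close> vanishing near \<open>\<phi> x = 0\<close> characterises
  the \<open>L\<^sup>2\<close> limits of \<open>G\<^sub>x F\<^sub>n\<close>, so each \<open>G\<^sub>x\<close> is closable, and the closure is given by weak gradients,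
  which obey the chain rule for the unit contraction.  The constant \<open>1\<close> is a limit of slowly
  varying cut-offs with energies tending to \<open>0\<close>; as the measure is finite, this gives recurrence and
  conservativeness.  The energy measure of \<open>F\<close> is twice the squared gradient times \<open>\<mu>\<close>.  Hence scaled
  bump functions show that intrinsic balls shrink to points, while a weak gradient of length at
  most \<open>1\<close> forces a continuous function to be \<open>1\<close>-Lipschitz for the \<open>l\<^sup>1\<close> distance, so that the intrinsic
  metric is at most that distance.
\<close>


section \<open>Square-integrable functions\<close>

text \<open>The reference measure charges every face of the orthant, and the density enters through
  bounds on compact boxes. Integration by parts is therefore arranged to leave plain Lebesgue
  measure in the coordinate \<open>x\<close>. It says nothing on the face, where limits are
  identified by another route: every approximating derivative is 0 there.

  Test functions are closed under composition with twice continuously differentiable functions,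
  while the unit contraction has kinks and the square has an unbounded derivative. Both are reached
  by limits of chain rules inside the closure, on representatives, with equality up to null sets.

  The energy inequality behind the intrinsic metric is at hand for test functions, and the squared
  gradient is merely integrable. Localising the inequality to a set takes a weighted
  \<open>L\<^sup>2\<close> space whose weight contains the squared gradient.

  The normalising constant is finite because one coordinate direction suffices: its bonds form
  chains ending at the boundary value 0 and can be integrated out site by site, and the remaining
  bonds are bounded by \<open>V \<ge> - b\<close>.\<close>

lemma L2_D:
  assumes "f \<in> L2 M"
  shows L2_measurable: "f \<in> borel_measurable M" and L2_integrable: "integrable M (\<lambda>x. (f x)\<^sup>2)"
  using assms by (auto simp: L2_def)

lemma L2_I: "f \<in> borel_measurable M \<Longrightarrow> integrable M (\<lambda>x. (f x)\<^sup>2) \<Longrightarrow> f \<in> L2 M"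
  by (auto simp: L2_def)

lemma L2_mult_integrable:
  assumes "f \<in> L2 M" "g \<in> L2 M" shows "integrable M (\<lambda>x. f x * g x)"
proof (rule Bochner_Integration.integrable_bound[where f="\<lambda>x. (f x)\<^sup>2 + (g x)\<^sup>2"])
  show "integrable M (\<lambda>x. (f x)\<^sup>2 + (g x)\<^sup>2)" using assms by (auto simp: L2_def)
  show "(\<lambda>x. f x * g x) \<in> borel_measurable M"
    using assms[THEN L2_measurable] by measurable
  have "\<bar>a * b\<bar> \<le> a\<^sup>2 + b\<^sup>2" for a b :: real
  proof -
    have "0 \<le> (\<bar>a\<bar> - \<bar>b\<bar>)\<^sup>2" "0 \<le> \<bar>a * b\<bar>" by simp_all
    then show ?thesis unfolding power2_diff abs_mult power2_abs by linarith
  qed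
  then show "AE x in M. norm (f x * g x) \<le> norm ((f x)\<^sup>2 + (g x)\<^sup>2)" by simp
qed

lemma L2_add: assumes "f \<in> L2 M" "g \<in> L2 M" shows "(\<lambda>x. f x + g x) \<in> L2 M"
  using assms integrable_mult_right[OF L2_mult_integrable[OF assms], of 2]
  by (auto simp: L2_def power2_sum mult.assoc)

lemma L2_cmult: assumes "f \<in> L2 M" shows "(\<lambda>x. c * f x) \<in> L2 M"
  using assms by (auto simp: L2_def power_mult_distrib)

lemma L2_minus: assumes "f \<in> L2 M" shows "(\<lambda>x. - f x) \<in> L2 M"
  using assms by (auto simp: L2_def)

lemma L2_diff: assumes "f \<in> L2 M" "g \<in> L2 M" shows "(\<lambda>x. f x - g x) \<in> L2 M"
  using L2_add[OF assms(1) L2_minus[OF assms(2)]] by simp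

lemma L2_0: "(\<lambda>x. 0) \<in> L2 M" by (auto simp: L2_def)

lemmas L2_intros = L2_add L2_cmult L2_minus L2_diff L2_0

lemma L2_bound:
  assumes "g \<in> L2 M" "f \<in> borel_measurable M" "AE x in M. \<bar>f x\<bar> \<le> \<bar>g x\<bar>" shows "f \<in> L2 M"
proof (rule L2_I)
  show "integrable M (\<lambda>x. (f x)\<^sup>2)"
    by (rule Bochner_Integration.integrable_bound[OF L2_integrable[OF assms(1)]])
       (use assms(2,3) in \<open>auto simp: abs_le_square_iff\<close>)
qed fact

lemma L2_AE_cong:
  assumes "f \<in> L2 M" "g \<in> borel_measurable M" "AE x in M. f x = g x" shows "g \<in> L2 M"
  by (rule L2_bound[OF assms(1,2)]) (use assms(3) in auto)

lemma L2_bounded_mult: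
  assumes "g \<in> L2 M" "f \<in> borel_measurable M" "AE x in M. \<bar>f x\<bar> \<le> C"
  shows "(\<lambda>x. f x * g x) \<in> L2 M"
proof (rule L2_bound[OF L2_cmult[of g M C]])
  show "(\<lambda>x. f x * g x) \<in> borel_measurable M" using L2_measurable[OF assms(1)] assms(2) by measurable
  show "AE x in M. \<bar>f x * g x\<bar> \<le> \<bar>C * g x\<bar>"
    using assms(3) by eventually_elim (auto simp: abs_mult intro!: mult_right_mono)
qed fact

lemma (in finite_measure) L2_const: "(\<lambda>x. c) \<in> L2 M"
  by (auto simp: L2_def)

lemma (in finite_measure) L2_bounded:
  assumes "f \<in> borel_measurable M" "AE x in M. \<bar>f x\<bar> \<le> C" shows "f \<in> L2 M"
  using L2_bounded_mult[OF L2_const[of 1] assms] by simp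

lemma (in finite_measure) L2_integrable1:
  assumes "f \<in> L2 M" shows "integrable M f"
  using L2_mult_integrable[OF assms L2_const[of 1]] by simp

section \<open>Inner product, norm and their inequalities\<close>

lemma l2_norm_nonneg: "l2_norm M f \<ge> 0"
  by (simp add: l2_norm_def l2_inner_def)

lemma l2_norm_sq: "(l2_norm M f)\<^sup>2 = (\<integral>x. (f x)\<^sup>2 \<partial>M)"
  by (simp add: l2_norm_def l2_inner_def power2_eq_square)

lemma l2_norm_sq': "(l2_norm M f)\<^sup>2 = l2_inner M f f"
  by (simp add: l2_norm_def l2_inner_def)

lemma l2_norm_AE_cong:
  assumes "AE x in M. f x = g x" "f \<in> borel_measurable M" "g \<in> borel_measurable M"
  shows "l2_norm M f = l2_norm M g"
  unfolding l2_norm_def l2_inner_def using assms by (intro arg_cong[where f=sqrt] integral_cong_AE) auto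

lemma l2_norm_AE_0: "AE x in M. f x = 0 \<Longrightarrow> l2_norm M f = 0"
  unfolding l2_norm_def l2_inner_def using integral_eq_zero_AE[of "\<lambda>x. f x * f x" M] by auto

lemma l2_norm_0_AE: "f \<in> L2 M \<Longrightarrow> l2_norm M f = 0 \<Longrightarrow> AE x in M. f x = 0"
  using integral_nonneg_eq_0_iff_AE[of M "\<lambda>x. (f x)\<^sup>2"] l2_norm_sq[of M f] by (simp add: L2_def)

lemma l2_inner_commute: "l2_inner M f g = l2_inner M g f"
  by (simp add: l2_inner_def mult.commute)

lemma l2_inner_add_left: "f \<in> L2 M \<Longrightarrow> g \<in> L2 M \<Longrightarrow> h \<in> L2 M \<Longrightarrow>
   l2_inner M (\<lambda>x. f x + g x) h = l2_inner M f h + l2_inner M g h"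
  by (simp add: l2_inner_def distrib_right L2_mult_integrable)

lemma l2_inner_cmult_left: "l2_inner M (\<lambda>x. c * f x) h = c * l2_inner M f h"
  by (simp add: l2_inner_def mult.assoc)

lemma l2_inner_cmult_right: "l2_inner M h (\<lambda>x. c * f x) = c * l2_inner M h f"
  by (simp add: l2_inner_def mult.left_commute)

lemma l2_inner_diff_left: "f \<in> L2 M \<Longrightarrow> g \<in> L2 M \<Longrightarrow> h \<in> L2 M \<Longrightarrow>
   l2_inner M (\<lambda>x. f x - g x) h = l2_inner M f h - l2_inner M g h"
  by (simp add: l2_inner_def left_diff_distrib L2_mult_integrable)

lemma l2_inner_add_right: "f \<in> L2 M \<Longrightarrow> g \<in> L2 M \<Longrightarrow> h \<in> L2 M \<Longrightarrow>
   l2_inner M h (\<lambda>x. f x + g x) = l2_inner M h f + l2_inner M h g"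
  by (simp add: l2_inner_def distrib_left L2_mult_integrable)

lemma l2_inner_diff_right: "f \<in> L2 M \<Longrightarrow> g \<in> L2 M \<Longrightarrow> h \<in> L2 M \<Longrightarrow>
   l2_inner M h (\<lambda>x. f x - g x) = l2_inner M h f - l2_inner M h g"
  by (simp add: l2_inner_def right_diff_distrib L2_mult_integrable)

lemma l2_inner_AE_cong:
  assumes "AE x in M. f x = f' x" "AE x in M. g x = g' x"
    "f \<in> borel_measurable M" "f' \<in> borel_measurable M" "g \<in> borel_measurable M" "g' \<in> borel_measurable M"
  shows "l2_inner M f g = l2_inner M f' g'"
  unfolding l2_inner_def using assms by (intro integral_cong_AE) auto

text \<open>The discriminant argument behind Cauchy-Schwarz, for \<open>l2_inner\<close> and for
  \<open>E_alpha\<close> alike. The case \<open>c = 0\<close> matters for forms with a nontrivial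
  kernel, where \<open>E g g = 0\<close> has to force \<open>E f g = 0\<close>.\<close>

lemma quadratic_discr:
  fixes a b c :: real
  assumes "\<And>t. a + 2 * t * b + t\<^sup>2 * c \<ge> 0" "c \<ge> 0" shows "b\<^sup>2 \<le> a * c"
proof (cases "c = 0")
  case False
  \<comment> \<open>The value at the minimiser \<open>t = - b / c\<close>, multiplied by
    \<open>c\<close> to clear the denominator.\<close>
  have "0 \<le> (a + 2 * (- b / c) * b + (- b / c)\<^sup>2 * c) * c"
    using assms(1)[of "-b/c"] assms(2) by (intro mult_nonneg_nonneg)
  also have "\<dots> = a * c - b\<^sup>2" using False by (simp add: field_simps power2_eq_square)
  finally show ?thesis by simp
next
  case True
  have "b = 0"
  proof (rule ccontr)
    assume "b \<noteq> 0"
    \<comment> \<open>This \<open>t\<close> makes \<open>a + 2 * t * b\<close> equal to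
      \<open>-1\<close>.\<close>
    then show False using assms(1)[of "-(a+1)/(2*b)"] True by (simp add: field_simps)
  qed
  then show ?thesis using True by simp
qed

lemma l2_CS:
  assumes "f \<in> L2 M" "g \<in> L2 M"
  shows "\<bar>l2_inner M f g\<bar> \<le> l2_norm M f * l2_norm M g"
proof -
  have "(l2_inner M f g)\<^sup>2 \<le> l2_inner M f f * l2_inner M g g"
  proof (rule quadratic_discr)
    fix t
    have "0 \<le> l2_inner M (\<lambda>x. f x + t * g x) (\<lambda>x. f x + t * g x)" by (simp add: l2_inner_def)
    also have "\<dots> = l2_inner M f f + 2 * t * l2_inner M f g + t\<^sup>2 * l2_inner M g g"
      using assms by (simp add: l2_inner_add_left l2_inner_add_right l2_inner_cmult_left L2_intros
        l2_inner_cmult_right l2_inner_commute[of M g f] algebra_simps power2_eq_square)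
    finally show "0 \<le> l2_inner M f f + 2 * t * l2_inner M f g + t\<^sup>2 * l2_inner M g g" .
  qed (simp add: l2_inner_def)
  also have "\<dots> = (l2_norm M f * l2_norm M g)\<^sup>2" by (simp add: power_mult_distrib l2_norm_sq')
  finally show ?thesis using l2_norm_nonneg by (metis abs_le_square_iff abs_of_nonneg mult_nonneg_nonneg)
qed

lemma l2_triangle:
  assumes "f \<in> L2 M" "g \<in> L2 M"
  shows "l2_norm M (\<lambda>x. f x + g x) \<le> l2_norm M f + l2_norm M g"
proof (rule power2_le_imp_le)
  have "(l2_norm M (\<lambda>x. f x + g x))\<^sup>2 = (l2_norm M f)\<^sup>2 + 2 * l2_inner M f g + (l2_norm M g)\<^sup>2"
    using assms by (simp add: l2_norm_sq' l2_inner_add_left l2_inner_add_right L2_add l2_inner_commute[of M g f])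
  also have "\<dots> \<le> (l2_norm M f + l2_norm M g)\<^sup>2"
    using l2_CS[OF assms] by (simp add: power2_sum)
  finally show "(l2_norm M (\<lambda>x. f x + g x))\<^sup>2 \<le> (l2_norm M f + l2_norm M g)\<^sup>2" .
qed (simp add: l2_norm_nonneg)

lemma l2_norm_cmult: "l2_norm M (\<lambda>x. c * f x) = \<bar>c\<bar> * l2_norm M f"
  by (simp add: l2_norm_def l2_inner_cmult_left l2_inner_cmult_right real_sqrt_mult flip: mult.assoc)

lemma l2_norm_minus_commute: "l2_norm M (\<lambda>x. f x - g x) = l2_norm M (\<lambda>x. g x - f x)"
  unfolding l2_norm_def l2_inner_def by (intro arg_cong[where f=sqrt] Bochner_Integration.integral_cong) (auto simp: algebra_simps)

lemma l2_triangle3: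
  assumes "f \<in> L2 M" "g \<in> L2 M" "h \<in> L2 M"
  shows "l2_norm M (\<lambda>x. f x - h x) \<le> l2_norm M (\<lambda>x. f x - g x) + l2_norm M (\<lambda>x. g x - h x)"
  using l2_triangle[OF L2_diff[OF assms(1,2)] L2_diff[OF assms(2,3)]] by simp

lemma l2_norm_mono:
  assumes "g \<in> L2 M" "f \<in> borel_measurable M" "AE x in M. \<bar>f x\<bar> \<le> \<bar>g x\<bar>"
  shows "l2_norm M f \<le> l2_norm M g"
proof (rule power2_le_imp_le)
  show "(l2_norm M f)\<^sup>2 \<le> (l2_norm M g)\<^sup>2" unfolding l2_norm_sq
    using L2_bound[OF assms] assms by (intro integral_mono_AE) (auto simp: L2_def abs_le_square_iff)
qed (simp add: l2_norm_nonneg)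

lemma l2_norm_bounded_mult:
  assumes "g \<in> L2 M" "f \<in> borel_measurable M" "AE x in M. \<bar>f x\<bar> \<le> C" "C \<ge> 0"
  shows "l2_norm M (\<lambda>x. f x * g x) \<le> C * l2_norm M g"
proof -
  have "l2_norm M (\<lambda>x. f x * g x) \<le> l2_norm M (\<lambda>x. C * g x)"
    using assms L2_measurable[OF assms(1)]
    by (intro l2_norm_mono L2_cmult) (auto simp: abs_mult elim!: eventually_mono intro!: mult_right_mono)
  then show ?thesis using assms(4) by (simp add: l2_norm_cmult)
qed

section \<open>Convergence in the norm and completeness\<close>

lemma l2_norm_tendsto_add:
  assumes "\<And>n. F n \<in> L2 M" "\<And>n. G n \<in> L2 M" "f \<in> L2 M" "g \<in> L2 M"
    "(\<lambda>n. l2_norm M (\<lambda>x. F n x - f x)) \<longlonglongrightarrow> 0" "(\<lambda>n. l2_norm M (\<lambda>x. G n x - g x)) \<longlonglongrightarrow> 0"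
  shows "(\<lambda>n. l2_norm M (\<lambda>x. (F n x + G n x) - (f x + g x))) \<longlonglongrightarrow> 0"
proof (rule real_tendsto_sandwich[OF _ _ tendsto_const])
  show "(\<lambda>n. l2_norm M (\<lambda>x. F n x - f x) + l2_norm M (\<lambda>x. G n x - g x)) \<longlonglongrightarrow> 0"
    using tendsto_add[OF assms(5,6)] by simp
  show "\<forall>\<^sub>F n in sequentially. l2_norm M (\<lambda>x. F n x + G n x - (f x + g x))
     \<le> l2_norm M (\<lambda>x. F n x - f x) + l2_norm M (\<lambda>x. G n x - g x)"
    using l2_triangle[OF L2_diff[OF assms(1,3)] L2_diff[OF assms(2,4)]]
    by (simp add: algebra_simps)
qed (simp add: l2_norm_nonneg)

lemma l2_norm_tendsto_cmult:
  assumes "(\<lambda>n. l2_norm M (\<lambda>x. F n x - f x)) \<longlonglongrightarrow> 0"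
  shows "(\<lambda>n. l2_norm M (\<lambda>x. c * F n x - c * f x)) \<longlonglongrightarrow> 0"
  using tendsto_mult_right_zero[OF assms, of "\<bar>c\<bar>"]
  by (simp add: l2_norm_cmult flip: right_diff_distrib)

lemma l2_norm_tendsto_bounded_mult:
  assumes "(\<lambda>n. l2_norm M (\<lambda>x. F n x - f x)) \<longlonglongrightarrow> 0" "\<And>n. F n \<in> L2 M" "f \<in> L2 M"
    "g \<in> borel_measurable M" "AE x in M. \<bar>g x\<bar> \<le> C"
  shows "(\<lambda>n. l2_norm M (\<lambda>x. g x * F n x - g x * f x)) \<longlonglongrightarrow> 0"
proof (rule real_tendsto_sandwich[OF _ _ tendsto_const])
  show "(\<lambda>n. \<bar>C\<bar> * l2_norm M (\<lambda>x. F n x - f x)) \<longlonglongrightarrow> 0"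
    by (rule tendsto_mult_right_zero[OF assms(1)])
  have "AE x in M. \<bar>g x\<bar> \<le> \<bar>C\<bar>" using assms(5) by auto
  then show "\<forall>\<^sub>F n in sequentially. l2_norm M (\<lambda>x. g x * F n x - g x * f x)
     \<le> \<bar>C\<bar> * l2_norm M (\<lambda>x. F n x - f x)"
    using l2_norm_bounded_mult[OF L2_diff[OF assms(2,3)] assms(4)]
    by (simp add: right_diff_distrib)
qed (simp add: l2_norm_nonneg)

lemma l2_inner_tendsto:
  assumes "\<And>n. F n \<in> L2 M" "\<And>n. G n \<in> L2 M" "f \<in> L2 M" "g \<in> L2 M"
    "(\<lambda>n. l2_norm M (\<lambda>x. F n x - f x)) \<longlonglongrightarrow> 0" "(\<lambda>n. l2_norm M (\<lambda>x. G n x - g x)) \<longlonglongrightarrow> 0"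
  shows "(\<lambda>n. l2_inner M (F n) (G n)) \<longlonglongrightarrow> l2_inner M f g"
proof (rule LIM_zero_cancel, rule tendsto_0_le[where K=1])
  let ?a = "\<lambda>n. l2_norm M (\<lambda>x. F n x - f x)" and ?b = "\<lambda>n. l2_norm M (\<lambda>x. G n x - g x)"
  show "(\<lambda>n. ?a n * ?b n + ?a n * l2_norm M g + l2_norm M f * ?b n) \<longlonglongrightarrow> 0"
    using assms(5,6) by (auto intro!: tendsto_eq_intros)
  have "\<bar>l2_inner M (F n) (G n) - l2_inner M f g\<bar> \<le> ?a n * ?b n + ?a n * l2_norm M g + l2_norm M f * ?b n" for n
  proof -
    have "l2_inner M (F n) (G n) - l2_inner M f g =
      l2_inner M (\<lambda>x. F n x - f x) (\<lambda>x. G n x - g x) + l2_inner M (\<lambda>x. F n x - f x) g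
      + l2_inner M f (\<lambda>x. G n x - g x)"
      using assms by (simp add: l2_inner_diff_left l2_inner_diff_right L2_intros)
    then show ?thesis
      using l2_CS[OF L2_diff[OF assms(1,3)] L2_diff[OF assms(2,4)], of n n]
        l2_CS[OF L2_diff[OF assms(1,3)] assms(4), of n] l2_CS[OF assms(3) L2_diff[OF assms(2,4)], of n]
      by linarith
  qed
  then show "\<forall>\<^sub>F n in sequentially. norm (l2_inner M (F n) (G n) - l2_inner M f g)
     \<le> norm (?a n * ?b n + ?a n * l2_norm M g + l2_norm M f * ?b n) * 1"
    by (auto intro!: always_eventually order_trans[OF _ abs_ge_self])
qed

text \<open>Norm convergence is \<open>L\<^sup>1\<close> convergence of the squared differences to
  0, and that yields an almost everywhere convergent subsequence.\<close>

lemma l2_norm_tendsto_subseq: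
  assumes "(\<lambda>n. l2_norm M (\<lambda>x. F n x - f x)) \<longlonglongrightarrow> 0" "\<And>n. F n \<in> L2 M" "f \<in> L2 M"
  shows "\<exists>r::nat\<Rightarrow>nat. strict_mono r \<and> (AE x in M. (\<lambda>n. F (r n) x) \<longlonglongrightarrow> f x)"
proof -
  have "(\<lambda>n. \<integral>x. norm ((F n x - f x)\<^sup>2) \<partial>M) \<longlonglongrightarrow> 0"
    using tendsto_power[OF assms(1), of 2] by (simp add: l2_norm_sq)
  then obtain r :: "nat \<Rightarrow> nat" where r: "strict_mono r" "AE x in M. (\<lambda>n. (F (r n) x - f x)\<^sup>2) \<longlonglongrightarrow> 0"
    using tendsto_L1_AE_subseq[of M "\<lambda>n x. (F n x - f x)\<^sup>2"] L2_diff[OF assms(2,3)]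
    by (auto simp: L2_def)
  have "AE x in M. (\<lambda>n. F (r n) x) \<longlonglongrightarrow> f x"
    using r(2)
  proof eventually_elim
    case (elim x)
    then have "(\<lambda>n. sqrt ((F (r n) x - f x)\<^sup>2)) \<longlonglongrightarrow> sqrt 0" by (rule tendsto_real_sqrt)
    then show ?case by (simp add: tendsto_rabs_zero_iff LIM_zero_iff)
  qed
  with r(1) show ?thesis by blast
qed

lemma l2_norm_tendsto_unique:
  assumes "(\<lambda>n. l2_norm M (\<lambda>x. F n x - f x)) \<longlonglongrightarrow> 0" "(\<lambda>n. l2_norm M (\<lambda>x. F n x - g x)) \<longlonglongrightarrow> 0"
    "\<And>n. F n \<in> L2 M" "f \<in> L2 M" "g \<in> L2 M"
  shows "AE x in M. f x = g x"
proof -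
  have "l2_norm M (\<lambda>x. f x - g x) \<le> l2_norm M (\<lambda>x. F n x - f x) + l2_norm M (\<lambda>x. F n x - g x)" for n
    using l2_triangle3[OF assms(4) assms(3) assms(5), of n] l2_norm_minus_commute[of M f "F n"] by simp
  then have "l2_norm M (\<lambda>x. f x - g x) \<le> 0"
    using LIMSEQ_le_const[OF tendsto_add[OF assms(1,2)], of "l2_norm M (\<lambda>x. f x - g x)"] by auto
  then have "AE x in M. f x - g x = 0"
    using l2_norm_nonneg[of M "\<lambda>x. f x - g x"] L2_diff[OF assms(4,5)] by (intro l2_norm_0_AE) auto
  then show ?thesis by auto
qed

text \<open>The squared differences are dominated by \<open>4 * (g x)\<^sup>2\<close>, because
  \<open>F n\<close> and, through the limit, \<open>f\<close> are bounded by
  \<open>g\<close>.\<close>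

lemma l2_dominated_convergence:
  assumes "\<And>n. F n \<in> borel_measurable M" "f \<in> borel_measurable M" "g \<in> L2 M"
    "AE x in M. (\<lambda>n. F n x) \<longlonglongrightarrow> f x" "\<And>n. AE x in M. \<bar>F n x\<bar> \<le> g x"
  shows "f \<in> L2 M" "\<And>n. F n \<in> L2 M" "(\<lambda>n. l2_norm M (\<lambda>x. F n x - f x)) \<longlonglongrightarrow> 0"
proof -
  have all: "AE x in M. \<forall>n. \<bar>F n x\<bar> \<le> g x" using assms(5) by (subst AE_all_countable) auto
  have fg: "AE x in M. \<bar>f x\<bar> \<le> g x"
    using all assms(4)
  proof eventually_elim
    case (elim x) then show ?case
      using LIMSEQ_le_const2[OF tendsto_rabs[OF elim(2)], of "g x"] by auto
  qed
  show "f \<in> L2 M" by (rule L2_bound[OF assms(3,2)]) (use fg in auto)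
  show "F n \<in> L2 M" for n by (rule L2_bound[OF assms(3,1)]) (use assms(5)[of n] in auto)
  have "(\<lambda>n. \<integral>x. (F n x - f x)\<^sup>2 \<partial>M) \<longlonglongrightarrow> (\<integral>x. 0 \<partial>M)"
  proof (rule integral_dominated_convergence[where w="\<lambda>x. 4 * (g x)\<^sup>2"])
    show "integrable M (\<lambda>x. 4 * (g x)\<^sup>2)" using L2_integrable[OF assms(3)] by simp
    show "AE x in M. (\<lambda>n. (F n x - f x)\<^sup>2) \<longlonglongrightarrow> 0"
      using assms(4) by eventually_elim (auto intro!: tendsto_eq_intros)
    show "AE x in M. norm ((F n x - f x)\<^sup>2) \<le> 4 * (g x)\<^sup>2" for n
      using all fg
    proof eventually_elim
      case (elim x)
      then have "\<bar>F n x - f x\<bar> \<le> \<bar>2 * g x\<bar>" using elim(1)[rule_format, of n] by linarith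
      then show ?case by (simp add: abs_le_square_iff power_mult_distrib)
    qed
  qed (use assms(1,2) in auto)
  then have "(\<lambda>n. sqrt ((l2_norm M (\<lambda>x. F n x - f x))\<^sup>2)) \<longlonglongrightarrow> sqrt 0"
    by (intro tendsto_real_sqrt) (simp add: l2_norm_sq)
  then show "(\<lambda>n. l2_norm M (\<lambda>x. F n x - f x)) \<longlonglongrightarrow> 0" by (simp add: l2_norm_nonneg)
qed

text \<open>Riesz-Fischer: the increments of a rapidly converging subsequence are summable almost
  everywhere, and Fatou's lemma turns the Cauchy bound into a bound on the distance to the limit.
  Finiteness of the measure lets Cauchy-Schwarz against 1 turn norms of increments into
  \<open>L\<^sup>1\<close> bounds.\<close>

lemma (in finite_measure) l2_complete:
  assumes F: "\<And>n. F n \<in> L2 M"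
    and C: "\<And>e. e > 0 \<Longrightarrow> \<exists>n0. \<forall>m\<ge>n0. \<forall>n\<ge>n0. l2_norm M (\<lambda>x. F m x - F n x) < e"
  shows "\<exists>f\<in>L2 M. (\<lambda>n. l2_norm M (\<lambda>x. F n x - f x)) \<longlonglongrightarrow> 0"
proof -
  have "\<forall>k. \<exists>n0. \<forall>m\<ge>n0. \<forall>n\<ge>n0. l2_norm M (\<lambda>x. F m x - F n x) < (1/2)^k"
    using C[of "(1/2)^_"] by simp
  then obtain q where q: "\<And>k m n. m \<ge> q k \<Longrightarrow> n \<ge> q k \<Longrightarrow> l2_norm M (\<lambda>x. F m x - F n x) < (1/2)^k"
    by metis
  \<comment> \<open>The sum over \<open>j \<le> k\<close> makes \<open>r\<close> monotone while
    keeping \<open>r k \<ge> q k\<close>; the summand \<open>k\<close> makes it unbounded.\<close>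
  define r where "r k = k + (\<Sum>j\<le>k. q j)" for k
  have r: "r k \<ge> q k" "r k \<ge> k" "r (Suc k) \<ge> r k" for k
    using member_le_sum[of k "{..k}" q] by (auto simp: r_def)
  have d: "l2_norm M (\<lambda>x. F (r (Suc k)) x - F (r k) x) \<le> (1/2)^k" for k
    using q[of k "r (Suc k)" "r k"] r[of k] by linarith
  let ?c = "l2_norm M (\<lambda>_. 1)"
  have Fm [measurable]: "\<And>n. F n \<in> borel_measurable M" using F by (rule L2_measurable)
  have d1: "(\<integral>\<^sup>+x. ennreal \<bar>F (r (Suc k)) x - F (r k) x\<bar> \<partial>M) \<le> ennreal (?c * (1/2)^k)" for k
  proof -
    have L: "(\<lambda>x. \<bar>F (r (Suc k)) x - F (r k) x\<bar>) \<in> L2 M"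
      by (rule L2_bound[OF L2_diff[OF F F]]) auto
    have "(\<integral>x. \<bar>F (r (Suc k)) x - F (r k) x\<bar> \<partial>M) = l2_inner M (\<lambda>x. \<bar>F (r (Suc k)) x - F (r k) x\<bar>) (\<lambda>_. 1)"
      by (simp add: l2_inner_def)
    also have "\<dots> \<le> l2_norm M (\<lambda>x. \<bar>F (r (Suc k)) x - F (r k) x\<bar>) * ?c"
      using l2_CS[OF L L2_const[of 1]] by linarith
    also have "l2_norm M (\<lambda>x. \<bar>F (r (Suc k)) x - F (r k) x\<bar>) \<le> (1/2)^k"
      using d[of k] by (simp add: l2_norm_def l2_inner_def)
    finally have "(\<integral>x. \<bar>F (r (Suc k)) x - F (r k) x\<bar> \<partial>M) \<le> ?c * (1/2)^k"
      by (simp add: l2_norm_nonneg mult.commute mult_right_mono)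
    then show ?thesis
      using L2_integrable1[OF L] by (subst nn_integral_eq_integral) (auto intro: ennreal_leI)
  qed
  have "(\<integral>\<^sup>+x. (\<Sum>k. ennreal \<bar>F (r (Suc k)) x - F (r k) x\<bar>) \<partial>M)
      = (\<Sum>k. \<integral>\<^sup>+x. ennreal \<bar>F (r (Suc k)) x - F (r k) x\<bar> \<partial>M)"
    by (intro nn_integral_suminf) auto
  also have "\<dots> \<le> (\<Sum>k. ennreal (?c * (1/2)^k))"
    by (intro suminf_le d1 summableI)
  also have "\<dots> = ennreal (\<Sum>k. ?c * (1/2)^k)"
    by (intro suminf_ennreal2) (auto simp: l2_norm_nonneg intro!: summable_mult summable_geometric)
  also have "\<dots> < \<infinity>" by simp
  finally have "AE x in M. (\<Sum>k. ennreal \<bar>F (r (Suc k)) x - F (r k) x\<bar>) \<noteq> \<infinity>"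
    by (intro nn_integral_PInf_AE) auto
  then have conv: "AE x in M. convergent (\<lambda>k. F (r k) x)"
  proof eventually_elim
    case (elim x)
    then have "summable (\<lambda>k. \<bar>F (r (Suc k)) x - F (r k) x\<bar>)"
      by (intro summable_suminf_not_top) auto
    then have "summable (\<lambda>k. F (r (Suc k)) x - F (r k) x)" by (rule summable_rabs_cancel)
    then have "convergent (\<lambda>n. \<Sum>k<n. F (r (Suc k)) x - F (r k) x)"
      by (simp add: summable_iff_convergent)
    then have "convergent (\<lambda>n. F (r n) x - F (r 0) x)" by (simp only: sum_lessThan_telescope[where f="\<lambda>k. F (r k) x"])
    then obtain L where "(\<lambda>n. F (r n) x - F (r 0) x) \<longlonglongrightarrow> L" by (auto simp: convergent_def)
    from tendsto_add[OF this tendsto_const[of "F (r 0) x"]] show ?case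
      by (auto simp: convergent_def)
  qed
  define f where "f x = lim (\<lambda>k. F (r k) x)" for x
  have fm [measurable]: "f \<in> borel_measurable M"
    unfolding f_def by (rule borel_measurable_lim_metric) auto
  have fl: "AE x in M. (\<lambda>k. F (r k) x) \<longlonglongrightarrow> f x"
    using conv by eventually_elim (auto simp: f_def convergent_LIMSEQ_iff)
  \<comment> \<open>Fatou's lemma along the subsequence \<open>r\<close>, with \<open>n\<close> held
    fixed.\<close>
  have main: "(\<integral>\<^sup>+x. ennreal ((F n x - f x)\<^sup>2) \<partial>M) \<le> ennreal (e\<^sup>2)"
    if e: "e > 0" and n0: "\<forall>m\<ge>n0. \<forall>n\<ge>n0. l2_norm M (\<lambda>x. F m x - F n x) < e" and n: "n \<ge> n0" for e n0 n
  proof -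
    have "(\<integral>\<^sup>+x. ennreal ((F n x - f x)\<^sup>2) \<partial>M)
        \<le> (\<integral>\<^sup>+x. liminf (\<lambda>k. ennreal ((F n x - F (r k) x)\<^sup>2)) \<partial>M)"
    proof (rule nn_integral_mono_AE, use fl in eventually_elim)
      case (elim x)
      then have "(\<lambda>k. ennreal ((F n x - F (r k) x)\<^sup>2)) \<longlonglongrightarrow> ennreal ((F n x - f x)\<^sup>2)"
        by (intro tendsto_intros)
      from lim_imp_Liminf[OF _ this] show ?case by simp
    qed
    also have "\<dots> \<le> liminf (\<lambda>k. \<integral>\<^sup>+x. ennreal ((F n x - F (r k) x)\<^sup>2) \<partial>M)"
      by (intro nn_integral_liminf) auto
    also have "\<dots> \<le> ennreal (e\<^sup>2)"
    proof (rule Liminf_le[OF _ eventually_sequentiallyI])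
      fix k assume k: "k \<ge> n0"
      have "l2_norm M (\<lambda>x. F n x - F (r k) x) < e" using n0 n k r(2)[of k] by simp
      then have "(l2_norm M (\<lambda>x. F n x - F (r k) x))\<^sup>2 \<le> e\<^sup>2"
        using l2_norm_nonneg by (intro power_mono) auto
      then show "(\<integral>\<^sup>+x. ennreal ((F n x - F (r k) x)\<^sup>2) \<partial>M) \<le> ennreal (e\<^sup>2)"
        using L2_integrable[OF L2_diff[OF F F]]
        by (subst nn_integral_eq_integral) (auto simp: l2_norm_sq)
    qed simp
    finally show ?thesis .
  qed
  have fin: "(\<lambda>x. F n x - f x) \<in> L2 M"
    if "e > 0" "\<forall>m\<ge>n0. \<forall>n\<ge>n0. l2_norm M (\<lambda>x. F m x - F n x) < e" "n \<ge> n0" for e n0 n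
    using main[OF that] by (intro L2_I integrableI_nonneg) (auto simp: top_unique less_top[symmetric])
  obtain n1 where n1: "\<forall>m\<ge>n1. \<forall>n\<ge>n1. l2_norm M (\<lambda>x. F m x - F n x) < 1" using C[of 1] by auto
  \<comment> \<open>Membership of \<open>f\<close> itself follows from that of the single difference
    \<open>F n1 - f\<close>.\<close>
  have fL: "f \<in> L2 M" using L2_diff[OF F[of n1] fin[OF _ n1, of n1]] by simp
  have "(\<lambda>n. l2_norm M (\<lambda>x. F n x - f x)) \<longlonglongrightarrow> 0"
  proof (rule LIMSEQ_I)
    fix e :: real assume e: "e > 0"
    obtain n0 where n0: "\<forall>m\<ge>n0. \<forall>n\<ge>n0. l2_norm M (\<lambda>x. F m x - F n x) < e/2" using C[of "e/2"] e by auto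
    have "l2_norm M (\<lambda>x. F n x - f x) \<le> e/2" if "n \<ge> n0" for n
    proof (rule power2_le_imp_le)
      have "ennreal ((l2_norm M (\<lambda>x. F n x - f x))\<^sup>2) \<le> ennreal ((e/2)\<^sup>2)"
        using main[OF _ n0 that] e nn_integral_eq_integral[OF L2_integrable[OF L2_diff[OF F fL]]]
        by (simp add: l2_norm_sq)
      then show "(l2_norm M (\<lambda>x. F n x - f x))\<^sup>2 \<le> (e/2)\<^sup>2" by (simp add: ennreal_le_iff)
    qed (use e in simp)
    then have "norm (l2_norm M (\<lambda>x. F n x - f x) - 0) < e" if "n \<ge> n0" for n
      using that e l2_norm_nonneg[of M "\<lambda>x. F n x - f x"] by fastforce
    then show "\<exists>no. \<forall>n\<ge>no. norm (l2_norm M (\<lambda>x. F n x - f x) - 0) < e" by blast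
  qed
  with fL show ?thesis by blast
qed


section \<open>Forms given by a family of derivations\<close>

text \<open>The first derivative is an argument because it occurs in the chain rule; of the second,
  existence and continuity matter, to keep a composition twice continuously differentiable.\<close>

definition C2_real :: "(real \<Rightarrow> real) \<Rightarrow> (real \<Rightarrow> real) \<Rightarrow> bool" where
  "C2_real \<psi> \<psi>' \<longleftrightarrow> (\<forall>t. (\<psi> has_real_derivative \<psi>' t) (at t)) \<and>
     (\<exists>\<psi>''. (\<forall>t. (\<psi>' has_real_derivative \<psi>'' t) (at t)) \<and> continuous_on UNIV \<psi>'')"

lemma C2_real_continuous:
  assumes "C2_real \<psi> \<psi>'" shows "continuous_on UNIV \<psi>" "continuous_on UNIV \<psi>'"
  using assms unfolding C2_real_def
  by (auto intro!: DERIV_continuous_on[of UNIV \<psi> \<psi>'] simp: has_field_derivative_at_within)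
     (rule DERIV_continuous_on, auto intro: has_field_derivative_at_within)

lemma C2_real_lipschitz:
  assumes "C2_real \<psi> \<psi>'" "\<And>t. \<bar>\<psi>' t\<bar> \<le> C" shows "\<bar>\<psi> s - \<psi> t\<bar> \<le> C * \<bar>s - t\<bar>"
  using field_differentiable_bound[of UNIV \<psi> \<psi>' C t s] assms
  by (auto simp: C2_real_def has_field_derivative_at_within abs_minus_commute)

text \<open>The index set is arbitrary so that one translation serves both \<open>E0\<close>, with
  an index for each partial derivative, and \<open>E_alpha M En 1\<close>, with a further index for
  the function itself.\<close>

lemma form_Cauchy_l2:
  assumes "finite I" "\<And>n i. i \<in> I \<Longrightarrow> H n i \<in> L2 M"
    "\<And>m n. E (\<lambda>x. F m x - F n x) (\<lambda>x. F m x - F n x) = (\<Sum>i\<in>I. (l2_norm M (\<lambda>x. H m i x - H n i x))\<^sup>2)"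
  shows form_Cauchy_imp_l2: "form_Cauchy E F \<Longrightarrow> i \<in> I \<Longrightarrow> e > 0 \<Longrightarrow>
      \<exists>n0. \<forall>m\<ge>n0. \<forall>n\<ge>n0. l2_norm M (\<lambda>x. H m i x - H n i x) < e"
    and l2_conv_imp_form_Cauchy: "(\<And>i. i \<in> I \<Longrightarrow> h i \<in> L2 M) \<Longrightarrow>
      (\<And>i. i \<in> I \<Longrightarrow> (\<lambda>n. l2_norm M (\<lambda>x. H n i x - h i x)) \<longlonglongrightarrow> 0) \<Longrightarrow> form_Cauchy E F"
proof -
  assume C: "form_Cauchy E F" "i \<in> I" "e > 0"
  then obtain n0 where n0: "\<forall>m\<ge>n0. \<forall>n\<ge>n0. E (\<lambda>x. F m x - F n x) (\<lambda>x. F m x - F n x) < e\<^sup>2"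
    unfolding form_Cauchy_def by (meson zero_less_power)
  have "l2_norm M (\<lambda>x. H m i x - H n i x) < e" if "m \<ge> n0" "n \<ge> n0" for m n
  proof (rule power2_less_imp_less)
    have "(l2_norm M (\<lambda>x. H m i x - H n i x))\<^sup>2 \<le> (\<Sum>i\<in>I. (l2_norm M (\<lambda>x. H m i x - H n i x))\<^sup>2)"
      using assms(1) C(2) by (intro member_le_sum) auto
    then show "(l2_norm M (\<lambda>x. H m i x - H n i x))\<^sup>2 < e\<^sup>2"
      using n0 that assms(3)[of m n] by fastforce
  qed (use C in simp)
  then show "\<exists>n0. \<forall>m\<ge>n0. \<forall>n\<ge>n0. l2_norm M (\<lambda>x. H m i x - H n i x) < e" by blast
next
  assume h: "\<And>i. i \<in> I \<Longrightarrow> h i \<in> L2 M"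
    and conv: "\<And>i. i \<in> I \<Longrightarrow> (\<lambda>n. l2_norm M (\<lambda>x. H n i x - h i x)) \<longlonglongrightarrow> 0"
  have "(\<lambda>n. \<Sum>i\<in>I. (l2_norm M (\<lambda>x. H n i x - h i x))\<^sup>2) \<longlonglongrightarrow> (\<Sum>i\<in>I. 0\<^sup>2)"
    using conv by (intro tendsto_intros) auto
  then have S: "(\<lambda>n. \<Sum>i\<in>I. (l2_norm M (\<lambda>x. H n i x - h i x))\<^sup>2) \<longlonglongrightarrow> 0" by simp
  show "form_Cauchy E F" unfolding form_Cauchy_def
  proof (intro allI impI)
    fix e :: real assume "e > 0"
    then obtain n0 where n0: "\<forall>n\<ge>n0. (\<Sum>i\<in>I. (l2_norm M (\<lambda>x. H n i x - h i x))\<^sup>2) < e/4"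
      using order_tendstoD(2)[OF S, of "e/4"] by (auto simp: eventually_sequentially)
    have "E (\<lambda>x. F m x - F n x) (\<lambda>x. F m x - F n x) < e" if "m \<ge> n0" "n \<ge> n0" for m n
    proof -
      have "(l2_norm M (\<lambda>x. H m i x - H n i x))\<^sup>2 \<le>
        2 * (l2_norm M (\<lambda>x. H m i x - h i x))\<^sup>2 + 2 * (l2_norm M (\<lambda>x. H n i x - h i x))\<^sup>2" if "i \<in> I" for i
      proof -
        let ?a = "l2_norm M (\<lambda>x. H m i x - h i x)" and ?b = "l2_norm M (\<lambda>x. H n i x - h i x)"
        have "l2_norm M (\<lambda>x. H m i x - H n i x) \<le> ?a + ?b"
          using l2_triangle3[OF assms(2)[OF that] h[OF that] assms(2)[OF that], of m n]
            l2_norm_minus_commute[of M "h i" "H n i"] by simp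
        then have "(l2_norm M (\<lambda>x. H m i x - H n i x))\<^sup>2 \<le> (?a + ?b)\<^sup>2"
          by (intro power_mono l2_norm_nonneg)
        also have "\<dots> \<le> 2 * ?a\<^sup>2 + 2 * ?b\<^sup>2"
          using zero_le_power2[of "?a - ?b"] unfolding power2_diff power2_sum by linarith
        finally show ?thesis .
      qed
      then have "(\<Sum>i\<in>I. (l2_norm M (\<lambda>x. H m i x - H n i x))\<^sup>2) \<le>
        (\<Sum>i\<in>I. 2 * (l2_norm M (\<lambda>x. H m i x - h i x))\<^sup>2 + 2 * (l2_norm M (\<lambda>x. H n i x - h i x))\<^sup>2)"
        by (rule sum_mono)
      also have "\<dots> = 2 * (\<Sum>i\<in>I. (l2_norm M (\<lambda>x. H m i x - h i x))\<^sup>2)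
          + 2 * (\<Sum>i\<in>I. (l2_norm M (\<lambda>x. H n i x - h i x))\<^sup>2)"
        by (simp add: sum.distrib sum_distrib_left)
      also have "\<dots> < e" using n0[rule_format, OF that(1)] n0[rule_format, OF that(2)] by linarith
      finally show ?thesis using assms(3) by simp
    qed
    then show "\<exists>n0. \<forall>m\<ge>n0. \<forall>n\<ge>n0. E (\<lambda>x. F m x - F n x) (\<lambda>x. F m x - F n x) < e" by blast
  qed
qed

text \<open>The rules of calculus for \<open>G\<close> are required pointwise on
  \<open>space M\<close>; among the rules for \<open>G\<close>, \<open>G_closable\<close> is the one
  that speaks of null sets. The condition \<open>\<psi> 0 = 0\<close> in \<open>D0_comp\<close>
  reflects that in the model any other composition destroys compact support. \<open>D0_one\<close>
  puts the constant 1 into the closure with zero gradient.\<close>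

locale derivation_form = finite_measure M for M :: "'a measure" +
  fixes I :: "'i set" and D0 :: "('a \<Rightarrow> real) set" and G :: "'i \<Rightarrow> ('a \<Rightarrow> real) \<Rightarrow> 'a \<Rightarrow> real"
    and E0 :: "'a form"
  assumes finI: "finite I" and D0_nonempty: "D0 \<noteq> {}"
    and D0_meas: "f \<in> D0 \<Longrightarrow> f \<in> borel_measurable M"
    and D0_bdd: "f \<in> D0 \<Longrightarrow> \<exists>C. \<forall>x\<in>space M. \<bar>f x\<bar> \<le> C"
    and G_meas: "f \<in> D0 \<Longrightarrow> i \<in> I \<Longrightarrow> G i f \<in> borel_measurable M"
    and G_bdd: "f \<in> D0 \<Longrightarrow> i \<in> I \<Longrightarrow> \<exists>C. \<forall>x\<in>space M. \<bar>G i f x\<bar> \<le> C"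
    and D0_add: "f \<in> D0 \<Longrightarrow> g \<in> D0 \<Longrightarrow> (\<lambda>x. f x + g x) \<in> D0"
    and D0_cmult: "f \<in> D0 \<Longrightarrow> (\<lambda>x. c * f x) \<in> D0"
    and D0_mult: "f \<in> D0 \<Longrightarrow> g \<in> D0 \<Longrightarrow> (\<lambda>x. f x * g x) \<in> D0"
    and G_add: "f \<in> D0 \<Longrightarrow> g \<in> D0 \<Longrightarrow> i \<in> I \<Longrightarrow> x \<in> space M \<Longrightarrow> G i (\<lambda>x. f x + g x) x = G i f x + G i g x"
    and G_cmult: "f \<in> D0 \<Longrightarrow> i \<in> I \<Longrightarrow> x \<in> space M \<Longrightarrow> G i (\<lambda>x. c * f x) x = c * G i f x"
    and G_mult: "f \<in> D0 \<Longrightarrow> g \<in> D0 \<Longrightarrow> i \<in> I \<Longrightarrow> x \<in> space M \<Longrightarrow>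
       G i (\<lambda>x. f x * g x) x = f x * G i g x + g x * G i f x"
    and D0_comp: "f \<in> D0 \<Longrightarrow> C2_real \<psi> \<psi>' \<Longrightarrow> \<psi> 0 = 0 \<Longrightarrow> (\<lambda>x. \<psi> (f x)) \<in> D0"
    and G_comp: "f \<in> D0 \<Longrightarrow> C2_real \<psi> \<psi>' \<Longrightarrow> \<psi> 0 = 0 \<Longrightarrow> i \<in> I \<Longrightarrow> x \<in> space M \<Longrightarrow>
       G i (\<lambda>x. \<psi> (f x)) x = \<psi>' (f x) * G i f x"
    and G_closable: "(\<And>n. F n \<in> D0) \<Longrightarrow> i \<in> I \<Longrightarrow> h \<in> L2 M \<Longrightarrow> (\<lambda>n. l2_norm M (F n)) \<longlonglongrightarrow> 0 \<Longrightarrow>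
       (\<lambda>n. l2_norm M (\<lambda>x. G i (F n) x - h x)) \<longlonglongrightarrow> 0 \<Longrightarrow> AE x in M. h x = 0"
    and D0_dense: "f \<in> L2 M \<Longrightarrow> e > 0 \<Longrightarrow> \<exists>g\<in>D0. l2_norm M (\<lambda>x. f x - g x) < e"
    and D0_one: "\<exists>F. (\<forall>n. F n \<in> D0) \<and> (\<lambda>n. l2_norm M (\<lambda>x. F n x - 1)) \<longlonglongrightarrow> 0 \<and>
       (\<forall>i\<in>I. (\<lambda>n. l2_norm M (G i (F n))) \<longlonglongrightarrow> 0)"
    and E0_eq: "f \<in> D0 \<Longrightarrow> g \<in> D0 \<Longrightarrow> E0 f g = (\<Sum>i\<in>I. l2_inner M (G i f) (G i g))"
begin

abbreviation "N \<equiv> l2_norm M"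

lemma D0_L2: "f \<in> D0 \<Longrightarrow> f \<in> L2 M"
  using D0_bdd[of f] by (auto intro!: L2_bounded D0_meas)

lemma G_L2: "f \<in> D0 \<Longrightarrow> i \<in> I \<Longrightarrow> G i f \<in> L2 M"
  using G_bdd[of f i] by (auto intro!: L2_bounded G_meas)

lemma D0_diff: "f \<in> D0 \<Longrightarrow> g \<in> D0 \<Longrightarrow> (\<lambda>x. f x - g x) \<in> D0"
  using D0_add[OF _ D0_cmult, of f g "-1"] by simp

lemma D0_0: "(\<lambda>x. 0) \<in> D0"
  using D0_cmult[of _ 0] D0_nonempty by auto

lemma G_diff: "f \<in> D0 \<Longrightarrow> g \<in> D0 \<Longrightarrow> i \<in> I \<Longrightarrow> x \<in> space M \<Longrightarrow> G i (\<lambda>x. f x - g x) x = G i f x - G i g x"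
  using G_add[OF _ D0_cmult, of f g i x "-1"] G_cmult[of g i x "-1"] by simp

lemma inner_G_cong:
  assumes "\<And>x. x \<in> space M \<Longrightarrow> f x = f' x" "\<And>x. x \<in> space M \<Longrightarrow> g x = g' x"
  shows "l2_inner M f g = l2_inner M f' g'"
  unfolding l2_inner_def by (intro Bochner_Integration.integral_cong) (auto simp: assms)

lemma norm_space_cong:
  assumes "\<And>x. x \<in> space M \<Longrightarrow> f x = f' x" shows "N f = N f'"
  unfolding l2_norm_def using inner_G_cong[OF assms assms] by simp

text \<open>Closability of the gradient makes \<open>h\<close> unique up to null sets, so that the closure of \<open>E0\<close> is
  \<open>\<Sum>\<^sub>i \<langle>h\<^sub>i, k\<^sub>i\<rangle>\<close> on the pairs \<open>f\<close>, \<open>g\<close> with weak gradients \<open>h\<close>, \<open>k\<close>.\<close>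

definition weak_grad :: "('a \<Rightarrow> real) \<Rightarrow> ('i \<Rightarrow> 'a \<Rightarrow> real) \<Rightarrow> bool" where
  "weak_grad f h \<longleftrightarrow> f \<in> L2 M \<and> (\<forall>i\<in>I. h i \<in> L2 M) \<and> (\<exists>F. (\<forall>n. F n \<in> D0) \<and>
     (\<lambda>n. N (\<lambda>x. F n x - f x)) \<longlonglongrightarrow> 0 \<and> (\<forall>i\<in>I. (\<lambda>n. N (\<lambda>x. G i (F n) x - h i x)) \<longlonglongrightarrow> 0))"

lemma weak_grad_L2: "weak_grad f h \<Longrightarrow> f \<in> L2 M" "weak_grad f h \<Longrightarrow> i \<in> I \<Longrightarrow> h i \<in> L2 M"
  by (auto simp: weak_grad_def)

lemma weak_grad_D0: "f \<in> D0 \<Longrightarrow> weak_grad f (\<lambda>i. G i f)"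
  unfolding weak_grad_def by (auto simp: D0_L2 G_L2 l2_norm_def l2_inner_def intro!: exI[of _ "\<lambda>n. f"])

lemma weak_grad_add:
  assumes "weak_grad f h" "weak_grad g k" shows "weak_grad (\<lambda>x. f x + g x) (\<lambda>i x. h i x + k i x)"
proof -
  obtain F where F: "\<And>n. F n \<in> D0" "(\<lambda>n. N (\<lambda>x. F n x - f x)) \<longlonglongrightarrow> 0"
      "\<And>i. i \<in> I \<Longrightarrow> (\<lambda>n. N (\<lambda>x. G i (F n) x - h i x)) \<longlonglongrightarrow> 0" using assms(1) by (auto simp: weak_grad_def)
  obtain K where K: "\<And>n. K n \<in> D0" "(\<lambda>n. N (\<lambda>x. K n x - g x)) \<longlonglongrightarrow> 0"
      "\<And>i. i \<in> I \<Longrightarrow> (\<lambda>n. N (\<lambda>x. G i (K n) x - k i x)) \<longlonglongrightarrow> 0" using assms(2) by (auto simp: weak_grad_def)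
  have "(\<lambda>n. N (\<lambda>x. G i (\<lambda>x. F n x + K n x) x - (h i x + k i x))) \<longlonglongrightarrow> 0" if i: "i \<in> I" for i
  proof -
    have "N (\<lambda>x. G i (\<lambda>x. F n x + K n x) x - (h i x + k i x)) =
       N (\<lambda>x. G i (F n) x + G i (K n) x - (h i x + k i x))" for n
      by (rule norm_space_cong) (simp add: G_add F K i)
    then show ?thesis
      using l2_norm_tendsto_add[OF G_L2[OF F(1) i] G_L2[OF K(1) i] weak_grad_L2(2)[OF assms(1) i] weak_grad_L2(2)[OF assms(2) i] F(3)[OF i] K(3)[OF i]]
      by simp
  qed
  moreover have "(\<lambda>n. N (\<lambda>x. (F n x + K n x) - (f x + g x))) \<longlonglongrightarrow> 0"
    by (intro l2_norm_tendsto_add) (use F K assms in \<open>auto intro: D0_L2 weak_grad_L2\<close>)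
  ultimately show ?thesis
    unfolding weak_grad_def using assms F(1) K(1)
    by (auto intro!: exI[of _ "\<lambda>n x. F n x + K n x"] D0_add L2_add dest: weak_grad_L2)
qed

lemma weak_grad_cmult:
  assumes "weak_grad f h" shows "weak_grad (\<lambda>x. c * f x) (\<lambda>i x. c * h i x)"
proof -
  obtain F where F: "\<And>n. F n \<in> D0" "(\<lambda>n. N (\<lambda>x. F n x - f x)) \<longlonglongrightarrow> 0"
      "\<And>i. i \<in> I \<Longrightarrow> (\<lambda>n. N (\<lambda>x. G i (F n) x - h i x)) \<longlonglongrightarrow> 0" using assms(1) by (auto simp: weak_grad_def)
  have "(\<lambda>n. N (\<lambda>x. G i (\<lambda>x. c * F n x) x - c * h i x)) \<longlonglongrightarrow> 0" if i: "i \<in> I" for i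
  proof -
    have "N (\<lambda>x. G i (\<lambda>x. c * F n x) x - c * h i x) = N (\<lambda>x. c * G i (F n) x - c * h i x)" for n
      by (rule norm_space_cong) (simp add: G_cmult F i)
    then show ?thesis using l2_norm_tendsto_cmult[OF F(3)[OF i]] by simp
  qed
  moreover note l2_norm_tendsto_cmult[OF F(2), of c]
  ultimately show ?thesis
    unfolding weak_grad_def using assms F(1)
    by (auto intro!: exI[of _ "\<lambda>n x. c * F n x"] D0_cmult L2_cmult dest: weak_grad_L2)
qed

lemma weak_grad_diff: assumes "weak_grad f h" "weak_grad g k" shows "weak_grad (\<lambda>x. f x - g x) (\<lambda>i x. h i x - k i x)"
  using weak_grad_add[OF assms(1) weak_grad_cmult[OF assms(2), of "-1"]] by simp

lemma weak_grad_AE_cong: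
  assumes "weak_grad f h" "g \<in> borel_measurable M" "AE x in M. f x = g x"
  shows "weak_grad g h"
proof -
  have *: "N (\<lambda>x. F x - g x) = N (\<lambda>x. F x - f x)" if "F \<in> D0" for F
    by (rule l2_norm_AE_cong)
       (use assms D0_meas[OF that] L2_measurable[OF weak_grad_L2(1)[OF assms(1)]] in auto)
  obtain F where "\<And>n. F n \<in> D0" "(\<lambda>n. N (\<lambda>x. F n x - f x)) \<longlonglongrightarrow> 0"
      "\<And>i. i \<in> I \<Longrightarrow> (\<lambda>n. N (\<lambda>x. G i (F n) x - h i x)) \<longlonglongrightarrow> 0" using assms(1) by (auto simp: weak_grad_def)
  then show ?thesis
    using assms L2_AE_cong[of f M g] unfolding weak_grad_def by (auto simp: * intro!: exI[of _ F])
qed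

lemma weak_grad_approx:
  assumes "weak_grad f h" "e > 0" shows "\<exists>F\<in>D0. N (\<lambda>x. F x - f x) < e \<and> (\<forall>i\<in>I. N (\<lambda>x. G i F x - h i x) < e)"
proof -
  obtain F where F: "\<And>n. F n \<in> D0" "(\<lambda>n. N (\<lambda>x. F n x - f x)) \<longlonglongrightarrow> 0"
      "\<And>i. i \<in> I \<Longrightarrow> (\<lambda>n. N (\<lambda>x. G i (F n) x - h i x)) \<longlonglongrightarrow> 0" using assms(1) by (auto simp: weak_grad_def)
  have "\<forall>\<^sub>F n in sequentially. N (\<lambda>x. F n x - f x) < e \<and> (\<forall>i\<in>I. N (\<lambda>x. G i (F n) x - h i x) < e)"
    using order_tendstoD(2)[OF F(2) assms(2)] order_tendstoD(2)[OF F(3) assms(2)] finI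
    by (auto intro!: eventually_conj simp: eventually_ball_finite_distrib)
  then obtain n where "N (\<lambda>x. F n x - f x) < e \<and> (\<forall>i\<in>I. N (\<lambda>x. G i (F n) x - h i x) < e)"
    using eventually_happens' sequentially_bot by blast
  then show ?thesis using F(1) by blast
qed

text \<open>A diagonal sequence: \<open>P n\<close> in \<open>D0\<close> is within
  \<open>1 / Suc n\<close> of \<open>F n\<close>, and its gradient within the same distance of
  \<open>H n\<close>, so it inherits the limits.\<close>

lemma weak_grad_closed:
  assumes WF: "\<And>n. weak_grad (F n) (H n)" and f: "f \<in> L2 M" and h: "\<And>i. i \<in> I \<Longrightarrow> h i \<in> L2 M"
    and Ff: "(\<lambda>n. N (\<lambda>x. F n x - f x)) \<longlonglongrightarrow> 0"
    and Hh: "\<And>i. i \<in> I \<Longrightarrow> (\<lambda>n. N (\<lambda>x. H n i x - h i x)) \<longlonglongrightarrow> 0"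
  shows "weak_grad f h"
proof -
  have "\<forall>n. \<exists>P\<in>D0. N (\<lambda>x. P x - F n x) < 1 / real (Suc n) \<and> (\<forall>i\<in>I. N (\<lambda>x. G i P x - H n i x) < 1 / real (Suc n))"
    using weak_grad_approx[OF WF] by simp
  then obtain P where P: "\<And>n. P n \<in> D0" "\<And>n. N (\<lambda>x. P n x - F n x) < 1 / real (Suc n)"
      "\<And>n i. i \<in> I \<Longrightarrow> N (\<lambda>x. G i (P n) x - H n i x) < 1 / real (Suc n)"
    by metis
  have *: "(\<lambda>n. N (\<lambda>x. p n x - a x)) \<longlonglongrightarrow> 0"
    if "\<And>n. p n \<in> L2 M" "\<And>n. q n \<in> L2 M" "a \<in> L2 M" "(\<lambda>n. N (\<lambda>x. q n x - a x)) \<longlonglongrightarrow> 0"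
      "\<And>n. N (\<lambda>x. p n x - q n x) < 1 / real (Suc n)" for p q :: "nat \<Rightarrow> 'a \<Rightarrow> real" and a
  proof (rule real_tendsto_sandwich[OF _ _ tendsto_const])
    have "(\<lambda>n. 1 / real (Suc n)) \<longlonglongrightarrow> 0"
      by (rule LIMSEQ_Suc[OF lim_1_over_n])
    from tendsto_add[OF this that(4)]
    show "(\<lambda>n. 1 / real (Suc n) + N (\<lambda>x. q n x - a x)) \<longlonglongrightarrow> 0" by simp
    have "N (\<lambda>x. p n x - a x) \<le> 1 / real (Suc n) + N (\<lambda>x. q n x - a x)" for n
      using l2_triangle3[OF that(1)[of n] that(2)[of n] that(3)] that(5)[of n] by linarith
    then show "\<forall>\<^sub>F n in sequentially. N (\<lambda>x. p n x - a x) \<le> 1 / real (Suc n) + N (\<lambda>x. q n x - a x)"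
      by simp
  qed (simp add: l2_norm_nonneg)
  show ?thesis unfolding weak_grad_def
  proof (intro conjI ballI exI[of _ P] allI P(1) f h)
    show "(\<lambda>n. N (\<lambda>x. P n x - f x)) \<longlonglongrightarrow> 0"
      by (rule *[OF _ _ f Ff P(2)]) (use P(1) D0_L2 weak_grad_L2(1)[OF WF] in auto)
    show "(\<lambda>n. N (\<lambda>x. G i (P n) x - h i x)) \<longlonglongrightarrow> 0" if "i \<in> I" for i
      by (rule *[OF _ _ h[OF that] Hh[OF that] P(3)[OF that]]) (use P(1) G_L2[OF _ that] weak_grad_L2(2)[OF WF that] that in auto)
  qed
qed

text \<open>Closability of each \<open>G i\<close> enters here; it is what makes the weak gradient
  of an equivalence class well defined.\<close>

lemma weak_grad_zero:
  assumes "weak_grad f h" "AE x in M. f x = 0" "i \<in> I" shows "AE x in M. h i x = 0"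
proof -
  obtain F where F: "\<And>n. F n \<in> D0" "(\<lambda>n. N (\<lambda>x. F n x - f x)) \<longlonglongrightarrow> 0"
      "\<And>i. i \<in> I \<Longrightarrow> (\<lambda>n. N (\<lambda>x. G i (F n) x - h i x)) \<longlonglongrightarrow> 0" using assms(1) by (auto simp: weak_grad_def)
  have "N (F n) = N (\<lambda>x. F n x - f x)" for n
    by (rule l2_norm_AE_cong) (use assms(2) D0_meas[OF F(1)] L2_measurable[OF weak_grad_L2(1)[OF assms(1)]] in auto)
  then show ?thesis using G_closable[OF F(1) assms(3) weak_grad_L2(2)[OF assms(1,3)] _ F(3)[OF assms(3)]] F(2) by simp
qed

lemma weak_grad_unique:
  assumes "weak_grad f h" "weak_grad g k" "AE x in M. f x = g x" "i \<in> I" shows "AE x in M. h i x = k i x"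
  using weak_grad_zero[OF weak_grad_diff[OF assms(1,2)] _ assms(4)] assms(3) by auto

section \<open>The closure of the form in terms of weak gradients\<close>

lemma E0_diff:
  assumes "\<And>n. F n \<in> D0"
  shows "E0 (\<lambda>x. F m x - F n x) (\<lambda>x. F m x - F n x) = (\<Sum>i\<in>I. (N (\<lambda>x. G i (F m) x - G i (F n) x))\<^sup>2)"
  unfolding E0_eq[OF D0_diff[OF assms assms] D0_diff[OF assms assms]] l2_norm_sq'
  by (intro sum.cong refl inner_G_cong) (auto simp: G_diff assms)

text \<open>The link from the abstract closure to weak gradients: convergence in energy makes every
  \<open>G i (F n)\<close> a Cauchy sequence in a complete space, and the limits form the
  gradient.\<close>

lemma approximates_W:
  assumes "approximates M D0 E0 F f" "f \<in> L2 M"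
  shows "\<exists>h. weak_grad f h \<and> (\<forall>i\<in>I. (\<lambda>n. N (\<lambda>x. G i (F n) x - h i x)) \<longlonglongrightarrow> 0)"
proof -
  have F: "\<And>n. F n \<in> D0" "form_Cauchy E0 F" "(\<lambda>n. N (\<lambda>x. F n x - f x)) \<longlonglongrightarrow> 0"
    using assms by (auto simp: approximates_def)
  have "\<exists>h\<in>L2 M. (\<lambda>n. N (\<lambda>x. G i (F n) x - h x)) \<longlonglongrightarrow> 0" if i: "i \<in> I" for i
    by (rule l2_complete[OF G_L2[OF F(1) i]])
       (rule form_Cauchy_imp_l2[where H="\<lambda>n i. G i (F n)" and F=F and E=E0, OF finI _ E0_diff[where F=F, OF F(1)] F(2) i], auto intro: G_L2 F)
  then have "\<forall>i\<in>I. \<exists>h. h \<in> L2 M \<and> (\<lambda>n. N (\<lambda>x. G i (F n) x - h x)) \<longlonglongrightarrow> 0" by blast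
  from bchoice[OF this] obtain h where h: "\<And>i. i \<in> I \<Longrightarrow> h i \<in> L2 M"
    "\<And>i. i \<in> I \<Longrightarrow> (\<lambda>n. N (\<lambda>x. G i (F n) x - h i x)) \<longlonglongrightarrow> 0"
    by blast
  then have "weak_grad f h" unfolding weak_grad_def using F assms(2) by (intro conjI ballI exI[of _ F] allI) auto
  with h show ?thesis by blast
qed

lemma weak_grad_approximates:
  assumes "weak_grad f h" shows "\<exists>F. approximates M D0 E0 F f"
proof -
  obtain F where F: "\<And>n. F n \<in> D0" "(\<lambda>n. N (\<lambda>x. F n x - f x)) \<longlonglongrightarrow> 0"
      "\<And>i. i \<in> I \<Longrightarrow> (\<lambda>n. N (\<lambda>x. G i (F n) x - h i x)) \<longlonglongrightarrow> 0" using assms(1) by (auto simp: weak_grad_def)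
  have "form_Cauchy E0 F"
    by (rule l2_conv_imp_form_Cauchy[where H="\<lambda>n i. G i (F n)" and F=F and E=E0 and h=h, OF finI _ E0_diff[where F=F, OF F(1)] _ F(3)])
       (use F assms in \<open>auto intro: G_L2 weak_grad_L2\<close>)
  then show ?thesis using F by (auto simp: approximates_def)
qed

abbreviation "Dom \<equiv> closure_domain M D0 E0"
abbreviation "En \<equiv> closure_form M D0 E0"

lemma Dom_iff: "f \<in> Dom \<longleftrightarrow> (\<exists>h. weak_grad f h)"
  unfolding closure_domain_def using approximates_W[of _ f] weak_grad_approximates[of f] weak_grad_L2(1)[of f] by blast

lemma weak_grad_Dom: "weak_grad f h \<Longrightarrow> f \<in> Dom" by (auto simp: Dom_iff)

lemma Dom_L2: "f \<in> Dom \<Longrightarrow> f \<in> L2 M" by (auto simp: closure_domain_def)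

text \<open>The definite description in \<open>closure_form\<close> asks for one limit common to all
  approximating pairs, which is uniqueness of weak gradients, and for at least one such pair,
  without which any number would qualify.\<close>

lemma En_eq:
  assumes "weak_grad f h" "weak_grad g k" shows "En f g = (\<Sum>i\<in>I. l2_inner M (h i) (k i))"
  unfolding closure_form_def
proof (rule the_equality)
  show *: "\<forall>F H. approximates M D0 E0 F f \<longrightarrow> approximates M D0 E0 H g \<longrightarrow>
      (\<lambda>n. E0 (F n) (H n)) \<longlonglongrightarrow> (\<Sum>i\<in>I. l2_inner M (h i) (k i))"
  proof (intro allI impI)
    fix F H assume A: "approximates M D0 E0 F f" "approximates M D0 E0 H g"
    have FD: "\<And>n. F n \<in> D0" "\<And>n. H n \<in> D0" using A by (auto simp: approximates_def)
    obtain h' where h': "weak_grad f h'" "\<And>i. i \<in> I \<Longrightarrow> (\<lambda>n. N (\<lambda>x. G i (F n) x - h' i x)) \<longlonglongrightarrow> 0"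
      using approximates_W[OF A(1)] weak_grad_L2[OF assms(1)] by blast
    obtain k' where k': "weak_grad g k'" "\<And>i. i \<in> I \<Longrightarrow> (\<lambda>n. N (\<lambda>x. G i (H n) x - k' i x)) \<longlonglongrightarrow> 0"
      using approximates_W[OF A(2)] weak_grad_L2[OF assms(2)] by blast
    have "(\<lambda>n. \<Sum>i\<in>I. l2_inner M (G i (F n)) (G i (H n))) \<longlonglongrightarrow> (\<Sum>i\<in>I. l2_inner M (h' i) (k' i))"
      by (intro tendsto_sum l2_inner_tendsto G_L2 FD weak_grad_L2(2)[OF h'(1)] weak_grad_L2(2)[OF k'(1)] h'(2) k'(2))
    also have "(\<Sum>i\<in>I. l2_inner M (h' i) (k' i)) = (\<Sum>i\<in>I. l2_inner M (h i) (k i))"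
      by (intro sum.cong refl l2_inner_AE_cong weak_grad_unique[OF h'(1) assms(1)] weak_grad_unique[OF k'(1) assms(2)])
         (use weak_grad_L2(2)[OF h'(1)] weak_grad_L2(2)[OF k'(1)] weak_grad_L2(2)[OF assms(1)] weak_grad_L2(2)[OF assms(2)] in \<open>auto intro: L2_measurable\<close>)
    finally show "(\<lambda>n. E0 (F n) (H n)) \<longlonglongrightarrow> (\<Sum>i\<in>I. l2_inner M (h i) (k i))"
      by (simp add: E0_eq FD)
  qed
  fix c assume c: "\<forall>F H. approximates M D0 E0 F f \<longrightarrow> approximates M D0 E0 H g \<longrightarrow> (\<lambda>n. E0 (F n) (H n)) \<longlonglongrightarrow> c"
  obtain F H where "approximates M D0 E0 F f" "approximates M D0 E0 H g"
    using weak_grad_approximates assms by metis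
  then show "c = (\<Sum>i\<in>I. l2_inner M (h i) (k i))"
    using c * LIMSEQ_unique by blast
qed

lemma En_diag: "weak_grad f h \<Longrightarrow> En f f = (\<Sum>i\<in>I. (N (h i))\<^sup>2)"
  by (simp add: En_eq l2_norm_sq')

lemma D0_subset_Dom: "D0 \<subseteq> Dom" using weak_grad_D0 weak_grad_Dom by blast

lemma E0_En: "f \<in> D0 \<Longrightarrow> g \<in> D0 \<Longrightarrow> E0 f g = En f g"
  by (simp add: E0_eq En_eq[OF weak_grad_D0 weak_grad_D0])

lemma Dom_cong: "f \<in> Dom \<Longrightarrow> g \<in> L2 M \<Longrightarrow> AE x in M. f x = g x \<Longrightarrow> g \<in> Dom"
  using weak_grad_AE_cong[of f _ g] L2_measurable by (auto simp: Dom_iff)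

lemma bilinear_En: "bilinear_form M Dom En"
proof -
  have add: "En (\<lambda>x. f x + g x) h = En f h + En g h" "En h (\<lambda>x. f x + g x) = En h f + En h g"
    if A: "f \<in> Dom" "g \<in> Dom" "h \<in> Dom" for f g h
  proof -
    obtain a b c where w: "weak_grad f a" "weak_grad g b" "weak_grad h c" using A unfolding Dom_iff by blast
    note L = w[THEN weak_grad_L2(2)]
    show "En (\<lambda>x. f x + g x) h = En f h + En g h" "En h (\<lambda>x. f x + g x) = En h f + En h g"
      by (simp_all add: En_eq w weak_grad_add[OF w(1,2)] En_eq[OF weak_grad_add[OF w(1,2)] w(3)] En_eq[OF w(3) weak_grad_add[OF w(1,2)]]
          En_eq[OF w(1,3)] En_eq[OF w(2,3)] En_eq[OF w(3,1)] En_eq[OF w(3,2)] L l2_inner_add_left l2_inner_add_right sum.distrib)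
  qed
  have cm: "En (\<lambda>x. c * f x) g = c * En f g" "En f (\<lambda>x. c * g x) = c * En f g"
    if A: "f \<in> Dom" "g \<in> Dom" for f g c
  proof -
    obtain a b where w: "weak_grad f a" "weak_grad g b" using A unfolding Dom_iff by blast
    show "En (\<lambda>x. c * f x) g = c * En f g" "En f (\<lambda>x. c * g x) = c * En f g"
      by (simp_all add: En_eq[OF w] En_eq[OF weak_grad_cmult[OF w(1)] w(2)] En_eq[OF w(1) weak_grad_cmult[OF w(2)]]
          l2_inner_cmult_left l2_inner_cmult_right sum_distrib_left)
  qed
  have AE: "En f g = En f' g'"
    if A: "f \<in> Dom" "f' \<in> Dom" "g \<in> Dom" "g' \<in> Dom" "AE x in M. f x = f' x" "AE x in M. g x = g' x" for f f' g g'
  proof -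
    obtain a b where w: "weak_grad f a" "weak_grad g b" using A unfolding Dom_iff by blast
    have "weak_grad f' a" "weak_grad g' b"
      using weak_grad_AE_cong[OF w(1) _ A(5)] weak_grad_AE_cong[OF w(2) _ A(6)] A(2,4) Dom_L2 L2_measurable by blast+
    then show ?thesis using w by (simp add: En_eq)
  qed
  show ?thesis unfolding bilinear_form_def
    using Dom_L2 D0_0 D0_subset_Dom by (auto simp: add cm intro: AE) (auto simp: Dom_iff intro: weak_grad_add weak_grad_cmult)
qed

lemma bilinear_E0: "bilinear_form M D0 E0"
proof -
  have D: "f \<in> Dom" if "f \<in> D0" for f using that D0_subset_Dom by auto
  note B = bilinear_En[unfolded bilinear_form_def]
  show ?thesis unfolding bilinear_form_def
  proof (intro conjI ballI allI impI)
    fix f f' g g' assume "f \<in> D0" "f' \<in> D0" "g \<in> D0" "g' \<in> D0" "AE x in M. f x = f' x" "AE x in M. g x = g' x"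
    then show "E0 f g = E0 f' g'" using B D by (simp add: E0_En)
  qed (use B D in \<open>auto simp: E0_En D0_L2 D0_0 D0_add D0_cmult\<close>)
qed

lemma symmetric_En: "symmetric_form Dom En"
  by (auto simp: symmetric_form_def Dom_iff En_eq l2_inner_commute)

lemma symmetric_E0: "symmetric_form D0 E0"
  by (auto simp: symmetric_form_def E0_eq l2_inner_commute)

lemma positive_En: "positive_definite_form Dom En"
  by (auto simp: positive_definite_form_def Dom_iff En_diag intro!: sum_nonneg)

lemma positive_E0: "positive_definite_form D0 E0"
  using positive_En D0_subset_Dom by (auto simp: positive_definite_form_def E0_En)

lemma dense_D0: "densely_defined M D0"
  using D0_dense D0_L2 by (auto simp: densely_defined_def)

lemma dense_Dom: "densely_defined M Dom"
  using dense_D0 D0_subset_Dom Dom_L2 by (auto simp: densely_defined_def) blast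

text \<open>A sequence as in the definition approximates 0 in the sense of the closure, so its
  energies tend to the energy of 0 there.\<close>

lemma closable_E0: "closable M D0 E0"
  unfolding closable_def
proof (intro allI impI)
  fix F assume F: "\<forall>n. F n \<in> D0" "form_Cauchy E0 F" "(\<lambda>n. N (F n)) \<longlonglongrightarrow> 0"
  then have A: "approximates M D0 E0 F (\<lambda>x. 0)" by (simp add: approximates_def)
  have "weak_grad (\<lambda>x. 0) (\<lambda>i x. 0)"
    using weak_grad_cmult[OF weak_grad_D0[OF D0_0], of 0] by simp
  then have "En (\<lambda>x. 0) (\<lambda>x. 0) = 0" by (simp add: En_eq l2_inner_def)
  obtain h where h: "weak_grad (\<lambda>x. 0) h" "\<And>i. i \<in> I \<Longrightarrow> (\<lambda>n. N (\<lambda>x. G i (F n) x - h i x)) \<longlonglongrightarrow> 0"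
    using approximates_W[OF A L2_0] by blast
  have "(\<lambda>n. \<Sum>i\<in>I. l2_inner M (G i (F n)) (G i (F n))) \<longlonglongrightarrow> (\<Sum>i\<in>I. l2_inner M (h i) (h i))"
    by (intro tendsto_sum l2_inner_tendsto G_L2 F(1)[rule_format] weak_grad_L2(2)[OF h(1)] h(2))
  also have "(\<Sum>i\<in>I. l2_inner M (h i) (h i)) = En (\<lambda>x. 0) (\<lambda>x. 0)"
    by (simp add: En_eq[OF h(1) h(1)])
  also have "\<dots> = 0" by fact
  finally show "(\<lambda>n. E0 (F n) (F n)) \<longlonglongrightarrow> 0" using F(1) by (simp add: E0_eq)
qed

lemma closed_En: "closed_form M Dom En"
  unfolding closed_form_def
proof (intro allI impI)
  fix F assume F: "\<forall>n. F n \<in> Dom" "form_Cauchy (E_alpha M En 1) F"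
  obtain H where H: "\<And>n. weak_grad (F n) (H n)" using F(1) by (auto simp: Dom_iff) metis
  \<comment> \<open>\<open>None\<close> indexes the function and \<open>Some i\<close> its gradient
    components, so that \<open>E_alpha M En 1\<close> of a difference becomes one sum of squared
    norms.\<close>
  let ?K = "\<lambda>n. case_option (F n) (H n)" and ?J = "insert None (Some ` I)"
  have sumJ: "(\<Sum>i\<in>?J. c i) = c None + (\<Sum>i\<in>I. c (Some i))" for c :: "'i option \<Rightarrow> real"
    using finI by (subst sum.insert) (auto simp: sum.reindex)
  have K: "?K n i \<in> L2 M" if "i \<in> ?J" for n i using that weak_grad_L2[OF H] by auto
  have Ea: "E_alpha M En 1 (\<lambda>x. F m x - f x) (\<lambda>x. F m x - f x) =
     (\<Sum>i\<in>?J. (N (\<lambda>x. ?K m i x - case_option f h i x))\<^sup>2)" if "weak_grad f h" for m f h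
    using En_diag[OF weak_grad_diff[OF H that]] by (simp add: E_alpha_def sumJ l2_norm_sq')
  have C: "\<exists>h\<in>L2 M. (\<lambda>n. N (\<lambda>x. ?K n i x - h x)) \<longlonglongrightarrow> 0" if i: "i \<in> ?J" for i
    by (rule l2_complete[OF K[OF i]])
       (rule form_Cauchy_imp_l2[where H="?K", OF _ K Ea[OF H] F(2) i], use finI in auto)
  obtain f where f: "f \<in> L2 M" "(\<lambda>n. N (\<lambda>x. F n x - f x)) \<longlonglongrightarrow> 0" using C[of None] by auto
  have "\<forall>i\<in>I. \<exists>h\<in>L2 M. (\<lambda>n. N (\<lambda>x. H n i x - h x)) \<longlonglongrightarrow> 0" using C[of "Some _"] by auto
  then have "\<forall>i\<in>I. \<exists>h. h \<in> L2 M \<and> (\<lambda>n. N (\<lambda>x. H n i x - h x)) \<longlonglongrightarrow> 0" by blast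
  from bchoice[OF this] obtain h where h: "\<And>i. i \<in> I \<Longrightarrow> h i \<in> L2 M"
    "\<And>i. i \<in> I \<Longrightarrow> (\<lambda>n. N (\<lambda>x. H n i x - h i x)) \<longlonglongrightarrow> 0"
    by blast
  have w: "weak_grad f h" by (rule weak_grad_closed[OF H f(1) h(1) f(2) h(2)])
  have "(\<lambda>n. (N (\<lambda>x. F n x - f x))\<^sup>2 + (\<Sum>i\<in>I. (N (\<lambda>x. H n i x - h i x))\<^sup>2)) \<longlonglongrightarrow> 0\<^sup>2 + (\<Sum>i\<in>I. 0\<^sup>2)"
    by (intro tendsto_intros f h(2))
  then have "(\<lambda>n. E_alpha M En 1 (\<lambda>x. F n x - f x) (\<lambda>x. F n x - f x)) \<longlonglongrightarrow> 0"
    by (simp add: Ea[OF w] sumJ)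
  then show "\<exists>f\<in>Dom. (\<lambda>n. E_alpha M En 1 (\<lambda>x. F n x - f x) (\<lambda>x. F n x - f x)) \<longlonglongrightarrow> 0"
    using weak_grad_Dom[OF w] by blast
qed

section \<open>The chain rule and the contraction property\<close>

lemma weak_grad_comp:
  assumes w: "weak_grad f h" and \<psi>: "C2_real \<psi> \<psi>'" "\<psi> 0 = 0" "\<And>t. \<bar>\<psi>' t\<bar> \<le> C"
  shows "weak_grad (\<lambda>x. \<psi> (f x)) (\<lambda>i x. \<psi>' (f x) * h i x)"
proof -
  note [measurable] = borel_measurable_continuous_onI[OF C2_real_continuous(1)[OF \<psi>(1)]]
    borel_measurable_continuous_onI[OF C2_real_continuous(2)[OF \<psi>(1)]]
  have C0: "C \<ge> 0" using \<psi>(3)[of 0] by linarith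
  note fL = weak_grad_L2(1)[OF w] and hL = weak_grad_L2(2)[OF w]
  obtain F0 where F0: "\<And>n. F0 n \<in> D0" "(\<lambda>n. N (\<lambda>x. F0 n x - f x)) \<longlonglongrightarrow> 0"
      "\<And>i. i \<in> I \<Longrightarrow> (\<lambda>n. N (\<lambda>x. G i (F0 n) x - h i x)) \<longlonglongrightarrow> 0" using w by (auto simp: weak_grad_def)
  \<comment> \<open>\<open>\<psi>'\<close> is bounded but not assumed Lipschitz, so
    \<open>\<psi>' (F n x)\<close> is controlled pointwise, along an almost everywhere convergent
    subsequence.\<close>
  obtain r :: "nat \<Rightarrow> nat" where r: "strict_mono r" "AE x in M. (\<lambda>n. F0 (r n) x) \<longlonglongrightarrow> f x"
    using l2_norm_tendsto_subseq[OF F0(2) D0_L2[OF F0(1)] fL] by blast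
  define F where "F n = F0 (r n)" for n
  have F: "\<And>n. F n \<in> D0" "(\<lambda>n. N (\<lambda>x. F n x - f x)) \<longlonglongrightarrow> 0"
      "\<And>i. i \<in> I \<Longrightarrow> (\<lambda>n. N (\<lambda>x. G i (F n) x - h i x)) \<longlonglongrightarrow> 0" "AE x in M. (\<lambda>n. F n x) \<longlonglongrightarrow> f x"
    using F0(1) LIMSEQ_subseq_LIMSEQ[OF F0(2) r(1)] LIMSEQ_subseq_LIMSEQ[OF F0(3) r(1)] r(2)
    by (auto simp: F_def o_def)
  have [measurable]: "f \<in> borel_measurable M" "\<And>n. F n \<in> borel_measurable M"
    using fL F(1) D0_meas by (auto intro: L2_measurable)
  have fC: "\<bar>\<psi> t\<bar> \<le> C * \<bar>t\<bar>" for t using C2_real_lipschitz[OF \<psi>(1,3), of t 0] \<psi>(2) by simp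
  have L1: "(\<lambda>x. \<psi> (f x)) \<in> L2 M"
    by (rule L2_bound[OF L2_cmult[OF fL, of C]]) (use fC C0 in \<open>auto simp: abs_mult\<close>)
  have L2: "(\<lambda>x. \<psi>' (f x) * h i x) \<in> L2 M" if "i \<in> I" for i
    by (rule L2_bounded_mult[OF hL[OF that], of _ C]) (use \<psi>(3) in auto)
  have conv1: "(\<lambda>n. N (\<lambda>x. \<psi> (F n x) - \<psi> (f x))) \<longlonglongrightarrow> 0"
  proof (rule real_tendsto_sandwich[OF _ _ tendsto_const])
    show "(\<lambda>n. C * N (\<lambda>x. F n x - f x)) \<longlonglongrightarrow> 0" by (rule tendsto_mult_right_zero[OF F(2)])
    have "N (\<lambda>x. \<psi> (F n x) - \<psi> (f x)) \<le> N (\<lambda>x. C * (F n x - f x))" for n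
      using C2_real_lipschitz[OF \<psi>(1,3)] C0
      by (intro l2_norm_mono L2_cmult L2_diff D0_L2[OF F(1)] fL) (auto simp: abs_mult)
    then show "\<forall>\<^sub>F n in sequentially. N (\<lambda>x. \<psi> (F n x) - \<psi> (f x)) \<le> C * N (\<lambda>x. F n x - f x)"
      using C0 by (simp add: l2_norm_cmult)
  qed (simp add: l2_norm_nonneg)
  have conv2: "(\<lambda>n. N (\<lambda>x. G i (\<lambda>x. \<psi> (F n x)) x - \<psi>' (f x) * h i x)) \<longlonglongrightarrow> 0" if i: "i \<in> I" for i
  proof (rule real_tendsto_sandwich[OF _ _ tendsto_const])
    have [measurable]: "h i \<in> borel_measurable M" "\<And>n. G i (F n) \<in> borel_measurable M"
      using L2_measurable[OF hL[OF i]] G_meas[OF F(1) i] by auto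
    \<comment> \<open>The error splits into \<open>\<psi>' (F n x)\<close> times the error of the
      gradient, bounded with the help of \<open>C\<close>, and this term, treated by dominated
      convergence.\<close>
    let ?a = "\<lambda>n x. (\<psi>' (F n x) - \<psi>' (f x)) * h i x"
    have d: "\<bar>\<psi>' s - \<psi>' t\<bar> \<le> 2 * C" for s t using \<psi>(3)[of s] \<psi>(3)[of t] by linarith
    have aL: "?a n \<in> L2 M" for n
      by (rule L2_bounded_mult[OF hL[OF i], where C="2*C"]) (use d in auto)
    have "(\<lambda>n. N (\<lambda>x. ?a n x - 0)) \<longlonglongrightarrow> 0"
    proof (rule l2_dominated_convergence(3)[where g="\<lambda>x. \<bar>2 * C * h i x\<bar>"])
      show "(\<lambda>x. \<bar>2 * C * h i x\<bar>) \<in> L2 M"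
        by (rule L2_bound[OF L2_cmult[OF hL[OF i], of "2*C"]]) auto
      show "AE x in M. (\<lambda>n. ?a n x) \<longlonglongrightarrow> 0"
        using F(4)
      proof eventually_elim
        case (elim x)
        have "(\<lambda>n. \<psi>' (F n x)) \<longlonglongrightarrow> \<psi>' (f x)"
          using continuous_on_tendsto_compose[OF C2_real_continuous(2)[OF \<psi>(1)] elim] by simp
        then show ?case by (auto intro!: tendsto_eq_intros)
      qed
      show "AE x in M. \<bar>?a n x\<bar> \<le> \<bar>2 * C * h i x\<bar>" for n
        using d C0 by (auto simp: abs_mult intro!: mult_right_mono)
    qed (auto)
    from tendsto_add[OF tendsto_mult_right_zero[OF F(3)[OF i], of C] this]
    show "(\<lambda>n. C * N (\<lambda>x. G i (F n) x - h i x) + N (?a n)) \<longlonglongrightarrow> 0" by simp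
    have "N (\<lambda>x. G i (\<lambda>x. \<psi> (F n x)) x - \<psi>' (f x) * h i x) \<le> C * N (\<lambda>x. G i (F n) x - h i x) + N (?a n)" for n
    proof -
      have bL: "(\<lambda>x. \<psi>' (F n x) * (G i (F n) x - h i x)) \<in> L2 M"
        by (rule L2_bounded_mult[OF L2_diff[OF G_L2[OF F(1) i] hL[OF i]], of _ C]) (use \<psi>(3) in auto)
      have "N (\<lambda>x. G i (\<lambda>x. \<psi> (F n x)) x - \<psi>' (f x) * h i x) =
        N (\<lambda>x. \<psi>' (F n x) * (G i (F n) x - h i x) + ?a n x)"
        by (rule norm_space_cong) (simp add: G_comp[OF F(1) \<psi>(1,2) i] algebra_simps)
      also have "\<dots> \<le> N (\<lambda>x. \<psi>' (F n x) * (G i (F n) x - h i x)) + N (?a n)"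
        by (rule l2_triangle[OF bL aL])
      also have "N (\<lambda>x. \<psi>' (F n x) * (G i (F n) x - h i x)) \<le> C * N (\<lambda>x. G i (F n) x - h i x)"
        by (rule l2_norm_bounded_mult[OF L2_diff[OF G_L2[OF F(1) i] hL[OF i]]]) (use \<psi>(3) C0 in auto)
      finally show ?thesis by simp
    qed
    then show "\<forall>\<^sub>F n in sequentially. N (\<lambda>x. G i (\<lambda>x. \<psi> (F n x)) x - \<psi>' (f x) * h i x) \<le>
      C * N (\<lambda>x. G i (F n) x - h i x) + N (?a n)" by simp
  qed (simp add: l2_norm_nonneg)
  show ?thesis unfolding weak_grad_def
    using L1 L2 conv1 conv2 D0_comp[OF F(1) \<psi>(1,2)] by (auto intro!: exI[of _ "\<lambda>n x. \<psi> (F n x)"])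
qed

text \<open>The limit \<open>\<eta>\<close> may have kinks, with \<open>\<theta>\<close> a choice of
  derivative there, and the uniform bounds are asked for on a set \<open>K\<close> carrying the
  values of \<open>f\<close>. The first freedom serves the unit contraction, the second the
  square.\<close>

lemma weak_grad_comp_limit:
  assumes w: "weak_grad f h" and \<psi>: "\<And>n. C2_real (\<psi> n) (\<psi>' n)" "\<And>n. \<psi> n 0 = 0" "\<And>n. \<exists>C. \<forall>t. \<bar>\<psi>' n t\<bar> \<le> C"
    and K: "AE x in M. f x \<in> K" and bd: "\<And>n t. t \<in> K \<Longrightarrow> \<bar>\<psi>' n t\<bar> \<le> C" "\<And>n t. t \<in> K \<Longrightarrow> \<bar>\<psi> n t\<bar> \<le> C * \<bar>t\<bar>"
    and lim: "\<And>t. (\<lambda>n. \<psi> n t) \<longlonglongrightarrow> \<eta> t" "\<And>t. (\<lambda>n. \<psi>' n t) \<longlonglongrightarrow> \<theta> t"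
  shows "weak_grad (\<lambda>x. \<eta> (f x)) (\<lambda>i x. \<theta> (f x) * h i x)"
proof -
  note [measurable] = borel_measurable_continuous_onI[OF C2_real_continuous(1)[OF \<psi>(1)]]
    borel_measurable_continuous_onI[OF C2_real_continuous(2)[OF \<psi>(1)]]
  have [measurable]: "\<eta> \<in> borel_measurable borel" "\<theta> \<in> borel_measurable borel"
    by (rule borel_measurable_LIMSEQ_real[OF lim(1)], simp) (rule borel_measurable_LIMSEQ_real[OF lim(2)], simp)
  note fL = weak_grad_L2(1)[OF w] and hL = weak_grad_L2(2)[OF w]
  have [measurable]: "f \<in> borel_measurable M" "\<And>i. i \<in> I \<Longrightarrow> h i \<in> borel_measurable M"
    using fL hL by (auto intro: L2_measurable)
  have le_abs: "\<bar>a\<bar> \<le> \<bar>C * b\<bar>" if "\<bar>a\<bar> \<le> C * \<bar>b\<bar>" for a b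
    using that abs_ge_self[of C] mult_right_mono[of C "\<bar>C\<bar>" "\<bar>b\<bar>"] by (simp add: abs_mult)
  have le_abs': "\<bar>a * b\<bar> \<le> \<bar>C * b\<bar>" if "\<bar>a\<bar> \<le> C" for a b
    using that by (auto simp: abs_mult intro!: mult_right_mono)
  have 1: "(\<lambda>x. \<eta> (f x)) \<in> L2 M" "(\<lambda>n. N (\<lambda>x. \<psi> n (f x) - \<eta> (f x))) \<longlonglongrightarrow> 0"
  proof (rule_tac [!] l2_dominated_convergence[where g="\<lambda>x. \<bar>C * f x\<bar>" and F="\<lambda>n x. \<psi> n (f x)"])
    show "(\<lambda>x. \<bar>C * f x\<bar>) \<in> L2 M" by (rule L2_bound[OF L2_cmult[OF fL, of C]]) auto
    then show "(\<lambda>x. \<bar>C * f x\<bar>) \<in> L2 M" .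
    show "AE x in M. \<bar>\<psi> n (f x)\<bar> \<le> \<bar>C * f x\<bar>" for n
      using K by eventually_elim (use bd(2) in \<open>simp add: le_abs\<close>)
    then show "AE x in M. \<bar>\<psi> n (f x)\<bar> \<le> \<bar>C * f x\<bar>" for n .
  qed (auto simp: lim)
  have 2: "(\<lambda>x. \<theta> (f x) * h i x) \<in> L2 M" "(\<lambda>n. N (\<lambda>x. \<psi>' n (f x) * h i x - \<theta> (f x) * h i x)) \<longlonglongrightarrow> 0"
    if i: "i \<in> I" for i
  proof (rule_tac [!] l2_dominated_convergence[where g="\<lambda>x. \<bar>C * h i x\<bar>" and F="\<lambda>n x. \<psi>' n (f x) * h i x"])
    show "(\<lambda>x. \<bar>C * h i x\<bar>) \<in> L2 M" by (rule L2_bound[OF L2_cmult[OF hL[OF i], of C]]) (use i in auto)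
    then show "(\<lambda>x. \<bar>C * h i x\<bar>) \<in> L2 M" .
    show "AE x in M. \<bar>\<psi>' n (f x) * h i x\<bar> \<le> \<bar>C * h i x\<bar>" for n
      using K by eventually_elim (use bd(1) in \<open>simp add: le_abs'\<close>)
    then show "AE x in M. \<bar>\<psi>' n (f x) * h i x\<bar> \<le> \<bar>C * h i x\<bar>" for n .
  qed (use i in \<open>auto intro!: tendsto_intros lim\<close>)
  show ?thesis
  proof (rule weak_grad_closed)
    show "weak_grad (\<lambda>x. \<psi> n (f x)) (\<lambda>i x. \<psi>' n (f x) * h i x)" for n
      using \<psi>(3)[of n] weak_grad_comp[OF w \<psi>(1,2)] by blast
  qed (use 1 2 in auto)
qed

text \<open>A factor from \<open>D0\<close> is bounded together with its gradient, so both terms of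
  the Leibniz rule pass to the limit in \<open>L\<^sup>2\<close>.\<close>

lemma weak_grad_mult_D0:
  assumes F: "F \<in> D0" and w: "weak_grad g k" shows "weak_grad (\<lambda>x. F x * g x) (\<lambda>i x. F x * k i x + g x * G i F x)"
proof -
  obtain Q where Q: "\<And>n. Q n \<in> D0" "(\<lambda>n. N (\<lambda>x. Q n x - g x)) \<longlonglongrightarrow> 0"
      "\<And>i. i \<in> I \<Longrightarrow> (\<lambda>n. N (\<lambda>x. G i (Q n) x - k i x)) \<longlonglongrightarrow> 0" using w by (auto simp: weak_grad_def)
  obtain C where C: "AE x in M. \<bar>F x\<bar> \<le> C" using D0_bdd[OF F] by auto
  have GC: "\<exists>C. AE x in M. \<bar>G i F x\<bar> \<le> C" if "i \<in> I" for i using G_bdd[OF F that] by auto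
  note gL = weak_grad_L2(1)[OF w] and kL = weak_grad_L2(2)[OF w] and QL = D0_L2[OF Q(1)]
  have c1: "(\<lambda>n. N (\<lambda>x. F x * Q n x - F x * g x)) \<longlonglongrightarrow> 0"
    by (rule l2_norm_tendsto_bounded_mult[OF Q(2) QL gL D0_meas[OF F] C])
  have L1: "(\<lambda>x. F x * g x) \<in> L2 M" by (rule L2_bounded_mult[OF gL D0_meas[OF F] C])
  have "(\<lambda>x. F x * k i x + g x * G i F x) \<in> L2 M \<and>
    (\<lambda>n. N (\<lambda>x. G i (\<lambda>x. F x * Q n x) x - (F x * k i x + g x * G i F x))) \<longlonglongrightarrow> 0" if i: "i \<in> I" for i
  proof
    obtain C' where C': "AE x in M. \<bar>G i F x\<bar> \<le> C'" using GC[OF i] by blast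
    have A: "(\<lambda>x. F x * k i x) \<in> L2 M" by (rule L2_bounded_mult[OF kL[OF i] D0_meas[OF F] C])
    have B: "(\<lambda>x. G i F x * g x) \<in> L2 M" by (rule L2_bounded_mult[OF gL G_meas[OF F i] C'])
    show "(\<lambda>x. F x * k i x + g x * G i F x) \<in> L2 M"
      using L2_add[OF A B] by (simp add: mult.commute)
    have "(\<lambda>n. N (\<lambda>x. (F x * G i (Q n) x + G i F x * Q n x) - (F x * k i x + G i F x * g x))) \<longlonglongrightarrow> 0"
      by (intro l2_norm_tendsto_add A B
         l2_norm_tendsto_bounded_mult[OF Q(3)[OF i] G_L2[OF Q(1) i] kL[OF i] D0_meas[OF F] C]
         l2_norm_tendsto_bounded_mult[OF Q(2) QL gL G_meas[OF F i] C']
         L2_bounded_mult[OF G_L2[OF Q(1) i] D0_meas[OF F] C] L2_bounded_mult[OF QL G_meas[OF F i] C'])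
    also have "(\<lambda>n. N (\<lambda>x. (F x * G i (Q n) x + G i F x * Q n x) - (F x * k i x + G i F x * g x))) =
      (\<lambda>n. N (\<lambda>x. G i (\<lambda>x. F x * Q n x) x - (F x * k i x + g x * G i F x)))"
      by (rule ext, rule norm_space_cong) (simp add: G_mult[OF F Q(1) i] mult.commute)
    finally show "(\<lambda>n. N (\<lambda>x. G i (\<lambda>x. F x * Q n x) x - (F x * k i x + g x * G i F x))) \<longlonglongrightarrow> 0" .
  qed
  then show ?thesis unfolding weak_grad_def using L1 c1 D0_mult[OF F Q(1)]
    by (auto intro!: exI[of _ "\<lambda>n x. F x * Q n x"])
qed

lemma weak_grad_one: "weak_grad (\<lambda>x. 1) (\<lambda>i x. 0)"
  using D0_one unfolding weak_grad_def by (auto simp: L2_const)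

text \<open>The unit contraction is \<open>(\<bar>t\<bar> - \<bar>t - 1\<bar> + 1) / 2\<close>, and
  each modulus \<open>\<bar>s\<bar>\<close> is smoothed to \<open>sqrt (s\<^sup>2 + e n)\<close>. At
  the two kinks the limiting derivative takes the value 1/2.\<close>

lemma weak_grad_clamp:
  assumes "weak_grad f h"
  shows "weak_grad (\<lambda>x. min (max (f x) 0) 1) (\<lambda>i x. (sgn (f x) - sgn (f x - 1)) / 2 * h i x)"
proof -
  define e where "e n = 1 / real (Suc n)" for n
  have e: "e n > 0" for n by (simp add: e_def)
  have e0: "e \<longlonglongrightarrow> 0" unfolding e_def by (rule LIMSEQ_Suc[OF lim_1_over_n])
  have p: "s\<^sup>2 + e n > 0" for s n using e[of n] zero_le_power2[of s] by linarith
  \<comment> \<open>The additive constant normalises \<open>\<psi> n 0 = 0\<close> and tends to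
    1/2.\<close>
  define \<psi> where "\<psi> n t = (sqrt (t\<^sup>2 + e n) - sqrt ((t - 1)\<^sup>2 + e n)) / 2 + (sqrt (1 + e n) - sqrt (e n)) / 2" for n t
  define \<psi>' where "\<psi>' n t = (t / sqrt (t\<^sup>2 + e n) - (t - 1) / sqrt ((t - 1)\<^sup>2 + e n)) / 2" for n t
  define \<psi>'' where "\<psi>'' n t = (e n / sqrt (t\<^sup>2 + e n) ^ 3 - e n / sqrt ((t - 1)\<^sup>2 + e n) ^ 3) / 2" for n t
  have d1: "((\<lambda>t. sqrt ((t - a)\<^sup>2 + e n)) has_real_derivative ((t - a) / sqrt ((t - a)\<^sup>2 + e n))) (at t)" for a t n
    using p[of "t - a" n] by (auto intro!: derivative_eq_intros simp: field_simps)
  have d2: "((\<lambda>t. (t - a) / sqrt ((t - a)\<^sup>2 + e n)) has_real_derivative (e n / sqrt ((t - a)\<^sup>2 + e n) ^ 3)) (at t)" for a t n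
  proof -
    let ?s = "sqrt ((t - a)\<^sup>2 + e n)"
    have s: "?s > 0" "?s\<^sup>2 = (t - a)\<^sup>2 + e n" using p[of "t - a" n] by simp_all
    have "((\<lambda>t. (t - a) / sqrt ((t - a)\<^sup>2 + e n)) has_real_derivative (1 * ?s - (t - a) * ((t - a) / ?s)) / (?s * ?s)) (at t)"
      using s(1) by (intro DERIV_divide d1) (auto intro!: derivative_eq_intros)
    also have "(1 * ?s - (t - a) * ((t - a) / ?s)) / (?s * ?s) = (?s\<^sup>2 - (t - a)\<^sup>2) / ?s ^ 3"
      using s(1) by (simp add: field_simps power2_eq_square power3_eq_cube)
    also have "?s\<^sup>2 - (t - a)\<^sup>2 = e n" using s(2) by simp
    finally show ?thesis .
  qed
  have C2: "C2_real (\<psi> n) (\<psi>' n)" for n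
    unfolding C2_real_def
  proof (intro conjI allI exI[of _ "\<psi>'' n"])
    show "(\<psi> n has_real_derivative \<psi>' n t) (at t)" for t
      unfolding \<psi>_def \<psi>'_def using DERIV_cdivide[OF DERIV_diff[OF d1[of 0 n t] d1[of 1 n t]], of 2]
      by (auto intro!: DERIV_add[where E=0, simplified])
    show "(\<psi>' n has_real_derivative \<psi>'' n t) (at t)" for t
      unfolding \<psi>''_def \<psi>'_def using DERIV_cdivide[OF DERIV_diff[OF d2[of 0 n t] d2[of 1 n t]], of 2] by simp
    show "continuous_on UNIV (\<psi>'' n)"
      unfolding \<psi>''_def using p[of _ n] by (intro continuous_intros) (auto simp: less_imp_neq[symmetric])
  qed
  have q: "\<bar>s / sqrt (s\<^sup>2 + e n)\<bar> \<le> 1" for s n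
  proof -
    have "\<bar>s\<bar> \<le> sqrt (s\<^sup>2 + e n)" using e[of n] by (intro real_le_rsqrt) simp
    then show ?thesis using p[of s n] by (simp add: abs_divide)
  qed
  have bd: "\<bar>\<psi>' n t\<bar> \<le> 1" for n t
    using q[of t n] q[of "t - 1" n] unfolding \<psi>'_def abs_le_iff by (auto simp del: abs_divide)
  have z: "\<psi> n 0 = 0" for n by (simp add: \<psi>_def field_simps)
  have l1: "(\<lambda>n. sqrt (s\<^sup>2 + e n)) \<longlonglongrightarrow> \<bar>s\<bar>" for s
    using tendsto_real_sqrt[OF tendsto_add[OF tendsto_const e0, of "s\<^sup>2"]] by simp
  have l2: "(\<lambda>n. s / sqrt (s\<^sup>2 + e n)) \<longlonglongrightarrow> sgn s" for s
  proof (cases "s = 0")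
    case False
    then have "(\<lambda>n. s / sqrt (s\<^sup>2 + e n)) \<longlonglongrightarrow> s / \<bar>s\<bar>" by (intro tendsto_intros l1) simp
    then show ?thesis by (simp add: real_sgn_eq)
  qed simp
  have "weak_grad (\<lambda>x. (\<bar>f x\<bar> - \<bar>f x - 1\<bar>) / 2 + (1 - 0) / 2) (\<lambda>i x. (sgn (f x) - sgn (f x - 1)) / 2 * h i x)"
  proof (rule weak_grad_comp_limit[OF assms C2 z, where K=UNIV and C=1])
    show "\<bar>\<psi> n t\<bar> \<le> 1 * \<bar>t\<bar>" for n t
      using C2_real_lipschitz[OF C2 bd, of n t 0] by (simp add: z)
    have "(\<lambda>n. sqrt (1 + e n)) \<longlonglongrightarrow> 1" "(\<lambda>n. sqrt (e n)) \<longlonglongrightarrow> 0"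
      using l1[of 1] l1[of 0] by simp_all
    then show "(\<lambda>n. \<psi> n t) \<longlonglongrightarrow> (\<bar>t\<bar> - \<bar>t - 1\<bar>) / 2 + (1 - 0) / 2" for t
      unfolding \<psi>_def by (intro tendsto_intros l1) auto
    show "(\<lambda>n. \<psi>' n t) \<longlonglongrightarrow> (sgn t - sgn (t - 1)) / 2" for t
      unfolding \<psi>'_def by (intro tendsto_intros l2) auto
  qed (use bd in auto)
  also have "(\<lambda>x. (\<bar>f x\<bar> - \<bar>f x - 1\<bar>) / 2 + (1 - 0) / 2) = (\<lambda>x. min (max (f x) 0) 1)"
    by (rule ext) (simp add: min_def max_def abs_if field_simps)
  finally show ?thesis .
qed

text \<open>The derivative of the square is unbounded, so
  \<open>t\<^sup>2 / (1 + t\<^sup>2 * e n)\<close> takes its place: its derivative is bounded for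
  each \<open>n\<close>, and uniformly in \<open>n\<close> on the interval containing the values of
  \<open>f\<close>.\<close>

lemma weak_grad_square:
  assumes "weak_grad f h" "AE x in M. \<bar>f x\<bar> \<le> C"
  shows "weak_grad (\<lambda>x. (f x)\<^sup>2) (\<lambda>i x. 2 * f x * h i x)"
proof -
  define e where "e n = 1 / real (Suc n)" for n
  have e: "e n > 0" for n by (simp add: e_def)
  have e0: "e \<longlonglongrightarrow> 0" unfolding e_def by (rule LIMSEQ_Suc[OF lim_1_over_n])
  have p: "1 + s\<^sup>2 * e n \<ge> 1" for s n using e[of n] zero_le_power2[of s] by simp
  have p': "1 + s\<^sup>2 * e n \<noteq> 0" for s n using p[of s n] by linarith
  define \<psi> where "\<psi> n t = t\<^sup>2 / (1 + t\<^sup>2 * e n)" for n t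
  define \<psi>' where "\<psi>' n t = 2 * t / (1 + t\<^sup>2 * e n)\<^sup>2" for n t
  define \<psi>'' where "\<psi>'' n t = (2 - 6 * t\<^sup>2 * e n) / (1 + t\<^sup>2 * e n)^3" for n t
  have C2: "C2_real (\<psi> n) (\<psi>' n)" for n
    unfolding C2_real_def
  proof (intro conjI allI exI[of _ "\<psi>'' n"])
    fix t
    have "((\<lambda>t. t\<^sup>2 / (1 + t\<^sup>2 * e n)) has_real_derivative
       ((2 * t) * (1 + t\<^sup>2 * e n) - t\<^sup>2 * (2 * t * e n)) / ((1 + t\<^sup>2 * e n) * (1 + t\<^sup>2 * e n))) (at t)"
      using p'[of t n] by (intro DERIV_divide) (auto intro!: derivative_eq_intros)
    also have "((2 * t) * (1 + t\<^sup>2 * e n) - t\<^sup>2 * (2 * t * e n)) / ((1 + t\<^sup>2 * e n) * (1 + t\<^sup>2 * e n)) = \<psi>' n t"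
      by (simp add: \<psi>'_def power2_eq_square algebra_simps)
    finally show "(\<psi> n has_real_derivative \<psi>' n t) (at t)" by (simp add: \<psi>_def[abs_def])
    let ?s = "1 + t\<^sup>2 * e n"
    have "((\<lambda>t. 2 * t / (1 + t\<^sup>2 * e n)\<^sup>2) has_real_derivative
       (2 * ?s\<^sup>2 - (2 * t) * (2 * ?s * (2 * t * e n))) / (?s\<^sup>2 * ?s\<^sup>2)) (at t)"
      using p'[of t n] by (intro DERIV_divide) (auto intro!: derivative_eq_intros)
    also have "(2 * ?s\<^sup>2 - (2 * t) * (2 * ?s * (2 * t * e n))) / (?s\<^sup>2 * ?s\<^sup>2) =
       (?s * (2 * ?s - 8 * t\<^sup>2 * e n)) / (?s * ?s^3)"
      by (simp add: power2_eq_square power3_eq_cube algebra_simps)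
    also have "\<dots> = (2 * ?s - 8 * t\<^sup>2 * e n) / ?s^3" using p'[of t n] by (rule mult_divide_mult_cancel_left)
    also have "\<dots> = \<psi>'' n t" by (simp add: \<psi>''_def algebra_simps)
    finally show "(\<psi>' n has_real_derivative \<psi>'' n t) (at t)" by (simp add: \<psi>'_def[abs_def])
  next
    show "continuous_on UNIV (\<psi>'' n)"
      unfolding \<psi>''_def using p'[of _ n] by (intro continuous_intros) auto
  qed
  have b0: "\<bar>\<psi>' n t\<bar> \<le> 2 * \<bar>t\<bar>" for n t
  proof -
    have "1 \<le> (1 + t\<^sup>2 * e n)\<^sup>2" using p[of t n] by simp
    then have "2 * \<bar>t\<bar> / (1 + t\<^sup>2 * e n)\<^sup>2 \<le> 2 * \<bar>t\<bar> / 1" by (intro divide_left_mono) auto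
    then show ?thesis by (simp add: \<psi>'_def abs_mult)
  qed
  have b1: "\<bar>\<psi> n t\<bar> \<le> \<bar>t\<bar> * \<bar>t\<bar>" for n t
  proof -
    have "t\<^sup>2 / (1 + t\<^sup>2 * e n) \<le> t\<^sup>2 / 1" using p[of t n] by (intro divide_left_mono) auto
    then show ?thesis using p[of t n] by (simp add: \<psi>_def power2_eq_square)
  qed
  \<comment> \<open>A bound depending on \<open>n\<close>, as the chain rule for a single
    \<open>\<psi> n\<close> demands. For \<open>\<bar>t\<bar> > 1\<close> it rests on
    \<open>\<bar>t\<bar> * e n \<le> (1 + t\<^sup>2 * e n)\<^sup>2\<close>.\<close>
  have b2: "\<bar>\<psi>' n t\<bar> \<le> 2 + 2 / e n" for n t
  proof (cases "\<bar>t\<bar> \<le> 1")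
    case True
    then show ?thesis using b0[of n t] divide_nonneg_pos[of 2 "e n"] e[of n] by linarith
  next
    case False
    have 1: "\<bar>t\<bar> * e n \<le> (1 + t\<^sup>2 * e n)\<^sup>2"
    proof -
      have "\<bar>t\<bar> * 1 \<le> \<bar>t\<bar> * \<bar>t\<bar>" using False by (intro mult_left_mono) auto
      then have "\<bar>t\<bar> * e n \<le> t\<^sup>2 * e n" using e[of n] by (intro mult_right_mono) (auto simp: power2_eq_square)
      also have "\<dots> \<le> 1 + t\<^sup>2 * e n" by simp
      also have "\<dots> \<le> (1 + t\<^sup>2 * e n)\<^sup>2" using p[of t n] by (simp add: power2_eq_square)
      finally show ?thesis .
    qed
    have "\<bar>\<psi>' n t\<bar> = 2 * \<bar>t\<bar> / (1 + t\<^sup>2 * e n)\<^sup>2" by (simp add: \<psi>'_def abs_mult)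
    also have "\<dots> \<le> 2 * \<bar>t\<bar> / (\<bar>t\<bar> * e n)"
      using 1 False e[of n] p[of t n] p'[of t n] by (intro divide_left_mono) (auto intro!: mult_pos_pos)
    also have "\<dots> = 2 / e n" using False by simp
    finally show ?thesis by simp
  qed
  define K where "K = max C 0"
  have "weak_grad (\<lambda>x. (f x)\<^sup>2) (\<lambda>i x. 2 * f x * h i x)"
  proof (rule weak_grad_comp_limit[OF assms(1) C2, where K="{-K..K}" and C="2 * K"])
    show "AE x in M. f x \<in> {-K..K}" using assms(2) by eventually_elim (auto simp: K_def)
    show "\<bar>\<psi>' n t\<bar> \<le> 2 * K" if "t \<in> {-K..K}" for n t using that b0[of n t] by auto
    show "\<bar>\<psi> n t\<bar> \<le> 2 * K * \<bar>t\<bar>" if "t \<in> {-K..K}" for n t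
    proof -
      have "\<bar>t\<bar> * \<bar>t\<bar> \<le> 2 * K * \<bar>t\<bar>" using that by (intro mult_right_mono) auto
      then show ?thesis using b1[of n t] by linarith
    qed
    show "(\<lambda>n. \<psi> n t) \<longlonglongrightarrow> t\<^sup>2" for t
      unfolding \<psi>_def by (rule tendsto_eq_intros e0 refl | simp)+
    show "(\<lambda>n. \<psi>' n t) \<longlonglongrightarrow> 2 * t" for t
      unfolding \<psi>'_def by (rule tendsto_eq_intros e0 refl | simp)+
    show "\<exists>C. \<forall>t. \<bar>\<psi>' n t\<bar> \<le> C" for n using b2[of n] by blast
  qed (simp add: \<psi>_def)
  then show ?thesis .
qed

text \<open>The clamped function has the gradient of \<open>f\<close> multiplied by a factor of
  modulus at most 1, so its energy cannot exceed that of \<open>f\<close>.\<close>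

theorem Dirichlet_En: "symmetric_Dirichlet_form M Dom En"
proof -
  have "(\<lambda>x. min (max (f x) 0) 1) \<in> Dom \<and>
        En (\<lambda>x. min (max (f x) 0) 1) (\<lambda>x. min (max (f x) 0) 1) \<le> En f f" if "f \<in> Dom" for f
  proof -
    obtain h where w: "weak_grad f h" using \<open>f \<in> Dom\<close> unfolding Dom_iff by blast
    note w' = weak_grad_clamp[OF w]
    have "N (\<lambda>x. (sgn (f x) - sgn (f x - 1)) / 2 * h i x) \<le> N (h i)" if i: "i \<in> I" for i
    proof (rule l2_norm_mono[OF weak_grad_L2(2)[OF w i] L2_measurable[OF weak_grad_L2(2)[OF w' i]]])
      have "\<bar>(sgn t - sgn (t - 1)) / 2\<bar> \<le> 1" for t :: real by (simp add: sgn_if)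
      then show "AE x in M. \<bar>(sgn (f x) - sgn (f x - 1)) / 2 * h i x\<bar> \<le> \<bar>h i x\<bar>"
        by (intro AE_I2) (simp only: abs_mult, rule mult_left_le_one_le, auto)
    qed
    then show ?thesis using weak_grad_Dom[OF w'] unfolding En_diag[OF w] En_diag[OF w']
      by (auto intro!: sum_mono power_mono simp: l2_norm_nonneg)
  qed
  then show ?thesis unfolding symmetric_Dirichlet_form_def
    using bilinear_En dense_Dom symmetric_En positive_En closed_En Dom_cong by blast
qed

end


section \<open>Recurrence and conservativeness when \<open>1\<close> has zero energy\<close>

text \<open>An abstract setting: a finite measure, the Dirichlet property and zero energy of the
  constant 1 are all that is kept of the model.\<close>

locale dirichlet_one = finite_measure M for M :: "'a measure" +
  fixes D :: "('a \<Rightarrow> real) set" and E :: "'a form"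
  assumes DF: "symmetric_Dirichlet_form M D E"
    and one_D: "(\<lambda>x. 1) \<in> D" and E_one: "E (\<lambda>x. 1) (\<lambda>x. 1) = 0"
begin

abbreviation "N \<equiv> l2_norm M"

lemma BF: "bilinear_form M D E" and D_cong: "f \<in> D \<Longrightarrow> g \<in> L2 M \<Longrightarrow> AE x in M. f x = g x \<Longrightarrow> g \<in> D"
  and E_closed: "closed_form M D E"
  and clamp_D: "f \<in> D \<Longrightarrow> (\<lambda>x. min (max (f x) 0) 1) \<in> D"
  and clamp_E: "f \<in> D \<Longrightarrow> E (\<lambda>x. min (max (f x) 0) 1) (\<lambda>x. min (max (f x) 0) 1) \<le> E f f"
  using DF unfolding symmetric_Dirichlet_form_def by blast+

lemma E_sym: "f \<in> D \<Longrightarrow> g \<in> D \<Longrightarrow> E f g = E g f"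
  using DF by (simp add: symmetric_Dirichlet_form_def symmetric_form_def)

lemma E_nonneg: "f \<in> D \<Longrightarrow> E f f \<ge> 0"
  using DF by (simp add: symmetric_Dirichlet_form_def positive_definite_form_def)

lemma D_L2: "f \<in> D \<Longrightarrow> f \<in> L2 M" and D_0: "(\<lambda>x. 0) \<in> D"
  and D_add: "f \<in> D \<Longrightarrow> g \<in> D \<Longrightarrow> (\<lambda>x. f x + g x) \<in> D"
  and D_cmult: "f \<in> D \<Longrightarrow> (\<lambda>x. c * f x) \<in> D"
  and E_add: "f \<in> D \<Longrightarrow> g \<in> D \<Longrightarrow> h \<in> D \<Longrightarrow> E (\<lambda>x. f x + g x) h = E f h + E g h"
    "f \<in> D \<Longrightarrow> g \<in> D \<Longrightarrow> h \<in> D \<Longrightarrow> E h (\<lambda>x. f x + g x) = E h f + E h g"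
  and E_cmult: "f \<in> D \<Longrightarrow> g \<in> D \<Longrightarrow> E (\<lambda>x. c * f x) g = c * E f g"
    "f \<in> D \<Longrightarrow> g \<in> D \<Longrightarrow> E f (\<lambda>x. c * g x) = c * E f g"
  using BF unfolding bilinear_form_def by blast+

lemma E_cong:
  assumes "f \<in> D" "f' \<in> D" "g \<in> D" "g' \<in> D" "AE x in M. f x = f' x" "AE x in M. g x = g' x"
  shows "E f g = E f' g'"
  using BF assms unfolding bilinear_form_def by meson

lemma D_diff: "f \<in> D \<Longrightarrow> g \<in> D \<Longrightarrow> (\<lambda>x. f x - g x) \<in> D"
  using D_add[OF _ D_cmult, of f g "-1"] by simp

lemma E_diff: "f \<in> D \<Longrightarrow> g \<in> D \<Longrightarrow> h \<in> D \<Longrightarrow> E (\<lambda>x. f x - g x) h = E f h - E g h"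
    "f \<in> D \<Longrightarrow> g \<in> D \<Longrightarrow> h \<in> D \<Longrightarrow> E h (\<lambda>x. f x - g x) = E h f - E h g"
  using E_add(1)[OF _ D_cmult, of f g h "-1"] E_add(2)[OF _ D_cmult, of f g h "-1"]
    E_cmult[of g h "-1"] E_cmult[of h g "-1"] by simp_all

lemma E_scale: "f \<in> D \<Longrightarrow> E (\<lambda>x. c * f x) (\<lambda>x. c * f x) = c\<^sup>2 * E f f"
  by (simp add: E_cmult D_cmult power2_eq_square)

abbreviation "Ea \<equiv> E_alpha M E"

lemma Ea_add: "f \<in> D \<Longrightarrow> g \<in> D \<Longrightarrow> h \<in> D \<Longrightarrow> Ea \<alpha> (\<lambda>x. f x + g x) h = Ea \<alpha> f h + Ea \<alpha> g h"
    "f \<in> D \<Longrightarrow> g \<in> D \<Longrightarrow> h \<in> D \<Longrightarrow> Ea \<alpha> h (\<lambda>x. f x + g x) = Ea \<alpha> h f + Ea \<alpha> h g"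
  and Ea_diff: "f \<in> D \<Longrightarrow> g \<in> D \<Longrightarrow> h \<in> D \<Longrightarrow> Ea \<alpha> (\<lambda>x. f x - g x) h = Ea \<alpha> f h - Ea \<alpha> g h"
    "f \<in> D \<Longrightarrow> g \<in> D \<Longrightarrow> h \<in> D \<Longrightarrow> Ea \<alpha> h (\<lambda>x. f x - g x) = Ea \<alpha> h f - Ea \<alpha> h g"
  and Ea_cmult: "f \<in> D \<Longrightarrow> g \<in> D \<Longrightarrow> Ea \<alpha> (\<lambda>x. c * f x) g = c * Ea \<alpha> f g"
    "f \<in> D \<Longrightarrow> g \<in> D \<Longrightarrow> Ea \<alpha> f (\<lambda>x. c * g x) = c * Ea \<alpha> f g"
  and Ea_sym: "f \<in> D \<Longrightarrow> g \<in> D \<Longrightarrow> Ea \<alpha> f g = Ea \<alpha> g f"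
  by (simp_all add: E_alpha_def E_add E_diff E_cmult l2_inner_add_left l2_inner_add_right l2_inner_diff_left
      l2_inner_diff_right l2_inner_cmult_left l2_inner_cmult_right D_L2 algebra_simps l2_inner_commute[of M f g] E_sym[of f g])

lemma Ea_diag: "Ea \<alpha> f f = E f f + \<alpha> * (N f)\<^sup>2"
  by (simp add: E_alpha_def l2_norm_sq')

lemma Ea_nonneg: "f \<in> D \<Longrightarrow> \<alpha> \<ge> 0 \<Longrightarrow> Ea \<alpha> f f \<ge> 0"
  by (simp add: Ea_diag E_nonneg)

lemma Ea_0: "Ea 0 = E" by (simp add: E_alpha_def fun_eq_iff)

lemma Ea_CS:
  assumes "f \<in> D" "g \<in> D" "\<alpha> \<ge> 0" shows "(Ea \<alpha> f g)\<^sup>2 \<le> Ea \<alpha> f f * Ea \<alpha> g g"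
proof (rule quadratic_discr)
  fix t
  have "0 \<le> Ea \<alpha> (\<lambda>x. f x + t * g x) (\<lambda>x. f x + t * g x)"
    using assms by (intro Ea_nonneg D_add D_cmult)
  also have "\<dots> = Ea \<alpha> f f + 2 * t * Ea \<alpha> f g + t\<^sup>2 * Ea \<alpha> g g"
    using assms by (simp add: Ea_add Ea_cmult D_add D_cmult Ea_sym[of g f] algebra_simps power2_eq_square)
  finally show "0 \<le> Ea \<alpha> f f + 2 * t * Ea \<alpha> f g + t\<^sup>2 * Ea \<alpha> g g" .
qed (simp add: assms Ea_nonneg)

text \<open>Cauchy-Schwarz with \<open>\<alpha> = 0\<close>: zero energy places \<open>g\<close> in
  the radical of the form.\<close>

lemma E_zero: "f \<in> D \<Longrightarrow> g \<in> D \<Longrightarrow> E g g = 0 \<Longrightarrow> E f g = 0"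
  using Ea_CS[of f g 0] by (simp add: Ea_0)

text \<open>The expanded inequality \<open>0 \<le> E (f - 2 g) (f - 2 g)\<close>. It carries small
  energy over from approximating functions \<open>g\<close> to their limit \<open>f\<close>.\<close>

lemma E_diff_le: "f \<in> D \<Longrightarrow> g \<in> D \<Longrightarrow> E f f \<le> 2 * E g g + 2 * E (\<lambda>x. g x - f x) (\<lambda>x. g x - f x)"
proof -
  assume D: "f \<in> D" "g \<in> D"
  have "0 \<le> E (\<lambda>x. f x - 2 * g x) (\<lambda>x. f x - 2 * g x)" by (intro E_nonneg D_diff D_cmult D)
  then show ?thesis using D
    by (simp add: E_diff E_cmult D_cmult D_diff E_sym[of g f])
qed

text \<open>The resolvent is the minimiser of \<open>J\<close> below; the parallelogram identity makes minimising sequences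
  Cauchy for the form.\<close>

lemma resolvent_exists:
  assumes f: "f \<in> L2 M" and \<alpha>: "\<alpha> > 0"
  shows "\<exists>u\<in>D. \<forall>g\<in>D. Ea \<alpha> u g = l2_inner M f g"
proof -
  define J where "J u = Ea \<alpha> u u - 2 * l2_inner M f u" for u
  \<comment> \<open>Cauchy-Schwarz followed by completing the square in \<open>N u\<close> bounds
    \<open>J\<close> from below.\<close>
  have Jb: "J u \<ge> - (N f)\<^sup>2 / \<alpha>" if u: "u \<in> D" for u
  proof -
    have "\<alpha> * (N u)\<^sup>2 - 2 * (N f * N u) \<le> J u"
      unfolding J_def Ea_diag using E_nonneg[OF u] l2_CS[OF f D_L2[OF u]] by linarith
    moreover have "0 \<le> (\<alpha> * N u - N f)\<^sup>2 / \<alpha>" using \<alpha> by simp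
    moreover have "(\<alpha> * N u - N f)\<^sup>2 / \<alpha> = \<alpha> * (N u)\<^sup>2 - 2 * (N f * N u) + (N f)\<^sup>2 / \<alpha>"
      using \<alpha> by (simp add: power2_diff field_simps power2_eq_square)
    ultimately show ?thesis by simp
  qed
  define m where "m = Inf (J ` D)"
  have bdd: "bdd_below (J ` D)" using Jb by (auto intro!: bdd_belowI2)
  have mJ: "m \<le> J u" if "u \<in> D" for u unfolding m_def by (rule cInf_lower[OF _ bdd]) (use that in auto)
  have "\<exists>u\<in>D. J u < m + 1 / real (Suc n)" for n
    using cInf_lessD[of "J ` D" "m + 1 / real (Suc n)"] D_0 by (auto simp: m_def)
  then obtain u where u: "\<And>n. u n \<in> D" "\<And>n. J (u n) < m + 1 / real (Suc n)" by metis
  have par: "Ea \<alpha> (\<lambda>x. u i x - u j x) (\<lambda>x. u i x - u j x) \<le> 2 / real (Suc i) + 2 / real (Suc j)" for i j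
  proof -
    have two: "2 / real (Suc k) = 2 * (1 / real (Suc k))" for k by simp
    have "J (\<lambda>x. c * (u i x + u j x)) = c\<^sup>2 * (Ea \<alpha> (u i) (u i) + 2 * Ea \<alpha> (u i) (u j) + Ea \<alpha> (u j) (u j))
       - 2 * c * (l2_inner M f (u i) + l2_inner M f (u j))" for c
      using u(1) by (simp add: J_def Ea_add Ea_cmult D_add D_cmult power2_eq_square
         l2_inner_cmult_right l2_inner_add_right D_L2 f Ea_sym[of "u j" "u i"] algebra_simps)
    then have "4 * J (\<lambda>x. (1/2) * (u i x + u j x)) = 4 * ((1/2)\<^sup>2 * (Ea \<alpha> (u i) (u i) + 2 * Ea \<alpha> (u i) (u j) + Ea \<alpha> (u j) (u j))
       - 2 * (1/2) * (l2_inner M f (u i) + l2_inner M f (u j)))" by (rule arg_cong)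
    also have "\<dots> = Ea \<alpha> (u i) (u i) + 2 * Ea \<alpha> (u i) (u j) + Ea \<alpha> (u j) (u j)
       - 4 * (l2_inner M f (u i) + l2_inner M f (u j))" by (simp add: power2_eq_square)
    finally have "4 * J (\<lambda>x. (1/2) * (u i x + u j x)) = \<dots>" .
    moreover have "Ea \<alpha> (\<lambda>x. u i x - u j x) (\<lambda>x. u i x - u j x) =
        Ea \<alpha> (u i) (u i) - 2 * Ea \<alpha> (u i) (u j) + Ea \<alpha> (u j) (u j)"
      using u(1) by (simp add: Ea_diff D_diff Ea_sym[of "u j" "u i"])
    ultimately
    have "Ea \<alpha> (\<lambda>x. u i x - u j x) (\<lambda>x. u i x - u j x) = 2 * J (u i) + 2 * J (u j) - 4 * J (\<lambda>x. (1/2) * (u i x + u j x))"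
      unfolding J_def[of "u i"] J_def[of "u j"] by (simp only: distrib_left right_diff_distrib)
    also have "\<dots> \<le> 2 / real (Suc i) + 2 / real (Suc j)"
      using u(2)[of i] u(2)[of j] mJ[OF D_cmult[OF D_add[OF u(1) u(1)]], of "1/2" i j]
      unfolding two by linarith
    finally show ?thesis .
  qed
  \<comment> \<open>Closedness speaks of \<open>Ea 1\<close> and the minimisation of
    \<open>Ea \<alpha>\<close>; the two quadratic forms are comparable.\<close>
  have c1: "Ea 1 w w \<le> max 1 (1/\<alpha>) * Ea \<alpha> w w" if w: "w \<in> D" for w
  proof -
    have "1 \<le> max 1 (1/\<alpha>) * \<alpha>" using \<alpha> mult_right_mono[of "1/\<alpha>" "max 1 (1/\<alpha>)" \<alpha>] by simp
    then have "E w w \<le> max 1 (1/\<alpha>) * E w w" "1 * (N w)\<^sup>2 \<le> (max 1 (1/\<alpha>) * \<alpha>) * (N w)\<^sup>2"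
      using E_nonneg[OF w] mult_right_mono[of 1 "max 1 (1/\<alpha>)" "E w w"]
      using mult_right_mono[of 1 "max 1 (1/\<alpha>) * \<alpha>" "(N w)\<^sup>2"] by auto
    then show ?thesis by (simp add: Ea_diag distrib_left mult.assoc)
  qed
  have "form_Cauchy (Ea 1) u" unfolding form_Cauchy_def
  proof (intro allI impI)
    fix e :: real assume e: "e > 0"
    define C where "C = max 1 (1/\<alpha>)"
    have C: "C > 0" by (simp add: C_def)
    obtain n0 :: nat where n0: "4 * C / e < real n0" using reals_Archimedean2 by blast
    have "Ea 1 (\<lambda>x. u i x - u j x) (\<lambda>x. u i x - u j x) < e" if "i \<ge> n0" "j \<ge> n0" for i j
    proof -
      have n1: "n0 > 0" using n0 C e by (cases n0) (auto simp: field_simps not_less)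
      have "Ea 1 (\<lambda>x. u i x - u j x) (\<lambda>x. u i x - u j x) \<le> C * (2 / real (Suc i) + 2 / real (Suc j))"
        using c1[OF D_diff[OF u(1) u(1)], of i j] par[of i j] C unfolding C_def[symmetric]
        by (meson less_imp_le mult_left_mono order_trans)
      also have "\<dots> \<le> C * (2 / real n0 + 2 / real n0)"
        using that n1 C by (intro mult_left_mono add_mono divide_left_mono) auto
      also have "\<dots> < e" using n0 e n1 by (simp add: field_simps)
      finally show ?thesis .
    qed
    then show "\<exists>n0. \<forall>i\<ge>n0. \<forall>j\<ge>n0. Ea 1 (\<lambda>x. u i x - u j x) (\<lambda>x. u i x - u j x) < e" by blast
  qed
  then obtain v where v: "v \<in> D" "(\<lambda>n. Ea 1 (\<lambda>x. u n x - v x) (\<lambda>x. u n x - v x)) \<longlonglongrightarrow> 0"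
    using E_closed u(1) unfolding closed_form_def by blast
  have va: "(\<lambda>n. Ea \<alpha> (\<lambda>x. u n x - v x) (\<lambda>x. u n x - v x)) \<longlonglongrightarrow> 0"
  proof (rule real_tendsto_sandwich[OF _ _ tendsto_const])
    show "(\<lambda>n. max 1 \<alpha> * Ea 1 (\<lambda>x. u n x - v x) (\<lambda>x. u n x - v x)) \<longlonglongrightarrow> 0"
      by (rule tendsto_mult_right_zero[OF v(2)])
    have "Ea \<alpha> w w \<le> max 1 \<alpha> * Ea 1 w w" if w: "w \<in> D" for w
    proof -
      have "E w w \<le> max 1 \<alpha> * E w w" "\<alpha> * (N w)\<^sup>2 \<le> max 1 \<alpha> * (N w)\<^sup>2"
        using E_nonneg[OF w] mult_right_mono[of 1 "max 1 \<alpha>" "E w w"] by (auto intro!: mult_right_mono)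
      then show ?thesis by (simp add: Ea_diag distrib_left)
    qed
    then show "\<forall>\<^sub>F n in sequentially. Ea \<alpha> (\<lambda>x. u n x - v x) (\<lambda>x. u n x - v x)
       \<le> max 1 \<alpha> * Ea 1 (\<lambda>x. u n x - v x) (\<lambda>x. u n x - v x)"
      using u(1) v(1) D_diff by auto
    show "\<forall>\<^sub>F n in sequentially. 0 \<le> Ea \<alpha> (\<lambda>x. u n x - v x) (\<lambda>x. u n x - v x)"
      using u(1) v(1) \<alpha> by (auto intro!: always_eventually Ea_nonneg D_diff)
  qed
  have "Ea \<alpha> v g = l2_inner M f g" if g: "g \<in> D" for g
  proof -
    \<comment> \<open>Perturbing a near-minimiser: the quadratic in \<open>t\<close> is bounded
      below by \<open>- 1 / Suc n\<close>, and its discriminant yields the Euler-Lagrange equation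
      up to an error.\<close>
    have le: "(Ea \<alpha> (u n) g - l2_inner M f g)\<^sup>2 \<le> 1 / real (Suc n) * Ea \<alpha> g g" for n
    proof (rule quadratic_discr)
      fix t
      have "J (\<lambda>x. u n x + t * g x) - J (u n) = 2 * t * (Ea \<alpha> (u n) g - l2_inner M f g) + t\<^sup>2 * Ea \<alpha> g g"
        using u(1)[of n] g f by (simp add: J_def Ea_add Ea_cmult D_add D_cmult l2_inner_add_right
           l2_inner_cmult_right D_L2 L2_cmult Ea_sym[of g "u n"] algebra_simps power2_eq_square)
      then show "0 \<le> 1 / real (Suc n) + 2 * t * (Ea \<alpha> (u n) g - l2_inner M f g) + t\<^sup>2 * Ea \<alpha> g g"
        using mJ[OF D_add[OF u(1) D_cmult[OF g]], of n t] u(2)[of n] by linarith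
    qed (use g \<alpha> in \<open>simp add: Ea_nonneg\<close>)
    have lim: "(\<lambda>n. 1 / real (Suc n) * Ea \<alpha> g g) \<longlonglongrightarrow> 0"
      by (rule tendsto_mult_left_zero[OF LIMSEQ_Suc[OF lim_1_over_n]])
    have "(\<lambda>n. (Ea \<alpha> (u n) g - l2_inner M f g)\<^sup>2) \<longlonglongrightarrow> 0"
      by (rule real_tendsto_sandwich[OF always_eventually always_eventually tendsto_const lim])
         (simp, use le in blast)
    moreover have "(\<lambda>n. (Ea \<alpha> (\<lambda>x. u n x - v x) g)\<^sup>2) \<longlonglongrightarrow> 0"
    proof (rule real_tendsto_sandwich[OF _ _ tendsto_const])
      show "(\<lambda>n. Ea \<alpha> (\<lambda>x. u n x - v x) (\<lambda>x. u n x - v x) * Ea \<alpha> g g) \<longlonglongrightarrow> 0"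
        by (rule tendsto_mult_left_zero[OF va])
      show "\<forall>\<^sub>F n in sequentially. (Ea \<alpha> (\<lambda>x. u n x - v x) g)\<^sup>2 \<le>
          Ea \<alpha> (\<lambda>x. u n x - v x) (\<lambda>x. u n x - v x) * Ea \<alpha> g g"
        using u(1) v(1) g \<alpha> by (auto intro!: always_eventually Ea_CS D_diff)
    qed simp
    moreover have sq: "X \<longlonglongrightarrow> 0" if "(\<lambda>n. (X n)\<^sup>2) \<longlonglongrightarrow> 0" for X :: "nat \<Rightarrow> real"
      using tendsto_real_sqrt[OF that] by (simp add: tendsto_rabs_zero_iff)
    ultimately have "(\<lambda>n. Ea \<alpha> (u n) g - l2_inner M f g) \<longlonglongrightarrow> 0" "(\<lambda>n. Ea \<alpha> (\<lambda>x. u n x - v x) g) \<longlonglongrightarrow> 0"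
      by - (rule sq, assumption)+
    from tendsto_diff[OF this] have "(\<lambda>n. Ea \<alpha> v g - l2_inner M f g) \<longlonglongrightarrow> 0"
      using u(1) v(1) g by (simp add: Ea_diff)
    then show ?thesis by (simp add: LIMSEQ_const_iff)
  qed
  with v(1) show ?thesis by blast
qed

text \<open>The factor \<open>\<alpha>\<close> turns the resolvent into the minimiser of
  \<open>E g g + \<alpha> * (N (\<lambda>x. g x - f x))\<^sup>2\<close> over \<open>g\<close>, and
  makes it fix the constant 1.\<close>

definition scaled_resolvent where "scaled_resolvent \<alpha> f x = \<alpha> * resolvent M D E \<alpha> f x"

lemma resolvent_spec:
  assumes "f \<in> L2 M" "\<alpha> > 0"
  shows "resolvent M D E \<alpha> f \<in> D" "g \<in> D \<Longrightarrow> Ea \<alpha> (resolvent M D E \<alpha> f) g = l2_inner M f g"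
  using someI_ex[OF resolvent_exists[OF assms, unfolded Bex_def]] unfolding resolvent_def by blast+

lemma scaled_resolvent_spec:
  assumes "f \<in> L2 M" "\<alpha> > 0"
  shows "scaled_resolvent \<alpha> f \<in> D" "g \<in> D \<Longrightarrow> Ea \<alpha> (scaled_resolvent \<alpha> f) g = \<alpha> * l2_inner M f g"
  unfolding scaled_resolvent_def using D_cmult[OF resolvent_spec(1)[OF assms]] Ea_cmult(1)[OF resolvent_spec(1)[OF assms]]
  by (auto simp: resolvent_spec(2)[OF assms])

text \<open>The functional is quadratic with critical point \<open>w\<close>, so its expansion about
  \<open>w\<close> has no linear term and an exact remainder. The exact remainder, rather than an
  inequality, allows the comparison of two values of \<open>\<alpha>\<close>.\<close>

lemma variational:
  assumes "f \<in> L2 M" "\<alpha> > 0" "g \<in> D"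
  defines "w \<equiv> scaled_resolvent \<alpha> f"
  shows "E g g + \<alpha> * (N (\<lambda>x. g x - f x))\<^sup>2 = E w w + \<alpha> * (N (\<lambda>x. w x - f x))\<^sup>2
    + (E (\<lambda>x. g x - w x) (\<lambda>x. g x - w x) + \<alpha> * (N (\<lambda>x. g x - w x))\<^sup>2)"
proof -
  have w: "w \<in> D" "\<And>h. h \<in> D \<Longrightarrow> Ea \<alpha> w h = \<alpha> * l2_inner M f h"
    using scaled_resolvent_spec[OF assms(1,2)] by (auto simp: w_def)
  have Q: "E h h + \<alpha> * (N (\<lambda>x. h x - f x))\<^sup>2 = Ea \<alpha> h h - 2 * Ea \<alpha> w h + \<alpha> * (N f)\<^sup>2" if "h \<in> D" for h
    using that assms(1) by (simp add: w(2) Ea_diag l2_norm_sq' l2_inner_diff_left l2_inner_diff_right D_L2 L2_diff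
        l2_inner_commute[of M h f] algebra_simps)
  have "Ea \<alpha> (\<lambda>x. g x - w x) (\<lambda>x. g x - w x) = Ea \<alpha> g g - 2 * Ea \<alpha> w g + Ea \<alpha> w w"
    using w(1) assms(3) by (simp add: Ea_diff D_diff Ea_sym[of g w])
  then show ?thesis using Q[OF w(1)] Q[OF assms(3)] by (simp add: Ea_diag)
qed

lemma scaled_resolvent_unique:
  assumes "f \<in> L2 M" "\<alpha> > 0" "g \<in> D"
    "E g g + \<alpha> * (N (\<lambda>x. g x - f x))\<^sup>2 \<le> E (scaled_resolvent \<alpha> f) (scaled_resolvent \<alpha> f) + \<alpha> * (N (\<lambda>x. scaled_resolvent \<alpha> f x - f x))\<^sup>2"
  shows "AE x in M. g x = scaled_resolvent \<alpha> f x"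
proof -
  have D: "(\<lambda>x. g x - scaled_resolvent \<alpha> f x) \<in> D" by (intro D_diff assms scaled_resolvent_spec)
  have "\<alpha> * (N (\<lambda>x. g x - scaled_resolvent \<alpha> f x))\<^sup>2 \<le> 0"
    using variational[OF assms(1-3)] assms(4) E_nonneg[OF D] by linarith
  then have "N (\<lambda>x. g x - scaled_resolvent \<alpha> f x) = 0" using assms(2) by (simp add: mult_le_0_iff)
  then show ?thesis using l2_norm_0_AE[OF D_L2[OF D]] by auto
qed

text \<open>As \<open>f\<close> takes values in \<open>[0, K]\<close>, truncating
  \<open>scaled_resolvent \<alpha> f\<close> to \<open>[0, K]\<close> raises neither its energy nor
  its distance to \<open>f\<close>; by uniqueness the minimiser equals its truncation.\<close>

lemma scaled_resolvent_bounds: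
  assumes f: "f \<in> L2 M" and "\<alpha> > 0" "K > 0" and fK: "AE x in M. 0 \<le> f x \<and> f x \<le> K"
  shows "AE x in M. 0 \<le> scaled_resolvent \<alpha> f x"
proof -
  let ?w = "scaled_resolvent \<alpha> f" and ?g = "\<lambda>x. min (max ((1/K) * scaled_resolvent \<alpha> f x) 0) 1"
  let ?v = "\<lambda>x. K * ?g x"
  note w = scaled_resolvent_spec(1)[OF f assms(2)]
  have v: "?v \<in> D" by (intro D_cmult clamp_D w)
  have "E ?v ?v \<le> E ?w ?w"
  proof -
    have "E ?v ?v = K\<^sup>2 * E ?g ?g" by (rule E_scale[OF clamp_D[OF D_cmult[OF w]]])
    also have "\<dots> \<le> K\<^sup>2 * E (\<lambda>x. (1/K) * ?w x) (\<lambda>x. (1/K) * ?w x)"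
      by (intro mult_left_mono clamp_E D_cmult w) auto
    also have "\<dots> = E ?w ?w" unfolding E_scale[OF w] using assms(3) by (simp add: power2_eq_square)
    finally show ?thesis .
  qed
  moreover have "N (\<lambda>x. ?v x - f x) \<le> N (\<lambda>x. ?w x - f x)"
  proof (rule l2_norm_mono)
    show "(\<lambda>x. ?w x - f x) \<in> L2 M" by (intro L2_diff D_L2 w f)
    show "(\<lambda>x. ?v x - f x) \<in> borel_measurable M" by (intro L2_measurable L2_diff D_L2 v f)
    show "AE x in M. \<bar>?v x - f x\<bar> \<le> \<bar>?w x - f x\<bar>"
      using fK by eventually_elim (use assms(3) in \<open>auto simp: min_def max_def field_simps abs_if\<close>)
  qed
  then have "(N (\<lambda>x. ?v x - f x))\<^sup>2 \<le> (N (\<lambda>x. ?w x - f x))\<^sup>2"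
    by (intro power_mono l2_norm_nonneg)
  ultimately have "AE x in M. ?v x = ?w x"
    using assms(2) by (intro scaled_resolvent_unique[OF f assms(2) v] add_mono mult_left_mono) auto
  then show ?thesis
  proof eventually_elim
    case (elim x) then show ?case using assms(3) by (metis less_imp_le max.cobounded2 min_def mult_nonneg_nonneg zero_le_one)
  qed
qed

text \<open>The truncations of \<open>k * w\<close> to \<open>[0, 1]\<close> have zero energy by the
  contraction property and converge to the indicator of \<open>w > 0\<close>; closedness hands zero
  energy to the limit.\<close>

lemma zero_energy_indicator:
  assumes w: "w \<in> D" "E w w = 0"
  shows "(\<lambda>x. if w x > 0 then 1 else 0) \<in> D" "E (\<lambda>x. if w x > 0 then 1 else 0) (\<lambda>x. if w x > 0 then 1 else 0) = 0"
proof -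
  let ?B = "\<lambda>x. if w x > 0 then 1 else (0::real)"
  define g where "g k x = min (max (real k * w x) 0) 1" for k x
  have [measurable]: "w \<in> borel_measurable M" by (rule L2_measurable[OF D_L2[OF w(1)]])
  have gD: "g k \<in> D" for k using clamp_D[OF D_cmult[OF w(1)], of "real k"] by (simp add: g_def[abs_def])
  have gE: "E (g k) (g k) = 0" for k
    using clamp_E[OF D_cmult[OF w(1)], of "real k"] E_nonneg[OF gD, of k] w by (simp add: g_def[abs_def] E_scale)
  have g2: "E (\<lambda>x. g i x - g j x) (\<lambda>x. g i x - g j x) = 0" for i j
    using gD E_zero[OF gD gD gE] by (simp add: E_diff D_diff)
  have [measurable]: "g n \<in> borel_measurable M" for n by (rule L2_measurable[OF D_L2[OF gD]])
  have lim: "?B \<in> L2 M" "(\<lambda>n. N (\<lambda>x. g n x - ?B x)) \<longlonglongrightarrow> 0"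
  proof (rule_tac [!] l2_dominated_convergence[where g="\<lambda>x. 1" and F=g])
    have "(\<lambda>n. g n x) \<longlonglongrightarrow> ?B x" for x
    proof (cases "w x > 0")
      case True
      obtain n0 :: nat where "1 / w x < real n0" using reals_Archimedean2 by blast
      then have "g n x = 1" if "n \<ge> n0" for n
      proof -
        have "1 / w x < real n" using that \<open>1 / w x < real n0\<close> by simp
        then have "1 < real n * w x" using True by (simp add: field_simps)
        then show ?thesis by (simp add: g_def)
      qed
      then show ?thesis using True by (intro tendsto_eventually) (auto simp: eventually_sequentially)
    next
      case False
      then have "g n x = 0" for n by (simp add: g_def mult_le_0_iff not_less)
      then show ?thesis using False by simp
    qed
    then show "AE x in M. (\<lambda>n. g n x) \<longlonglongrightarrow> ?B x" "AE x in M. (\<lambda>n. g n x) \<longlonglongrightarrow> ?B x" by auto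
    show "AE x in M. \<bar>g n x\<bar> \<le> 1" "AE x in M. \<bar>g n x\<bar> \<le> 1" for n by (auto simp: g_def)
  qed (auto simp: L2_const)
  have N2: "(N (\<lambda>x. g i x - g j x))\<^sup>2 \<le> 2 * (N (\<lambda>x. g i x - ?B x))\<^sup>2 + 2 * (N (\<lambda>x. g j x - ?B x))\<^sup>2" for i j
  proof -
    let ?a = "N (\<lambda>x. g i x - ?B x)" and ?b = "N (\<lambda>x. g j x - ?B x)"
    have "N (\<lambda>x. g i x - g j x) \<le> ?a + ?b"
      using l2_triangle3[OF D_L2[OF gD] lim(1) D_L2[OF gD], of i j] l2_norm_minus_commute[of M ?B "g j"] by simp
    then have "(N (\<lambda>x. g i x - g j x))\<^sup>2 \<le> (?a + ?b)\<^sup>2" by (intro power_mono l2_norm_nonneg)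
    also have "\<dots> \<le> 2 * ?a\<^sup>2 + 2 * ?b\<^sup>2"
      using zero_le_power2[of "?a - ?b"] unfolding power2_diff power2_sum by linarith
    finally show ?thesis .
  qed
  have "form_Cauchy (Ea 1) g" unfolding form_Cauchy_def
  proof (intro allI impI)
    fix e :: real assume "e > 0"
    have "(\<lambda>n. (N (\<lambda>x. g n x - ?B x))\<^sup>2) \<longlonglongrightarrow> 0" using tendsto_power[OF lim(2), of 2] by simp
    from order_tendstoD(2)[OF this, of "e/4"] \<open>e > 0\<close>
    obtain n0 where n0: "\<And>n. n \<ge> n0 \<Longrightarrow> (N (\<lambda>x. g n x - ?B x))\<^sup>2 < e / 4"
      by (auto simp: eventually_sequentially)
    have "Ea 1 (\<lambda>x. g i x - g j x) (\<lambda>x. g i x - g j x) < e" if "i \<ge> n0" "j \<ge> n0" for i j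
      using n0[OF that(1)] n0[OF that(2)] N2[of i j] g2 by (simp add: Ea_diag)
    then show "\<exists>n0. \<forall>i\<ge>n0. \<forall>j\<ge>n0. Ea 1 (\<lambda>x. g i x - g j x) (\<lambda>x. g i x - g j x) < e" by blast
  qed
  then obtain v where v: "v \<in> D" "(\<lambda>n. Ea 1 (\<lambda>x. g n x - v x) (\<lambda>x. g n x - v x)) \<longlonglongrightarrow> 0"
    using E_closed gD unfolding closed_form_def by blast
  have nn: "0 \<le> E (\<lambda>x. g n x - v x) (\<lambda>x. g n x - v x)" for n by (intro E_nonneg D_diff gD v)
  have "(\<lambda>n. (N (\<lambda>x. g n x - v x))\<^sup>2) \<longlonglongrightarrow> 0"
    by (rule real_tendsto_sandwich[OF _ _ tendsto_const v(2)]) (use nn in \<open>auto simp: Ea_diag\<close>)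
  from tendsto_real_sqrt[OF this] have "(\<lambda>n. N (\<lambda>x. g n x - v x)) \<longlonglongrightarrow> 0" by (simp add: l2_norm_nonneg)
  then have vB: "AE x in M. v x = ?B x"
    by (rule l2_norm_tendsto_unique[OF _ lim(2) D_L2[OF gD] D_L2[OF v(1)] lim(1)])
  have "E v v \<le> 2 * Ea 1 (\<lambda>x. g n x - v x) (\<lambda>x. g n x - v x)" for n
    using E_diff_le[OF v(1) gD, of n] gE[of n] zero_le_power2[of "N (\<lambda>x. g n x - v x)"]
    unfolding Ea_diag distrib_left mult_1_left by linarith
  from LIMSEQ_le_const[OF tendsto_mult_right_zero[OF v(2), of 2]] this
  have "E v v \<le> 0" by blast
  then have Ev: "E v v = 0" using E_nonneg[OF v(1)] by simp
  show B: "?B \<in> D" by (rule D_cong[OF v(1) lim(1) vB])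
  show "E ?B ?B = 0" using E_cong[OF v(1) B v(1) B vB vB] Ev by simp
qed

text \<open>The functions \<open>\<alpha> G\<^sub>\<alpha> f\<close> converge, as \<open>\<alpha> \<rightarrow> 0\<close>, to some \<open>v\<close> of zero energy, so the potential is infinite where
  \<open>v > 0\<close>.  The set where \<open>v = 0\<close> also has an indicator of zero energy, and testing with it shows
  that \<open>f\<close> and all \<open>G\<^sub>\<alpha> f\<close> vanish there.\<close>

lemma potential_dichotomy:
  assumes f: "f \<in> L2 M" and fK: "AE x in M. 0 \<le> f x \<and> f x \<le> K" "K > 0"
  shows "AE x in M. (SUP n. ennreal (resolvent M D E (1 / real (Suc n)) f x)) = 0 \<or>
     (SUP n. ennreal (resolvent M D E (1 / real (Suc n)) f x)) = \<infinity>"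
proof -
  define a where "a n = 1 / real (Suc n)" for n
  have a: "a n > 0" "a n \<le> 1" for n by (auto simp: a_def)
  have a_strict: "a n > a m" if "n < m" for n m using that by (auto simp: a_def field_simps)
  define w where "w n = scaled_resolvent (a n) f" for n
  define d where "d n = (N (\<lambda>x. w n x - f x))\<^sup>2" for n
  have w: "w n \<in> D" for n unfolding w_def by (rule scaled_resolvent_spec[OF f a(1)])
  have var: "E g g + a n * (N (\<lambda>x. g x - f x))\<^sup>2 = E (w n) (w n) + a n * d n
    + (E (\<lambda>x. g x - w n x) (\<lambda>x. g x - w n x) + a n * (N (\<lambda>x. g x - w n x))\<^sup>2)" if "g \<in> D" for g n
    unfolding w_def d_def by (rule variational[OF f a(1) that])
  let ?q = "\<lambda>n m. E (\<lambda>x. w n x - w m x) (\<lambda>x. w n x - w m x)" and ?z = "\<lambda>n m. (N (\<lambda>x. w n x - w m x))\<^sup>2"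
  have q: "?q n m \<ge> 0" for n m by (intro E_nonneg D_diff w)
  \<comment> \<open>Each of the two minimisers is inserted into the variational identity of the
    other. Adding the results cancels the energies and gives \<open>eq\<close>, which makes
    \<open>d\<close> monotone and controls the differences in energy and in norm.\<close>
  have qz: "?z n m \<le> d m - d n \<and> ?q n m \<le> d m - d n" if nm: "n < m" for n m
  proof -
    have q_sym: "?q m n = ?q n m"
      using w by (simp add: E_diff D_diff)
    have z_sym: "?z m n = ?z n m" by (subst l2_norm_minus_commute) simp
    have "E (w n) (w n) + a m * d n = E (w m) (w m) + a m * d m + (?q n m + a m * ?z n m)"
      using var[OF w, of n m] by (simp add: d_def)
    moreover have "E (w m) (w m) + a n * d m = E (w n) (w n) + a n * d n + (?q n m + a n * ?z n m)"
      using var[OF w, of m n] q_sym z_sym by (simp add: d_def)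
    ultimately have eq: "(a n - a m) * (d m - d n) = 2 * ?q n m + (a n + a m) * ?z n m"
      by (simp add: algebra_simps)
    have "(a n - a m) * ?z n m \<le> (a n + a m) * ?z n m" using a[of m] by (intro mult_right_mono) auto
    then have "(a n - a m) * ?z n m \<le> (a n - a m) * (d m - d n)" using eq q[of n m] by linarith
    then have 1: "?z n m \<le> d m - d n" using a_strict[OF nm] by simp
    have "0 \<le> ?z n m" by simp
    then have d0: "0 \<le> d m - d n" using 1 by linarith
    have "2 * ?q n m \<le> (a n - a m) * (d m - d n)" using eq a[of n] a[of m] by simp
    also have "\<dots> \<le> 1 * (d m - d n)" using a[of n] a[of m] d0 by (intro mult_right_mono) auto
    finally show ?thesis using 1 q[of n m] by simp
  qed
  have E0: "E (\<lambda>x. 0) (\<lambda>x. 0) = 0" using E_cmult(1)[OF D_0 D_0, of 0] by simp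
  \<comment> \<open>Comparison with the competitor 0; it also shows that the energy of
    \<open>w n\<close> is at most \<open>a n * (N f)\<^sup>2\<close> and hence tends to 0.\<close>
  have dbd: "E (w n) (w n) + a n * d n \<le> a n * (N f)\<^sup>2" for n
  proof -
    have "N (\<lambda>x. 0 - f x) = N f" using l2_norm_cmult[of M "-1" f] by simp
    then show ?thesis
      using var[OF D_0, of n] E0 E_nonneg[OF D_diff[OF D_0 w], of n] a[of n] by simp
  qed
  have dle: "d n \<le> (N f)\<^sup>2" for n
  proof -
    have "a n * d n \<le> a n * (N f)\<^sup>2" using dbd[of n] E_nonneg[OF w, of n] by linarith
    then show ?thesis using a[of n] by simp
  qed
  have "incseq d"
  proof (rule incseq_SucI)
    show "d n \<le> d (Suc n)" for n using qz[of n "Suc n"] zero_le_power2[of "N (\<lambda>x. w n x - w (Suc n) x)"] by linarith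
  qed
  then have "convergent d"
    by (intro Bseq_mono_convergent BseqI'[of d "(N f)\<^sup>2"]) (use dle in \<open>auto simp: d_def incseq_def\<close>)
  then have "Cauchy d" by (rule convergent_Cauchy)
  have "form_Cauchy (Ea 1) w" unfolding form_Cauchy_def
  proof (intro allI impI)
    fix e :: real assume "e > 0"
    then obtain n0 where n0: "\<And>n m. n \<ge> n0 \<Longrightarrow> m \<ge> n0 \<Longrightarrow> \<bar>d m - d n\<bar> < e / 2"
      using \<open>Cauchy d\<close> unfolding Cauchy_def dist_real_def by (metis half_gt_zero)
    have 1: "?q n m + ?z n m < e" if "n \<ge> n0" "m \<ge> n0" "n < m" for n m
      using n0[OF that(1,2)] qz[OF that(3)] by linarith
    have "Ea 1 (\<lambda>x. w n x - w m x) (\<lambda>x. w n x - w m x) < e" if nm: "n \<ge> n0" "m \<ge> n0" for n m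
    proof (cases n m rule: linorder_cases)
      case less then show ?thesis using 1[OF nm less] by (simp add: Ea_diag)
    next
      case equal then show ?thesis using \<open>e > 0\<close> E0 by (simp add: Ea_diag l2_norm_def l2_inner_def)
    next
      case greater
      have "?q m n = ?q n m" using w by (simp add: E_diff D_diff)
      moreover have "?z m n = ?z n m" by (subst l2_norm_minus_commute) simp
      ultimately show ?thesis using 1[OF nm(2,1) greater] by (simp add: Ea_diag)
    qed
    then show "\<exists>n0. \<forall>n\<ge>n0. \<forall>m\<ge>n0. Ea 1 (\<lambda>x. w n x - w m x) (\<lambda>x. w n x - w m x) < e" by blast
  qed
  then obtain v where v: "v \<in> D" "(\<lambda>n. Ea 1 (\<lambda>x. w n x - v x) (\<lambda>x. w n x - v x)) \<longlonglongrightarrow> 0"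
    using E_closed w unfolding closed_form_def by blast
  have nn: "0 \<le> E (\<lambda>x. w n x - v x) (\<lambda>x. w n x - v x)" for n by (intro E_nonneg D_diff w v)
  have "(\<lambda>n. (N (\<lambda>x. w n x - v x))\<^sup>2) \<longlonglongrightarrow> 0"
    by (rule real_tendsto_sandwich[OF _ _ tendsto_const v(2)]) (use nn in \<open>auto simp: Ea_diag\<close>)
  from tendsto_real_sqrt[OF this] have wv: "(\<lambda>n. N (\<lambda>x. w n x - v x)) \<longlonglongrightarrow> 0" by (simp add: l2_norm_nonneg)
  have "E v v \<le> 2 * (a n * (N f)\<^sup>2) + 2 * Ea 1 (\<lambda>x. w n x - v x) (\<lambda>x. w n x - v x)" for n
  proof -
    have "0 \<le> a n * d n" using a[of n] by (simp add: d_def)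
    then have "E (w n) (w n) \<le> a n * (N f)\<^sup>2" using dbd[of n] by linarith
    then show ?thesis using E_diff_le[OF v(1) w, of n] zero_le_power2[of "N (\<lambda>x. w n x - v x)"]
      unfolding Ea_diag distrib_left mult_1_left by linarith
  qed
  moreover have "(\<lambda>n. 2 * (a n * (N f)\<^sup>2) + 2 * Ea 1 (\<lambda>x. w n x - v x) (\<lambda>x. w n x - v x)) \<longlonglongrightarrow> 2 * (0 * (N f)\<^sup>2) + 2 * 0"
    unfolding a_def by (intro tendsto_intros v(2) LIMSEQ_Suc[OF lim_1_over_n])
  ultimately have "E v v \<le> 0" using LIMSEQ_le_const by fastforce
  then have Ev: "E v v = 0" using E_nonneg[OF v(1)] by simp
  \<comment> \<open>Against a function of zero energy the energy term drops out of the resolvent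
    equation, so the pairing does not depend on \<open>n\<close>.\<close>
  have inv: "l2_inner M (w n) g = l2_inner M f g" if g: "g \<in> D" "E g g = 0" for g n
    using scaled_resolvent_spec(2)[OF f a(1)[of n] g(1)] E_zero[OF w g, of n] a(1)[of n] unfolding w_def[symmetric] E_alpha_def
    by simp
  let ?B = "\<lambda>x. if v x > 0 then 1 else (0::real)"
  let ?A = "\<lambda>x. 1 - ?B x"
  note B = zero_energy_indicator[OF v(1) Ev]
  have A: "?A \<in> D" "E ?A ?A = 0"
    using D_diff[OF one_D B(1)] E_zero[OF one_D B(1) B(2)] E_zero[OF B(1) one_D E_one] B one_D E_one
    by (simp_all add: E_diff D_diff)
  have [measurable]: "v \<in> borel_measurable M" "f \<in> borel_measurable M" "w n \<in> borel_measurable M" for n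
    using D_L2[OF v(1)] f D_L2[OF w] by (auto intro: L2_measurable)
  have "(\<lambda>n. l2_inner M (w n) ?A) \<longlonglongrightarrow> l2_inner M v ?A"
    by (rule l2_inner_tendsto[OF D_L2[OF w] D_L2[OF A(1)] D_L2[OF v(1)] D_L2[OF A(1)] wv])
       (simp add: l2_norm_def l2_inner_def)
  then have vf: "l2_inner M v ?A = l2_inner M f ?A" by (simp add: inv[OF A] LIMSEQ_const_iff)
  have "0 \<le> l2_inner M (\<lambda>x. (-1) * v x) ?A"
    unfolding l2_inner_def by (rule integral_nonneg_AE) auto
  then have "l2_inner M v ?A \<le> 0" unfolding l2_inner_cmult_left by simp
  moreover have "l2_inner M f ?A \<ge> 0" unfolding l2_inner_def
    by (rule integral_nonneg_AE, use fK(1) in eventually_elim) auto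
  ultimately have f0: "l2_inner M f ?A = 0" using vf by linarith
  have wA: "AE x in M. w n x * ?A x = 0" for n
  proof -
    have "AE x in M. 0 \<le> w n x" unfolding w_def by (rule scaled_resolvent_bounds[OF f a(1) fK(2,1)])
    then have "AE x in M. 0 \<le> w n x * ?A x" by eventually_elim auto
    moreover have "(\<integral>x. w n x * ?A x \<partial>M) = 0" using inv[OF A, of n] f0 by (simp add: l2_inner_def)
    ultimately show ?thesis
      using integral_nonneg_eq_0_iff_AE[OF L2_mult_integrable[OF D_L2[OF w] D_L2[OF A(1)]], of n] by simp
  qed
  obtain r :: "nat \<Rightarrow> nat" where r: "strict_mono r" "AE x in M. (\<lambda>n. w (r n) x) \<longlonglongrightarrow> v x"
    using l2_norm_tendsto_subseq[OF wv D_L2[OF w] D_L2[OF v(1)]] by blast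
  have "AE x in M. \<forall>n. w n x * ?A x = 0" using wA by (subst AE_all_countable) auto
  then show ?thesis using r(2)
  proof eventually_elim
    case (elim x)
    \<comment> \<open>Undoing the scaling multiplies by \<open>Suc n\<close>: where
      \<open>w n\<close> stays away from 0 along a subsequence, the resolvents are
      unbounded.\<close>
    have Rw: "resolvent M D E (1 / real (Suc n)) f x = real (Suc n) * w n x" for n
      by (simp add: w_def scaled_resolvent_def a_def)
    show ?case
    proof (cases "v x > 0")
      case False
      then have "w n x = 0" for n using elim(1) by auto
      then show ?thesis by (simp add: Rw del: of_nat_Suc)
    next
      case True
      have "(SUP n. ennreal (real (Suc n) * w n x)) = \<infinity>"
        unfolding infinity_ennreal_def SUP_eq_top_iff
      proof (intro allI impI)
        fix y :: ennreal assume "y < top"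
        then obtain c where c: "y = ennreal c" "c \<ge> 0" by (cases y) auto
        have "\<forall>\<^sub>F n in sequentially. w (r n) x > v x / 2"
          using order_tendstoD(1)[OF elim(2), of "v x / 2"] True by simp
        moreover have "\<forall>\<^sub>F n in sequentially. real n > 2 * c / v x"
          using filterlim_real_sequentially by (simp add: filterlim_at_top_dense)
        ultimately have "\<forall>\<^sub>F n in sequentially. w (r n) x > v x / 2 \<and> real n > 2 * c / v x" by (rule eventually_conj)
        then obtain n where n: "w (r n) x > v x / 2" "real n > 2 * c / v x"
          using eventually_happens' sequentially_bot by blast
        have "real (Suc (r n)) > 2 * c / v x" using n(2) seq_suble[OF r(1), of n] by linarith
        then have "2 * c / v x * (v x / 2) < real (Suc (r n)) * w (r n) x"
          using n(1) True c(2) by (intro mult_strict_mono) auto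
        then have "y < ennreal (real (Suc (r n)) * w (r n) x)" using c True by (simp add: ennreal_less_iff del: of_nat_Suc)
        then show "\<exists>n\<in>UNIV. y < ennreal (real (Suc n) * w n x)" by blast
      qed
      then show ?thesis by (simp add: Rw del: of_nat_Suc)
    qed
  qed
qed

text \<open>The dichotomy holds for each truncation \<open>min (f y) (real k)\<close>; exchanging
  the two suprema in \<open>potential\<close> reduces the claim to these countably many
  statements.\<close>

theorem is_recurrent: "recurrent M D E"
  unfolding recurrent_def
proof (intro allI impI)
  fix f :: "'a \<Rightarrow> real" assume f: "integrable M f" "AE x in M. f x \<ge> 0"
  have [measurable]: "f \<in> borel_measurable M" using f(1) by simp
  let ?R = "\<lambda>n k x. ennreal (resolvent M D E (1 / real (Suc n)) (\<lambda>y. min (f y) (real k)) x)"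
  have "AE x in M. (SUP n. ?R n k x) = 0 \<or> (SUP n. ?R n k x) = \<infinity>" for k
  proof (rule potential_dichotomy[where K="real k + 1"])
    show "AE x in M. 0 \<le> min (f x) (real k) \<and> min (f x) (real k) \<le> real k + 1"
      using f(2) by eventually_elim auto
    then show "(\<lambda>y. min (f y) (real k)) \<in> L2 M"
      by (intro L2_bounded[where C="real k + 1"]) (auto elim!: eventually_mono)
  qed simp
  then have "AE x in M. \<forall>k. (SUP n. ?R n k x) = 0 \<or> (SUP n. ?R n k x) = \<infinity>"
    by (subst AE_all_countable) auto
  then show "AE x in M. potential M D E f x = 0 \<or> potential M D E f x = \<infinity>"
  proof eventually_elim
    case (elim x)
    have eq: "potential M D E f x = (SUP k. SUP n. ?R n k x)"
      unfolding potential_def by (rule SUP_commute)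
    show ?case
    proof (cases "\<exists>k. (SUP n. ?R n k x) = \<infinity>")
      case True
      then obtain k where "(SUP n. ?R n k x) = \<infinity>" by blast
      moreover have "(SUP n. ?R n k x) \<le> potential M D E f x" unfolding eq by (rule SUP_upper) simp
      ultimately have "\<infinity> \<le> potential M D E f x" by (rule ord_eq_le_trans[OF sym])
      then show ?thesis by (simp add: top_unique)
    next
      case False
      then have z: "\<And>k. (SUP n. ?R n k x) = 0" using elim by blast
      show ?thesis unfolding eq z by simp
    qed
  qed
qed

text \<open>For the constant 1 both terms of the functional vanish, so it is the minimiser. The
  datum is 1 merely almost everywhere because iteration passes on representatives.\<close>

lemma scaled_resolvent_one:
  assumes "f \<in> L2 M" "\<alpha> > 0" "AE x in M. f x = 1"
  shows "scaled_resolvent \<alpha> f \<in> L2 M" "AE x in M. scaled_resolvent \<alpha> f x = 1"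
proof -
  show "scaled_resolvent \<alpha> f \<in> L2 M" by (intro D_L2 scaled_resolvent_spec assms)
  have "N (\<lambda>x. 1 - f x) = 0" by (rule l2_norm_AE_0) (use assms(3) in auto)
  moreover have "0 \<le> E (scaled_resolvent \<alpha> f) (scaled_resolvent \<alpha> f)" by (intro E_nonneg scaled_resolvent_spec assms)
  ultimately have "AE x in M. 1 = scaled_resolvent \<alpha> f x"
    using assms(2) by (intro scaled_resolvent_unique[OF assms(1,2) one_D]) (simp add: E_one)
  then show "AE x in M. scaled_resolvent \<alpha> f x = 1" by auto
qed

text \<open>Every iterate in the exponential formula equals 1 almost everywhere, so the norms in
  question are constantly 0.\<close>

theorem is_conservative: "conservative M D E"
  unfolding conservative_def semigroup_value_def
proof (intro allI impI conjI L2_const)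
  fix t :: real assume t: "t > 0"
  have "((scaled_resolvent (real (Suc n) / t)) ^^ k) (\<lambda>_. 1) \<in> L2 M \<and> (AE x in M. ((scaled_resolvent (real (Suc n) / t)) ^^ k) (\<lambda>_. 1) x = 1)" for n k
  proof (induction k)
    case 0 then show ?case by (simp add: L2_const)
  next
    case (Suc k) then show ?case using scaled_resolvent_one[of _ "real (Suc n) / t"] t by simp
  qed
  then have "l2_norm M (\<lambda>x. ((scaled_resolvent (real (Suc n) / t)) ^^ Suc n) (\<lambda>_. 1) x - 1) = 0" for n
    by (intro l2_norm_AE_0) (auto elim!: allE[of _ n] allE[of _ "Suc n"] simp del: funpow.simps)
  then show "(\<lambda>n. l2_norm M (\<lambda>x. ((\<lambda>g y. real (Suc n) / t * resolvent M D E (real (Suc n) / t) g y) ^^ Suc n)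
       (\<lambda>_. 1) x - 1)) \<longlonglongrightarrow> 0"
    unfolding scaled_resolvent_def[abs_def] by simp
qed

end


section \<open>Differentiable functions on the orthant\<close>

text \<open>Countability of the index type makes the function type metrizable, so that the product
  over the finite set \<open>L\<close> can be treated as a metrizable subspace of it.\<close>

locale orthant =
  fixes L :: "'i::countable set"
  assumes finL: "finite L"
begin

section \<open>The topology of the orthant\<close>

definition X :: "('i \<Rightarrow> real) set" where "X = (\<Pi>\<^sub>E x\<in>L. {0..})"

abbreviation "T \<equiv> product_topology (\<lambda>_. top_of_set {0::real..}) L"

lemma X_upd: "\<phi> \<in> X \<Longrightarrow> x \<in> L \<Longrightarrow> t \<ge> 0 \<Longrightarrow> \<phi>(x := t) \<in> X"
  by (auto simp: X_def PiE_def extensional_def)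

lemma X_nonneg: "\<phi> \<in> X \<Longrightarrow> x \<in> L \<Longrightarrow> \<phi> x \<ge> 0"
  by (auto simp: X_def PiE_def)

lemma topspace_T: "topspace T = X"
  by (simp add: X_def)

text \<open>Extensional functions are constant off \<open>L\<close>, so the further coordinates of
  the function type add no open sets. Both inclusions are continuity of the identity map.\<close>

lemma T_eq: "T = top_of_set X"
proof -
  have 1: "continuous_map T (top_of_set X) (\<lambda>x. x)"
  proof -
    have "continuous_map T euclidean (\<lambda>x. x k)" for k
    proof (cases "k \<in> L")
      case True
      have "continuous_map T (top_of_set {0..}) (\<lambda>x. x k)"
        by (rule continuous_map_product_projection[OF True])
      then show ?thesis using continuous_map_in_subtopology by blast
    next
      case False
      have "continuous_map T euclidean (\<lambda>x. undefined)" by simp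
      then show ?thesis by (rule continuous_map_eq) (use False in \<open>auto simp: PiE_def extensional_def\<close>)
    qed
    then have "continuous_map T euclidean (\<lambda>x. x)"
      by (simp add: continuous_map_componentwise_UNIV flip: euclidean_product_topology)
    then show ?thesis by (auto simp: continuous_map_in_subtopology X_def)
  qed
  have 2: "continuous_map (top_of_set X) T (\<lambda>x. x)"
    unfolding continuous_map_componentwise
    by (auto simp: X_def PiE_def intro!: continuous_on_subset[OF continuous_on_product_coordinates])
  show ?thesis
  proof (rule topology_eq[THEN iffD2], rule allI, rule iffI)
    fix S
    assume "openin T S"
    then have "openin (top_of_set X) {x \<in> topspace (top_of_set X). x \<in> S}" "S \<subseteq> X"
      using 2 openin_subset[of T S] unfolding continuous_map_def topspace_T by auto
    then show "openin (top_of_set X) S" by (simp add: Collect_conj_eq Int_absorb1)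
  next
    fix S
    assume "openin (top_of_set X) S"
    then have "openin T {x \<in> topspace T. x \<in> S}" "S \<subseteq> X"
      using 1 openin_subset[of "top_of_set X" S] unfolding continuous_map_def by auto
    then show "openin T S" unfolding topspace_T by (simp add: Collect_conj_eq Int_absorb1)
  qed
qed

lemma continuous_map_T: "continuous_map T euclideanreal f \<longleftrightarrow> continuous_on X f"
  by (simp add: T_eq)

lemma compactin_box: "compactin T (\<Pi>\<^sub>E x\<in>L. {0..M})"
  unfolding compactin_PiE by (auto simp: compactin_subtopology)

lemma compact_box: "compact (\<Pi>\<^sub>E x\<in>L. {0..M::real})"
  using compactin_box[of M] by (simp add: T_eq compactin_subtopology)

lemma coord_continuous: "continuous_on S (\<lambda>\<phi>. \<phi> x)"
  by (rule continuous_on_subset[OF continuous_on_product_coordinates]) simp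

lemma box_memI: "\<phi> \<in> X \<Longrightarrow> (\<And>x. x \<in> L \<Longrightarrow> \<phi> x \<le> M) \<Longrightarrow> \<phi> \<in> (\<Pi>\<^sub>E x\<in>L. {0..M})"
  by (auto simp: X_def PiE_def)

lemma upd_continuous: "continuous_on S (\<lambda>t. \<phi>(x := t))"
proof (rule continuous_on_coordinatewise_then_product)
  show "continuous_on S (\<lambda>t. (\<phi>(x := t)) i)" for i by (cases "i = x") auto
qed

lemma compactin_bounded:
  assumes "compactin T K" shows "\<exists>M. K \<subseteq> (\<Pi>\<^sub>E x\<in>L. {0..M})"
proof -
  have K: "compact K" "K \<subseteq> X" using assms by (auto simp: T_eq compactin_subtopology)
  have "\<exists>M. \<forall>\<phi>\<in>K. \<phi> x \<le> M" for x
  proof -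
    obtain M where "\<forall>y\<in>(\<lambda>\<phi>. \<phi> x) ` K. norm y \<le> M"
      using compact_imp_bounded[OF compact_continuous_image[OF coord_continuous K(1), of x]] unfolding bounded_iff by blast
    then have "\<forall>\<phi>\<in>K. \<phi> x \<le> M" by (auto simp: abs_le_iff)
    then show ?thesis ..
  qed
  then obtain M where M: "\<And>x \<phi>. \<phi> \<in> K \<Longrightarrow> \<phi> x \<le> M x" by metis
  have "\<phi> \<in> (\<Pi>\<^sub>E x\<in>L. {0..Max (insert 0 (M ` L))})" if "\<phi> \<in> K" for \<phi>
  proof -
    have "\<phi> x \<le> Max (insert 0 (M ` L))" if "x \<in> L" for x
      using M[OF \<open>\<phi> \<in> K\<close>, of x] finL that by (auto intro!: order_trans[OF _ Max_ge])
    then show ?thesis using that K(2) by (intro box_memI) auto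
  qed
  then show ?thesis by blast
qed

text \<open>Boxes \<open>[0, M]\<close> are compact and every compact set lies in one, so
  compactness of the support is a bound on the coordinates of the points where \<open>f\<close> does
  not vanish.\<close>

lemma Cc_iff: "f \<in> Cc T \<longleftrightarrow> continuous_on X f \<and> (\<exists>M. \<forall>\<phi>\<in>X. f \<phi> \<noteq> 0 \<longrightarrow> (\<forall>x\<in>L. \<phi> x \<le> M))"
proof -
  have "compact_support T f \<longleftrightarrow> (\<exists>M. \<forall>\<phi>\<in>X. f \<phi> \<noteq> 0 \<longrightarrow> (\<forall>x\<in>L. \<phi> x \<le> M))"
  proof
    assume "compact_support T f"
    then obtain M where M: "T closure_of {x \<in> topspace T. f x \<noteq> 0} \<subseteq> (\<Pi>\<^sub>E x\<in>L. {0..M})"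
      using compactin_bounded unfolding compact_support_def by blast
    have "{x \<in> topspace T. f x \<noteq> 0} \<subseteq> T closure_of {x \<in> topspace T. f x \<noteq> 0}"
      by (rule closure_of_subset) auto
    from this M have "{x \<in> X. f x \<noteq> 0} \<subseteq> (\<Pi>\<^sub>E x\<in>L. {0..M})" unfolding topspace_T by (rule subset_trans)
    then show "\<exists>M. \<forall>\<phi>\<in>X. f \<phi> \<noteq> 0 \<longrightarrow> (\<forall>x\<in>L. \<phi> x \<le> M)"
      by (intro exI[of _ M]) (auto simp: PiE_def Pi_def)
  next
    assume "\<exists>M. \<forall>\<phi>\<in>X. f \<phi> \<noteq> 0 \<longrightarrow> (\<forall>x\<in>L. \<phi> x \<le> M)"
    then obtain M where M: "\<And>\<phi> x. \<phi> \<in> X \<Longrightarrow> f \<phi> \<noteq> 0 \<Longrightarrow> x \<in> L \<Longrightarrow> \<phi> x \<le> M" by blast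
    have sub: "{x \<in> topspace T. f x \<noteq> 0} \<subseteq> (\<Pi>\<^sub>E x\<in>L. {0..M})"
      unfolding topspace_T using M by (auto simp: X_def PiE_def)
    have "closedin T (\<Pi>\<^sub>E x\<in>L. {0..M})"
      by (rule closedin_product_topology[THEN iffD2], rule disjI2) (auto simp: closed_subset)
    then have "T closure_of {x \<in> topspace T. f x \<noteq> 0} \<subseteq> (\<Pi>\<^sub>E x\<in>L. {0..M})"
      by (rule closure_of_minimal[OF sub])
    then show "compact_support T f" unfolding compact_support_def
      by (rule closed_compactin[OF compactin_box]) simp
  qed
  then show ?thesis by (simp add: Cc_def continuous_map_T)
qed

lemma continuous_bounded_on_box:
  fixes f :: "('i \<Rightarrow> real) \<Rightarrow> real"
  assumes "continuous_on X f" shows "\<exists>C. \<forall>\<phi>\<in>(\<Pi>\<^sub>E x\<in>L. {0..M}). \<bar>f \<phi>\<bar> \<le> C"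
proof -
  have "(\<Pi>\<^sub>E x\<in>L. {0..M}) \<subseteq> X" by (auto simp: X_def PiE_def)
  then have "bounded (f ` (\<Pi>\<^sub>E x\<in>L. {0..M}))"
    by (intro compact_imp_bounded compact_continuous_image continuous_on_subset[OF assms] compact_box)
  then show ?thesis by (auto simp: bounded_iff)
qed

lemma Cc_bounded:
  assumes "f \<in> Cc T" shows "\<exists>C. \<forall>\<phi>\<in>X. \<bar>f \<phi>\<bar> \<le> C"
proof -
  obtain M where M: "\<And>\<phi>. \<phi> \<in> X \<Longrightarrow> f \<phi> \<noteq> 0 \<Longrightarrow> \<forall>x\<in>L. \<phi> x \<le> M" and c: "continuous_on X f"
    using assms unfolding Cc_iff by blast
  obtain C where C: "\<And>\<phi>. \<phi> \<in> (\<Pi>\<^sub>E x\<in>L. {0..M}) \<Longrightarrow> \<bar>f \<phi>\<bar> \<le> C"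
    using continuous_bounded_on_box[OF c] by blast
  have "\<bar>f \<phi>\<bar> \<le> max C 0" if "\<phi> \<in> X" for \<phi>
    using M[OF that] C[OF box_memI[OF that]] by (cases "f \<phi> = 0") force+
  then show ?thesis by blast
qed

text \<open>On the face \<open>\<phi> x = 0\<close> the value \<open>g \<phi>\<close> is not a derivative; in \<open>Ck\<close> continuity makes it the
  extension of the derivative.\<close>

definition pdx :: "'i \<Rightarrow> (('i \<Rightarrow> real) \<Rightarrow> real) \<Rightarrow> (('i \<Rightarrow> real) \<Rightarrow> real) \<Rightarrow> bool" where
  "pdx x F g \<longleftrightarrow> (\<forall>\<phi>\<in>X. \<phi> x > 0 \<longrightarrow> ((\<lambda>t. F (\<phi>(x := t))) has_real_derivative g \<phi>) (at (\<phi> x)))"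

primrec Ck :: "nat \<Rightarrow> (('i \<Rightarrow> real) \<Rightarrow> real) \<Rightarrow> bool" where
  "Ck 0 F \<longleftrightarrow> continuous_on X F"
| "Ck (Suc k) F \<longleftrightarrow> continuous_on X F \<and> (\<forall>x\<in>L. \<exists>g. pdx x F g \<and> Ck k g)"

primrec Rk :: "nat \<Rightarrow> (real \<Rightarrow> real) \<Rightarrow> bool" where
  "Rk 0 \<psi> \<longleftrightarrow> continuous_on UNIV \<psi>"
| "Rk (Suc k) \<psi> \<longleftrightarrow> (\<exists>\<psi>'. (\<forall>t. (\<psi> has_real_derivative \<psi>' t) (at t)) \<and> Rk k \<psi>')"

section \<open>Calculus up to the faces of the orthant\<close>

lemma Ck_continuous: "Ck k F \<Longrightarrow> continuous_on X F"
  by (cases k) auto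

lemma Ck_SucD: "Ck (Suc k) F \<Longrightarrow> Ck k F"
proof (induction k arbitrary: F)
  case (Suc k)
  then show ?case by (metis Ck.simps(2))
qed simp

lemma DERIV_all_continuous: "(\<And>t. (\<psi> has_real_derivative \<psi>' t) (at t)) \<Longrightarrow> continuous_on UNIV \<psi>"
  by (meson DERIV_isCont continuous_at_imp_continuous_on)

lemma Rk_continuous: "Rk k \<psi> \<Longrightarrow> continuous_on UNIV \<psi>"
  by (cases k) (auto intro: DERIV_all_continuous)

lemma Rk_SucD: "Rk (Suc k) \<psi> \<Longrightarrow> Rk k \<psi>"
proof (induction k arbitrary: \<psi>)
  case (Suc k)
  then show ?case by (metis Rk.simps(2))
qed (auto intro: DERIV_all_continuous)

lemma C2_real_Rk: "C2_real \<psi> \<psi>' \<Longrightarrow> Rk 2 \<psi>"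
  unfolding C2_real_def numeral_2_eq_2 by auto

lemma pdx_const: "pdx x (\<lambda>\<phi>. c) (\<lambda>\<phi>. 0)"
  by (auto simp: pdx_def)

lemma pdx_coord: "pdx x (\<lambda>\<phi>. \<phi> y) (\<lambda>\<phi>. if x = y then 1 else 0)"
  by (auto simp: pdx_def intro!: derivative_eq_intros)

lemma pdx_add: "pdx x F F' \<Longrightarrow> pdx x G G' \<Longrightarrow> pdx x (\<lambda>\<phi>. F \<phi> + G \<phi>) (\<lambda>\<phi>. F' \<phi> + G' \<phi>)"
  by (auto simp: pdx_def intro!: DERIV_add)

lemma pdx_mult: "pdx x F F' \<Longrightarrow> pdx x G G' \<Longrightarrow> pdx x (\<lambda>\<phi>. F \<phi> * G \<phi>) (\<lambda>\<phi>. F \<phi> * G' \<phi> + G \<phi> * F' \<phi>)"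
  unfolding pdx_def
proof (intro ballI impI)
  fix \<phi> assume H: "\<forall>\<phi>\<in>X. 0 < \<phi> x \<longrightarrow> ((\<lambda>t. F (\<phi>(x := t))) has_real_derivative F' \<phi>) (at (\<phi> x))"
    "\<forall>\<phi>\<in>X. 0 < \<phi> x \<longrightarrow> ((\<lambda>t. G (\<phi>(x := t))) has_real_derivative G' \<phi>) (at (\<phi> x))" "\<phi> \<in> X" "0 < \<phi> x"
  then have "((\<lambda>t. F (\<phi>(x := t))) has_real_derivative F' \<phi>) (at (\<phi> x))"
    "((\<lambda>t. G (\<phi>(x := t))) has_real_derivative G' \<phi>) (at (\<phi> x))" by auto
  from DERIV_mult[OF this] show "((\<lambda>t. F (\<phi>(x := t)) * G (\<phi>(x := t))) has_real_derivative F \<phi> * G' \<phi> + G \<phi> * F' \<phi>) (at (\<phi> x))"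
    by (simp add: mult.commute add.commute)
qed

lemma pdx_comp:
  assumes "\<And>t. (\<psi> has_real_derivative \<psi>' t) (at t)" "pdx x F F'"
  shows "pdx x (\<lambda>\<phi>. \<psi> (F \<phi>)) (\<lambda>\<phi>. \<psi>' (F \<phi>) * F' \<phi>)"
  unfolding pdx_def
proof (intro ballI impI)
  fix \<phi> assume "\<phi> \<in> X" "0 < \<phi> x"
  then have "((\<lambda>t. F (\<phi>(x := t))) has_real_derivative F' \<phi>) (at (\<phi> x))" using assms(2) by (auto simp: pdx_def)
  from DERIV_chain2[OF assms(1) this]
  show "((\<lambda>t. \<psi> (F (\<phi>(x := t)))) has_real_derivative \<psi>' (F \<phi>) * F' \<phi>) (at (\<phi> x))" by simp
qed

lemma Ck_const: "Ck k (\<lambda>\<phi>. c)"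
proof (induction k arbitrary: c)
  case (Suc k)
  then show ?case using pdx_const by (auto intro: exI[of _ "\<lambda>\<phi>. 0"])
qed simp

lemma Ck_coord: "Ck k (\<lambda>\<phi>. \<phi> y)"
proof (cases k)
  case (Suc k)
  have "\<exists>g. pdx x (\<lambda>\<phi>. \<phi> y) g \<and> Ck k g" for x
    using pdx_coord[of x y] Ck_const by blast
  then show ?thesis using Suc by (simp add: coord_continuous)
qed (simp add: coord_continuous)

lemma Ck_add: "Ck k F \<Longrightarrow> Ck k G \<Longrightarrow> Ck k (\<lambda>\<phi>. F \<phi> + G \<phi>)"
proof (induction k arbitrary: F G)
  case (Suc k)
  have "\<exists>g. pdx x (\<lambda>\<phi>. F \<phi> + G \<phi>) g \<and> Ck k g" if x: "x \<in> L" for x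
  proof -
    obtain f where "pdx x F f" "Ck k f" using Suc.prems(1) x unfolding Ck.simps by blast
    moreover obtain g where "pdx x G g" "Ck k g" using Suc.prems(2) x unfolding Ck.simps by blast
    ultimately show ?thesis using pdx_add Suc.IH by blast
  qed
  then show ?case using Suc.prems by (auto intro: continuous_on_add)
qed (auto intro: continuous_on_add)

lemma Ck_mult: "Ck k F \<Longrightarrow> Ck k G \<Longrightarrow> Ck k (\<lambda>\<phi>. F \<phi> * G \<phi>)"
proof (induction k arbitrary: F G)
  case (Suc k)
  have "\<exists>g. pdx x (\<lambda>\<phi>. F \<phi> * G \<phi>) g \<and> Ck k g" if x: "x \<in> L" for x
  proof -
    obtain f where "pdx x F f" "Ck k f" using Suc.prems(1) x unfolding Ck.simps by blast
    moreover obtain g where "pdx x G g" "Ck k g" using Suc.prems(2) x unfolding Ck.simps by blast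
    ultimately show ?thesis
      using Ck_SucD[OF Suc.prems(1)] Ck_SucD[OF Suc.prems(2)]
      by (intro exI[of _ "\<lambda>\<phi>. F \<phi> * g \<phi> + G \<phi> * f \<phi>"] conjI pdx_mult Ck_add Suc.IH)
  qed
  then show ?case using Suc.prems by (auto intro: continuous_on_mult)
qed (auto intro: continuous_on_mult)

lemma Ck_comp: "Rk k \<psi> \<Longrightarrow> Ck k F \<Longrightarrow> Ck k (\<lambda>\<phi>. \<psi> (F \<phi>))"
proof (induction k arbitrary: F \<psi>)
  case 0
  then show ?case by (auto intro: continuous_on_compose2)
next
  case (Suc k)
  obtain \<psi>' where \<psi>': "\<And>t. (\<psi> has_real_derivative \<psi>' t) (at t)" "Rk k \<psi>'" using Suc.prems by auto
  have "\<exists>g. pdx x (\<lambda>\<phi>. \<psi> (F \<phi>)) g \<and> Ck k g" if x: "x \<in> L" for x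
  proof -
    obtain f where f: "pdx x F f" "Ck k f" using Suc.prems x by auto
    have "Ck k (\<lambda>\<phi>. \<psi>' (F \<phi>) * f \<phi>)"
      by (rule Ck_mult[OF Suc.IH[OF \<psi>'(2) Ck_SucD[OF Suc.prems(2)]] f(2)])
    then show ?thesis using pdx_comp[OF \<psi>'(1) f(1)] by blast
  qed
  moreover have "continuous_on X (\<lambda>\<phi>. \<psi> (F \<phi>))"
    by (rule continuous_on_compose2[OF Rk_continuous[OF Suc.prems(1)] Ck_continuous[OF Suc.prems(2)]]) simp
  ultimately show ?case by simp
qed

lemma Ck_diff: "Ck k F \<Longrightarrow> Ck k G \<Longrightarrow> Ck k (\<lambda>\<phi>. F \<phi> - G \<phi>)"
  using Ck_add[OF _ Ck_mult[OF Ck_const[of k "-1"]], of F G] by simp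

lemma Ck_prod: "finite A \<Longrightarrow> (\<And>i. i \<in> A \<Longrightarrow> Ck k (F i)) \<Longrightarrow> Ck k (\<lambda>\<phi>. \<Prod>i\<in>A. F i \<phi>)"
  by (induction A rule: finite_induct) (auto intro: Ck_const Ck_mult)

lemma Ck_power: "Ck k F \<Longrightarrow> Ck k (\<lambda>\<phi>. F \<phi> ^ n)"
  by (induction n) (auto intro: Ck_const Ck_mult)

section \<open>Compactly supported test functions\<close>

lemma DERIV_pos_power:
  "((\<lambda>t. max 0 t ^ Suc (Suc n)) has_real_derivative real (Suc (Suc n)) * max 0 t ^ Suc n) (at (t::real))"
proof (cases t "0::real" rule: linorder_cases)
  case less
  have "((\<lambda>t. 0) has_real_derivative 0) (at t)" by simp
  then have "((\<lambda>t. max 0 t ^ Suc (Suc n)) has_real_derivative 0) (at t)"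
    by (rule has_field_derivative_transform_within_open[where S="{..<0}"]) (use less in auto)
  then show ?thesis using less by simp
next
  case greater
  have "((\<lambda>t. t ^ Suc (Suc n)) has_real_derivative real (Suc (Suc n)) * t ^ Suc n) (at t)"
    using DERIV_pow[of "Suc (Suc n)" t UNIV] by simp
  then have "((\<lambda>t. max 0 t ^ Suc (Suc n)) has_real_derivative real (Suc (Suc n)) * t ^ Suc n) (at t)"
    by (rule has_field_derivative_transform_within_open[where S="{0<..}"]) (use greater in auto)
  then show ?thesis using greater by (simp add: max_def)
next
  case equal
  \<comment> \<open>At the origin Caratheodory's criterion applies, with slope function
    \<open>max 0 t ^ Suc n\<close>.\<close>
  have "isCont (\<lambda>t::real. max 0 t ^ Suc n) 0" by (intro continuous_intros)
  then have "((\<lambda>t::real. max 0 t ^ Suc (Suc n)) has_real_derivative 0) (at 0)"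
    unfolding CARAT_DERIV by (intro exI[of _ "\<lambda>t. max 0 t ^ Suc n"]) (auto simp: max_def)
  then show ?thesis using equal by simp
qed

text \<open>The cube is the smallest integer power of the positive part that is twice continuously
  differentiable.\<close>

definition pos3 :: "real \<Rightarrow> real" where "pos3 t = max 0 t ^ 3"

lemma Rk_pos3: "Rk 2 pos3"
proof -
  have *: "((\<lambda>t. c * max 0 t ^ Suc (Suc n)) has_real_derivative c * (real (Suc (Suc n)) * max 0 t ^ Suc n)) (at t)"
    for c t :: real and n
    by (rule DERIV_cmult[OF DERIV_pos_power])
  have "Rk 2 (\<lambda>t. 1 * max 0 t ^ Suc (Suc 1))"
    unfolding numeral_2_eq_2 Rk.simps
  proof (intro exI conjI allI)
    show "((\<lambda>t. 1 * max 0 t ^ Suc (Suc 1)) has_real_derivative 3 * max 0 t ^ Suc (Suc 0)) (at t)" for t :: real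
      using *[of 1 1 t] by simp
    show "((\<lambda>t. 3 * max 0 t ^ Suc (Suc 0)) has_real_derivative 3 * (real (Suc (Suc 0)) * max 0 t ^ Suc 0)) (at t)" for t :: real
      by (rule *)
    show "continuous_on UNIV (\<lambda>t::real. 3 * (real (Suc (Suc 0)) * max 0 t ^ Suc 0))"
      by (intro continuous_intros)
  qed
  also have "(\<lambda>t. 1 * max 0 t ^ Suc (Suc 1)) = pos3" by (simp add: fun_eq_iff pos3_def numeral_3_eq_3)
  finally show ?thesis .
qed

lemma pos3_nonneg: "pos3 t \<ge> 0" and pos3_pos_iff: "pos3 t > 0 \<longleftrightarrow> t > 0" and pos3_eq_0_iff: "pos3 t = 0 \<longleftrightarrow> t \<le> 0"
  by (auto simp: pos3_def max_def)

definition C2c :: "(('i \<Rightarrow> real) \<Rightarrow> real) set" where "C2c = {F \<in> Cc T. Ck 2 F}"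

lemma C2c_Cc: "F \<in> C2c \<Longrightarrow> F \<in> Cc T" and C2c_Ck: "F \<in> C2c \<Longrightarrow> Ck 2 F" and C2c_cont: "F \<in> C2c \<Longrightarrow> continuous_on X F"
  by (auto simp: C2c_def Cc_iff)

lemma C2c_I: "Ck 2 F \<Longrightarrow> (\<And>\<phi> x. \<phi> \<in> X \<Longrightarrow> F \<phi> \<noteq> 0 \<Longrightarrow> x \<in> L \<Longrightarrow> \<phi> x \<le> M) \<Longrightarrow> F \<in> C2c"
  unfolding C2c_def Cc_iff using Ck_continuous by blast

lemma C2c_D: "F \<in> C2c \<Longrightarrow> \<exists>M\<ge>0. \<forall>\<phi>\<in>X. F \<phi> \<noteq> 0 \<longrightarrow> (\<forall>x\<in>L. \<phi> x \<le> M)"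
proof -
  assume "F \<in> C2c"
  then obtain M where "\<forall>\<phi>\<in>X. F \<phi> \<noteq> 0 \<longrightarrow> (\<forall>x\<in>L. \<phi> x \<le> M)" unfolding C2c_def Cc_iff by blast
  then show ?thesis by (intro exI[of _ "max M 0"]) (auto simp: le_max_iff_disj)
qed

lemma C2c_bounded: "F \<in> C2c \<Longrightarrow> \<exists>C. \<forall>\<phi>\<in>X. \<bar>F \<phi>\<bar> \<le> C"
  using Cc_bounded C2c_Cc by blast

lemma C2c_mult_Ck: assumes "F \<in> C2c" "Ck 2 G" shows "(\<lambda>\<phi>. F \<phi> * G \<phi>) \<in> C2c"
proof -
  obtain M where M: "\<forall>\<phi>\<in>X. F \<phi> \<noteq> 0 \<longrightarrow> (\<forall>x\<in>L. \<phi> x \<le> M)" using C2c_D[OF assms(1)] by blast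
  show ?thesis by (rule C2c_I[OF Ck_mult[OF C2c_Ck[OF assms(1)] assms(2)], of M]) (use M in auto)
qed

lemma C2c_mult: "F \<in> C2c \<Longrightarrow> G \<in> C2c \<Longrightarrow> (\<lambda>\<phi>. F \<phi> * G \<phi>) \<in> C2c"
  by (simp add: C2c_mult_Ck C2c_Ck)

lemma C2c_cmult: "F \<in> C2c \<Longrightarrow> (\<lambda>\<phi>. c * F \<phi>) \<in> C2c"
  using C2c_mult_Ck[OF _ Ck_const[of 2 c], of F] by (simp add: mult.commute)

lemma C2c_add: assumes "F \<in> C2c" "G \<in> C2c" shows "(\<lambda>\<phi>. F \<phi> + G \<phi>) \<in> C2c"
proof -
  obtain M where M: "\<forall>\<phi>\<in>X. F \<phi> \<noteq> 0 \<longrightarrow> (\<forall>x\<in>L. \<phi> x \<le> M)" using C2c_D[OF assms(1)] by blast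
  obtain K where K: "\<forall>\<phi>\<in>X. G \<phi> \<noteq> 0 \<longrightarrow> (\<forall>x\<in>L. \<phi> x \<le> K)" using C2c_D[OF assms(2)] by blast
  show ?thesis
  proof (rule C2c_I[OF Ck_add[OF C2c_Ck[OF assms(1)] C2c_Ck[OF assms(2)]], of "max M K"])
    fix \<phi> x assume "\<phi> \<in> X" "F \<phi> + G \<phi> \<noteq> 0" "x \<in> L"
    then show "\<phi> x \<le> max M K" using M K by (cases "F \<phi> = 0") (auto simp: le_max_iff_disj)
  qed
qed

lemma C2c_comp: assumes "F \<in> C2c" "Rk 2 \<psi>" "\<psi> 0 = 0" shows "(\<lambda>\<phi>. \<psi> (F \<phi>)) \<in> C2c"
proof -
  obtain M where M: "\<forall>\<phi>\<in>X. F \<phi> \<noteq> 0 \<longrightarrow> (\<forall>x\<in>L. \<phi> x \<le> M)" using C2c_D[OF assms(1)] by blast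
  show ?thesis
    by (rule C2c_I[OF Ck_comp[OF assms(2) C2c_Ck[OF assms(1)]], of M]) (use M assms(3) in metis)
qed

text \<open>The corners are arbitrary reals: with \<open>a x < 0 < b x\<close> the factor at
  \<open>x\<close> does not vanish on the face \<open>\<phi> x = 0\<close>, as neighbourhoods of
  boundary points require.\<close>

definition bump :: "('i \<Rightarrow> real) \<Rightarrow> ('i \<Rightarrow> real) \<Rightarrow> ('i \<Rightarrow> real) \<Rightarrow> real" where
  "bump a b \<phi> = (\<Prod>x\<in>L. pos3 (\<phi> x - a x) * pos3 (b x - \<phi> x))"

lemma bump_nonneg: "bump a b \<phi> \<ge> 0"
  unfolding bump_def by (intro prod_nonneg) (simp add: pos3_nonneg)

lemma bump_pos_iff: "bump a b \<phi> > 0 \<longleftrightarrow> (\<forall>x\<in>L. a x < \<phi> x \<and> \<phi> x < b x)"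
proof -
  have "bump a b \<phi> = 0 \<longleftrightarrow> (\<exists>x\<in>L. \<phi> x \<le> a x \<or> b x \<le> \<phi> x)"
    unfolding bump_def using finL by (simp add: pos3_eq_0_iff)
  then show ?thesis using bump_nonneg[of a b \<phi>] by (force simp: less_le)
qed

lemma Ck_pos3: "Ck 2 F \<Longrightarrow> Ck 2 (\<lambda>\<phi>. pos3 (F \<phi>))"
  by (rule Ck_comp[OF Rk_pos3])

lemma bump_C2c: "bump a b \<in> C2c"
proof (rule C2c_I)
  show "Ck 2 (bump a b)" unfolding bump_def[abs_def]
    by (intro Ck_prod finL Ck_mult Ck_pos3 Ck_diff Ck_coord Ck_const)
  fix \<phi> x assume "bump a b \<phi> \<noteq> 0" "x \<in> L"
  then have "\<phi> x < b x" using bump_pos_iff[of a b \<phi>] bump_nonneg[of a b \<phi>] by (auto simp: less_le)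
  then show "\<phi> x \<le> Max (b ` L)" using finL \<open>x \<in> L\<close>
    by (intro order_trans[OF _ Max_ge[of "b ` L" "b x"]]) auto
qed

text \<open>The hypothesis \<open>d\<close> covers the open orthant, whereas \<open>pdx\<close> asks
  for the derivative also where other coordinates are 0. The fundamental theorem of calculus holds
  on lines whose other coordinates are raised by \<open>e > 0\<close>; continuity of
  \<open>F\<close> and \<open>g\<close> lets \<open>e\<close> tend to 0, and the limiting integral
  formula is differentiated.\<close>

lemma pdx_extend:
  assumes F: "continuous_on X F" and g: "continuous_on X g" and x: "x \<in> L"
    and d: "\<And>\<phi>. \<phi> \<in> X \<Longrightarrow> (\<forall>y\<in>L. \<phi> y > 0) \<Longrightarrow> ((\<lambda>t. F (\<phi>(x := t))) has_real_derivative g \<phi>) (at (\<phi> x))"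
  shows "pdx x F g"
  unfolding pdx_def
proof (intro ballI impI)
  fix \<phi> assume \<phi>: "\<phi> \<in> X" "0 < \<phi> x"
  define s where "s = \<phi> x"
  \<comment> \<open>Coordinate \<open>x\<close> is set to \<open>t\<close> and the others are raised
    by \<open>e\<close>. Starting the integrals at \<open>s / 2\<close> stays off the face
    \<open>\<phi> x = 0\<close>.\<close>
  define P where "P e t y = (if y = x then t else if y \<in> L then \<phi> y + e else undefined)" for e t :: real and y
  have PX: "P e t \<in> X" if "e \<ge> 0" "t \<ge> 0" for e t
    using that \<phi>(1) x by (auto simp: P_def X_def PiE_def Pi_def extensional_def)
  have Pc: "continuous_on S (\<lambda>p. P (fst p) (snd p))" for S
  proof (rule continuous_on_coordinatewise_then_product)
    show "continuous_on S (\<lambda>p. P (fst p) (snd p) y)" for y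
      by (cases "y = x"; cases "y \<in> L") (auto simp: P_def intro!: continuous_intros)
  qed
  have FTC: "F (P e b) - F (P e (s/2)) = integral {s/2..b} (\<lambda>t. g (P e t))" if e: "e > 0" and b: "b \<ge> s/2" for e b
  proof -
    have "((\<lambda>t. F (P e t)) has_real_derivative g (P e t)) (at t)" if t: "t \<ge> s/2" for t
    proof -
      have "(P e t)(x := u) = P e u" for u by (auto simp: P_def)
      moreover have "\<forall>y\<in>L. P e t y > 0"
        using e t \<phi> X_nonneg[OF \<phi>(1)] by (auto simp: P_def s_def intro: add_nonneg_pos)
      ultimately show ?thesis using d[of "P e t"] PX[of e t] e t \<phi>(2) by (simp add: s_def) (simp add: P_def)
    qed
    then have "((\<lambda>t. g (P e t)) has_integral F (P e b) - F (P e (s/2))) {s/2..b}"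
      using b by (intro fundamental_theorem_of_calculus)
        (auto simp: has_real_derivative_iff_has_vector_derivative[symmetric] intro: has_field_derivative_at_within)
    then show ?thesis by (simp add: integral_unique)
  qed
  have main: "F (P 0 b) - F (P 0 (s/2)) = integral {s/2..b} (\<lambda>t. g (P 0 t))" if b: "b \<ge> s/2" for b
  proof -
    let ?D = "\<lambda>e. F (P e b) - F (P e (s/2)) - integral (cbox (s/2) b) (\<lambda>t. g (P e t))"
    have cP: "continuous_on {0..1} (\<lambda>e. P e t)" for t
    proof -
      have "continuous_on {0..1} (\<lambda>e. P (fst (e, t)) (snd (e, t)))"
        by (rule continuous_on_compose2[OF Pc[of UNIV]]) (auto intro!: continuous_on_Pair)
      then show ?thesis by simp
    qed
    have "continuous_on ({0..1} \<times> cbox (s/2) b) (\<lambda>(e, t). g (P e t))"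
      unfolding split_beta by (rule continuous_on_compose2[OF g Pc]) (use PX \<phi>(2) in \<open>auto simp: s_def\<close>)
    from integral_continuous_on_param[OF this] have "continuous_on {0..1} ?D"
      using b \<phi>(2) by (intro continuous_intros continuous_on_compose2[OF F cP]) (auto intro!: PX simp: s_def)
    then have "(?D \<longlongrightarrow> ?D 0) (at 0 within {0..1})" by (simp add: continuous_on_def)
    moreover have "(?D \<longlongrightarrow> 0) (at 0 within {0..1})"
      by (rule tendsto_eventually) (use FTC b in \<open>auto simp: eventually_at_filter\<close>)
    moreover have "at 0 within {0..1::real} \<noteq> bot" by (simp add: at_within_Icc_at_right)
    ultimately have "?D 0 = 0" using tendsto_unique by blast
    then show ?thesis by simp
  qed
  have P0: "P 0 b = \<phi>(x := b)" for b
    using \<phi>(1) by (auto simp: P_def X_def PiE_def extensional_def)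
  have eq: "F (\<phi>(x := b)) = integral {s/2..b} (\<lambda>t. g (\<phi>(x := t))) + F (\<phi>(x := s/2))" if "b \<ge> s/2" for b
    using main[OF that] unfolding P0 by simp
  have gc: "continuous_on {s/2..s+s} (\<lambda>t. g (\<phi>(x := t)))"
  proof (rule continuous_on_compose2[OF g])
    show "continuous_on {s/2..s+s} (\<lambda>t. \<phi>(x := t))" by (rule upd_continuous)
  qed (use X_upd[OF \<phi>(1) x] \<phi>(2) in \<open>auto simp: s_def\<close>)
  have "((\<lambda>b. integral {s/2..b} (\<lambda>t. g (\<phi>(x := t))) + F (\<phi>(x := s/2))) has_real_derivative g (\<phi>(x := s)) + 0) (at s within {s/2..s+s})"
    by (intro DERIV_add integral_has_real_derivative gc) (use \<phi>(2) in \<open>auto simp: s_def\<close>)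
  moreover have "at s within {s/2..s+s} = at s" using \<phi>(2) by (intro at_within_interior) (auto simp: s_def)
  ultimately have "((\<lambda>b. integral {s/2..b} (\<lambda>t. g (\<phi>(x := t))) + F (\<phi>(x := s/2))) has_real_derivative g \<phi>) (at s)"
    by (simp add: s_def)
  then have "((\<lambda>b. F (\<phi>(x := b))) has_real_derivative g \<phi>) (at s)"
  proof (rule has_field_derivative_transform_within_open[where S="{s/2<..}"])
    show "integral {s/2..b} (\<lambda>t. g (\<phi>(x := t))) + F (\<phi>(x := s/2)) = F (\<phi>(x := b))" if "b \<in> {s/2<..}" for b
      using eq[of b] that by simp
  qed (use \<phi>(2) in \<open>auto simp: s_def\<close>)
  then show "((\<lambda>t. F (\<phi>(x := t))) has_real_derivative g \<phi>) (at (\<phi> x))" by (simp add: s_def)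
qed

lemma pdx_cong_line:
  assumes "pdx y g h" "y \<in> L" "\<phi> \<in> X" "\<phi> y > 0" "\<And>t. t > 0 \<Longrightarrow> G (\<phi>(y := t)) = g (\<phi>(y := t))"
  shows "((\<lambda>t. G (\<phi>(y := t))) has_real_derivative h \<phi>) (at (\<phi> y))"
proof -
  have "((\<lambda>t. g (\<phi>(y := t))) has_real_derivative h \<phi>) (at (\<phi> y))" using assms by (auto simp: pdx_def)
  then show ?thesis
    by (rule has_field_derivative_transform_within_open[where S="{0<..}"]) (use assms in auto)
qed

end


section \<open>Measures on the orthant\<close>

lemma space_site: "space (site_measure \<beta>) = {0..}"
  unfolding site_measure_def by (rule space_measure_of) (auto simp: sets_restrict_space_iff)

lemma sets_site: "sets (site_measure \<beta>) = sets (restrict_space borel {0..})"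
proof -
  have "sets (site_measure \<beta>) = sigma_sets {0..} (sets (restrict_space borel {0..}))"
    unfolding site_measure_def by (rule sets_measure_of) (auto simp: sets_restrict_space_iff)
  then show ?thesis using sets.sigma_sets_eq[of "restrict_space borel {0::real..}"] by (simp add: space_restrict_space)
qed

lemma sets_site_iff: "A \<in> sets (site_measure \<beta>) \<longleftrightarrow> A \<in> sets borel \<and> A \<subseteq> {0..}"
  by (auto simp: sets_site sets_restrict_space_iff)

lemma emeasure_site:
  assumes "A \<in> sets (site_measure \<beta>)"
  shows "emeasure (site_measure \<beta>) A = ennreal \<beta> * indicator A 0 + emeasure lborel A"
  unfolding site_measure_def
proof (rule emeasure_measure_of_sigma)
  let ?S = "sets (restrict_space borel {0::real..})" and ?\<mu> = "\<lambda>A. ennreal \<beta> * indicator A 0 + emeasure lborel A"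
  show "sigma_algebra {0..} ?S"
    using sets.sigma_algebra_axioms[of "restrict_space borel {0::real..}"] by (simp add: space_restrict_space)
  show "positive ?S ?\<mu>" by (simp add: positive_def)
  show "A \<in> ?S" using assms by (simp add: sets_site)
  show "countably_additive ?S ?\<mu>"
  proof (rule countably_additiveI)
    fix A :: "nat \<Rightarrow> real set" assume A: "range A \<subseteq> ?S" "disjoint_family A"
    then have "range A \<subseteq> sets lborel" by (auto simp: sets_restrict_space_iff)
    from suminf_emeasure[OF this A(2)]
    show "(\<Sum>i. ?\<mu> (A i)) = ?\<mu> (\<Union> (range A))"
      by (subst suminf_add[symmetric]) (auto simp: suminf_indicator[OF A(2)] intro: summableI)
  qed
qed

lemma measurable_site: "f \<in> borel_measurable borel \<Longrightarrow> f \<in> borel_measurable (site_measure \<beta>)"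
  using measurable_restrict_space1[of f borel borel "{0..}"] measurable_cong_sets[OF sets_site refl] by blast

text \<open>The atom at 0 is invisible on the open half-line, which opens the way to one-dimensional
  Lebesgue calculus.\<close>

lemma restrict_site: "restrict_space (site_measure \<beta>) {0<..} = restrict_space lborel {0<..}"
proof (rule measure_eqI)
  have S1: "A \<in> sets borel \<and> A \<subseteq> {0<..} \<longleftrightarrow> A \<in> sets (restrict_space (site_measure \<beta>) {0<..})" for A
    by (subst sets_restrict_space_iff) (auto simp: sets_site_iff space_site)
  then show "sets (restrict_space (site_measure \<beta>) {0<..}) = sets (restrict_space lborel {0<..})"
    by (auto simp: sets_restrict_space_iff S1[symmetric])
  fix A assume "A \<in> sets (restrict_space (site_measure \<beta>) {0<..})"
  then have A: "A \<in> sets borel" "A \<subseteq> {0<..}"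
    by (auto simp: S1[symmetric])
  then have "A \<in> sets (site_measure \<beta>)" by (auto simp: sets_site_iff)
  with A show "emeasure (restrict_space (site_measure \<beta>) {0<..}) A = emeasure (restrict_space lborel {0<..}) A"
    by (subst (1 2) emeasure_restrict_space) (auto simp: emeasure_site sets_site_iff space_site indicator_def)
qed

lemma integral_site_pos:
  fixes f :: "real \<Rightarrow> real"
  shows "(\<integral>t. indicator {0<..} t * f t \<partial>site_measure \<beta>) = (\<integral>t. indicator {0<..} t * f t \<partial>lborel)"
  using integral_restrict_space[of "{0<..}" "site_measure \<beta>" f] integral_restrict_space[of "{0<..}" lborel f]
  by (simp add: restrict_site sets_site_iff space_site Int_absorb2 subset_iff)

text \<open>An upper bound with the Lebesgue integral taken over the whole line, where it is
  invariant under translations of \<open>f\<close>.\<close>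

lemma nn_integral_site_le:
  assumes [measurable]: "f \<in> borel_measurable borel"
  shows "(\<integral>\<^sup>+t. f t \<partial>site_measure \<beta>) \<le> ennreal \<beta> * f 0 + (\<integral>\<^sup>+t. f t \<partial>lborel)"
proof -
  have m [measurable]: "f \<in> borel_measurable (site_measure \<beta>)" by (rule measurable_site) simp
  have s [measurable]: "{0} \<in> sets (site_measure \<beta>)" "{0<..} \<in> sets (site_measure \<beta>)" by (auto simp: sets_site_iff)
  have "(\<integral>\<^sup>+t. f t \<partial>site_measure \<beta>) = (\<integral>\<^sup>+t. f 0 * indicator {0} t + f t * indicator {0<..} t \<partial>site_measure \<beta>)"
    by (intro nn_integral_cong) (auto simp: space_site indicator_def)
  also have "\<dots> = f 0 * emeasure (site_measure \<beta>) {0} + (\<integral>\<^sup>+t. f t * indicator {0<..} t \<partial>site_measure \<beta>)"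
    by (subst nn_integral_add) (auto simp: nn_integral_cmult_indicator)
  also have "(\<integral>\<^sup>+t. f t * indicator {0<..} t \<partial>site_measure \<beta>) = (\<integral>\<^sup>+t. f t * indicator {0<..} t \<partial>lborel)"
    using nn_integral_restrict_space[of "{0<..}" "site_measure \<beta>" f] nn_integral_restrict_space[of "{0<..}" lborel f]
    by (simp add: restrict_site s Int_absorb2 space_site subset_iff)
  also have "\<dots> \<le> (\<integral>\<^sup>+t. f t \<partial>lborel)" by (intro nn_integral_mono) (auto simp: indicator_def)
  also have "emeasure (site_measure \<beta>) {0} = ennreal \<beta>" by (subst emeasure_site) (auto simp: s)
  finally show ?thesis by (simp add: mult.commute add_mono)
qed

lemma sigma_finite_site: "sigma_finite_measure (site_measure \<beta>)"
proof
  have "emeasure (site_measure \<beta>) {0..real n} \<noteq> \<infinity>" for n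
    by (subst emeasure_site) (auto simp: sets_site_iff indicator_def ennreal_mult_eq_top_iff ennreal_add_eq_top)
  moreover have "\<exists>n. x \<in> {0..real n}" if "x \<ge> 0" for x using that real_arch_simple[of x] by auto
  ultimately show "\<exists>A. countable A \<and> A \<subseteq> sets (site_measure \<beta>) \<and> \<Union> A = space (site_measure \<beta>) \<and>
      (\<forall>a\<in>A. emeasure (site_measure \<beta>) a \<noteq> \<infinity>)"
    by (intro exI[of _ "range (\<lambda>n. {0..real n})"]) (auto simp: sets_site_iff space_site)
qed

context orthant begin

definition rbox :: "('i \<Rightarrow> real) \<Rightarrow> ('i \<Rightarrow> real) \<Rightarrow> ('i \<Rightarrow> real) set" where
  "rbox a b = {\<phi> \<in> X. \<forall>x\<in>L. a x < \<phi> x \<and> \<phi> x < b x}"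

abbreviation BX :: "('i \<Rightarrow> real) set set" where "BX \<equiv> sigma_sets X {U. openin T U}"

lemma rbox_open: "openin T (rbox a b)"
proof -
  have "openin (top_of_set X) (X \<inter> bump a b -` {0<..})"
    by (intro continuous_openin_preimage_gen C2c_cont bump_C2c) auto
  also have "X \<inter> bump a b -` {0<..} = rbox a b" by (auto simp: rbox_def bump_pos_iff)
  finally show ?thesis by (simp add: T_eq)
qed

text \<open>Rational corners, restricted to \<open>L\<close> to be extensional, leave countably many
  boxes to choose from.\<close>

lemma open_contains_rbox:
  assumes "openin T U" "\<phi> \<in> U"
  shows "\<exists>a\<in>L \<rightarrow>\<^sub>E \<rat>. \<exists>b\<in>L \<rightarrow>\<^sub>E \<rat>. \<phi> \<in> rbox a b \<and> rbox a b \<subseteq> U"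
proof -
  obtain V where V: "\<And>i. i \<in> L \<Longrightarrow> openin (top_of_set {0..}) (V i)" "\<phi> \<in> Pi\<^sub>E L V" "Pi\<^sub>E L V \<subseteq> U"
    using assms unfolding openin_product_topology_alt by meson
  have \<phi>X: "\<phi> \<in> X" using assms openin_subset topspace_T by blast
  have "\<exists>a b. a \<in> \<rat> \<and> b \<in> \<rat> \<and> a < \<phi> i \<and> \<phi> i < b \<and> (\<forall>t. a < t \<and> t < b \<and> 0 \<le> t \<longrightarrow> t \<in> V i)" if i: "i \<in> L" for i
  proof -
    have "\<phi> i \<in> V i" using V(2) i by auto
    then obtain e where e: "e > 0" "ball (\<phi> i) e \<inter> {0..} \<subseteq> V i" using V(1)[OF i] unfolding openin_contains_ball by blast
    obtain a where "a \<in> \<rat>" "\<phi> i - e < a" "a < \<phi> i" using Rats_dense_in_real[of "\<phi> i - e" "\<phi> i"] e by auto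
    moreover obtain b where "b \<in> \<rat>" "b < \<phi> i + e" "\<phi> i < b" using Rats_dense_in_real[of "\<phi> i" "\<phi> i + e"] e by auto
    moreover have "\<forall>t. a < t \<and> t < b \<and> 0 \<le> t \<longrightarrow> t \<in> V i"
      using calculation e(2) by (auto simp: subset_iff dist_real_def)
    ultimately show ?thesis by blast
  qed
  then obtain a b where ab: "\<And>i. i \<in> L \<Longrightarrow> a i \<in> \<rat> \<and> b i \<in> \<rat> \<and> a i < \<phi> i \<and> \<phi> i < b i \<and>
      (\<forall>t. a i < t \<and> t < b i \<and> 0 \<le> t \<longrightarrow> t \<in> V i)" by metis
  have "restrict a L \<in> L \<rightarrow>\<^sub>E \<rat>" "restrict b L \<in> L \<rightarrow>\<^sub>E \<rat>" using ab by auto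
  moreover have "\<phi> \<in> rbox (restrict a L) (restrict b L)" using ab \<phi>X by (auto simp: rbox_def)
  moreover have "rbox (restrict a L) (restrict b L) \<subseteq> Pi\<^sub>E L V"
    using ab by (auto simp: rbox_def X_def PiE_def extensional_def Pi_def)
  ultimately show ?thesis using V(3) by blast
qed

lemma countable_rat_boxes: "countable ((\<lambda>(a, b). rbox a b) ` ((L \<rightarrow>\<^sub>E \<rat>) \<times> (L \<rightarrow>\<^sub>E \<rat>)))"
  by (intro countable_image countable_SIGMA countable_PiE finL countable_rat)

lemma open_Union_rboxes:
  assumes "openin T U"
  shows "\<exists>\<B>. countable \<B> \<and> \<B> \<subseteq> range (\<lambda>(a, b). rbox a b) \<and> \<Union>\<B> = U"
proof (intro exI conjI)
  let ?B = "{B \<in> (\<lambda>(a, b). rbox a b) ` ((L \<rightarrow>\<^sub>E \<rat>) \<times> (L \<rightarrow>\<^sub>E \<rat>)). B \<subseteq> U}"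
  show "countable ?B" by (rule countable_subset[OF _ countable_rat_boxes]) auto
  show "?B \<subseteq> range (\<lambda>(a, b). rbox a b)" by auto
  show "\<Union>?B = U"
  proof (intro equalityI subsetI)
    fix \<phi> assume "\<phi> \<in> U"
    then obtain a b where "a \<in> L \<rightarrow>\<^sub>E \<rat>" "b \<in> L \<rightarrow>\<^sub>E \<rat>" "\<phi> \<in> rbox a b" "rbox a b \<subseteq> U"
      using open_contains_rbox[OF assms] by blast
    then show "\<phi> \<in> \<Union>?B" by (intro UnionI[of "rbox a b"]) auto
  qed auto
qed

lemma rboxes_generate: "sigma_sets X (range (\<lambda>(a, b). rbox a b)) = BX"
proof (rule sigma_sets_eqI)
  fix B assume "B \<in> range (\<lambda>(a, b). rbox a b)"
  then show "B \<in> BX" using rbox_open by (auto intro!: sigma_sets.Basic)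
next
  fix U assume "U \<in> {U. openin T U}"
  then obtain \<B> where \<B>: "countable \<B>" "\<B> \<subseteq> range (\<lambda>(a, b). rbox a b)" "\<Union>\<B> = U"
    using open_Union_rboxes by blast
  interpret S: sigma_algebra X "sigma_sets X (range (\<lambda>(a, b). rbox a b))"
    by (rule sigma_algebra_sigma_sets) (auto simp: rbox_def)
  show "U \<in> sigma_sets X (range (\<lambda>(a, b). rbox a b))"
    unfolding \<B>(3)[symmetric] by (rule S.countable_Union[OF \<B>(1)]) (use \<B>(2) in \<open>auto intro: sigma_sets.Basic\<close>)
qed

definition R :: "real \<Rightarrow> ('i \<Rightarrow> real) measure" where "R \<beta> = (\<Pi>\<^sub>M x\<in>L. site_measure \<beta>)"

lemma space_R: "space (R \<beta>) = X"
  by (simp add: R_def space_PiM space_site X_def)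

text \<open>Open sets are countable unions of boxes, and boxes are measurable rectangles; conversely
  the coordinates are continuous, so the identity is measurable from the Borel sets to the
  product.\<close>

lemma sets_R: "sets (R \<beta>) = BX"
proof
  have rb: "rbox a b \<in> sets (R \<beta>)" for a b
  proof -
    have "rbox a b = (\<Pi>\<^sub>E x\<in>L. {0..} \<inter> {a x<..<b x})"
      by (auto simp: rbox_def X_def PiE_def Pi_def)
    then show ?thesis unfolding R_def using finL by (auto intro!: sets_PiM_I_finite simp: sets_site_iff)
  qed
  have "range (\<lambda>(a, b). rbox a b) \<subseteq> sets (R \<beta>)" using rb by auto
  from sets.sigma_sets_subset[OF this] show "BX \<subseteq> sets (R \<beta>)" by (simp add: space_R rboxes_generate)
next
  define B where "B = sigma X {U. openin T U}"
  have sub: "{U. openin T U} \<subseteq> Pow X" using openin_subset[of T] topspace_T by auto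
  have B: "space B = X" "sets B = BX" using sub by (auto simp: B_def)
  have "(\<lambda>\<phi>. \<phi> x) \<in> measurable B (site_measure \<beta>)" if x: "x \<in> L" for x
  proof -
    have "(\<lambda>\<phi>. \<phi> x) \<in> borel_measurable B"
    proof (rule borel_measurableI)
      fix S :: "real set" assume "open S"
      then have "openin (top_of_set X) (X \<inter> (\<lambda>\<phi>. \<phi> x) -` S)"
        by (intro continuous_openin_preimage_gen coord_continuous)
      then show "(\<lambda>\<phi>. \<phi> x) -` S \<inter> space B \<in> sets B" by (auto simp: B T_eq Int_commute intro!: sigma_sets.Basic)
    qed
    then have "(\<lambda>\<phi>. \<phi> x) \<in> measurable B (restrict_space borel {0..})"
      by (intro measurable_restrict_space2) (use x in \<open>auto simp: B X_nonneg\<close>)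
    then show ?thesis using measurable_cong_sets[OF refl sets_site] by blast
  qed
  then have "(\<lambda>\<phi> x. \<phi> x) \<in> measurable B (R \<beta>)" unfolding R_def
    by (intro measurable_PiM_single') (auto simp: B space_site X_def)
  then show "sets (R \<beta>) \<subseteq> BX"
  proof (intro subsetI)
    fix A assume A: "A \<in> sets (R \<beta>)" and m: "(\<lambda>\<phi> x. \<phi> x) \<in> measurable B (R \<beta>)"
    have "(\<lambda>\<phi> x. \<phi> x) -` A \<inter> space B \<in> sets B" by (rule measurable_sets[OF m A])
    moreover have "(\<lambda>\<phi> x. \<phi> x) -` A \<inter> space B = A" using sets.sets_into_space[OF A] by (auto simp: B space_R)
    ultimately show "A \<in> BX" by (simp add: B)
  qed
qed

lemma continuous_measurable:
  fixes f :: "('i \<Rightarrow> real) \<Rightarrow> real"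
  assumes "sets M = BX" "continuous_on X f" shows "f \<in> borel_measurable M"
proof (rule borel_measurableI)
  have sp: "space M = X"
    using sets_eq_imp_space_eq[of M "R 1"] by (simp add: assms(1) sets_R space_R)
  fix S :: "real set" assume "open S"
  then have "openin (top_of_set X) (X \<inter> f -` S)"
    by (intro continuous_openin_preimage_gen assms)
  then show "f -` S \<inter> space M \<in> sets M" by (auto simp: assms sp T_eq Int_commute intro!: sigma_sets.Basic)
qed

lemma prod_site_integral:
  "product_sigma_finite (\<lambda>_. site_measure \<beta>)"
  by (simp add: product_sigma_finite_def sigma_finite_site)

text \<open>Each side of a nonempty box contains the open interval from \<open>max 0 (a x)\<close>
  to \<open>b x\<close>, so the Lebesgue part of every factor is already positive.\<close>

lemma R_rbox_pos:
  assumes "\<beta> > 0" "rbox a b \<noteq> {}" shows "emeasure (R \<beta>) (rbox a b) > 0"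
proof -
  interpret product_sigma_finite "\<lambda>_. site_measure \<beta>" by (rule prod_site_integral)
  have "rbox a b = (\<Pi>\<^sub>E x\<in>L. {0..} \<inter> {a x<..<b x})"
    by (auto simp: rbox_def X_def PiE_def Pi_def)
  then have "emeasure (R \<beta>) (rbox a b) = (\<Prod>x\<in>L. emeasure (site_measure \<beta>) ({0..} \<inter> {a x<..<b x}))"
    unfolding R_def using finL by (simp add: emeasure_PiM sets_site_iff)
  moreover have "emeasure (site_measure \<beta>) ({0..} \<inter> {a x<..<b x}) > 0" if x: "x \<in> L" for x
  proof -
    obtain \<phi> where "\<phi> \<in> rbox a b" using assms(2) by auto
    then have "a x < b x" "0 < b x" using x X_nonneg[of \<phi> x] by (force simp: rbox_def)+
    then have "0 < emeasure lborel {max 0 (a x)<..<b x}" by simp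
    also have "\<dots> \<le> emeasure lborel ({0..} \<inter> {a x<..<b x})" by (intro emeasure_mono) auto
    also have "\<dots> \<le> emeasure (site_measure \<beta>) ({0..} \<inter> {a x<..<b x})" by (subst emeasure_site) (auto simp: sets_site_iff)
    finally show ?thesis .
  qed
  ultimately show ?thesis using finL by (auto simp: less_le)
qed

text \<open>These polynomials vanish at \<open>t = 0\<close>, so composing them with a bump keeps
  its support while turning it into an approximate indicator.\<close>

lemma indicator_limit:
  assumes "0 \<le> t" "t \<le> (1::real)" shows "(\<lambda>n. 1 - (1 - t) ^ n) \<longlonglongrightarrow> (if t > 0 then 1 else 0)"
proof (cases "t > 0")
  case True
  have "(\<lambda>n. (1 - t) ^ n) \<longlonglongrightarrow> 0" using True assms by (intro LIMSEQ_realpow_zero) auto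
  then show ?thesis using True tendsto_diff[OF tendsto_const, of _ 0 _ 1] by fastforce
qed (use assms in auto)

lemma C2c_one_minus_power: assumes "F \<in> C2c" shows "(\<lambda>\<phi>. 1 - (1 - F \<phi>) ^ n) \<in> C2c"
proof -
  obtain M where M: "\<forall>\<phi>\<in>X. F \<phi> \<noteq> 0 \<longrightarrow> (\<forall>x\<in>L. \<phi> x \<le> M)" using C2c_D[OF assms(1)] by blast
  show ?thesis
  proof (rule C2c_I[where M=M])
    show "Ck 2 (\<lambda>\<phi>. 1 - (1 - F \<phi>) ^ n)" by (intro Ck_diff Ck_const Ck_power C2c_Ck assms)
    fix \<phi> x assume "\<phi> \<in> X" "1 - (1 - F \<phi>) ^ n \<noteq> 0" "x \<in> L"
    then show "\<phi> x \<le> M" using M by (cases "F \<phi> = 0") auto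
  qed
qed

lemma bump_seq:
  "\<exists>F. (\<forall>n::nat. F n \<in> C2c) \<and> (\<forall>n. \<forall>\<phi>\<in>X. 0 \<le> F n \<phi> \<and> F n \<phi> \<le> 1) \<and>
    (\<forall>\<phi>\<in>X. (\<lambda>n. F n \<phi>) \<longlonglongrightarrow> indicator (rbox a b) \<phi>)"
proof -
  obtain C where C: "\<forall>\<phi>\<in>X. \<bar>bump a b \<phi>\<bar> \<le> C" using C2c_bounded[OF bump_C2c] by blast
  define K where "K = max C 1"
  define G where "G \<phi> = (1 / K) * bump a b \<phi>" for \<phi>
  have K: "K > 0" by (simp add: K_def)
  have G: "G \<in> C2c" unfolding G_def[abs_def] by (intro C2c_cmult bump_C2c)
  have G01: "0 \<le> G \<phi>" "G \<phi> \<le> 1" if "\<phi> \<in> X" for \<phi>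
    using C[rule_format, OF that] bump_nonneg[of a b \<phi>] K by (auto simp: G_def K_def)
  have pos: "G \<phi> > 0 \<longleftrightarrow> \<phi> \<in> rbox a b" if "\<phi> \<in> X" for \<phi>
    using bump_pos_iff[of a b \<phi>] K that by (auto simp: G_def rbox_def zero_less_divide_iff)
  show ?thesis
  proof (intro exI[of _ "\<lambda>n \<phi>. 1 - (1 - G \<phi>) ^ n"] conjI allI ballI C2c_one_minus_power G)
    fix n \<phi> assume "\<phi> \<in> X"
    then have "0 \<le> 1 - G \<phi>" "1 - G \<phi> \<le> 1" using G01 by auto
    then show "0 \<le> 1 - (1 - G \<phi>) ^ n" "1 - (1 - G \<phi>) ^ n \<le> 1" by (auto simp: power_le_one)
  next
    fix \<phi> assume \<phi>: "\<phi> \<in> X"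
    show "(\<lambda>n. 1 - (1 - G \<phi>) ^ n) \<longlonglongrightarrow> indicator (rbox a b) \<phi>"
      using indicator_limit[OF G01[OF \<phi>]] pos[OF \<phi>] by (auto simp: indicator_def of_bool_def split: if_splits)
  qed
qed

text \<open>A monotone class argument for the closure \<open>Cl\<close> of the test functions: boxes
  generate the Borel sets and are stable under intersection, their indicators are limits of test
  functions, and simple functions follow. The measure is arbitrary because density is needed again
  for a measure weighted with a squared gradient.\<close>

lemma C2c_dense:
  assumes fin: "finite_measure M" and sM: "sets M = BX" and f: "f \<in> L2 M" and e: "e > 0"
  shows "\<exists>g\<in>C2c. l2_norm M (\<lambda>x. f x - g x) < e"
proof -
  interpret finite_measure M by fact
  have sp: "space M = X"
    using sets_eq_imp_space_eq[of M "R 1"] by (simp add: sM sets_R space_R)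
  have AL: "g \<in> L2 M" if "g \<in> C2c" for g
  proof -
    obtain C where "\<forall>\<phi>\<in>X. \<bar>g \<phi>\<bar> \<le> C" using C2c_bounded[OF \<open>g \<in> C2c\<close>] by blast
    then show ?thesis using that by (intro L2_bounded[where C=C] continuous_measurable[OF sM] C2c_cont AE_I2) (auto simp: sp)
  qed
  define Cl where "Cl = {f \<in> L2 M. \<forall>e>0. \<exists>g\<in>C2c. l2_norm M (\<lambda>x. f x - g x) < e}"
  have Cl_L2: "f \<in> L2 M" if "f \<in> Cl" for f using that by (simp add: Cl_def)
  have Cl_C2c: "g \<in> Cl" if "g \<in> C2c" for g
    using that AL[OF that] by (auto simp: Cl_def l2_norm_def l2_inner_def intro!: bexI[of _ g])
  have Cl_cmult: "(\<lambda>x. c * f x) \<in> Cl" if f: "f \<in> Cl" for c f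
  proof -
    have "\<exists>g\<in>C2c. l2_norm M (\<lambda>x. c * f x - g x) < e" if e: "e > 0" for e
    proof -
      have "e / (\<bar>c\<bar> + 1) > 0" using e by (intro divide_pos_pos) auto
      then obtain g where g: "g \<in> C2c" "l2_norm M (\<lambda>x. f x - g x) < e / (\<bar>c\<bar> + 1)" using f by (auto simp: Cl_def)
      have "l2_norm M (\<lambda>x. c * f x - c * g x) = \<bar>c\<bar> * l2_norm M (\<lambda>x. f x - g x)"
        by (simp add: l2_norm_cmult flip: right_diff_distrib)
      also have "\<dots> \<le> \<bar>c\<bar> * (e / (\<bar>c\<bar> + 1))" using g(2) by (intro mult_left_mono) auto
      also have "\<dots> < e" using e by (simp add: field_simps)
      finally show ?thesis by (intro bexI[OF _ C2c_cmult[OF g(1)]])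
    qed
    then show ?thesis using L2_cmult[OF Cl_L2[OF f]] by (simp add: Cl_def)
  qed
  have Cl_add: "(\<lambda>x. f x + h x) \<in> Cl" if f: "f \<in> Cl" and h: "h \<in> Cl" for f h
  proof -
    have "\<exists>g\<in>C2c. l2_norm M (\<lambda>x. f x + h x - g x) < e" if e: "e > 0" for e
    proof -
      obtain g k where g: "g \<in> C2c" "l2_norm M (\<lambda>x. f x - g x) < e / 2" "k \<in> C2c" "l2_norm M (\<lambda>x. h x - k x) < e / 2"
        using f h half_gt_zero[OF e] unfolding Cl_def by blast
      have "l2_norm M (\<lambda>x. (f x - g x) + (h x - k x)) < e"
        using l2_triangle[OF L2_diff[OF Cl_L2[OF f] AL[OF g(1)]] L2_diff[OF Cl_L2[OF h] AL[OF g(3)]]] g(2,4) by linarith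
      then show ?thesis using C2c_add[OF g(1,3)] by (intro bexI[of _ "\<lambda>x. g x + k x"]) (simp_all add: algebra_simps)
    qed
    then show ?thesis using L2_add[OF Cl_L2[OF f] Cl_L2[OF h]] by (simp add: Cl_def)
  qed
  have Cl_lim: "f \<in> Cl" if F: "\<And>n. F n \<in> Cl" and f: "f \<in> L2 M" and lim: "(\<lambda>n. l2_norm M (\<lambda>x. F n x - f x)) \<longlonglongrightarrow> 0" for F f
  proof -
    have "\<exists>g\<in>C2c. l2_norm M (\<lambda>x. f x - g x) < e" if e: "e > 0" for e
    proof -
      obtain n where n: "l2_norm M (\<lambda>x. F n x - f x) < e / 2"
        using order_tendstoD(2)[OF lim half_gt_zero[OF e]] by (auto simp: eventually_sequentially)
      obtain g where g: "g \<in> C2c" "l2_norm M (\<lambda>x. F n x - g x) < e / 2"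
        using F[of n] half_gt_zero[OF e] unfolding Cl_def by blast
      have "l2_norm M (\<lambda>x. f x - g x) < e"
        using l2_triangle3[OF f Cl_L2[OF F] AL[OF g(1)], of n] g(2) n l2_norm_minus_commute[of M f "F n"] by linarith
      then show ?thesis using g(1) by blast
    qed
    then show ?thesis using f by (simp add: Cl_def)
  qed
  \<comment> \<open>Closure under dominated pointwise limits serves boxes, disjoint unions and
    monotone sequences alike.\<close>
  have Cl_dom: "f \<in> Cl" if F: "\<And>n. F n \<in> Cl" and "f \<in> borel_measurable M" "g \<in> L2 M"
    "\<And>x. x \<in> X \<Longrightarrow> (\<lambda>n. F n x) \<longlonglongrightarrow> f x" "\<And>n x. x \<in> X \<Longrightarrow> \<bar>F n x\<bar> \<le> g x" for F f g
  proof -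
    note dc = l2_dominated_convergence[of F M f g, OF L2_measurable[OF Cl_L2[OF F]] that(2,3)]
    show ?thesis by (rule Cl_lim[OF F dc(1) dc(3)]) (use that sp in auto)
  qed
  have Cl_diff: "(\<lambda>x. f x - h x) \<in> Cl" if f: "f \<in> Cl" and h: "h \<in> Cl" for f h
    using Cl_add[OF f Cl_cmult[OF h, of "-1"]] by simp
  have Cl_rbox: "indicator (rbox a b) \<in> Cl" for a b
  proof -
    obtain F where F: "\<forall>n::nat. F n \<in> C2c" "\<forall>n. \<forall>\<phi>\<in>X. 0 \<le> F n \<phi> \<and> F n \<phi> \<le> 1"
      "\<forall>\<phi>\<in>X. (\<lambda>n. F n \<phi>) \<longlonglongrightarrow> indicator (rbox a b) \<phi>" using bump_seq[of a b] by (elim exE conjE)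
    have "rbox a b \<in> sets M" using rbox_open[of a b] by (auto simp: sM intro: sigma_sets.Basic)
    then have m: "indicator (rbox a b) \<in> borel_measurable M" by (rule borel_measurable_indicator)
    show ?thesis
    proof (rule Cl_dom[where g="\<lambda>x. 1" and F=F])
      show "F n \<in> Cl" for n by (rule Cl_C2c[OF F(1)[rule_format]])
      show "\<bar>F n x\<bar> \<le> 1" if "x \<in> X" for n x using F(2)[rule_format, OF that, of n] by simp
    qed (use F(3) m in \<open>auto simp: L2_const\<close>)
  qed
  \<comment> \<open>Boxes exhaust the whole space; the lower corner \<open>-1\<close> makes them
    contain the faces.\<close>
  have Cl_X: "indicator X \<in> Cl"
  proof (rule Cl_dom[where g="\<lambda>x. 1" and F="\<lambda>n. indicator (rbox (\<lambda>_. -1) (\<lambda>_. real n))", OF Cl_rbox])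
    show "indicator X \<in> borel_measurable M" by (metis borel_measurable_indicator sets.top sp)
    fix \<phi> assume \<phi>: "\<phi> \<in> X"
    obtain n0 where n0: "Max (insert 0 (\<phi> ` L)) < real n0" using reals_Archimedean2 by blast
    have "\<phi> \<in> rbox (\<lambda>_. -1) (\<lambda>_. real n)" if "n \<ge> n0" for n
    proof -
      have "\<phi> x < real n" if "x \<in> L" for x
      proof -
        have "\<phi> x \<le> Max (insert 0 (\<phi> ` L))" using finL that by (intro Max_ge) auto
        then show ?thesis using n0 \<open>n \<ge> n0\<close> by linarith
      qed
      then show ?thesis using \<phi> X_nonneg[OF \<phi>] by (auto simp: rbox_def intro: less_le_trans[of "-1" 0])
    qed
    then show "(\<lambda>n. indicator (rbox (\<lambda>_. -1) (\<lambda>_. real n)) \<phi>) \<longlonglongrightarrow> (indicator X \<phi> :: real)"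
      using \<phi> by (intro tendsto_eventually) (auto simp: eventually_sequentially intro!: exI[of _ n0])
  qed (auto simp: L2_const indicator_def)
  have Cl_set: "indicator A \<in> Cl" if A: "A \<in> sets M" for A
  proof -
    have IS: "Int_stable (range (\<lambda>(a, b). rbox a b))"
    proof (rule Int_stableI_image)
      show "\<exists>k\<in>UNIV. (case i of (a, b) \<Rightarrow> rbox a b) \<inter> (case j of (a, b) \<Rightarrow> rbox a b) = (case k of (a, b) \<Rightarrow> rbox a b)"
        for i j :: "('i \<Rightarrow> real) \<times> ('i \<Rightarrow> real)"
        by (intro bexI[of _ "(\<lambda>x. max (fst i x) (fst j x), \<lambda>x. min (snd i x) (snd j x))"])
           (auto simp: rbox_def split_beta)
    qed
    have "A \<in> sigma_sets X (range (\<lambda>(a, b). rbox a b))" using A by (simp add: rboxes_generate sM)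
    have sub: "range (\<lambda>(a, b). rbox a b) \<subseteq> Pow X" by (auto simp: rbox_def)
    from IS sub \<open>A \<in> sigma_sets X (range (\<lambda>(a, b). rbox a b))\<close> show ?thesis
    proof (induction rule: sigma_sets_induct_disjoint)
      case (basic A) then show ?case using Cl_rbox by auto
    next
      case empty
      have "indicator {} = (\<lambda>x. 0 * indicator X x :: real)" by (auto simp: fun_eq_iff)
      then show ?case using Cl_cmult[OF Cl_X, of 0] by simp
    next
      case (compl A)
      then have "A \<subseteq> X" using sigma_sets_into_sp[of "range (\<lambda>(a, b). rbox a b)" X A] by (auto simp: rbox_def)
      then have "indicator (X - A) = (\<lambda>x. indicator X x - indicator A x :: real)"
        by (auto simp: fun_eq_iff indicator_def)
      then show ?case using Cl_diff[OF Cl_X compl.IH] by simp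
    next
      case (union A)
      have s: "(\<lambda>x. \<Sum>i<n. indicator (A i) x) \<in> Cl" for n
      proof (induction n)
        case 0
        have "(\<lambda>x::'i \<Rightarrow> real. \<Sum>i<0::nat. indicator (A i) x) = (\<lambda>x. 0 * indicator X x :: real)" by (auto simp: fun_eq_iff)
        then show ?case using Cl_cmult[OF Cl_X, of 0] by simp
      next
        case (Suc n) then show ?case using Cl_add[OF Suc union.IH[of n]] by simp
      qed
      have eq: "(\<Sum>i<n. indicator (A i) x) = (indicator (\<Union>i<n. A i) x :: real)" for n x
      proof (induction n)
        case (Suc n)
        have "A n \<inter> A i = {}" if "i < n" for i using union.hyps(1) that by (auto simp: disjoint_family_on_def)
        then have "A n \<inter> (\<Union>i<n. A i) = {}" by blast
        then have "indicator (\<Union>i<Suc n. A i) x = (indicator (\<Union>i<n. A i) x + indicator (A n) x :: real)"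
          by (auto simp: lessThan_Suc indicator_def)
        then show ?case by (simp only: sum.lessThan_Suc Suc)
      qed simp
      show ?case
      proof (rule Cl_dom[where g="\<lambda>x. 1", OF s])
        have "(\<Union>i. A i) \<in> sets M" using union.hyps(2) unfolding sM rboxes_generate by (intro sigma_sets.Union) auto
        then show "indicator (\<Union>i. A i) \<in> borel_measurable M" by simp
        show "(\<lambda>n. \<Sum>i<n. indicator (A i) x) \<longlonglongrightarrow> (indicator (\<Union>i. A i) x :: real)" for x
          unfolding eq using LIMSEQ_indicator_UN[of A x] by simp
        show "\<bar>\<Sum>i<n. indicator (A i) x\<bar> \<le> (1::real)" for n x
          unfolding eq by (simp add: indicator_def)
      qed (auto simp: L2_const)
    qed
  qed
  have Cl_nonneg: "u \<in> Cl" if u: "u \<in> borel_measurable M" "\<And>x. 0 \<le> u x" "u \<in> L2 M" for u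
    using u
  proof (induction rule: borel_measurable_induct_real)
    case (set A) then show ?case using Cl_set by blast
  next
    case (mult u c)
    show ?case
    proof (cases "c = 0")
      case True
      then have "(\<lambda>x. c * u x) = (\<lambda>x. 0 * indicator X x)" by simp
      then show ?thesis using Cl_cmult[OF Cl_X, of 0] by simp
    next
      case False
      then have "u \<in> L2 M" using L2_cmult[OF mult.prems, of "1/c"] by simp
      then show ?thesis using mult.IH Cl_cmult by blast
    qed
  next
    case (add u v)
    have "u \<in> L2 M" "v \<in> L2 M"
      using add by (auto intro!: L2_bound[OF add.prems])
    then show ?case using add.IH Cl_add by blast
  next
    case (seq U)
    have le: "U i x \<le> u x" if "x \<in> X" for i x
      using seq.hyps(4)[of x] that sp incseq_le[of "\<lambda>i. U i x" "u x" i] seq.hyps(3) by (auto simp: incseq_def le_fun_def)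
    have "U i \<in> Cl" for i
    proof (intro seq.IH L2_bound[OF seq.prems] AE_I2)
      show "\<bar>U i x\<bar> \<le> \<bar>u x\<bar>" if "x \<in> space M" for x
        using le[of x i] seq.hyps(2)[of i x] that by (simp add: sp)
    qed (rule seq.hyps(1))
    then show ?case
      by (rule Cl_dom[where g=u]) (use seq le sp u in auto)
  qed
  have fm: "f \<in> borel_measurable M" using f by (rule L2_measurable)
  have "(\<lambda>x. max (f x) 0) \<in> Cl" "(\<lambda>x. max (- f x) 0) \<in> Cl"
    by (intro Cl_nonneg L2_bound[OF f]; use fm in force)+
  from Cl_diff[OF this] have "(\<lambda>x. max (f x) 0 - max (- f x) 0) \<in> Cl" .
  also have "(\<lambda>x. max (f x) 0 - max (- f x) 0) = f" by (auto simp: fun_eq_iff max_def)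
  finally show ?thesis using e unfolding Cl_def by blast
qed

end

text \<open>Continuity and positivity bound \<open>\<rho>\<close> from both sides on compact boxes,
  and this is how the density enters the estimates.\<close>

locale orthant_measure = orthant L for L :: "'i::countable set" +
  fixes \<beta> :: real and \<rho> :: "('i \<Rightarrow> real) \<Rightarrow> real"
  assumes \<beta>_pos: "\<beta> > 0"
    and \<rho>_cont: "continuous_on X \<rho>" and \<rho>_pos: "\<phi> \<in> X \<Longrightarrow> \<rho> \<phi> > 0"
    and \<rho>_finite: "(\<integral>\<^sup>+\<phi>. ennreal (\<rho> \<phi>) \<partial>R \<beta>) < \<infinity>"
begin

definition M :: "('i \<Rightarrow> real) measure" where "M = density (R \<beta>) (\<lambda>\<phi>. ennreal (\<rho> \<phi>))"

lemma sets_M: "sets M = BX" by (simp add: M_def sets_R)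

lemma space_M: "space M = X" by (simp add: M_def space_R)

lemma \<rho>_measurable [measurable]: "\<rho> \<in> borel_measurable (R \<beta>)"
  by (rule continuous_measurable[OF sets_R \<rho>_cont])

sublocale finite_measure M
proof
  have "emeasure M (space M) = (\<integral>\<^sup>+\<phi>. ennreal (\<rho> \<phi>) \<partial>R \<beta>)"
    unfolding M_def by (subst emeasure_density) (auto simp: indicator_def intro!: nn_integral_cong)
  then show "emeasure M (space M) \<noteq> \<infinity>" using \<rho>_finite by simp
qed

lemma cont_M: "continuous_on X f \<Longrightarrow> (f :: _ \<Rightarrow> real) \<in> borel_measurable M"
  by (rule continuous_measurable[OF sets_M])

lemma meas_MR: "f \<in> borel_measurable M \<longleftrightarrow> f \<in> borel_measurable (R \<beta>)"
  by (simp add: M_def)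

lemma integral_M:
  fixes f :: "_ \<Rightarrow> real"
  assumes "f \<in> borel_measurable M"
  shows "(\<integral>\<phi>. f \<phi> \<partial>M) = (\<integral>\<phi>. \<rho> \<phi> * f \<phi> \<partial>R \<beta>)"
  using assms \<rho>_pos unfolding M_def
  by (subst integral_density) (auto simp: space_R less_imp_le)

lemma open_pos:
  assumes "openin T U" "U \<noteq> {}" shows "emeasure M U > 0"
proof -
  obtain \<phi> where "\<phi> \<in> U" using assms by auto
  then obtain a b where ab: "\<phi> \<in> rbox a b" "rbox a b \<subseteq> U" using open_contains_rbox[OF assms(1)] by blast
  have s: "rbox a b \<in> sets (R \<beta>)" "U \<in> sets M" using rbox_open assms by (auto simp: sets_R sets_M intro: sigma_sets.Basic)
  have "emeasure M (rbox a b) \<noteq> 0"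
  proof
    assume "emeasure M (rbox a b) = 0"
    then have "(\<integral>\<^sup>+\<phi>. ennreal (\<rho> \<phi>) * indicator (rbox a b) \<phi> \<partial>R \<beta>) = 0"
      using s by (simp add: M_def emeasure_density)
    then have "AE \<phi> in R \<beta>. ennreal (\<rho> \<phi>) * indicator (rbox a b) \<phi> = 0"
      using s by (subst (asm) nn_integral_0_iff_AE) auto
    then have "AE \<phi> in R \<beta>. \<phi> \<notin> rbox a b"
      by (rule AE_mp) (use \<rho>_pos in \<open>auto intro!: AE_I2 simp: rbox_def indicator_def ennreal_eq_0_iff not_le[symmetric]\<close>)
    then have "emeasure (R \<beta>) (rbox a b) = 0"
      using AE_iff_null_sets[OF s(1)] by (auto simp: null_sets_def)
    then show False using R_rbox_pos[OF \<beta>_pos, of a b] ab by auto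
  qed
  then show ?thesis using emeasure_mono[OF ab(2) s(2)] by (metis bot.extremum_uniqueI bot_ennreal not_gr_zero)
qed

lemma integral_pos_open:
  fixes f :: "('i \<Rightarrow> real) \<Rightarrow> real"
  assumes f: "continuous_on X f" "\<And>\<phi>. \<phi> \<in> X \<Longrightarrow> f \<phi> \<ge> 0" "integrable M f" "\<phi>0 \<in> X" "f \<phi>0 > 0"
  shows "(\<integral>\<phi>. f \<phi> \<partial>M) > 0"
proof (rule ccontr)
  assume "\<not> ?thesis"
  moreover have "(\<integral>\<phi>. f \<phi> \<partial>M) \<ge> 0" by (rule integral_nonneg_AE) (use f(2) in \<open>auto simp: space_M\<close>)
  ultimately have "(\<integral>\<phi>. f \<phi> \<partial>M) = 0" by simp
  then have "AE \<phi> in M. f \<phi> = 0"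
    using integral_nonneg_eq_0_iff_AE[OF f(3) AE_I2] f(2) by (simp add: space_M)
  then have ae: "AE \<phi> in M. \<phi> \<notin> X \<inter> f -` {0<..}" by eventually_elim auto
  have o: "openin T (X \<inter> f -` {0<..})"
    unfolding T_eq by (intro continuous_openin_preimage_gen f) auto
  then have "X \<inter> f -` {0<..} \<in> sets M" by (auto simp: sets_M intro: sigma_sets.Basic)
  from AE_iff_null_sets[OF this] ae have "emeasure M (X \<inter> f -` {0<..}) = 0" by auto
  then show False using open_pos[OF o] f(4,5) by auto
qed

text \<open>\<open>R \<beta>\<close> need not be finite, but on a box \<open>\<rho>\<close> is
  bounded below, so a bounded function supported there is dominated by a multiple of
  \<open>\<rho>\<close>.\<close>

lemma box_integrable_R:
  assumes "f \<in> borel_measurable M" "\<And>\<phi>. \<phi> \<in> X \<Longrightarrow> \<bar>f \<phi>\<bar> \<le> C"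
    "\<forall>\<phi>\<in>X. f \<phi> \<noteq> 0 \<longrightarrow> (\<forall>x\<in>L. \<phi> x \<le> K)"
  shows "integrable (R \<beta>) f" "\<exists>C'. \<forall>\<phi>\<in>X. \<bar>f \<phi> / \<rho> \<phi>\<bar> \<le> C'"
proof -
  have "continuous_on X (\<lambda>\<phi>. 1 / \<rho> \<phi>)"
    using \<rho>_pos by (intro continuous_intros \<rho>_cont) (auto simp: less_imp_neq[symmetric])
  then obtain c where c: "\<And>\<phi>. \<phi> \<in> (\<Pi>\<^sub>E x\<in>L. {0..K}) \<Longrightarrow> \<bar>1 / \<rho> \<phi>\<bar> \<le> c"
    using continuous_bounded_on_box by blast
  have bd: "\<bar>f \<phi> / \<rho> \<phi>\<bar> \<le> \<bar>C\<bar> * \<bar>c\<bar>" if \<phi>: "\<phi> \<in> X" for \<phi>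
  proof (cases "f \<phi> = 0")
    case False
    have "\<bar>1 / \<rho> \<phi>\<bar> \<le> \<bar>c\<bar>" using c[OF box_memI[OF \<phi>]] assms(3) \<phi> False by force
    moreover have "\<bar>f \<phi>\<bar> \<le> \<bar>C\<bar>" using assms(2)[OF \<phi>] by linarith
    ultimately have "\<bar>f \<phi>\<bar> * \<bar>1 / \<rho> \<phi>\<bar> \<le> \<bar>C\<bar> * \<bar>c\<bar>" by (intro mult_mono) auto
    then show ?thesis by (simp add: abs_mult[symmetric])
  qed simp
  then show "\<exists>C'. \<forall>\<phi>\<in>X. \<bar>f \<phi> / \<rho> \<phi>\<bar> \<le> C'" by blast
  have i\<rho>: "integrable (R \<beta>) \<rho>"
    using \<rho>_finite \<rho>_pos by (intro integrableI_nonneg AE_I2) (auto simp: space_R less_imp_le)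
  have "\<bar>f \<phi>\<bar> \<le> \<bar>C\<bar> * \<bar>c\<bar> * \<rho> \<phi>" if "\<phi> \<in> X" for \<phi>
    using bd[OF that] \<rho>_pos[OF that] by (simp add: abs_divide field_simps)
  then show "integrable (R \<beta>) f"
    using assms(1) by (intro Bochner_Integration.integrable_bound[OF integrable_mult_right[OF i\<rho>, of "\<bar>C\<bar> * \<bar>c\<bar>"]])
      (auto simp: meas_MR space_R intro!: AE_I2 order_trans[OF _ abs_ge_self])
qed

text \<open>The value \<open>0\<close> on the face \<open>\<phi> x = 0\<close>, which has positive mass, accounts for the sum over \<open>x \<in> B\<close> only
  in the part of the form on \<open>Omega N B\<close>.\<close>

definition G :: "'i \<Rightarrow> (('i \<Rightarrow> real) \<Rightarrow> real) \<Rightarrow> ('i \<Rightarrow> real) \<Rightarrow> real" where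
  "G x F \<phi> = (if \<phi> x > 0 then deriv (\<lambda>t. F (\<phi>(x := t))) (\<phi> x) else 0)"

lemma G_eq: "pdx x F g \<Longrightarrow> \<phi> \<in> X \<Longrightarrow> G x F \<phi> = (if \<phi> x > 0 then g \<phi> else 0)"
  by (auto simp: G_def pdx_def intro: DERIV_imp_deriv)

lemma C2c_pdx: "F \<in> C2c \<Longrightarrow> x \<in> L \<Longrightarrow> \<exists>g. pdx x F g \<and> continuous_on X g"
  using C2c_Ck[of F] by (auto simp: numeral_2_eq_2)

lemma G_local:
  assumes "\<phi> x > 0" "open S" "\<phi> x \<in> S" "\<And>t. t \<in> S \<Longrightarrow> t > 0 \<Longrightarrow> F (\<phi>(x := t)) = c"
  shows "G x F \<phi> = 0"
proof -
  have "((\<lambda>t. c) has_real_derivative 0) (at (\<phi> x))" by simp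
  then have "((\<lambda>t. F (\<phi>(x := t))) has_real_derivative 0) (at (\<phi> x))"
    by (rule has_field_derivative_transform_within_open[where S="S \<inter> {0<..}"]) (use assms in auto)
  then show ?thesis by (simp add: G_def DERIV_imp_deriv)
qed

text \<open>At a point whose coordinate \<open>y\<close> exceeds \<open>K\<close>, the function
  vanishes along the line in direction \<open>x\<close>: near the point if \<open>y = x\<close>, on
  the whole line within the orthant otherwise.\<close>

lemma G_support:
  assumes K: "\<forall>\<phi>\<in>X. F \<phi> \<noteq> 0 \<longrightarrow> (\<forall>y\<in>L. \<phi> y \<le> K)" and x: "x \<in> L"
  shows "\<forall>\<phi>\<in>X. G x F \<phi> \<noteq> 0 \<longrightarrow> (\<forall>y\<in>L. \<phi> y \<le> K)"
proof (intro ballI impI, rule ccontr)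
  fix \<phi> y assume \<phi>: "\<phi> \<in> X" "G x F \<phi> \<noteq> 0" "y \<in> L"
  assume *: "\<not> \<phi> y \<le> K"
  have "\<phi> x > 0" using \<phi>(2) by (auto simp: G_def split: if_splits)
  then have "G x F \<phi> = 0"
  proof (rule G_local[where S="if x = y then {K<..} else UNIV" and c=0])
    fix t assume t: "t \<in> (if x = y then {K<..} else UNIV)" "0 < t"
    have "\<phi>(x := t) \<in> X" using X_upd[OF \<phi>(1) x] t by simp
    with K \<phi>(3) have "F (\<phi>(x := t)) \<noteq> 0 \<Longrightarrow> (\<phi>(x := t)) y \<le> K" by blast
    then show "F (\<phi>(x := t)) = 0" using t * by (cases "x = y") (auto split: if_splits)
  qed (use * in auto)
  then show False using \<phi>(2) by simp
qed

lemma pos_coord_measurable [measurable]: "x \<in> L \<Longrightarrow> (\<lambda>\<phi>. \<phi> x) \<in> borel_measurable M"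
  by (intro cont_M coord_continuous)

lemma G_measurable: assumes "F \<in> C2c" "x \<in> L" shows "G x F \<in> borel_measurable M"
proof -
  obtain g where g: "pdx x F g" "continuous_on X g" using C2c_pdx[OF assms] by blast
  have [measurable]: "g \<in> borel_measurable M" by (rule cont_M[OF g(2)])
  have "(\<lambda>\<phi>. if \<phi> x > 0 then g \<phi> else 0) \<in> borel_measurable M" using assms(2) by measurable
  then show ?thesis by (rule measurable_cong[THEN iffD1, rotated]) (simp add: G_eq[OF g(1)] space_M)
qed

lemma G_bounded: assumes "F \<in> C2c" "x \<in> L" shows "\<exists>C. \<forall>\<phi>\<in>X. \<bar>G x F \<phi>\<bar> \<le> C"
proof -
  obtain g where g: "pdx x F g" "continuous_on X g" using C2c_pdx[OF assms] by blast
  obtain K where K: "\<forall>\<phi>\<in>X. F \<phi> \<noteq> 0 \<longrightarrow> (\<forall>y\<in>L. \<phi> y \<le> K)" using C2c_D[OF assms(1)] by blast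
  obtain C where C: "\<And>\<phi>. \<phi> \<in> (\<Pi>\<^sub>E x\<in>L. {0..K}) \<Longrightarrow> \<bar>g \<phi>\<bar> \<le> C" using continuous_bounded_on_box[OF g(2)] by blast
  have "\<bar>G x F \<phi>\<bar> \<le> max C 0" if \<phi>: "\<phi> \<in> X" for \<phi>
  proof (cases "G x F \<phi> = 0")
    case False
    have "\<phi> \<in> (\<Pi>\<^sub>E x\<in>L. {0..K})" using G_support[OF K assms(2)] \<phi> False by (intro box_memI) auto
    from C[OF this] show ?thesis using G_eq[OF g(1) \<phi>] by auto
  qed simp
  then show ?thesis by blast
qed

lemma G_integrable_R: assumes "F \<in> C2c" "x \<in> L" shows "integrable (R \<beta>) (G x F)"
proof -
  obtain K where K: "\<forall>\<phi>\<in>X. F \<phi> \<noteq> 0 \<longrightarrow> (\<forall>y\<in>L. \<phi> y \<le> K)" using C2c_D[OF assms(1)] by blast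
  obtain C where "\<And>\<phi>. \<phi> \<in> X \<Longrightarrow> \<bar>G x F \<phi>\<bar> \<le> C" using G_bounded[OF assms] by blast
  from box_integrable_R(1)[where K=K, OF G_measurable[OF assms] this G_support[OF K assms(2)]] show ?thesis by blast
qed

text \<open>Since \<open>F\<close> vanishes near the face \<open>\<phi> x = 0\<close>, neither the Dirac masses nor the boundary contribute.\<close>

lemma integration_by_parts:
  assumes F: "F \<in> C2c" "x \<in> L" and a: "a > 0" "\<And>\<phi>. \<phi> \<in> X \<Longrightarrow> \<phi> x \<le> a \<Longrightarrow> F \<phi> = 0"
  shows "(\<integral>\<phi>. G x F \<phi> \<partial>R \<beta>) = 0"
proof -
  interpret product_sigma_finite "\<lambda>_. site_measure \<beta>" by (rule prod_site_integral)
  obtain g where g: "pdx x F g" "continuous_on X g" using C2c_pdx[OF F] by blast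
  obtain K where K: "K \<ge> 0" "\<And>\<phi> y. \<phi> \<in> X \<Longrightarrow> F \<phi> \<noteq> 0 \<Longrightarrow> y \<in> L \<Longrightarrow> \<phi> y \<le> K" using C2c_D[OF F(1)] by blast
  let ?L = "L - {x}"
  have L: "insert x ?L = L" using F(2) by auto
  have inner: "integral\<^sup>L (site_measure \<beta>) (\<lambda>t. G x F (fun_upd w x t)) = 0" if w: "w \<in> space (\<Pi>\<^sub>M y\<in>?L. site_measure \<beta>)" for w
  proof -
    have up: "w(x := t) \<in> X" if "t \<ge> 0" for t
      using w that F(2) by (auto simp: space_PiM space_site X_def PiE_def extensional_def Pi_def)
    let ?f = "\<lambda>t. G x F (w(x := t))"
    have f0: "?f t = 0" if "t < a \<or> t > K" "t > 0" for t
    proof (rule G_local[where S="{..<a} \<union> {K<..}" and c=0])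
      fix s :: real assume s: "s \<in> {..<a} \<union> {K<..}" "s > 0"
      then show "F ((w(x := t))(x := s)) = 0"
        using a(2)[OF up, of s] K(2)[OF up _ F(2), of s] by (cases "F (w(x := s)) = 0") auto
    qed (use that in auto)
    have der: "((\<lambda>t. F (w(x := t))) has_real_derivative ?f t) (at t)" if t: "t > 0" for t
      using g(1) up[of t] t G_eq[OF g(1) up[of t]] by (auto simp: pdx_def dest!: bspec[of X _ "w(x := t)"])
    have cont: "isCont ?f t" if t: "t > 0" for t
    proof -
      have "continuous_on {0<..} (\<lambda>t. g (w(x := t)))"
        by (rule continuous_on_compose2[OF g(2) upd_continuous]) (use up in auto)
      then have "continuous_on {0<..} ?f"
        by (rule continuous_on_eq) (simp add: G_eq[OF g(1) up])
      then show ?thesis using t by (simp add: continuous_on_eq_continuous_at)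
    qed
    have "(\<integral>t. ?f t \<partial>site_measure \<beta>) = (\<integral>t. indicator {0<..} t * ?f t \<partial>site_measure \<beta>)"
      by (intro Bochner_Integration.integral_cong) (auto simp: indicator_def G_def)
    also have "\<dots> = (\<integral>t. indicator {0<..} t * ?f t \<partial>lborel)" by (rule integral_site_pos)
    \<comment> \<open>The interval is chosen so that \<open>F\<close> vanishes at both ends, below
      because \<open>a / 2 \<le> a\<close> and above because \<open>K + a > K\<close>.\<close>
    also have "\<dots> = (\<integral>t. ?f t * indicator {a/2..K+a} t \<partial>lborel)"
    proof (intro Bochner_Integration.integral_cong refl)
      fix t
      have "?f t = 0" if "\<not> (a/2 \<le> t \<and> t \<le> K + a)"
        using that f0[of t] a(1) K(1) by (cases "t > 0") (auto simp: G_def)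
      moreover have "t > 0" if "a/2 \<le> t" using that a(1) by simp
      ultimately show "indicator {0<..} t * ?f t = ?f t * indicator {a/2..K+a} t"
        by (cases "a/2 \<le> t \<and> t \<le> K + a") auto
    qed
    also have "\<dots> = F (w(x := K + a)) - F (w(x := a/2))"
    proof (rule integral_FTC_Icc_real)
      show "a / 2 \<le> K + a" using a(1) K(1) by simp
    next
      fix t assume "a / 2 \<le> t"
      then have t: "t > 0" using a(1) by simp
      show "((\<lambda>t. F (w(x := t))) has_real_derivative ?f t) (at t)" by (rule der[OF t])
      show "isCont ?f t" by (rule cont[OF t])
    qed
    also have "F (w(x := K + a)) = 0" using K(2)[OF up _ F(2), of "K + a"] a(1) K(1) by force
    also have "F (w(x := a/2)) = 0" using a up[of "a/2"] by auto
    finally show ?thesis by (simp only: diff_self)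
  qed
  have "(\<integral>\<phi>. G x F \<phi> \<partial>R \<beta>) = (\<integral>w. integral\<^sup>L (site_measure \<beta>) (\<lambda>t. G x F (fun_upd w x t)) \<partial>(\<Pi>\<^sub>M y\<in>?L. site_measure \<beta>))"
    using product_integral_insert[of ?L x "G x F", unfolded L] G_integrable_R[OF F] finL by (simp add: R_def)
  also have "\<dots> = (\<integral>w. 0 \<partial>(\<Pi>\<^sub>M y\<in>?L. site_measure \<beta>))"
    by (intro Bochner_Integration.integral_cong inner) auto
  finally show ?thesis by simp
qed

lemma G_add: "F \<in> C2c \<Longrightarrow> H \<in> C2c \<Longrightarrow> x \<in> L \<Longrightarrow> \<phi> \<in> X \<Longrightarrow> G x (\<lambda>\<phi>. F \<phi> + H \<phi>) \<phi> = G x F \<phi> + G x H \<phi>"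
  using C2c_pdx[of F x] C2c_pdx[of H x] by (auto simp: G_eq G_eq[OF pdx_add])

lemma G_mult_Ck: "F \<in> C2c \<Longrightarrow> pdx x H h \<Longrightarrow> x \<in> L \<Longrightarrow> \<phi> \<in> X \<Longrightarrow>
    G x (\<lambda>\<phi>. F \<phi> * H \<phi>) \<phi> = F \<phi> * G x H \<phi> + H \<phi> * G x F \<phi>"
  using C2c_pdx[of F x] by (auto simp: G_eq G_eq[OF pdx_mult])

lemma G_mult: "F \<in> C2c \<Longrightarrow> H \<in> C2c \<Longrightarrow> x \<in> L \<Longrightarrow> \<phi> \<in> X \<Longrightarrow>
    G x (\<lambda>\<phi>. F \<phi> * H \<phi>) \<phi> = F \<phi> * G x H \<phi> + H \<phi> * G x F \<phi>"
  using C2c_pdx[of H x] G_mult_Ck[of F x H] by blast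

lemma G_cmult: "F \<in> C2c \<Longrightarrow> x \<in> L \<Longrightarrow> \<phi> \<in> X \<Longrightarrow> G x (\<lambda>\<phi>. c * F \<phi>) \<phi> = c * G x F \<phi>"
  using C2c_pdx[of F x] by (auto simp: G_eq G_eq[OF pdx_mult[OF pdx_const]])

lemma G_comp:
  assumes "F \<in> C2c" "C2_real \<psi> \<psi>'" "x \<in> L" "\<phi> \<in> X"
  shows "G x (\<lambda>\<phi>. \<psi> (F \<phi>)) \<phi> = \<psi>' (F \<phi>) * G x F \<phi>"
proof -
  obtain f where f: "pdx x F f" using C2c_pdx[OF assms(1,3)] by blast
  have "pdx x (\<lambda>\<phi>. \<psi> (F \<phi>)) (\<lambda>\<phi>. \<psi>' (F \<phi>) * f \<phi>)"
    using assms(2) by (intro pdx_comp f) (auto simp: C2_real_def)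
  then show ?thesis using G_eq[OF f assms(4)] by (simp add: G_eq assms(4))
qed

end


section \<open>The gradient form on the orthant\<close>

context orthant_measure begin

lemma C2c_L2: assumes "F \<in> C2c" shows "F \<in> L2 M"
proof -
  obtain C where "\<forall>\<phi>\<in>X. \<bar>F \<phi>\<bar> \<le> C" using C2c_bounded[OF assms] by blast
  then show ?thesis by (intro L2_bounded[where C=C] cont_M C2c_cont assms AE_I2) (auto simp: space_M)
qed

lemma G_L2: assumes "F \<in> C2c" "x \<in> L" shows "G x F \<in> L2 M"
proof -
  obtain C where "\<forall>\<phi>\<in>X. \<bar>G x F \<phi>\<bar> \<le> C" using G_bounded[OF assms] by blast
  then show ?thesis by (intro L2_bounded[where C=C] G_measurable assms AE_I2) (auto simp: space_M)
qed

lemma \<rho>_measurable_M [measurable]: "\<rho> \<in> borel_measurable M"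
  by (rule cont_M[OF \<rho>_cont])

lemma pair_R:
  assumes "f \<in> borel_measurable M" "\<eta> \<in> borel_measurable M"
  shows "l2_inner M f (\<lambda>\<phi>. \<eta> \<phi> / \<rho> \<phi>) = (\<integral>\<phi>. f \<phi> * \<eta> \<phi> \<partial>R \<beta>)"
proof -
  note [measurable] = assms
  have "l2_inner M f (\<lambda>\<phi>. \<eta> \<phi> / \<rho> \<phi>) = (\<integral>\<phi>. \<rho> \<phi> * (f \<phi> * (\<eta> \<phi> / \<rho> \<phi>)) \<partial>R \<beta>)"
    unfolding l2_inner_def by (rule integral_M) measurable
  also have "\<dots> = (\<integral>\<phi>. f \<phi> * \<eta> \<phi> \<partial>R \<beta>)"
    using \<rho>_pos by (intro Bochner_Integration.integral_cong) (auto simp: space_R less_imp_neq[symmetric])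
  finally show ?thesis .
qed

lemma C2c_div_\<rho>_L2: assumes "\<eta> \<in> C2c" shows "(\<lambda>\<phi>. \<eta> \<phi> / \<rho> \<phi>) \<in> L2 M" "\<exists>C. \<forall>\<phi>\<in>X. \<bar>\<eta> \<phi> / \<rho> \<phi>\<bar> \<le> C"
proof -
  obtain K where K: "\<forall>\<phi>\<in>X. \<eta> \<phi> \<noteq> 0 \<longrightarrow> (\<forall>y\<in>L. \<phi> y \<le> K)" using C2c_D[OF assms(1)] by blast
  obtain C where "\<And>\<phi>. \<phi> \<in> X \<Longrightarrow> \<bar>\<eta> \<phi>\<bar> \<le> C" using C2c_bounded[OF assms] by blast
  from box_integrable_R(2)[OF cont_M[OF C2c_cont[OF assms]] this K]
  obtain C' where C': "\<forall>\<phi>\<in>X. \<bar>\<eta> \<phi> / \<rho> \<phi>\<bar> \<le> C'" by blast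
  have [measurable]: "\<eta> \<in> borel_measurable M" by (rule cont_M[OF C2c_cont[OF assms]])
  show "(\<lambda>\<phi>. \<eta> \<phi> / \<rho> \<phi>) \<in> L2 M" using C' by (intro L2_bounded[where C=C'] AE_I2) (auto simp: space_M)
  show "\<exists>C. \<forall>\<phi>\<in>X. \<bar>\<eta> \<phi> / \<rho> \<phi>\<bar> \<le> C" using C' by blast
qed

lemma G_div_\<rho>_L2: assumes "\<eta> \<in> C2c" "x \<in> L" shows "(\<lambda>\<phi>. G x \<eta> \<phi> / \<rho> \<phi>) \<in> L2 M"
proof -
  obtain K where K: "\<forall>\<phi>\<in>X. \<eta> \<phi> \<noteq> 0 \<longrightarrow> (\<forall>y\<in>L. \<phi> y \<le> K)" using C2c_D[OF assms(1)] by blast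
  obtain C where "\<And>\<phi>. \<phi> \<in> X \<Longrightarrow> \<bar>G x \<eta> \<phi>\<bar> \<le> C" using G_bounded[OF assms] by blast
  from box_integrable_R(2)[OF G_measurable[OF assms] this G_support[OF K assms(2)]]
  obtain C' where C': "\<forall>\<phi>\<in>X. \<bar>G x \<eta> \<phi> / \<rho> \<phi>\<bar> \<le> C'" by blast
  have [measurable]: "G x \<eta> \<in> borel_measurable M" by (rule G_measurable[OF assms])
  show ?thesis using C' by (intro L2_bounded[where C=C'] AE_I2) (auto simp: space_M)
qed

text \<open>Dividing the test function by \<open>\<rho>\<close> turns the integrals into ones for \<open>R \<beta>\<close>; no derivative of \<open>\<rho>\<close>
  is involved.\<close>

lemma weak_derivative_C2c:
  assumes F: "F \<in> C2c" and x: "x \<in> L" and \<eta>: "\<eta> \<in> C2c" and a: "a > 0" "\<And>\<phi>. \<phi> \<in> X \<Longrightarrow> \<phi> x \<le> a \<Longrightarrow> \<eta> \<phi> = 0"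
  shows "l2_inner M (G x F) (\<lambda>\<phi>. \<eta> \<phi> / \<rho> \<phi>) = - l2_inner M F (\<lambda>\<phi>. G x \<eta> \<phi> / \<rho> \<phi>)"
proof -
  obtain K where K: "\<forall>\<phi>\<in>X. \<eta> \<phi> \<noteq> 0 \<longrightarrow> (\<forall>y\<in>L. \<phi> y \<le> K)" using C2c_D[OF \<eta>] by blast
  obtain C1 where C1: "\<And>\<phi>. \<phi> \<in> X \<Longrightarrow> \<bar>\<eta> \<phi>\<bar> \<le> C1" using C2c_bounded[OF \<eta>] by blast
  obtain C2 where C2: "\<And>\<phi>. \<phi> \<in> X \<Longrightarrow> \<bar>G x F \<phi>\<bar> \<le> C2" using G_bounded[OF F x] by blast
  obtain C3 where C3: "\<And>\<phi>. \<phi> \<in> X \<Longrightarrow> \<bar>F \<phi>\<bar> \<le> C3" using C2c_bounded[OF F] by blast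
  obtain C4 where C4: "\<And>\<phi>. \<phi> \<in> X \<Longrightarrow> \<bar>G x \<eta> \<phi>\<bar> \<le> C4" using G_bounded[OF \<eta> x] by blast
  have m [measurable]: "\<eta> \<in> borel_measurable M" "F \<in> borel_measurable M" "G x F \<in> borel_measurable M" "G x \<eta> \<in> borel_measurable M"
    by (intro cont_M C2c_cont G_measurable F \<eta> x)+
  have i1: "integrable (R \<beta>) (\<lambda>\<phi>. G x F \<phi> * \<eta> \<phi>)"
  proof (rule box_integrable_R(1))
    show "\<bar>G x F \<phi> * \<eta> \<phi>\<bar> \<le> C2 * C1" if "\<phi> \<in> X" for \<phi>
      using C1[OF that] C2[OF that] unfolding abs_mult by (intro mult_mono) auto
  qed (use K in auto)
  have i2: "integrable (R \<beta>) (\<lambda>\<phi>. F \<phi> * G x \<eta> \<phi>)"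
  proof (rule box_integrable_R(1))
    show "\<bar>F \<phi> * G x \<eta> \<phi>\<bar> \<le> C3 * C4" if "\<phi> \<in> X" for \<phi>
      using C3[OF that] C4[OF that] unfolding abs_mult by (intro mult_mono) auto
  qed (use G_support[OF K x] in auto)
  have "0 = (\<integral>\<phi>. G x (\<lambda>\<phi>. F \<phi> * \<eta> \<phi>) \<phi> \<partial>R \<beta>)"
    by (rule integration_by_parts[OF C2c_mult[OF F \<eta>] x a(1), symmetric]) (simp add: a(2))
  also have "\<dots> = (\<integral>\<phi>. G x F \<phi> * \<eta> \<phi> + F \<phi> * G x \<eta> \<phi> \<partial>R \<beta>)"
    by (intro Bochner_Integration.integral_cong) (auto simp: G_mult[OF F \<eta> x] space_R)
  also have "\<dots> = (\<integral>\<phi>. G x F \<phi> * \<eta> \<phi> \<partial>R \<beta>) + (\<integral>\<phi>. F \<phi> * G x \<eta> \<phi> \<partial>R \<beta>)"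
    by (rule Bochner_Integration.integral_add[OF i1 i2])
  finally show ?thesis by (simp add: pair_R m)
qed

text \<open>Both sides of the identity for \<open>F n\<close> are continuous in
  \<open>L\<^sup>2\<close>, since the test functions divided by \<open>\<rho>\<close> are fixed
  elements of it.\<close>

lemma weak_derivative:
  assumes F: "\<And>n. F n \<in> C2c" and f: "f \<in> L2 M" and h: "h \<in> L2 M" and x: "x \<in> L"
    and lim: "(\<lambda>n. l2_norm M (\<lambda>\<phi>. F n \<phi> - f \<phi>)) \<longlonglongrightarrow> 0" "(\<lambda>n. l2_norm M (\<lambda>\<phi>. G x (F n) \<phi> - h \<phi>)) \<longlonglongrightarrow> 0"
    and \<eta>: "\<eta> \<in> C2c" and a: "a > 0" "\<And>\<phi>. \<phi> \<in> X \<Longrightarrow> \<phi> x \<le> a \<Longrightarrow> \<eta> \<phi> = 0"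
  shows "l2_inner M h (\<lambda>\<phi>. \<eta> \<phi> / \<rho> \<phi>) = - l2_inner M f (\<lambda>\<phi>. G x \<eta> \<phi> / \<rho> \<phi>)"
proof (rule LIMSEQ_unique)
  have c: "(\<lambda>n. l2_norm M (\<lambda>\<phi>. g \<phi> - g \<phi>)) \<longlonglongrightarrow> 0" for g by (simp add: l2_norm_def l2_inner_def)
  show "(\<lambda>n. l2_inner M (G x (F n)) (\<lambda>\<phi>. \<eta> \<phi> / \<rho> \<phi>)) \<longlonglongrightarrow> l2_inner M h (\<lambda>\<phi>. \<eta> \<phi> / \<rho> \<phi>)"
    by (rule l2_inner_tendsto[OF G_L2[OF F x] C2c_div_\<rho>_L2(1)[OF \<eta>] h C2c_div_\<rho>_L2(1)[OF \<eta>] lim(2) c])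
  have "(\<lambda>n. - l2_inner M (F n) (\<lambda>\<phi>. G x \<eta> \<phi> / \<rho> \<phi>)) \<longlonglongrightarrow> - l2_inner M f (\<lambda>\<phi>. G x \<eta> \<phi> / \<rho> \<phi>)"
    by (intro tendsto_minus l2_inner_tendsto[OF C2c_L2[OF F] G_div_\<rho>_L2[OF \<eta> x] f G_div_\<rho>_L2[OF \<eta> x] lim(1) c])
  then show "(\<lambda>n. l2_inner M (G x (F n)) (\<lambda>\<phi>. \<eta> \<phi> / \<rho> \<phi>)) \<longlonglongrightarrow> - l2_inner M f (\<lambda>\<phi>. G x \<eta> \<phi> / \<rho> \<phi>)"
    by (simp add: weak_derivative_C2c[OF F x \<eta> a])
qed

text \<open>Some test function is close to \<open>k\<close>; pairing \<open>k\<close> with the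
  difference bounds its squared norm by its norm times an arbitrarily small number.\<close>

lemma orthogonal_C2c_zero:
  assumes k: "k \<in> L2 M" and o: "\<And>g. g \<in> C2c \<Longrightarrow> l2_inner M k g = 0"
  shows "AE \<phi> in M. k \<phi> = 0"
proof -
  have "l2_norm M k \<le> e" if e: "e > 0" for e
  proof (rule ccontr)
    assume "\<not> l2_norm M k \<le> e"
    obtain g where g: "g \<in> C2c" "l2_norm M (\<lambda>x. k x - g x) < e"
      using C2c_dense[OF finite_measure_axioms sets_M k e] by blast
    have "(l2_norm M k)\<^sup>2 = l2_inner M k (\<lambda>x. k x - g x)"
      using o[OF g(1)] C2c_L2[OF g(1)] k by (simp add: l2_norm_sq' l2_inner_diff_right)
    also have "\<dots> \<le> l2_norm M k * l2_norm M (\<lambda>x. k x - g x)"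
      using l2_CS[OF k L2_diff[OF k C2c_L2[OF g(1)]]] by linarith
    finally have "l2_norm M k * l2_norm M k \<le> l2_norm M k * l2_norm M (\<lambda>x. k x - g x)" by (simp add: power2_eq_square)
    moreover have "l2_norm M k > 0" using \<open>\<not> l2_norm M k \<le> e\<close> e by linarith
    ultimately show False using g(2) \<open>\<not> l2_norm M k \<le> e\<close> by simp
  qed
  then have "l2_norm M k \<le> 0" by (rule field_le_epsilon[of _ 0, simplified])
  then show ?thesis using l2_norm_0_AE[OF k] l2_norm_nonneg[of M k] by simp
qed

text \<open>Off the face, the weak identity with limit 0 makes \<open>h\<close> orthogonal to test
  functions multiplied by cut-offs that vanish near the face. On the face every
  \<open>G x (F n)\<close> is 0, and so is the almost everywhere limit of a subsequence.\<close>

lemma gradient_closable: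
  assumes F: "\<And>n. F n \<in> C2c" and x: "x \<in> L" and h: "h \<in> L2 M"
    and lim: "(\<lambda>n. l2_norm M (F n)) \<longlonglongrightarrow> 0" "(\<lambda>n. l2_norm M (\<lambda>\<phi>. G x (F n) \<phi> - h \<phi>)) \<longlonglongrightarrow> 0"
  shows "AE \<phi> in M. h \<phi> = 0"
proof -
  \<comment> \<open>Zero for \<open>\<phi> x \<le> 1 / Suc n\<close>, and positive at any given
    point with \<open>\<phi> x > 0\<close> once \<open>n\<close> is large.\<close>
  define \<kappa> where "\<kappa> n \<phi> = bump (\<lambda>_. -1) (\<lambda>_. real (Suc n)) \<phi> * pos3 (\<phi> x - 1 / real (Suc n))" for n \<phi>
  have \<kappa>: "\<kappa> n \<in> C2c" for n
    unfolding \<kappa>_def[abs_def] by (intro C2c_mult_Ck bump_C2c Ck_pos3 Ck_diff Ck_coord Ck_const)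
  have "AE \<phi> in M. h \<phi> * (\<kappa> n \<phi> / \<rho> \<phi>) = 0" for n
  proof (rule orthogonal_C2c_zero)
    obtain C where C: "\<forall>\<phi>\<in>X. \<bar>\<kappa> n \<phi> / \<rho> \<phi>\<bar> \<le> C" using C2c_div_\<rho>_L2(2)[OF \<kappa>] by blast
    have "(\<lambda>\<phi>. (\<kappa> n \<phi> / \<rho> \<phi>) * h \<phi>) \<in> L2 M"
      using C by (intro L2_bounded_mult[OF h L2_measurable[OF C2c_div_\<rho>_L2(1)[OF \<kappa>]], of _ C] AE_I2) (auto simp: space_M)
    then show "(\<lambda>\<phi>. h \<phi> * (\<kappa> n \<phi> / \<rho> \<phi>)) \<in> L2 M" by (simp add: mult.commute)
    fix g assume g: "g \<in> C2c"
    have "l2_inner M h (\<lambda>\<phi>. (g \<phi> * \<kappa> n \<phi>) / \<rho> \<phi>) = - l2_inner M (\<lambda>\<phi>. 0) (\<lambda>\<phi>. G x (\<lambda>\<phi>. g \<phi> * \<kappa> n \<phi>) \<phi> / \<rho> \<phi>)"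
      by (rule weak_derivative[OF F L2_0 h x _ lim(2) C2c_mult[OF g \<kappa>], of "1 / real (Suc n)"])
         (use lim(1) in \<open>auto simp: \<kappa>_def pos3_eq_0_iff\<close>)
    then show "l2_inner M (\<lambda>\<phi>. h \<phi> * (\<kappa> n \<phi> / \<rho> \<phi>)) g = 0" by (simp add: l2_inner_def mult_ac)
  qed
  then have a1: "AE \<phi> in M. \<forall>n. h \<phi> * (\<kappa> n \<phi> / \<rho> \<phi>) = 0" by (subst AE_all_countable) auto
  obtain r :: "nat \<Rightarrow> nat" where r: "AE \<phi> in M. (\<lambda>n. G x (F (r n)) \<phi>) \<longlonglongrightarrow> h \<phi>"
    using l2_norm_tendsto_subseq[OF lim(2) G_L2[OF F x] h] by blast
  show ?thesis using a1 r AE_space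
  proof eventually_elim
    case (elim \<phi>)
    then have \<phi>: "\<phi> \<in> X" by (simp add: space_M)
    show ?case
    proof (cases "\<phi> x > 0")
      case True
      obtain n0 :: nat where n0: "max (1 / \<phi> x) (Max (insert 0 (\<phi> ` L))) < real n0" using reals_Archimedean2 by blast
      have "\<phi> y < real (Suc n0)" if "y \<in> L" for y
      proof -
        have "\<phi> y \<le> Max (insert 0 (\<phi> ` L))" using finL that by (intro Max_ge) auto
        then show ?thesis using n0 by simp
      qed
      moreover have "1 / real (Suc n0) < \<phi> x"
      proof -
        have "1 / \<phi> x < real (Suc n0)" using n0 by simp
        then show ?thesis using True by (simp add: field_simps)
      qed
      ultimately have "\<kappa> n0 \<phi> > 0"
        using X_nonneg[OF \<phi>] unfolding \<kappa>_def
        by (intro mult_pos_pos) (auto simp: bump_pos_iff pos3_pos_iff intro: less_le_trans[of "-1" 0])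
      then show ?thesis using elim(1)[rule_format, of n0] \<rho>_pos[OF \<phi>] by simp
    next
      case False
      then have "(\<lambda>n. G x (F (r n)) \<phi>) = (\<lambda>n. 0)" by (simp add: G_def)
      then show ?thesis using elim(2) by (simp add: LIMSEQ_const_iff)
    qed
  qed
qed

text \<open>A fixed profile spread out to scale \<open>Suc n\<close>: the dilation multiplies the
  gradient by \<open>1 / Suc n\<close>, and the total mass is finite. Because
  \<open>pos3 1 = 1\<close>, the profile equals 1 at the origin.\<close>

lemma one_approximable:
  "\<exists>F. (\<forall>n. F n \<in> C2c) \<and> (\<lambda>n. l2_norm M (\<lambda>x. F n x - 1)) \<longlonglongrightarrow> 0 \<and>
       (\<forall>i\<in>L. (\<lambda>n. l2_norm M (G i (F n))) \<longlonglongrightarrow> 0)"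
proof -
  define c where "c n = 1 / real (Suc n)" for n
  have c0: "c \<longlonglongrightarrow> 0" unfolding c_def by (rule LIMSEQ_Suc[OF lim_1_over_n])
  have cp: "c n > 0" for n by (simp add: c_def)
  define \<kappa> where "\<kappa> = bump (\<lambda>_. -1) (\<lambda>_. 1)"
  \<comment> \<open>The dilation is made extensional so that it maps the orthant to itself.\<close>
  define S where "S n \<phi> = (\<lambda>y\<in>L. c n * \<phi> y)" for n \<phi>
  define F where "F n \<phi> = (\<Prod>y\<in>L. pos3 (c n * \<phi> y - (-1)) * pos3 (1 - c n * \<phi> y))" for n \<phi>
  have FS: "F n \<phi> = \<kappa> (S n \<phi>)" for n \<phi> by (simp add: F_def \<kappa>_def bump_def S_def)
  have SX: "S n \<phi> \<in> X" if "\<phi> \<in> X" for n \<phi>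
    using X_nonneg[OF that] cp[of n] by (auto simp: S_def X_def)
  have FA: "F n \<in> C2c" for n
  proof (rule C2c_I)
    show "Ck 2 (F n)" unfolding F_def[abs_def]
      by (intro Ck_prod finL Ck_mult Ck_pos3 Ck_diff Ck_coord Ck_const)
    fix \<phi> y assume H: "F n \<phi> \<noteq> 0" "y \<in> L"
    then have "pos3 (1 - c n * \<phi> y) \<noteq> 0" using finL by (auto simp: F_def)
    then have "c n * \<phi> y < 1" by (simp add: pos3_eq_0_iff)
    then show "\<phi> y \<le> real (Suc n)" by (simp add: c_def field_simps)
  qed
  obtain C where C: "\<forall>\<phi>\<in>X. \<bar>\<kappa> \<phi>\<bar> \<le> C" using C2c_bounded[OF bump_C2c] unfolding \<kappa>_def by blast
  have pc: "continuous_on UNIV pos3" by (rule Rk_continuous[OF Rk_pos3])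
  have Flim: "(\<lambda>n. F n \<phi>) \<longlonglongrightarrow> 1" for \<phi>
  proof -
    have "(\<lambda>n. F n \<phi>) \<longlonglongrightarrow> (\<Prod>y\<in>L. pos3 (0 * \<phi> y - (-1)) * pos3 (1 - 0 * \<phi> y))"
      unfolding F_def by (intro tendsto_prod tendsto_mult continuous_on_tendsto_compose[OF pc] tendsto_intros c0) auto
    then show ?thesis by (simp add: pos3_def)
  qed
  have 1: "(\<lambda>n. l2_norm M (\<lambda>x. F n x - 1)) \<longlonglongrightarrow> 0"
    by (rule l2_dominated_convergence(3)[where g="\<lambda>_. C"])
       (use C SX in \<open>auto simp: FS space_M L2_const intro!: AE_I2 cont_M[OF C2c_cont[OF FA], unfolded FS[abs_def]]\<close>, use Flim in \<open>simp add: FS\<close>)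
  have 2: "(\<lambda>n. l2_norm M (G x (F n))) \<longlonglongrightarrow> 0" if x: "x \<in> L" for x
  proof -
    obtain C' where C': "\<And>\<phi>. \<phi> \<in> X \<Longrightarrow> \<bar>G x \<kappa> \<phi>\<bar> \<le> C'" using G_bounded[OF bump_C2c x] unfolding \<kappa>_def by blast
    obtain g where g: "pdx x \<kappa> g" using C2c_pdx[OF bump_C2c x] unfolding \<kappa>_def by blast
    have "\<bar>G x (F n) \<phi>\<bar> \<le> \<bar>c n * C'\<bar>" if \<phi>: "\<phi> \<in> X" for n \<phi>
    proof (cases "\<phi> x > 0")
      case True
      have p: "S n \<phi> x > 0" using True cp[of n] x by (simp add: S_def)
      have eq: "(\<lambda>t. F n (\<phi>(x := t))) = (\<lambda>t. \<kappa> ((S n \<phi>)(x := c n * t)))"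
      proof
        fix t
        have "S n (\<phi>(x := t)) = (S n \<phi>)(x := c n * t)" using x by (auto simp: S_def)
        then show "F n (\<phi>(x := t)) = \<kappa> ((S n \<phi>)(x := c n * t))" by (simp add: FS)
      qed
      have "((\<lambda>t. \<kappa> ((S n \<phi>)(x := t))) has_real_derivative g (S n \<phi>)) (at (c n * \<phi> x))"
        using g SX[OF \<phi>, of n] p x by (auto simp: pdx_def S_def)
      moreover have "((\<lambda>t. c n * t) has_real_derivative c n) (at (\<phi> x))" by (auto intro!: derivative_eq_intros)
      ultimately have "((\<lambda>t. F n (\<phi>(x := t))) has_real_derivative g (S n \<phi>) * c n) (at (\<phi> x))"
        unfolding eq by (rule DERIV_chain2)
      then have "G x (F n) \<phi> = g (S n \<phi>) * c n"
        using True by (simp add: G_def DERIV_imp_deriv)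
      then have "G x (F n) \<phi> = G x \<kappa> (S n \<phi>) * c n"
        using p G_eq[OF g SX[OF \<phi>], of n] by simp
      moreover have "\<bar>G x \<kappa> (S n \<phi>) * c n\<bar> \<le> C' * c n"
        using C'[OF SX[OF \<phi>]] cp[of n] by (auto simp: abs_mult intro!: mult_right_mono)
      ultimately show ?thesis by (simp add: mult.commute)
    qed (simp add: G_def)
    then have "l2_norm M (G x (F n)) \<le> l2_norm M (\<lambda>_. c n * C')" for n
      by (intro l2_norm_mono L2_const G_measurable FA x AE_I2) (auto simp: space_M)
    then have le: "l2_norm M (G x (F n)) \<le> \<bar>c n\<bar> * l2_norm M (\<lambda>_. C')" for n
      using l2_norm_cmult[of M "c _" "\<lambda>_. C'"] by simp
    have "(\<lambda>n. \<bar>c n\<bar> * l2_norm M (\<lambda>_. C')) \<longlonglongrightarrow> 0"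
      using tendsto_mult_left_zero[OF tendsto_rabs_zero[OF c0]] by simp
    from real_tendsto_sandwich[OF _ _ tendsto_const this] show ?thesis
      using le by (simp add: l2_norm_nonneg)
  qed
  show ?thesis using FA 1 2 by blast
qed

end

text \<open>The given form is a parameter that agrees with the gradient form on test functions; in
  the model it is written as a sum over faces instead.\<close>

locale orthant_form = orthant_measure L \<beta> \<rho> for L :: "'i::countable set" and \<beta> \<rho> +
  fixes E0 :: "('i \<Rightarrow> real) form"
  assumes E0_C2c: "F \<in> C2c \<Longrightarrow> H \<in> C2c \<Longrightarrow> E0 F H = (\<Sum>x\<in>L. l2_inner M (G x F) (G x H))"
begin

sublocale df: derivation_form M L C2c G E0
proof
  show "C2c \<noteq> {}" using bump_C2c by blast
next
  fix f g x assume "f \<in> C2c" "g \<in> C2c" "x \<in> space M"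
  fix i assume "i \<in> L"
  show "G i (\<lambda>x. f x + g x) x = G i f x + G i g x" using G_add \<open>f \<in> C2c\<close> \<open>g \<in> C2c\<close> \<open>i \<in> L\<close> \<open>x \<in> space M\<close> by (simp add: space_M)
next
  fix f and \<psi> \<psi>' :: "real \<Rightarrow> real" assume "f \<in> C2c" "C2_real \<psi> \<psi>'" "\<psi> 0 = 0"
  then show "(\<lambda>x. \<psi> (f x)) \<in> C2c" using C2c_comp C2_real_Rk by blast
next
  fix F i h assume "\<And>n. F n \<in> C2c" "i \<in> L" "h \<in> L2 M" "(\<lambda>n. l2_norm M (F n)) \<longlonglongrightarrow> 0"
    "(\<lambda>n. l2_norm M (\<lambda>x. G i (F n) x - h x)) \<longlonglongrightarrow> 0"
  then show "AE x in M. h x = 0" using gradient_closable by blast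
next
  fix f and e :: real assume "f \<in> L2 M" "e > 0"
  then show "\<exists>g\<in>C2c. l2_norm M (\<lambda>x. f x - g x) < e" by (rule C2c_dense[OF finite_measure_axioms sets_M])
qed (use finL C2c_add C2c_cmult C2c_mult G_cmult G_mult G_comp one_approximable E0_C2c in
      \<open>simp_all add: space_M C2c_bounded G_measurable G_bounded cont_M[OF C2c_cont]\<close>)

abbreviation "Dom \<equiv> closure_domain M C2c E0"
abbreviation "En \<equiv> closure_form M C2c E0"
abbreviation "weak_grad \<equiv> df.weak_grad"

sublocale dn: dirichlet_one M Dom En
proof
  show "symmetric_Dirichlet_form M Dom En" by (rule df.Dirichlet_En)
  show "(\<lambda>x. 1) \<in> Dom" by (rule df.weak_grad_Dom[OF df.weak_grad_one])
  show "En (\<lambda>x. 1) (\<lambda>x. 1) = 0" by (simp add: df.En_diag[OF df.weak_grad_one] l2_norm_def l2_inner_def)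
qed

text \<open>A Lindelof argument: the null sets of possibly uncountably many neighbourhoods are
  traded for those of countably many rational boxes.\<close>

lemma AE_rboxes:
  assumes "\<And>\<phi>. \<phi> \<in> V \<Longrightarrow> \<exists>U. openin T U \<and> \<phi> \<in> U \<and> (AE \<phi> in M. \<phi> \<in> U \<longrightarrow> P \<phi>)"
  shows "AE \<phi> in M. \<phi> \<in> V \<longrightarrow> P \<phi>"
proof -
  let ?B = "{B \<in> (\<lambda>(a, b). rbox a b) ` ((L \<rightarrow>\<^sub>E \<rat>) \<times> (L \<rightarrow>\<^sub>E \<rat>)). AE \<phi> in M. \<phi> \<in> B \<longrightarrow> P \<phi>}"
  have "countable ?B" by (rule countable_subset[OF _ countable_rat_boxes]) auto
  then have "AE \<phi> in M. \<forall>B\<in>?B. \<phi> \<in> B \<longrightarrow> P \<phi>" by (subst AE_ball_countable) auto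
  then show ?thesis
  proof eventually_elim
    case (elim \<phi>)
    show ?case
    proof
      assume "\<phi> \<in> V"
      then obtain U where U: "openin T U" "\<phi> \<in> U" "AE \<phi> in M. \<phi> \<in> U \<longrightarrow> P \<phi>" using assms by blast
      then obtain a b where ab: "a \<in> L \<rightarrow>\<^sub>E \<rat>" "b \<in> L \<rightarrow>\<^sub>E \<rat>" "\<phi> \<in> rbox a b" "rbox a b \<subseteq> U"
        using open_contains_rbox[OF U(1,2)] by blast
      have "AE \<phi> in M. \<phi> \<in> rbox a b \<longrightarrow> P \<phi>" using U(3) by eventually_elim (use ab(4) in auto)
      then have "rbox a b \<in> ?B" using ab(1,2) by force
      from mp[OF bspec[OF elim this] ab(3)] show "P \<phi>" .
    qed
  qed
qed

text \<open>A bump in \<open>U\<close> times \<open>f - c\<close> vanishes, hence so does its weak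
  gradient, and the product rule leaves the bump times \<open>h x\<close> wherever
  \<open>f = c\<close>. The constant is subtracted after multiplication by the bump, so that the
  subtracted term is a test function.\<close>

lemma gradient_zero_local:
  assumes w: "weak_grad f h" and U: "openin T U" and c: "AE \<phi> in M. \<phi> \<in> U \<longrightarrow> f \<phi> = c" and x: "x \<in> L"
  shows "AE \<phi> in M. \<phi> \<in> U \<longrightarrow> h x \<phi> = 0"
proof (rule AE_rboxes)
  fix \<phi>0 assume "\<phi>0 \<in> U"
  then obtain a b where ab: "\<phi>0 \<in> rbox a b" "rbox a b \<subseteq> U" using open_contains_rbox[OF U] by blast
  let ?B = "bump a b"
  note w1 = df.weak_grad_diff[OF df.weak_grad_mult_D0[OF bump_C2c w, of a b] df.weak_grad_cmult[OF df.weak_grad_D0[OF bump_C2c], of c a b]]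
  have "AE \<phi> in M. ?B \<phi> * f \<phi> - c * ?B \<phi> = 0"
    using c AE_space
  proof eventually_elim
    case (elim \<phi>)
    show ?case
    proof (cases "?B \<phi> = 0")
      case False
      then have "\<phi> \<in> rbox a b" using elim(2) bump_pos_iff[of a b \<phi>] bump_nonneg[of a b \<phi>]
        by (auto simp: rbox_def space_M)
      then show ?thesis using elim(1) ab(2) by auto
    qed simp
  qed
  from df.weak_grad_zero[OF w1 this x] have "AE \<phi> in M. \<phi> \<in> rbox a b \<longrightarrow> h x \<phi> = 0"
    using c
  proof eventually_elim
    case (elim \<phi>)
    show ?case
    proof
      assume r: "\<phi> \<in> rbox a b"
      then have "f \<phi> = c" "?B \<phi> > 0" using elim(2) ab(2) bump_pos_iff[of a b \<phi>] by (auto simp: rbox_def)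
      then show "h x \<phi> = 0" using elim(1) by simp
    qed
  qed
  then show "\<exists>U. openin T U \<and> \<phi>0 \<in> U \<and> (AE \<phi> in M. \<phi> \<in> U \<longrightarrow> h x \<phi> = 0)"
    using rbox_open ab(1) by blast
qed

text \<open>The complement of the support of \<open>f\<close> and the set \<open>U\<close> cover the
  space; the gradient of \<open>f\<close> vanishes on the former, that of \<open>g\<close> on the
  latter.\<close>

lemma is_strongly_local: "strongly_local T M Dom En"
  unfolding strongly_local_def
proof (intro ballI impI)
  fix f g assume fg: "f \<in> Dom" "g \<in> Dom"
    and "\<exists>U c. openin T U \<and> ae_support T M f \<subseteq> U \<and> (AE x in M. x \<in> U \<longrightarrow> g x = c)"
  then obtain U c where U: "openin T U" "ae_support T M f \<subseteq> U" "AE \<phi> in M. \<phi> \<in> U \<longrightarrow> g \<phi> = c" by blast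
  obtain h k where w: "weak_grad f h" "weak_grad g k" using fg unfolding df.Dom_iff by blast
  let ?V = "\<Union>{U. openin T U \<and> (AE \<phi> in M. \<phi> \<in> U \<longrightarrow> f \<phi> = 0)}"
  have V: "openin T ?V" by (rule openin_Union) auto
  have f0: "AE \<phi> in M. \<phi> \<in> ?V \<longrightarrow> f \<phi> = 0" by (rule AE_rboxes) blast
  have "l2_inner M (h x) (k x) = 0" if x: "x \<in> L" for x
  proof -
    have "AE \<phi> in M. h x \<phi> * k x \<phi> = 0"
      using gradient_zero_local[OF w(1) V f0 x] gradient_zero_local[OF w(2) U(1,3) x] AE_space
    proof eventually_elim
      case (elim \<phi>)
      have "\<phi> \<in> ?V \<or> \<phi> \<in> U" using elim(3) U(2) unfolding ae_support_def topspace_T space_M by blast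
      then show ?case using elim(1,2) by auto
    qed
    then show ?thesis unfolding l2_inner_def by (rule integral_eq_zero_AE)
  qed
  then show "En f g = 0" by (simp add: df.En_eq[OF w])
qed

end


section \<open>Regularity\<close>

context orthant begin

text \<open>Stone-Weierstrass is applied on a compact box to the quotient of \<open>f\<close> by a
  cut-off \<open>\<kappa>\<close>; multiplying the approximation by \<open>\<kappa>\<close> restores
  compact support and does not enlarge the error, as \<open>\<kappa> \<le> 1\<close>.\<close>

lemma C2c_uniformly_dense:
  assumes f: "f \<in> Cc T" and e: "e > 0"
  shows "\<exists>g\<in>C2c. \<forall>\<phi>\<in>X. \<bar>f \<phi> - g \<phi>\<bar> < e"
proof -
  obtain M0 where M0: "\<forall>\<phi>\<in>X. f \<phi> \<noteq> 0 \<longrightarrow> (\<forall>x\<in>L. \<phi> x \<le> M0)" and fc: "continuous_on X f"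
    using f unfolding Cc_iff by blast
  \<comment> \<open>The margin 1 beyond the support of \<open>f\<close> keeps
    \<open>\<kappa>\<close> above \<open>\<delta>\<close> wherever \<open>f\<close> is
    nonzero.\<close>
  define K where "K = max M0 0 + 1"
  have K: "K > 0" "M0 \<le> K - 1" by (auto simp: K_def)
  define \<kappa> where "\<kappa> \<phi> = (\<Prod>y\<in>L. pos3 (1 - (1/K) * \<phi> y))" for \<phi>
  define \<delta> where "\<delta> = pos3 (1 / K) ^ card L"
  have \<delta>: "\<delta> > 0" using K by (simp add: \<delta>_def pos3_pos_iff)
  have \<kappa>Ck: "Ck 2 \<kappa>" unfolding \<kappa>_def[abs_def] by (intro Ck_prod finL Ck_mult Ck_pos3 Ck_diff Ck_coord Ck_const)
  have \<kappa>01: "0 \<le> \<kappa> \<phi>" "\<kappa> \<phi> \<le> 1" if "\<phi> \<in> X" for \<phi>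
  proof -
    show "0 \<le> \<kappa> \<phi>" unfolding \<kappa>_def by (intro prod_nonneg) (simp add: pos3_nonneg)
    have "pos3 (1 - (1/K) * \<phi> y) \<le> 1" if "y \<in> L" for y
      using X_nonneg[OF \<open>\<phi> \<in> X\<close> that] K unfolding pos3_def by (intro power_le_one) auto
    then show "\<kappa> \<phi> \<le> 1" unfolding \<kappa>_def by (intro prod_le_1) (auto simp: pos3_nonneg)
  qed
  have \<kappa>0: "\<phi> y < K" if "\<kappa> \<phi> \<noteq> 0" "y \<in> L" for \<phi> y
  proof -
    have "pos3 (1 - (1/K) * \<phi> y) \<noteq> 0" using that finL by (auto simp: \<kappa>_def)
    then show ?thesis using K by (simp add: pos3_eq_0_iff field_simps)
  qed
  have \<kappa>\<delta>: "\<kappa> \<phi> \<ge> \<delta>" if "\<phi> \<in> X" "f \<phi> \<noteq> 0" for \<phi>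
  proof -
    have "pos3 (1 / K) \<le> pos3 (1 - (1/K) * \<phi> y)" if "y \<in> L" for y
    proof -
      have "\<phi> y \<le> K - 1" using M0 \<open>\<phi> \<in> X\<close> \<open>f \<phi> \<noteq> 0\<close> that K by force
      then have "1 / K \<le> 1 - (1/K) * \<phi> y" using K by (simp add: field_simps)
      then show ?thesis unfolding pos3_def by (intro power_mono) auto
    qed
    then have "(\<Prod>y\<in>L. pos3 (1 / K)) \<le> \<kappa> \<phi>" unfolding \<kappa>_def by (intro prod_mono) (auto simp: pos3_nonneg)
    then show ?thesis by (simp add: \<delta>_def)
  qed
  \<comment> \<open>The maximum with \<open>\<delta>\<close> makes the quotient continuous
    everywhere and changes nothing where \<open>f\<close> is nonzero.\<close>
  define q where "q \<phi> = f \<phi> / max (\<kappa> \<phi>) \<delta>" for \<phi>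
  have qc: "continuous_on X q" unfolding q_def[abs_def]
    using \<delta> by (intro continuous_intros fc Ck_continuous[OF \<kappa>Ck]) (auto simp: max_def)
  have fq: "f \<phi> = \<kappa> \<phi> * q \<phi>" if "\<phi> \<in> X" for \<phi>
    using \<kappa>\<delta>[OF that] \<delta> by (cases "f \<phi> = 0") (auto simp: q_def max_def)
  let ?S = "\<Pi>\<^sub>E x\<in>L. {0..K}"
  have SX: "?S \<subseteq> X" by (auto simp: X_def PiE_def)
  interpret S: function_ring_on "{F. Ck 2 F}" ?S
  proof
    show "compact ?S" by (rule compact_box)
    show "continuous_on ?S F" if "F \<in> {F. Ck 2 F}" for F
      using that Ck_continuous[of 2 F] continuous_on_subset[OF _ SX] by simp
    show "\<exists>F\<in>{F. Ck 2 F}. F \<phi> \<noteq> F \<psi>" if ne: "\<phi> \<in> ?S" "\<psi> \<in> ?S" "\<phi> \<noteq> \<psi>" for \<phi> \<psi>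
    proof -
      obtain y where "\<phi> y \<noteq> \<psi> y" using ne(3) by auto
      then show ?thesis using Ck_coord[of 2 y] by (intro bexI[of _ "\<lambda>\<phi>. \<phi> y"]) auto
    qed
  qed (auto intro: Ck_add Ck_mult Ck_const)
  obtain p where p: "Ck 2 p" "\<forall>\<phi>\<in>?S. \<bar>q \<phi> - p \<phi>\<bar> < e"
    using S.Stone_Weierstrass_basic[OF continuous_on_subset[OF qc SX] e] by auto
  have \<kappa>A: "\<kappa> \<in> C2c" by (rule C2c_I[OF \<kappa>Ck, of K]) (use \<kappa>0 in \<open>auto intro: less_imp_le\<close>)
  have "\<bar>f \<phi> - \<kappa> \<phi> * p \<phi>\<bar> < e" if \<phi>: "\<phi> \<in> X" for \<phi>
  proof (cases "\<kappa> \<phi> = 0")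
    case True then show ?thesis using fq[OF \<phi>] e by simp
  next
    case False
    then have "\<phi> \<in> ?S" using \<kappa>0[OF False] by (intro box_memI[OF \<phi>]) (auto intro: less_imp_le)
    then have "\<bar>q \<phi> - p \<phi>\<bar> < e" using p(2) by blast
    moreover have "\<bar>f \<phi> - \<kappa> \<phi> * p \<phi>\<bar> = \<kappa> \<phi> * \<bar>q \<phi> - p \<phi>\<bar>"
      using \<kappa>01[OF \<phi>] unfolding fq[OF \<phi>] right_diff_distrib[symmetric] abs_mult by simp
    moreover have "\<kappa> \<phi> * \<bar>q \<phi> - p \<phi>\<bar> \<le> 1 * \<bar>q \<phi> - p \<phi>\<bar>" using \<kappa>01[OF \<phi>] by (intro mult_right_mono) auto
    ultimately have "\<bar>f \<phi> - \<kappa> \<phi> * p \<phi>\<bar> \<le> \<bar>q \<phi> - p \<phi>\<bar>" by simp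
    then show ?thesis using \<open>\<bar>q \<phi> - p \<phi>\<bar> < e\<close> by (rule le_less_trans)
  qed
  then show ?thesis by (intro bexI[OF _ C2c_mult_Ck[OF \<kappa>A p(1)]] ballI)
qed

lemma locally_compact_T: "locally_compact_space T"
  unfolding locally_compact_space_product_topology
  by (rule disjI2) (auto simp: finL intro!: locally_compact_space_closed_subset locally_compact_space_euclidean)

lemma metrizable_T: "metrizable_space T"
  unfolding T_eq by (intro metrizable_space_subtopology metrizable_space_euclidean)

lemma separable_T: "separable_space T"
proof (rule second_countable_imp_separable_space)
  let ?B = "(\<lambda>(a, b). rbox a b) ` ((L \<rightarrow>\<^sub>E \<rat>) \<times> (L \<rightarrow>\<^sub>E \<rat>))"
  show "second_countable T" unfolding second_countable_def
  proof (intro exI[of _ ?B] conjI allI impI ballI countable_rat_boxes)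
    fix U \<phi> assume "openin T U \<and> \<phi> \<in> U"
    then obtain a b where "a \<in> L \<rightarrow>\<^sub>E \<rat>" "b \<in> L \<rightarrow>\<^sub>E \<rat>" "\<phi> \<in> rbox a b" "rbox a b \<subseteq> U"
      using open_contains_rbox[of U \<phi>] by blast
    then show "\<exists>V\<in>?B. \<phi> \<in> V \<and> V \<subseteq> U" by (intro bexI[of _ "rbox a b"]) auto
  qed (auto simp: rbox_open)
qed

end

context orthant_form begin

lemma is_regular: "regular_Dirichlet_form T M Dom En"
  unfolding regular_Dirichlet_form_def
proof (intro conjI allI impI ballI)
  show "locally_compact_space T" "separable_space T" "metrizable_space T"
    by (rule locally_compact_T separable_T metrizable_T)+
  show "space M = topspace T" unfolding topspace_T by (rule space_M)
  show "sets M = sigma_sets (topspace T) {U. openin T U}" unfolding topspace_T by (rule sets_M)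
  show "emeasure M K < \<infinity>" for K using emeasure_finite[of K] less_top infinity_ennreal_def by metis
  show "emeasure M U > 0" if "openin T U" "U \<noteq> {}" for U by (rule open_pos[OF that])
  show "symmetric_Dirichlet_form M Dom En" by (rule df.Dirichlet_En)
  show "\<exists>g\<in>Dom \<inter> Cc T. \<forall>x\<in>topspace T. \<bar>f x - g x\<bar> < e" if "f \<in> Cc T" "e > 0" for f and e :: real
    using C2c_uniformly_dense[OF that] df.D0_subset_Dom C2c_Cc unfolding topspace_T by blast
  fix f and e :: real assume f: "f \<in> Dom" and e: "e > 0"
  obtain h where w: "weak_grad f h" using f unfolding df.Dom_iff by blast
  \<comment> \<open>A common bound for \<open>card L + 1\<close> norms: as \<open>d \<le> 1\<close>,
    their squares are at most \<open>d\<close> each and add up to less than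
    \<open>e\<close>.\<close>
  define d where "d = min 1 (e / (2 * (real (card L) + 1)))"
  have d: "d > 0" "d \<le> 1" "(real (card L) + 1) * d < e"
  proof -
    show "d > 0" "d \<le> 1" using e by (auto simp: d_def)
    have "(real (card L) + 1) * d \<le> (real (card L) + 1) * (e / (2 * (real (card L) + 1)))"
      by (intro mult_left_mono) (auto simp: d_def)
    also have "\<dots> = e / 2" by (simp add: field_simps add_nonneg_eq_0_iff)
    finally show "(real (card L) + 1) * d < e" using e by linarith
  qed
  obtain F where F: "F \<in> C2c" "l2_norm M (\<lambda>x. F x - f x) < d" "\<forall>i\<in>L. l2_norm M (\<lambda>x. G i F x - h i x) < d"
    using df.weak_grad_approx[OF w d(1)] by blast
  have sq: "t\<^sup>2 \<le> d" if "0 \<le> t" "t < d" for t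
  proof -
    have "t * t \<le> d * 1" using that d by (intro mult_mono) auto
    then show ?thesis by (simp add: power2_eq_square)
  qed
  have "En (\<lambda>x. f x - F x) (\<lambda>x. f x - F x) = (\<Sum>i\<in>L. (l2_norm M (\<lambda>x. h i x - G i F x))\<^sup>2)"
    by (rule df.En_diag[OF df.weak_grad_diff[OF w df.weak_grad_D0[OF F(1)]]])
  also have "\<dots> \<le> (\<Sum>i\<in>L. d)"
    using F(3) by (intro sum_mono sq l2_norm_nonneg, subst l2_norm_minus_commute) blast
  finally have "En (\<lambda>x. f x - F x) (\<lambda>x. f x - F x) \<le> real (card L) * d" by simp
  moreover have "(l2_norm M (\<lambda>x. f x - F x))\<^sup>2 \<le> d"
    using F(2) by (intro sq l2_norm_nonneg, subst l2_norm_minus_commute)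
  ultimately have "E_alpha M En 1 (\<lambda>x. f x - F x) (\<lambda>x. f x - F x) < e"
    using d(3) by (simp add: E_alpha_def l2_norm_sq' algebra_simps)
  then show "\<exists>g\<in>Dom \<inter> Cc T. E_alpha M En 1 (\<lambda>x. f x - g x) (\<lambda>x. f x - g x) < e"
    using F(1) df.D0_subset_Dom C2c_Cc by blast
qed

text \<open>The terms containing \<open>F * k x * h x\<close> cancel between the two energies. The
  weak gradients of the product and of the square are hypotheses so that the identity applies with
  either factor taken from the test functions.\<close>

lemma energy_identity:
  assumes w: "weak_grad F h" "weak_grad g k" "weak_grad (\<lambda>\<phi>. F \<phi> * g \<phi>) (\<lambda>x \<phi>. F \<phi> * k x \<phi> + g \<phi> * h x \<phi>)"
      "weak_grad (\<lambda>\<phi>. (F \<phi>)\<^sup>2) (\<lambda>x \<phi>. 2 * F \<phi> * h x \<phi>)"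
    and bF: "AE \<phi> in M. \<bar>F \<phi>\<bar> \<le> C" and bg: "AE \<phi> in M. \<bar>g \<phi>\<bar> \<le> C'"
  shows "2 * En (\<lambda>\<phi>. F \<phi> * g \<phi>) F - En (\<lambda>\<phi>. (F \<phi>)\<^sup>2) g = (\<integral>\<phi>. g \<phi> * (2 * (\<Sum>x\<in>L. (h x \<phi>)\<^sup>2)) \<partial>M)"
    "integrable M (\<lambda>\<phi>. g \<phi> * (2 * (\<Sum>x\<in>L. (h x \<phi>)\<^sup>2)))"
proof -
  note m = df.weak_grad_L2(1)[OF w(1), THEN L2_measurable] df.weak_grad_L2(1)[OF w(2), THEN L2_measurable]
  have hL: "h x \<in> L2 M" "k x \<in> L2 M" if "x \<in> L" for x using that df.weak_grad_L2(2)[OF w(1)] df.weak_grad_L2(2)[OF w(2)] by auto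
  have ghL: "(\<lambda>\<phi>. g \<phi> * h x \<phi>) \<in> L2 M" "(\<lambda>\<phi>. F \<phi> * k x \<phi>) \<in> L2 M" if "x \<in> L" for x
    using L2_bounded_mult[OF hL(1)[OF that] m(2) bg] L2_bounded_mult[OF hL(2)[OF that] m(1) bF] by auto
  have i: "integrable M (\<lambda>\<phi>. g \<phi> * (h x \<phi>)\<^sup>2)" if "x \<in> L" for x
    using L2_mult_integrable[OF ghL(1)[OF that] hL(1)[OF that]] by (simp add: power2_eq_square mult.assoc)
  have e: "g \<phi> * (2 * (\<Sum>x\<in>L. (h x \<phi>)\<^sup>2)) = 2 * (\<Sum>x\<in>L. g \<phi> * (h x \<phi>)\<^sup>2)" for \<phi>
    by (simp add: sum_distrib_left mult_ac)
  show "integrable M (\<lambda>\<phi>. g \<phi> * (2 * (\<Sum>x\<in>L. (h x \<phi>)\<^sup>2)))"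
    unfolding e using i by (intro integrable_mult_right Bochner_Integration.integrable_sum) auto
  have "2 * l2_inner M (\<lambda>\<phi>. F \<phi> * k x \<phi> + g \<phi> * h x \<phi>) (h x) - l2_inner M (\<lambda>\<phi>. 2 * F \<phi> * h x \<phi>) (k x)
     = 2 * (\<integral>\<phi>. g \<phi> * (h x \<phi>)\<^sup>2 \<partial>M)" if x: "x \<in> L" for x
  proof -
    have "l2_inner M (\<lambda>\<phi>. 2 * F \<phi> * h x \<phi>) (k x) = 2 * l2_inner M (\<lambda>\<phi>. F \<phi> * k x \<phi>) (h x)"
      unfolding l2_inner_def by (subst integral_mult_right_zero[symmetric]) (simp add: mult_ac)
    moreover have "l2_inner M (\<lambda>\<phi>. g \<phi> * h x \<phi>) (h x) = (\<integral>\<phi>. g \<phi> * (h x \<phi>)\<^sup>2 \<partial>M)"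
      unfolding l2_inner_def by (simp add: power2_eq_square mult.assoc)
    ultimately show ?thesis by (simp add: l2_inner_add_left[OF ghL(2)[OF x] ghL(1)[OF x] hL(1)[OF x]])
  qed
  then have "2 * En (\<lambda>\<phi>. F \<phi> * g \<phi>) F - En (\<lambda>\<phi>. (F \<phi>)\<^sup>2) g = (\<Sum>x\<in>L. 2 * (\<integral>\<phi>. g \<phi> * (h x \<phi>)\<^sup>2 \<partial>M))"
    unfolding df.En_eq[OF w(3,1)] df.En_eq[OF w(4,2)] sum_distrib_left sum_subtractf[symmetric] by (intro sum.cong) auto
  also have "\<dots> = (\<integral>\<phi>. g \<phi> * (2 * (\<Sum>x\<in>L. (h x \<phi>)\<^sup>2)) \<partial>M)"
    unfolding e using i by (simp add: Bochner_Integration.integral_sum sum_distrib_left)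
  finally show "2 * En (\<lambda>\<phi>. F \<phi> * g \<phi>) F - En (\<lambda>\<phi>. (F \<phi>)\<^sup>2) g = (\<integral>\<phi>. g \<phi> * (2 * (\<Sum>x\<in>L. (h x \<phi>)\<^sup>2)) \<partial>M)" .
qed

lemma Cc_AE_bounded: assumes "f \<in> Cc T" shows "\<exists>C. AE \<phi> in M. \<bar>f \<phi>\<bar> \<le> C"
proof -
  obtain C where C: "\<forall>\<phi>\<in>X. \<bar>f \<phi>\<bar> \<le> C" using Cc_bounded[OF assms] by blast
  have "AE \<phi> in M. \<bar>f \<phi>\<bar> \<le> C" by (rule AE_I2) (use C in \<open>auto simp: space_M\<close>)
  then show ?thesis ..
qed

lemma energy_measure_C2c:
  assumes F: "F \<in> C2c"
  shows "energy_measure T M Dom En F (density M (\<lambda>\<phi>. ennreal (2 * (\<Sum>x\<in>L. (G x F \<phi>)\<^sup>2))))"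
  unfolding energy_measure_def
proof (intro conjI ballI)
  let ?g = "\<lambda>\<phi>. 2 * (\<Sum>x\<in>L. (G x F \<phi>)\<^sup>2)"
  have m: "?g \<in> borel_measurable M" using G_measurable[OF F] by measurable
  fix g assume g: "g \<in> Dom \<inter> Cc T"
  have "g \<in> Dom" using g by simp
  then obtain k where k: "weak_grad g k" unfolding df.Dom_iff by blast
  obtain C C' where C: "AE \<phi> in M. \<bar>F \<phi>\<bar> \<le> C" "AE \<phi> in M. \<bar>g \<phi>\<bar> \<le> C'"
    using Cc_AE_bounded C2c_Cc[OF F] g by blast
  note wF = df.weak_grad_D0[OF F]
  note id = energy_identity[OF wF k df.weak_grad_mult_D0[OF F k] df.weak_grad_square[OF wF C(1)] C]
  have gm: "g \<in> borel_measurable M" using df.weak_grad_L2(1)[OF k] by (rule L2_measurable)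
  have nn: "AE \<phi> in M. 0 \<le> ?g \<phi>" by (auto intro!: AE_I2 sum_nonneg)
  show "integrable (density M (\<lambda>\<phi>. ennreal (?g \<phi>))) g"
    using id(2) by (subst integrable_density[OF gm m nn]) (simp add: mult.commute)
  have "(\<integral>\<phi>. g \<phi> \<partial>density M (\<lambda>\<phi>. ennreal (?g \<phi>))) = (\<integral>\<phi>. g \<phi> * ?g \<phi> \<partial>M)"
    by (subst integral_density[OF gm m nn]) (simp add: mult.commute)
  then show "(\<integral>\<phi>. g \<phi> \<partial>density M (\<lambda>\<phi>. ennreal (?g \<phi>))) = 2 * En (\<lambda>\<phi>. F \<phi> * g \<phi>) F - En (\<lambda>\<phi>. (F \<phi>)\<^sup>2) g"
    using id(1) by simp
qed simp_all

abbreviation "dist_E \<equiv> intrinsic_metric T M Dom En"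

text \<open>A bump in \<open>U\<close> with gradient of length at most 1 competes in the supremum.
  It is positive at \<open>\<phi>\<close> and 0 off \<open>U\<close>, so points outside
  \<open>U\<close> are at least its value at \<open>\<phi>\<close> away.\<close>

lemma intrinsic_ball_subset:
  assumes U: "openin T U" and \<phi>: "\<phi> \<in> U"
  shows "\<exists>e>0. \<forall>\<psi>\<in>topspace T. dist_E \<phi> \<psi> < ereal e \<longrightarrow> \<psi> \<in> U"
proof -
  obtain a b where ab: "\<phi> \<in> rbox a b" "rbox a b \<subseteq> U" using open_contains_rbox[OF U \<phi>] by blast
  let ?B = "bump a b"
  have "\<forall>x\<in>L. \<exists>C. \<forall>\<phi>\<in>X. \<bar>G x ?B \<phi>\<bar> \<le> C" using G_bounded[OF bump_C2c] by blast
  then obtain C where C: "\<And>x \<phi>. x \<in> L \<Longrightarrow> \<phi> \<in> X \<Longrightarrow> \<bar>G x ?B \<phi>\<bar> \<le> C x" by metis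
  \<comment> \<open>The summand 1 gives \<open>S \<ge> 1\<close>, so that the sum of squares is at
    most \<open>S\<^sup>2\<close> and dividing the bump by \<open>S\<close> is enough.\<close>
  define S where "S = (\<Sum>x\<in>L. (C x)\<^sup>2) + 1"
  have S: "S \<ge> 1" by (simp add: S_def sum_nonneg)
  define F where "F \<phi> = (1 / S) * ?B \<phi>" for \<phi>
  have F: "F \<in> C2c" unfolding F_def[abs_def] by (intro C2c_cmult bump_C2c)
  have \<Gamma>: "(\<Sum>x\<in>L. (G x F \<phi>)\<^sup>2) \<le> 1" if "\<phi> \<in> X" for \<phi>
  proof -
    have "(\<Sum>x\<in>L. (G x F \<phi>)\<^sup>2) = (1 / S)\<^sup>2 * (\<Sum>x\<in>L. (G x ?B \<phi>)\<^sup>2)"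
      unfolding F_def[abs_def] sum_distrib_left power_mult_distrib[symmetric]
      by (intro sum.cong refl) (simp only: G_cmult[OF bump_C2c _ that])
    also have "\<dots> \<le> (1 / S)\<^sup>2 * (\<Sum>x\<in>L. (C x)\<^sup>2)"
      using C[OF _ that] by (intro mult_left_mono sum_mono) (auto simp: abs_le_square_iff[symmetric] intro: order_trans[OF _ abs_ge_self])
    also have "\<dots> \<le> (1 / S)\<^sup>2 * S\<^sup>2"
    proof (rule mult_left_mono)
      have "S * 1 \<le> S * S" using S by (intro mult_left_mono) auto
      then show "(\<Sum>x\<in>L. (C x)\<^sup>2) \<le> S\<^sup>2" by (simp add: S_def power2_eq_square)
    qed simp
    also have "\<dots> = 1" using S by (simp add: power_divide)
    finally show ?thesis .
  qed
  let ?g = "\<lambda>\<phi>. 2 * (\<Sum>x\<in>L. (G x F \<phi>)\<^sup>2)"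
  let ?\<nu> = "density M (\<lambda>\<phi>. ennreal (?g \<phi>))"
  have m: "(\<lambda>\<phi>. ennreal (?g \<phi>)) \<in> borel_measurable M" using G_measurable[OF F] by measurable
  have "AE \<phi> in M. ennreal (?g \<phi>) = RN_deriv M ?\<nu> \<phi>" by (rule RN_deriv_unique[OF m refl])
  then have RN: "AE \<phi> in M. RN_deriv M ?\<nu> \<phi> \<le> 2"
    using AE_space
  proof eventually_elim
    case (elim \<phi>)
    then have "?g \<phi> \<le> 2" using \<Gamma>[of \<phi>] by (simp add: space_M)
    then have "ennreal (?g \<phi>) \<le> ennreal 2" by (rule ennreal_leI)
    then show ?case using elim(1) by simp
  qed
  have ac: "absolutely_continuous M ?\<nu>" using m by (intro absolutely_continuousI_density) auto
  have F\<phi>: "F \<phi> > 0" using ab(1) S bump_pos_iff[of a b \<phi>] by (auto simp: F_def rbox_def)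
  show ?thesis
  proof (intro exI[of _ "F \<phi>"] conjI ballI impI F\<phi>, rule ccontr)
    fix \<psi> assume \<psi>: "\<psi> \<in> topspace T" "dist_E \<phi> \<psi> < ereal (F \<phi>)" "\<psi> \<notin> U"
    then have "\<psi> \<notin> rbox a b" "\<psi> \<in> X" using ab(2) unfolding topspace_T by auto
    then have "F \<psi> = 0" using bump_pos_iff[of a b \<psi>] bump_nonneg[of a b \<psi>] by (auto simp: F_def rbox_def less_le)
    moreover have "ereal (F \<phi> - F \<psi>) \<le> dist_E \<phi> \<psi>"
      unfolding intrinsic_metric_def
      by (rule Sup_upper) (use F df.D0_subset_Dom C2c_Cc[OF F] energy_measure_C2c[OF F] ac RN in blast)
    ultimately show False using \<psi>(2) by simp
  qed
qed

text \<open>Tested with squares of test functions, the bound on the energy measure says that the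
  integral of \<open>g\<^sup>2 * \<Gamma>\<close> is at most that of \<open>g\<^sup>2\<close>. As
  \<open>\<Gamma>\<close> is merely integrable, convergence of \<open>g\<close> to the indicator of
  \<open>\<Gamma> > 1\<close> in \<open>L2 M\<close> would not control the left-hand side; in
  \<open>L2 \<Lambda>\<close>, with weight \<open>1 + \<Gamma>\<close>, both integrals are
  continuous.\<close>

lemma energy_bound_imp_gradient_bound:
  assumes w: "weak_grad F h" and F: "F \<in> Cc T" and \<nu>: "energy_measure T M Dom En F \<nu>"
    and ac: "absolutely_continuous M \<nu>" and RN: "AE \<phi> in M. RN_deriv M \<nu> \<phi> \<le> 2"
  shows "AE \<phi> in M. (\<Sum>x\<in>L. (h x \<phi>)\<^sup>2) \<le> 1"
proof -
  define \<Gamma> where "\<Gamma> \<phi> = (\<Sum>x\<in>L. (h x \<phi>)\<^sup>2)" for \<phi>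
  have \<Gamma>0: "\<Gamma> \<phi> \<ge> 0" for \<phi> by (simp add: \<Gamma>_def sum_nonneg)
  note hL = df.weak_grad_L2(2)[OF w]
  have \<Gamma>i: "integrable M \<Gamma>" unfolding \<Gamma>_def[abs_def] by (intro Bochner_Integration.integrable_sum L2_integrable hL)
  then have [measurable]: "\<Gamma> \<in> borel_measurable M" by simp
  define r where "r \<phi> = enn2real (RN_deriv M \<nu> \<phi>)" for \<phi>
  have [measurable]: "r \<in> borel_measurable M" by (simp add: r_def[abs_def])
  have sM\<nu>: "sets \<nu> = sets M" using \<nu> by (simp add: energy_measure_def)
  have rE: "AE \<phi> in M. RN_deriv M \<nu> \<phi> = ennreal (r \<phi>) \<and> 0 \<le> r \<phi> \<and> r \<phi> \<le> 2"
    using RN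
  proof eventually_elim
    case (elim \<phi>)
    then have "RN_deriv M \<nu> \<phi> < top" by (rule le_less_trans) simp
    moreover have "enn2real (RN_deriv M \<nu> \<phi>) \<le> enn2real 2" using elim by (intro enn2real_mono) auto
    ultimately show ?case by (simp add: r_def)
  qed
  have \<nu>d: "\<nu> = density M (\<lambda>\<phi>. ennreal (r \<phi>))"
  proof -
    have "\<nu> = density M (RN_deriv M \<nu>)" using density_RN_deriv[OF ac sM\<nu>] by simp
    also have "\<dots> = density M (\<lambda>\<phi>. ennreal (r \<phi>))" using rE by (intro density_cong) auto
    finally show ?thesis .
  qed
  obtain CF where CF: "AE \<phi> in M. \<bar>F \<phi>\<bar> \<le> CF" using Cc_AE_bounded[OF F] by blast
  have key: "(\<integral>\<phi>. (g \<phi>)\<^sup>2 * \<Gamma> \<phi> \<partial>M) \<le> (\<integral>\<phi>. (g \<phi>)\<^sup>2 \<partial>M)" "integrable M (\<lambda>\<phi>. (g \<phi>)\<^sup>2 * \<Gamma> \<phi>)" if g: "g \<in> C2c" for g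
  proof -
    let ?q = "\<lambda>\<phi>. g \<phi> * g \<phi>"
    have q: "?q \<in> C2c" by (rule C2c_mult[OF g g])
    obtain C where C: "AE \<phi> in M. \<bar>?q \<phi>\<bar> \<le> C" using Cc_AE_bounded[OF C2c_Cc[OF q]] by blast
    \<comment> \<open>Here the test function \<open>?q\<close> supplies the bounded gradient for the
      product rule, \<open>F\<close> being an element of the closure.\<close>
    have wFq: "weak_grad (\<lambda>\<phi>. F \<phi> * ?q \<phi>) (\<lambda>x \<phi>. F \<phi> * G x ?q \<phi> + ?q \<phi> * h x \<phi>)"
      using df.weak_grad_mult_D0[OF q w] by (simp add: mult.commute add.commute)
    note id = energy_identity[OF w df.weak_grad_D0[OF q] wFq df.weak_grad_square[OF w CF] CF C]
    have qm [measurable]: "?q \<in> borel_measurable M" by (rule cont_M[OF C2c_cont[OF q]])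
    have "(\<integral>\<phi>. ?q \<phi> * (2 * \<Gamma> \<phi>) \<partial>M) = (\<integral>\<phi>. ?q \<phi> \<partial>\<nu>)"
      using \<nu> q df.D0_subset_Dom C2c_Cc[OF q] id(1) unfolding energy_measure_def \<Gamma>_def by auto
    also have "\<dots> = (\<integral>\<phi>. r \<phi> * ?q \<phi> \<partial>M)"
      unfolding \<nu>d using rE by (subst integral_density) auto
    also have "\<dots> \<le> (\<integral>\<phi>. 2 * ?q \<phi> \<partial>M)"
    proof (rule integral_mono_AE)
      have iq: "integrable M ?q" by (rule L2_integrable1[OF C2c_L2[OF q]])
      then show "integrable M (\<lambda>\<phi>. 2 * ?q \<phi>)" by simp
      show "integrable M (\<lambda>\<phi>. r \<phi> * ?q \<phi>)"
      proof (rule Bochner_Integration.integrable_bound[OF integrable_mult_right[OF iq, of 2]])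
        show "AE \<phi> in M. norm (r \<phi> * ?q \<phi>) \<le> norm (2 * ?q \<phi>)"
          using rE by eventually_elim (auto simp: abs_mult intro!: mult_right_mono)
      qed simp
      show "AE \<phi> in M. r \<phi> * ?q \<phi> \<le> 2 * ?q \<phi>"
        using rE by eventually_elim (auto intro!: mult_right_mono)
    qed
    finally have "2 * (\<integral>\<phi>. ?q \<phi> * \<Gamma> \<phi> \<partial>M) \<le> 2 * (\<integral>\<phi>. ?q \<phi> \<partial>M)"
      by (simp add: mult.left_commute[of _ 2])
    then show "(\<integral>\<phi>. (g \<phi>)\<^sup>2 * \<Gamma> \<phi> \<partial>M) \<le> (\<integral>\<phi>. (g \<phi>)\<^sup>2 \<partial>M)" by (simp add: power2_eq_square)
    have "integrable M (\<lambda>\<phi>. (1/2) * (?q \<phi> * (2 * \<Gamma> \<phi>)))" using id(2) unfolding \<Gamma>_def by (rule integrable_mult_right)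
    then show "integrable M (\<lambda>\<phi>. (g \<phi>)\<^sup>2 * \<Gamma> \<phi>)" by (simp add: power2_eq_square mult.assoc)
  qed
  define \<Lambda> where "\<Lambda> = density M (\<lambda>\<phi>. ennreal (1 + \<Gamma> \<phi>))"
  have s\<Lambda>: "sets \<Lambda> = sets M" "space \<Lambda> = space M" by (auto simp: \<Lambda>_def)
  have int\<Lambda>: "integral\<^sup>L \<Lambda> f = (\<integral>\<phi>. (1 + \<Gamma> \<phi>) * f \<phi> \<partial>M)" if "f \<in> borel_measurable M" for f :: "_ \<Rightarrow> real"
    unfolding \<Lambda>_def using that \<Gamma>0 by (subst integral_density) (auto intro!: AE_I2 add_nonneg_nonneg)
  have fin: "finite_measure \<Lambda>"
  proof
    have "emeasure \<Lambda> (space \<Lambda>) = (\<integral>\<^sup>+\<phi>. ennreal (1 + \<Gamma> \<phi>) \<partial>M)"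
      unfolding \<Lambda>_def by (subst emeasure_density) (auto simp: indicator_def intro!: nn_integral_cong)
    also have "\<dots> = ennreal (\<integral>\<phi>. 1 + \<Gamma> \<phi> \<partial>M)"
      using \<Gamma>i \<Gamma>0 by (intro nn_integral_eq_integral) (auto intro!: AE_I2 add_nonneg_nonneg)
    finally show "emeasure \<Lambda> (space \<Lambda>) \<noteq> \<infinity>" by simp
  qed
  interpret \<Lambda>: finite_measure \<Lambda> by fact
  define A where "A = {\<phi> \<in> space M. \<Gamma> \<phi> > 1}"
  have A [measurable]: "A \<in> sets M" unfolding A_def by measurable
  have meas: "f \<in> borel_measurable \<Lambda> \<longleftrightarrow> f \<in> borel_measurable M" for f :: "_ \<Rightarrow> real"
    by (simp add: \<Lambda>_def)
  \<comment> \<open>\<open>?m\<close> is the density of \<open>M\<close> with respect to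
    \<open>\<Lambda>\<close>; it turns the inequality between the two integrals into one between
    inner products in \<open>L2 \<Lambda>\<close>.\<close>
  let ?I = "indicator A :: _ \<Rightarrow> real" and ?m = "\<lambda>\<phi>. 1 / (1 + \<Gamma> \<phi>)"
  have I: "?I \<in> L2 \<Lambda>" by (rule \<Lambda>.L2_bounded[where C=1]) (auto simp: meas indicator_def)
  have "\<forall>n. \<exists>g\<in>C2c. l2_norm \<Lambda> (\<lambda>x. ?I x - g x) < 1 / real (Suc n)"
    using C2c_dense[OF fin _ I] by (simp add: s\<Lambda> sets_M)
  then obtain g where g: "\<And>n. g n \<in> C2c" "\<And>n. l2_norm \<Lambda> (\<lambda>x. ?I x - g n x) < 1 / real (Suc n)" by metis
  have gL: "g n \<in> L2 \<Lambda>" for n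
  proof -
    obtain C where "\<forall>\<phi>\<in>X. \<bar>g n \<phi>\<bar> \<le> C" using C2c_bounded[OF g(1)] by blast
    then show ?thesis
      by (intro \<Lambda>.L2_bounded[where C=C] AE_I2) (auto simp: meas s\<Lambda> space_M intro: cont_M[OF C2c_cont[OF g(1)]])
  qed
  have lim: "(\<lambda>n. l2_norm \<Lambda> (\<lambda>x. g n x - ?I x)) \<longlonglongrightarrow> 0"
  proof (rule real_tendsto_sandwich[OF _ _ tendsto_const LIMSEQ_Suc[OF lim_1_over_n]])
    have "l2_norm \<Lambda> (\<lambda>x. g n x - ?I x) \<le> 1 / real (Suc n)" for n
      using g(2)[of n] by (subst l2_norm_minus_commute) (rule less_imp_le)
    then show "\<forall>\<^sub>F n in sequentially. l2_norm \<Lambda> (\<lambda>x. g n x - ?I x) \<le> 1 / real (Suc n)"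
      by (intro always_eventually allI)
  qed (simp add: l2_norm_nonneg)
  have mm: "?m \<in> borel_measurable \<Lambda>" "AE \<phi> in \<Lambda>. \<bar>?m \<phi>\<bar> \<le> 1"
  proof -
    show "?m \<in> borel_measurable \<Lambda>" by (simp add: meas)
    have "\<bar>?m \<phi>\<bar> \<le> 1" for \<phi> using \<Gamma>0[of \<phi>] by simp
    then show "AE \<phi> in \<Lambda>. \<bar>?m \<phi>\<bar> \<le> 1" by simp
  qed
  note limm = l2_norm_tendsto_bounded_mult[OF lim gL I mm]
  have le_n: "l2_inner \<Lambda> (g n) (g n) \<le> 2 * l2_inner \<Lambda> (g n) (\<lambda>\<phi>. ?m \<phi> * g n \<phi>)" for n
  proof -
    have [measurable]: "g n \<in> borel_measurable M" by (rule cont_M[OF C2c_cont[OF g(1)]])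
    have ig: "integrable M (\<lambda>\<phi>. (g n \<phi>)\<^sup>2)" by (rule L2_integrable[OF C2c_L2[OF g(1)]])
    have "l2_inner \<Lambda> (g n) (g n) = (\<integral>\<phi>. (g n \<phi>)\<^sup>2 + (g n \<phi>)\<^sup>2 * \<Gamma> \<phi> \<partial>M)"
      unfolding l2_inner_def by (subst int\<Lambda>) (auto simp: algebra_simps power2_eq_square)
    also have "\<dots> = (\<integral>\<phi>. (g n \<phi>)\<^sup>2 \<partial>M) + (\<integral>\<phi>. (g n \<phi>)\<^sup>2 * \<Gamma> \<phi> \<partial>M)"
      by (rule Bochner_Integration.integral_add[OF ig key(2)[OF g(1)]])
    also have "\<dots> \<le> 2 * (\<integral>\<phi>. (g n \<phi>)\<^sup>2 \<partial>M)" using key(1)[OF g(1), of n] by simp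
    also have "(\<integral>\<phi>. (g n \<phi>)\<^sup>2 \<partial>M) = l2_inner \<Lambda> (g n) (\<lambda>\<phi>. ?m \<phi> * g n \<phi>)"
    proof -
      have "(1 + \<Gamma> \<phi>) * (g n \<phi> * (?m \<phi> * g n \<phi>)) = (g n \<phi>)\<^sup>2" for \<phi>
        using \<Gamma>0[of \<phi>] by (simp add: field_simps power2_eq_square)
      then show ?thesis unfolding l2_inner_def by (subst int\<Lambda>) (simp_all only:, measurable)
    qed
    finally show ?thesis .
  qed
  have lim1: "(\<lambda>n. l2_inner \<Lambda> (g n) (g n)) \<longlonglongrightarrow> l2_inner \<Lambda> ?I ?I"
    by (rule l2_inner_tendsto[OF gL gL I I lim lim])
  have lim2: "(\<lambda>n. 2 * l2_inner \<Lambda> (g n) (\<lambda>\<phi>. ?m \<phi> * g n \<phi>)) \<longlonglongrightarrow> 2 * l2_inner \<Lambda> ?I (\<lambda>\<phi>. ?m \<phi> * ?I \<phi>)"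
    by (intro tendsto_mult_left l2_inner_tendsto[OF gL L2_bounded_mult[OF gL mm] I L2_bounded_mult[OF I mm] lim limm])
  have le: "l2_inner \<Lambda> ?I ?I \<le> 2 * l2_inner \<Lambda> ?I (\<lambda>\<phi>. ?m \<phi> * ?I \<phi>)"
    by (rule LIMSEQ_le[OF lim1 lim2]) (use le_n in blast)
  \<comment> \<open>On \<open>A\<close> this equals \<open>1 - 2 / (1 + \<Gamma> \<phi>)\<close>,
    which is positive because \<open>\<Gamma> \<phi> > 1\<close>; off \<open>A\<close> it is
    0.\<close>
  let ?k = "\<lambda>\<phi>. ?I \<phi> * ?I \<phi> - 2 * (?I \<phi> * (?m \<phi> * ?I \<phi>))"
  have ki: "integrable \<Lambda> ?k"
    by (intro Bochner_Integration.integrable_diff integrable_mult_right L2_mult_integrable I L2_bounded_mult[OF I mm])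
  have k0: "?k \<phi> \<ge> 0 \<and> (?k \<phi> = 0 \<longrightarrow> \<phi> \<notin> A)" for \<phi>
    using \<Gamma>0[of \<phi>] by (auto simp: indicator_def A_def field_simps)
  have "integral\<^sup>L \<Lambda> ?k = (\<integral>\<phi>. ?I \<phi> * ?I \<phi> \<partial>\<Lambda>) - (\<integral>\<phi>. 2 * (?I \<phi> * (?m \<phi> * ?I \<phi>)) \<partial>\<Lambda>)"
    by (rule Bochner_Integration.integral_diff[OF L2_mult_integrable[OF I I]
          integrable_mult_right[OF L2_mult_integrable[OF I L2_bounded_mult[OF I mm]]]])
  also have "(\<integral>\<phi>. 2 * (?I \<phi> * (?m \<phi> * ?I \<phi>)) \<partial>\<Lambda>) = 2 * (\<integral>\<phi>. ?I \<phi> * (?m \<phi> * ?I \<phi>) \<partial>\<Lambda>)"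
    by (rule integral_mult_right_zero)
  finally have "integral\<^sup>L \<Lambda> ?k = l2_inner \<Lambda> ?I ?I - 2 * l2_inner \<Lambda> ?I (\<lambda>\<phi>. ?m \<phi> * ?I \<phi>)"
    unfolding l2_inner_def .
  moreover have "integral\<^sup>L \<Lambda> ?k \<ge> 0" by (rule integral_nonneg_AE, rule AE_I2, rule k0[THEN conjunct1])
  ultimately have "integral\<^sup>L \<Lambda> ?k = 0" using le by linarith
  then have "AE \<phi> in \<Lambda>. ?k \<phi> = 0"
    by (rule integral_nonneg_eq_0_iff_AE[OF ki AE_I2[OF k0[THEN conjunct1]], THEN iffD1])
  then have "AE \<phi> in \<Lambda>. \<phi> \<notin> A" by eventually_elim (rule k0[THEN conjunct2, rule_format])
  then have "AE \<phi> in M. 0 < ennreal (1 + \<Gamma> \<phi>) \<longrightarrow> \<phi> \<notin> A" unfolding \<Lambda>_def by (subst (asm) AE_density) auto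
  then show ?thesis using AE_space
  proof eventually_elim
    case (elim \<phi>)
    have "0 < ennreal (1 + \<Gamma> \<phi>)" unfolding ennreal_less_zero_iff using \<Gamma>0[of \<phi>] by simp
    then show ?case using elim by (auto simp: A_def \<Gamma>_def[symmetric] not_less)
  qed
qed

end


section \<open>The intrinsic metric\<close>

context orthant begin

section \<open>Cut-offs of one variable\<close>

lemma Rk_const: "Rk k (\<lambda>t. c)"
  by (induction k arbitrary: c) (auto intro!: exI[of _ "\<lambda>t. 0"])

lemma Rk_add: "Rk k \<psi> \<Longrightarrow> Rk k \<eta> \<Longrightarrow> Rk k (\<lambda>t. \<psi> t + \<eta> t)"
proof (induction k arbitrary: \<psi> \<eta>)
  case (Suc k)
  then obtain \<psi>' \<eta>' where "\<forall>t. (\<psi> has_real_derivative \<psi>' t) (at t)" "Rk k \<psi>'"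
    "\<forall>t. (\<eta> has_real_derivative \<eta>' t) (at t)" "Rk k \<eta>'" by auto
  then show ?case using Suc.IH unfolding Rk.simps
    by (intro exI[of _ "\<lambda>t. \<psi>' t + \<eta>' t"]) (auto intro: DERIV_add)
qed (auto intro: continuous_on_add)

lemma Rk_mult: "Rk k \<psi> \<Longrightarrow> Rk k \<eta> \<Longrightarrow> Rk k (\<lambda>t. \<psi> t * \<eta> t)"
proof (induction k arbitrary: \<psi> \<eta>)
  case (Suc k)
  then obtain \<psi>' \<eta>' where d: "\<forall>t. (\<psi> has_real_derivative \<psi>' t) (at t)" "Rk k \<psi>'"
    "\<forall>t. (\<eta> has_real_derivative \<eta>' t) (at t)" "Rk k \<eta>'" by auto
  have "Rk k (\<lambda>t. \<psi>' t * \<eta> t + \<eta>' t * \<psi> t)"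
    using Suc.IH[OF d(2) Rk_SucD[OF Suc.prems(2)]] Suc.IH[OF d(4) Rk_SucD[OF Suc.prems(1)]] by (rule Rk_add)
  then show ?case using d unfolding Rk.simps
    by (intro exI[of _ "\<lambda>t. \<psi>' t * \<eta> t + \<eta>' t * \<psi> t"]) (auto intro: DERIV_mult)
qed (auto intro: continuous_on_mult)

lemma Rk_inverse: "Rk k \<psi> \<Longrightarrow> (\<And>t. \<psi> t \<noteq> 0) \<Longrightarrow> Rk k (\<lambda>t. inverse (\<psi> t))"
proof (induction k arbitrary: \<psi>)
  case (Suc k)
  then obtain \<psi>' where d: "\<forall>t. (\<psi> has_real_derivative \<psi>' t) (at t)" "Rk k \<psi>'" by auto
  note IH = Suc.IH[OF Rk_SucD[OF Suc.prems(1)] Suc.prems(2)]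
  have "Rk k (\<lambda>t. (-1) * (inverse (\<psi> t) * \<psi>' t * inverse (\<psi> t)))"
    by (intro Rk_mult Rk_const IH d)
  moreover have "((\<lambda>t. inverse (\<psi> t)) has_real_derivative (-1) * (inverse (\<psi> t) * \<psi>' t * inverse (\<psi> t))) (at t)" for t
    using DERIV_inverse'[OF d(1)[rule_format] Suc.prems(2), of t] by simp
  ultimately show ?case unfolding Rk.simps
    by (intro exI[of _ "\<lambda>t. (-1) * (inverse (\<psi> t) * \<psi>' t * inverse (\<psi> t))"]) blast
qed (auto intro: continuous_on_inverse)

lemma Rk_affine_comp: "Rk k \<psi> \<Longrightarrow> Rk k (\<lambda>t. \<psi> (c * t + d))"
proof (induction k arbitrary: \<psi>)
  case 0 then show ?case by (auto intro!: continuous_on_compose2[of UNIV \<psi>] continuous_intros)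
next
  case (Suc k)
  then obtain \<psi>' where d: "\<And>t. (\<psi> has_real_derivative \<psi>' t) (at t)" "Rk k \<psi>'" by auto
  have "((\<lambda>t. \<psi> (c * t + d)) has_real_derivative \<psi>' (c * t + d) * c) (at t)" for t
    by (rule DERIV_chain2[OF d(1)]) (auto intro!: derivative_eq_intros)
  then show ?case unfolding Rk.simps
    by (intro exI[of _ "\<lambda>t. \<psi>' (c * t + d) * c"]) (auto intro!: Rk_mult[OF Suc.IH[OF d(2)] Rk_const])
qed

text \<open>A transition from 0 up to \<open>a\<close> to 1 from \<open>b\<close> on, written as a
  quotient of cubes so that its derivative \<open>dstep\<close> is explicit.\<close>

definition step :: "real \<Rightarrow> real \<Rightarrow> real \<Rightarrow> real" where
  "step a b t = pos3 (t - a) / (pos3 (t - a) + pos3 (b - t))"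

definition dstep :: "real \<Rightarrow> real \<Rightarrow> real \<Rightarrow> real" where
  "dstep a b t = (3 * (max 0 (t - a))\<^sup>2 * pos3 (b - t) + 3 * (max 0 (b - t))\<^sup>2 * pos3 (t - a)) / (pos3 (t - a) + pos3 (b - t))\<^sup>2"

context
  fixes a b :: real assumes ab: "a < b"
begin

lemma step_denom: "pos3 (t - a) + pos3 (b - t) > 0"
  using ab pos3_nonneg[of "t - a"] pos3_nonneg[of "b - t"] pos3_pos_iff[of "t - a"] pos3_pos_iff[of "b - t"]
  by (cases "t > a") auto

lemma DERIV_pos3: "(pos3 has_real_derivative 3 * (max 0 t)\<^sup>2) (at t)"
  using DERIV_pos_power[of 1 t] by (simp add: pos3_def[abs_def] numeral_3_eq_3 numeral_2_eq_2)

lemma DERIV_step: "(step a b has_real_derivative dstep a b t) (at t)"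
proof -
  let ?p = "pos3 (t - a)" and ?q = "pos3 (b - t)"
  have p: "((\<lambda>t. pos3 (t - a)) has_real_derivative 3 * (max 0 (t - a))\<^sup>2 * 1) (at t)"
    by (rule DERIV_chain2[OF DERIV_pos3]) (auto intro!: derivative_eq_intros)
  have q: "((\<lambda>t. pos3 (b - t)) has_real_derivative 3 * (max 0 (b - t))\<^sup>2 * (-1)) (at t)"
    by (rule DERIV_chain2[OF DERIV_pos3]) (auto intro!: derivative_eq_intros)
  have "(step a b has_real_derivative ((3 * (max 0 (t - a))\<^sup>2 * 1) * (?p + ?q) -
      ?p * (3 * (max 0 (t - a))\<^sup>2 * 1 + 3 * (max 0 (b - t))\<^sup>2 * (-1))) / ((?p + ?q) * (?p + ?q))) (at t)"
    unfolding step_def[abs_def] by (intro DERIV_divide DERIV_add p q) (use step_denom[of t] in simp)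
  moreover have "(3 * (max 0 (t - a))\<^sup>2 * 1) * (?p + ?q) -
      ?p * (3 * (max 0 (t - a))\<^sup>2 * 1 + 3 * (max 0 (b - t))\<^sup>2 * (-1)) = 3 * (max 0 (t - a))\<^sup>2 * ?q + 3 * (max 0 (b - t))\<^sup>2 * ?p"
    by (simp add: algebra_simps)
  ultimately show ?thesis unfolding dstep_def by (simp add: power2_eq_square)
qed

lemma Rk_step: "Rk 2 (step a b)"
proof -
  have "Rk 2 (\<lambda>t. pos3 (1 * t + (- a)) * inverse (pos3 (1 * t + (- a)) + pos3 ((-1) * t + b)))"
    using step_denom by (intro Rk_mult Rk_inverse Rk_add Rk_affine_comp Rk_pos3) (simp add: less_imp_neq[symmetric])
  also have "(\<lambda>t. pos3 (1 * t + (- a)) * inverse (pos3 (1 * t + (- a)) + pos3 ((-1) * t + b))) = step a b"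
    by (simp add: step_def[abs_def] divide_inverse)
  finally show ?thesis .
qed

lemma dstep_continuous: "continuous_on UNIV (dstep a b)"
  unfolding dstep_def[abs_def] using step_denom
  by (intro continuous_intros continuous_on_compose2[OF Rk_continuous[OF Rk_pos3]]) (auto simp: less_imp_neq[symmetric])

lemma step_le: "t \<le> a \<Longrightarrow> step a b t = 0" and step_ge: "b \<le> t \<Longrightarrow> step a b t = 1"
  using step_denom[of t] by (auto simp: step_def pos3_eq_0_iff[THEN iffD2])

lemma step_bounds: "0 \<le> step a b t" "step a b t \<le> 1"
  using step_denom[of t] pos3_nonneg[of "t - a"] pos3_nonneg[of "b - t"] by (auto simp: step_def)

lemma dstep_nonneg: "0 \<le> dstep a b t"
  unfolding dstep_def using pos3_nonneg by (intro divide_nonneg_nonneg add_nonneg_nonneg mult_nonneg_nonneg) auto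

lemma dstep_outside: "\<not> (a < t \<and> t < b) \<Longrightarrow> dstep a b t = 0"
  by (auto simp: dstep_def pos3_eq_0_iff[THEN iffD2] max_def)

lemma dstep_pos: "a < t \<Longrightarrow> t < b \<Longrightarrow> dstep a b t > 0"
  unfolding dstep_def using pos3_pos_iff[of "t - a"] pos3_pos_iff[of "b - t"] step_denom[of t]
  by (intro divide_pos_pos add_pos_pos mult_pos_pos) auto

end

lemma Cc_mult_continuous:
  assumes "f \<in> Cc T" "continuous_on X g" shows "(\<lambda>\<phi>. f \<phi> * g \<phi>) \<in> Cc T"
  using assms unfolding Cc_iff by (auto intro!: continuous_on_mult)

end

context orthant_measure begin

lemma Cc_integrable_R: assumes "f \<in> Cc T" shows "integrable (R \<beta>) f"
proof -
  obtain K where K: "\<forall>\<phi>\<in>X. f \<phi> \<noteq> 0 \<longrightarrow> (\<forall>y\<in>L. \<phi> y \<le> K)" and c: "continuous_on X f"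
    using assms unfolding Cc_iff by blast
  obtain C where "\<And>\<phi>. \<phi> \<in> X \<Longrightarrow> \<bar>f \<phi>\<bar> \<le> C" using Cc_bounded[OF assms] by blast
  from box_integrable_R(1)[OF cont_M[OF c] this K] show ?thesis by blast
qed

text \<open>The integral over \<open>R \<beta>\<close> is that of \<open>f / \<rho>\<close> over
  \<open>M\<close>, a finite measure charging every nonempty open set.\<close>

lemma Cc_integral_R_pos:
  assumes f: "f \<in> Cc T" "\<And>\<phi>. \<phi> \<in> X \<Longrightarrow> f \<phi> \<ge> 0" "\<phi>0 \<in> X" "f \<phi>0 > 0"
  shows "(\<integral>\<phi>. f \<phi> \<partial>R \<beta>) > 0"
proof -
  obtain K where K: "\<forall>\<phi>\<in>X. f \<phi> \<noteq> 0 \<longrightarrow> (\<forall>y\<in>L. \<phi> y \<le> K)" and c: "continuous_on X f"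
    using f(1) unfolding Cc_iff by blast
  obtain C where "\<And>\<phi>. \<phi> \<in> X \<Longrightarrow> \<bar>f \<phi>\<bar> \<le> C" using Cc_bounded[OF f(1)] by blast
  from box_integrable_R(2)[OF cont_M[OF c] this K] obtain C' where C': "\<forall>\<phi>\<in>X. \<bar>f \<phi> / \<rho> \<phi>\<bar> \<le> C'" by blast
  have fc: "continuous_on X (\<lambda>\<phi>. f \<phi> / \<rho> \<phi>)"
    using \<rho>_pos by (intro continuous_intros c \<rho>_cont) (auto simp: less_imp_neq[symmetric])
  have "integrable M (\<lambda>\<phi>. f \<phi> / \<rho> \<phi>)"
    using C' by (intro L2_integrable1 L2_bounded[where C=C'] cont_M fc AE_I2) (auto simp: space_M)
  then have "(\<integral>\<phi>. f \<phi> / \<rho> \<phi> \<partial>M) > 0"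
    using f \<rho>_pos by (intro integral_pos_open[OF fc _ _ f(3)]) (auto intro: divide_nonneg_pos)
  also have "(\<integral>\<phi>. f \<phi> / \<rho> \<phi> \<partial>M) = (\<integral>\<phi>. f \<phi> \<partial>R \<beta>)"
    using pair_R[of "\<lambda>_. 1" f] cont_M[OF c] by (simp add: l2_inner_def)
  finally show ?thesis .
qed

end

context orthant_form begin

section \<open>Lipschitz bounds from weak gradients\<close>

lemma weak_grad_parts:
  assumes w: "weak_grad f h" and x: "x \<in> L" and \<eta>: "\<eta> \<in> C2c" and a: "a > 0" "\<And>\<phi>. \<phi> \<in> X \<Longrightarrow> \<phi> x \<le> a \<Longrightarrow> \<eta> \<phi> = 0"
  shows "(\<integral>\<phi>. h x \<phi> * \<eta> \<phi> \<partial>R \<beta>) = - (\<integral>\<phi>. f \<phi> * G x \<eta> \<phi> \<partial>R \<beta>)"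
proof -
  obtain F where F: "\<And>n. F n \<in> C2c" "(\<lambda>n. l2_norm M (\<lambda>x. F n x - f x)) \<longlonglongrightarrow> 0"
      "(\<lambda>n. l2_norm M (\<lambda>\<phi>. G x (F n) \<phi> - h x \<phi>)) \<longlonglongrightarrow> 0" using w x by (auto simp: df.weak_grad_def)
  from weak_derivative[OF F(1) df.weak_grad_L2(1)[OF w] df.weak_grad_L2(2)[OF w x] x F(2,3) \<eta> a]
  show ?thesis
    using df.weak_grad_L2(1)[OF w] df.weak_grad_L2(2)[OF w x] G_measurable[OF \<eta> x] cont_M[OF C2c_cont[OF \<eta>]]
    by (simp add: pair_R L2_measurable)
qed

text \<open>If \<open>H \<phi> = F \<phi> - \<phi> x\<close> were larger at \<open>\<phi>(x := t)\<close> than at \<open>\<phi>(x := s)\<close>, then testing with a product of bumps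
  in the other coordinates and of a plateau \<open>\<kappa>\<close> in \<open>x\<close>, which rises near \<open>s\<close> and falls near \<open>t\<close>, would
  contradict the weak inequality \<open>\<partial>\<^sub>x H \<le> 0\<close>.\<close>

lemma monotone_of_gradient_bound:
  assumes w: "weak_grad F h" and Fc: "continuous_on X F" and x: "x \<in> L" and le: "AE \<phi> in M. h x \<phi> \<le> 1"
    and \<phi>: "\<phi> \<in> X" and st: "0 < s" "s < t"
  shows "F (\<phi>(x := t)) - F (\<phi>(x := s)) \<le> t - s"
proof (rule ccontr)
  assume neg: "\<not> ?thesis"
  define H where "H \<phi> = F \<phi> - \<phi> x" for \<phi>
  have Hc: "continuous_on X H" unfolding H_def[abs_def] by (intro continuous_intros Fc coord_continuous)
  let ?u = "\<phi>(x := s)" and ?v = "\<phi>(x := t)"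
  have uv: "?u \<in> X" "?v \<in> X" using X_upd[OF \<phi> x] st by auto
  \<comment> \<open>With a third of the gap, the levels \<open>H ?u + \<delta>\<close> and
    \<open>H ?v - \<delta>\<close>, used near \<open>?u\<close> and near \<open>?v\<close>, are
    still \<open>\<delta>\<close> apart.\<close>
  define \<delta> where "\<delta> = (H ?v - H ?u) / 3"
  have \<delta>: "\<delta> > 0" using neg by (simp add: \<delta>_def H_def)
  have "openin T (X \<inter> H -` {..<H ?u + \<delta>})" and o: "openin T (X \<inter> H -` {H ?v - \<delta><..})"
    unfolding T_eq by (intro continuous_openin_preimage_gen Hc open_lessThan open_greaterThan)+
  moreover have "?u \<in> X \<inter> H -` {..<H ?u + \<delta>}" and v: "?v \<in> X \<inter> H -` {H ?v - \<delta><..}"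
    using uv \<delta> by simp_all
  ultimately obtain a b where ab: "?u \<in> rbox a b" "rbox a b \<subseteq> X \<inter> H -` {..<H ?u + \<delta>}"
    using open_contains_rbox by metis
  obtain c d where cd: "?v \<in> rbox c d" "rbox c d \<subseteq> X \<inter> H -` {H ?v - \<delta><..}"
    using open_contains_rbox[OF o v] by metis
  \<comment> \<open>The midpoint separates the rise on \<open>(a1, b1)\<close> from the fall on
    \<open>(c1, d x)\<close>; taking \<open>a1 \<ge> s / 2\<close> keeps the support off the
    face.\<close>
  define m where "m = (s + t) / 2"
  define a1 where "a1 = max (a x) (s / 2)"
  define b1 where "b1 = min (b x) m"
  define c1 where "c1 = max (c x) m"
  have ax: "a x < s" "s < b x" "c x < t" "t < d x" using ab(1) cd(1) x by (auto simp: rbox_def)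
  have a1: "0 < a1" "a1 < s" and b1: "s < b1" "b1 \<le> c1" and c1: "c1 < t"
    using ax st by (auto simp: a1_def b1_def c1_def m_def)
  \<comment> \<open>In the other coordinates \<open>\<tau>\<close> lives in both boxes at once, so
    the rise takes place inside the first box and the fall inside the second.\<close>
  define \<tau> where "\<tau> \<psi> = (\<Prod>y\<in>L - {x}. pos3 (\<psi> y - max (a y) (c y)) * pos3 (min (b y) (d y) - \<psi> y))" for \<psi>
  have \<tau>0: "\<tau> \<psi> \<ge> 0" for \<psi> unfolding \<tau>_def by (intro prod_nonneg) (simp add: pos3_nonneg)
  have \<tau>box: "max (a y) (c y) < \<psi> y \<and> \<psi> y < min (b y) (d y)" if "\<tau> \<psi> \<noteq> 0" "y \<in> L" "y \<noteq> x" for \<psi> y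
    using that finL unfolding \<tau>_def by (auto simp: pos3_eq_0_iff not_le dest!: bspec[of "L - {x}" _ y])
  have \<tau>Ck: "Ck 2 \<tau>" unfolding \<tau>_def[abs_def]
    using finL by (intro Ck_prod Ck_mult Ck_pos3 Ck_diff Ck_coord Ck_const) auto
  have \<tau>upd: "\<tau> (\<psi>(x := r)) = \<tau> \<psi>" for \<psi> r unfolding \<tau>_def by (intro prod.cong) auto
  have \<tau>\<phi>: "\<tau> ?u > 0"
  proof -
    have "pos3 (?u y - max (a y) (c y)) * pos3 (min (b y) (d y) - ?u y) > 0" if "y \<in> L - {x}" for y
      using ab(1) cd(1) that by (intro mult_pos_pos) (auto simp: pos3_pos_iff rbox_def)
    then show ?thesis unfolding \<tau>_def by (intro prod_pos) auto
  qed
  define \<kappa> where "\<kappa> r = step a1 b1 r - step c1 (d x) r" for r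
  have lt: "a1 < b1" "c1 < d x" using a1 b1 c1 ax by auto
  have \<kappa>0: "\<kappa> r \<ge> 0" for r
    using step_bounds[OF lt(1), of r] step_bounds[OF lt(2), of r] step_ge[OF lt(1), of r] step_le[OF lt(2), of r] b1
    by (cases "r \<le> c1") (auto simp: \<kappa>_def)
  have \<kappa>out: "\<kappa> r = 0" if "r \<le> a1 \<or> d x \<le> r" for r
    using that step_le[OF lt(1), of r] step_le[OF lt(2), of r] step_ge[OF lt(1), of r] step_ge[OF lt(2), of r] lt b1
    by (auto simp: \<kappa>_def)
  have \<kappa>R: "Rk 2 \<kappa>"
    using Rk_add[OF Rk_step[OF lt(1)] Rk_mult[OF Rk_const[of 2 "-1"] Rk_step[OF lt(2)]]] by (simp add: \<kappa>_def[abs_def])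
  define \<eta> where "\<eta> \<psi> = \<tau> \<psi> * \<kappa> (\<psi> x)" for \<psi>
  define K where "K = Max (insert (d x) ((\<lambda>y. min (b y) (d y)) ` L))"
  have bd: "\<psi> y \<le> K" if "\<tau> \<psi> \<noteq> 0" "\<psi> x \<le> d x" "y \<in> L" for \<psi> y
  proof (cases "y = x")
    case True then show ?thesis using that finL by (auto simp: K_def intro!: order_trans[OF _ Max_ge])
  next
    case False
    have "\<psi> y \<le> min (b y) (d y)" using \<tau>box[OF that(1,3) False] by simp
    also have "\<dots> \<le> K" unfolding K_def using finL that(3) by (intro Max_ge) auto
    finally show ?thesis .
  qed
  have \<eta>A: "\<eta> \<in> C2c"
  proof (rule C2c_I)
    show "Ck 2 \<eta>" unfolding \<eta>_def[abs_def] by (intro Ck_mult \<tau>Ck Ck_comp[OF \<kappa>R Ck_coord])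
    fix \<psi> y assume "\<eta> \<psi> \<noteq> 0" "y \<in> L"
    then show "\<psi> y \<le> K" using \<kappa>out[of "\<psi> x"] by (intro bd) (auto simp: \<eta>_def not_le intro: less_imp_le le_cases[of "\<psi> x" "d x"])
  qed
  \<comment> \<open>\<open>G x \<eta>\<close> is a difference of nonnegative functions, one
    supported near \<open>?u\<close> and the other near \<open>?v\<close>.\<close>
  define k1 where "k1 \<psi> = \<tau> \<psi> * dstep a1 b1 (\<psi> x)" for \<psi>
  define k2 where "k2 \<psi> = \<tau> \<psi> * dstep c1 (d x) (\<psi> x)" for \<psi>
  have G\<eta>: "G x \<eta> \<psi> = k1 \<psi> - k2 \<psi>" if \<psi>: "\<psi> \<in> X" for \<psi>
  proof -
    have "pdx x \<eta> (\<lambda>\<psi>. k1 \<psi> - k2 \<psi>)" unfolding pdx_def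
    proof (intro ballI impI)
      fix \<psi>
      have "((\<lambda>r. \<tau> \<psi> * (step a1 b1 r - step c1 (d x) r)) has_real_derivative \<tau> \<psi> * (dstep a1 b1 (\<psi> x) - dstep c1 (d x) (\<psi> x))) (at (\<psi> x))"
        by (intro DERIV_cmult DERIV_diff DERIV_step lt)
      then show "((\<lambda>r. \<eta> (\<psi>(x := r))) has_real_derivative k1 \<psi> - k2 \<psi>) (at (\<psi> x))"
        by (simp add: \<eta>_def \<tau>upd \<kappa>_def k1_def k2_def right_diff_distrib)
    qed
    moreover have "k1 \<psi> - k2 \<psi> = 0" if "\<not> \<psi> x > 0"
      using that a1 b1 dstep_outside[OF lt(1), of "\<psi> x"] dstep_outside[OF lt(2), of "\<psi> x"] by (auto simp: k1_def k2_def)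
    ultimately show ?thesis using G_eq[of x \<eta> "\<lambda>\<psi>. k1 \<psi> - k2 \<psi>" \<psi>] \<psi> by simp
  qed
  have dc: "continuous_on X (\<lambda>\<psi>. dstep p q (\<psi> x))" if "p < q" for p q
    by (rule continuous_on_compose2[OF dstep_continuous[OF that] coord_continuous]) simp
  have kC: "k1 \<in> Cc T" "k2 \<in> Cc T"
    unfolding Cc_iff k1_def[abs_def] k2_def[abs_def]
    using dstep_outside[OF lt(1)] dstep_outside[OF lt(2)] b1 lt
    by (auto intro!: continuous_on_mult Ck_continuous[OF \<tau>Ck] dc lt exI[of _ K] bd intro: less_imp_le)
       (metis less_imp_le less_le_trans less_trans not_le)+
  have k0: "k1 \<psi> \<ge> 0" "k2 \<psi> \<ge> 0" for \<psi>
    using \<tau>0 dstep_nonneg[OF lt(1)] dstep_nonneg[OF lt(2)] by (auto simp: k1_def k2_def)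
  have k1box: "\<psi> \<in> rbox a b" if "k1 \<psi> \<noteq> 0" "\<psi> \<in> X" for \<psi>
    unfolding rbox_def
  proof (intro CollectI conjI ballI)
    fix y assume y: "y \<in> L"
    have "a1 < \<psi> x" "\<psi> x < b1" using that(1) dstep_outside[OF lt(1), of "\<psi> x"] by (auto simp: k1_def)
    then show "a y < \<psi> y" "\<psi> y < b y"
      using \<tau>box[of \<psi> y] y that(1) by (cases "y = x"; auto simp: k1_def a1_def b1_def)+
  qed fact
  have k2box: "\<psi> \<in> rbox c d" if "k2 \<psi> \<noteq> 0" "\<psi> \<in> X" for \<psi>
    unfolding rbox_def
  proof (intro CollectI conjI ballI)
    fix y assume y: "y \<in> L"
    have "c1 < \<psi> x" "\<psi> x < d x" using that(1) dstep_outside[OF lt(2), of "\<psi> x"] by (auto simp: k2_def)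
    then show "c y < \<psi> y" "\<psi> y < d y"
      using \<tau>box[of \<psi> y] y that(1) by (cases "y = x"; auto simp: k2_def c1_def)+
  qed fact
  have \<eta>a: "\<eta> \<psi> = 0" if "\<psi> x \<le> a1" for \<psi> using \<kappa>out[of "\<psi> x"] that by (simp add: \<eta>_def)
  note iR = Cc_integrable_R[OF kC(1)] Cc_integrable_R[OF kC(2)]
    Cc_integrable_R[OF Cc_mult_continuous[OF kC(1) Hc]] Cc_integrable_R[OF Cc_mult_continuous[OF kC(2) Hc]]
  \<comment> \<open>The integral of \<open>G x \<eta>\<close> is 0, so the two pieces have equal
    mass.\<close>
  have I12: "(\<integral>\<psi>. k1 \<psi> \<partial>R \<beta>) = (\<integral>\<psi>. k2 \<psi> \<partial>R \<beta>)"
  proof -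
    have "0 = (\<integral>\<psi>. G x \<eta> \<psi> \<partial>R \<beta>)" by (rule integration_by_parts[OF \<eta>A x a1(1) \<eta>a, symmetric])
    also have "\<dots> = (\<integral>\<psi>. k1 \<psi> - k2 \<psi> \<partial>R \<beta>)" by (intro Bochner_Integration.integral_cong) (auto simp: space_R G\<eta>)
    also have "\<dots> = (\<integral>\<psi>. k1 \<psi> \<partial>R \<beta>) - (\<integral>\<psi>. k2 \<psi> \<partial>R \<beta>)" by (rule Bochner_Integration.integral_diff[OF iR(1,2)])
    finally show ?thesis by simp
  qed
  have I1: "(\<integral>\<psi>. k1 \<psi> \<partial>R \<beta>) > 0"
    by (rule Cc_integral_R_pos[OF kC(1) k0(1) uv(1)])
       (use \<tau>\<phi> dstep_pos[OF lt(1), of s] a1 b1 in \<open>simp add: k1_def\<close>)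
  have "(\<integral>\<psi>. h x \<psi> * \<eta> \<psi> \<partial>R \<beta>) \<le> (\<integral>\<psi>. \<eta> \<psi> \<partial>R \<beta>)"
  proof -
    have hm: "h x \<in> borel_measurable M" by (rule L2_measurable[OF df.weak_grad_L2(2)[OF w x]])
    have em: "\<eta> \<in> borel_measurable M" by (rule cont_M[OF C2c_cont[OF \<eta>A]])
    have "l2_inner M (h x) (\<lambda>\<psi>. \<eta> \<psi> / \<rho> \<psi>) \<le> l2_inner M (\<lambda>_. 1) (\<lambda>\<psi>. \<eta> \<psi> / \<rho> \<psi>)"
      unfolding l2_inner_def
    proof (rule integral_mono_AE)
      show "integrable M (\<lambda>\<psi>. h x \<psi> * (\<eta> \<psi> / \<rho> \<psi>))" "integrable M (\<lambda>\<psi>. 1 * (\<eta> \<psi> / \<rho> \<psi>))"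
        by (rule L2_mult_integrable[OF df.weak_grad_L2(2)[OF w x] C2c_div_\<rho>_L2(1)[OF \<eta>A]]
            L2_mult_integrable[OF L2_const C2c_div_\<rho>_L2(1)[OF \<eta>A]])+
      show "AE \<psi> in M. h x \<psi> * (\<eta> \<psi> / \<rho> \<psi>) \<le> 1 * (\<eta> \<psi> / \<rho> \<psi>)"
        using le AE_space
      proof eventually_elim
        case (elim \<psi>)
        have "\<eta> \<psi> / \<rho> \<psi> \<ge> 0" using \<rho>_pos[of \<psi>] elim(2) \<tau>0 \<kappa>0 by (auto simp: \<eta>_def space_M intro: less_imp_le)
        then show ?case using elim(1) by (intro mult_right_mono)
      qed
    qed
    then show ?thesis using pair_R[OF hm em] pair_R[of "\<lambda>_. 1" \<eta>] em by simp
  qed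
  moreover have "(\<integral>\<psi>. h x \<psi> * \<eta> \<psi> \<partial>R \<beta>) = - (\<integral>\<psi>. F \<psi> * G x \<eta> \<psi> \<partial>R \<beta>)"
    by (rule weak_grad_parts[OF w x \<eta>A a1(1) \<eta>a])
  \<comment> \<open>The coordinate function has derivative 1; writing the integral of
    \<open>\<eta>\<close> through it lets the two sides combine into a statement about
    \<open>H\<close>.\<close>
  moreover have "(\<integral>\<psi>. \<eta> \<psi> \<partial>R \<beta>) = - (\<integral>\<psi>. \<psi> x * G x \<eta> \<psi> \<partial>R \<beta>)"
  proof -
    have cx: "Ck 2 (\<lambda>\<psi>. \<psi> x)" by (rule Ck_coord)
    have A: "(\<lambda>\<psi>. \<eta> \<psi> * \<psi> x) \<in> C2c" by (rule C2c_mult_Ck[OF \<eta>A cx])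
    have "0 = (\<integral>\<psi>. G x (\<lambda>\<psi>. \<eta> \<psi> * \<psi> x) \<psi> \<partial>R \<beta>)"
      by (rule integration_by_parts[OF A x a1(1), symmetric]) (simp add: \<eta>a)
    also have "\<dots> = (\<integral>\<psi>. \<eta> \<psi> + (k1 \<psi> * \<psi> x - k2 \<psi> * \<psi> x) \<partial>R \<beta>)"
    proof (intro Bochner_Integration.integral_cong refl)
      fix \<psi> assume "\<psi> \<in> space (R \<beta>)"
      then have \<psi>: "\<psi> \<in> X" by (simp add: space_R)
      have "G x (\<lambda>\<psi>. \<eta> \<psi> * \<psi> x) \<psi> = \<eta> \<psi> * G x (\<lambda>\<psi>. \<psi> x) \<psi> + \<psi> x * G x \<eta> \<psi>"
        by (rule G_mult_Ck[OF \<eta>A pdx_coord x \<psi>])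
      also have "\<eta> \<psi> * G x (\<lambda>\<psi>. \<psi> x) \<psi> = \<eta> \<psi>"
        using G_eq[OF pdx_coord \<psi>, of x x] \<eta>a[of \<psi>] a1(1) by (cases "\<psi> x > 0") auto
      finally show "G x (\<lambda>\<psi>. \<eta> \<psi> * \<psi> x) \<psi> = \<eta> \<psi> + (k1 \<psi> * \<psi> x - k2 \<psi> * \<psi> x)"
        by (simp add: G\<eta>[OF \<psi>] algebra_simps)
    qed
    also have "\<dots> = (\<integral>\<psi>. \<eta> \<psi> \<partial>R \<beta>) + (\<integral>\<psi>. k1 \<psi> * \<psi> x - k2 \<psi> * \<psi> x \<partial>R \<beta>)"
      by (intro Bochner_Integration.integral_add Bochner_Integration.integrable_diff Cc_integrable_R C2c_Cc[OF \<eta>A]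
          Cc_mult_continuous kC coord_continuous)
    also have "(\<integral>\<psi>. k1 \<psi> * \<psi> x - k2 \<psi> * \<psi> x \<partial>R \<beta>) = (\<integral>\<psi>. \<psi> x * G x \<eta> \<psi> \<partial>R \<beta>)"
      by (intro Bochner_Integration.integral_cong) (auto simp: space_R G\<eta> algebra_simps)
    finally show ?thesis by simp
  qed
  ultimately have "(\<integral>\<psi>. \<psi> x * G x \<eta> \<psi> \<partial>R \<beta>) \<le> (\<integral>\<psi>. F \<psi> * G x \<eta> \<psi> \<partial>R \<beta>)" by simp
  moreover have "(\<integral>\<psi>. F \<psi> * G x \<eta> \<psi> \<partial>R \<beta>) - (\<integral>\<psi>. \<psi> x * G x \<eta> \<psi> \<partial>R \<beta>) = (\<integral>\<psi>. k1 \<psi> * H \<psi> - k2 \<psi> * H \<psi> \<partial>R \<beta>)"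
  proof -
    have i: "integrable (R \<beta>) (\<lambda>\<psi>. f \<psi> * G x \<eta> \<psi>)" if "continuous_on X f" for f
    proof -
      have "integrable (R \<beta>) (\<lambda>\<psi>. k1 \<psi> * f \<psi> - k2 \<psi> * f \<psi>)"
        by (intro Bochner_Integration.integrable_diff Cc_integrable_R Cc_mult_continuous kC that)
      then show ?thesis
        by (rule Bochner_Integration.integrable_cong[THEN iffD1, rotated 2]) (auto simp: space_R G\<eta> algebra_simps)
    qed
    have "(\<integral>\<psi>. F \<psi> * G x \<eta> \<psi> \<partial>R \<beta>) - (\<integral>\<psi>. \<psi> x * G x \<eta> \<psi> \<partial>R \<beta>) = (\<integral>\<psi>. F \<psi> * G x \<eta> \<psi> - \<psi> x * G x \<eta> \<psi> \<partial>R \<beta>)"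
      by (rule Bochner_Integration.integral_diff[symmetric]) (intro i Fc coord_continuous)+
    also have "\<dots> = (\<integral>\<psi>. k1 \<psi> * H \<psi> - k2 \<psi> * H \<psi> \<partial>R \<beta>)"
      by (intro Bochner_Integration.integral_cong) (auto simp: space_R G\<eta> H_def algebra_simps)
    finally show ?thesis .
  qed
  moreover have "(\<integral>\<psi>. k1 \<psi> * H \<psi> - k2 \<psi> * H \<psi> \<partial>R \<beta>) = (\<integral>\<psi>. k1 \<psi> * H \<psi> \<partial>R \<beta>) - (\<integral>\<psi>. k2 \<psi> * H \<psi> \<partial>R \<beta>)"
    by (rule Bochner_Integration.integral_diff[OF iR(3,4)])
  moreover have "(\<integral>\<psi>. k1 \<psi> * H \<psi> \<partial>R \<beta>) \<le> (\<integral>\<psi>. k1 \<psi> * (H ?u + \<delta>) \<partial>R \<beta>)"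
  proof (rule integral_mono)
    fix \<psi> assume "\<psi> \<in> space (R \<beta>)"
    then show "k1 \<psi> * H \<psi> \<le> k1 \<psi> * (H ?u + \<delta>)"
      using k1box[of \<psi>] ab(2) k0(1)[of \<psi>] by (cases "k1 \<psi> = 0") (auto simp: space_R intro!: mult_left_mono)
  qed (use iR in auto)
  moreover have "(\<integral>\<psi>. k2 \<psi> * (H ?v - \<delta>) \<partial>R \<beta>) \<le> (\<integral>\<psi>. k2 \<psi> * H \<psi> \<partial>R \<beta>)"
  proof (rule integral_mono)
    fix \<psi> assume "\<psi> \<in> space (R \<beta>)"
    then show "k2 \<psi> * (H ?v - \<delta>) \<le> k2 \<psi> * H \<psi>"
      using k2box[of \<psi>] cd(2) k0(2)[of \<psi>] by (cases "k2 \<psi> = 0") (auto simp: space_R intro!: mult_left_mono)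
  qed (use iR in auto)
  \<comment> \<open>With equal masses, the bounds on the two levels leave the common mass times
    \<open>- \<delta>\<close>.\<close>
  ultimately have "0 \<le> (\<integral>\<psi>. k1 \<psi> \<partial>R \<beta>) * (H ?u + \<delta>) - (\<integral>\<psi>. k1 \<psi> \<partial>R \<beta>) * (H ?v - \<delta>)"
    using I12 by simp
  then have "0 \<le> (\<integral>\<psi>. k1 \<psi> \<partial>R \<beta>) * (- \<delta>)"
    unfolding \<delta>_def by (simp add: algebra_simps)
  then show False using I1 \<delta> by (simp add: mult_le_0_iff)
qed

text \<open>The one-sided bound is applied to \<open>F\<close> and to its negative. It asks for
  \<open>s > 0\<close>, so the face is reached by shifting both arguments by \<open>c n\<close> and
  letting \<open>n\<close> grow.\<close>

lemma lipschitz_coordinate: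
  assumes w: "weak_grad F h" and Fc: "continuous_on X F" and x: "x \<in> L" and le: "AE \<phi> in M. \<bar>h x \<phi>\<bar> \<le> 1"
    and \<phi>: "\<phi> \<in> X" and st: "0 \<le> s" "0 \<le> t"
  shows "\<bar>F (\<phi>(x := t)) - F (\<phi>(x := s))\<bar> \<le> \<bar>t - s\<bar>"
proof -
  have mono: "\<bar>F (\<phi>(x := t)) - F (\<phi>(x := s))\<bar> \<le> t - s" if st: "0 < s" "s < t" for s t
  proof -
    have "F (\<phi>(x := t)) - F (\<phi>(x := s)) \<le> t - s"
      by (rule monotone_of_gradient_bound[OF w Fc x _ \<phi> st]) (use le in \<open>auto elim!: eventually_mono\<close>)
    moreover have "(-1) * F (\<phi>(x := t)) - (-1) * F (\<phi>(x := s)) \<le> t - s"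
      by (rule monotone_of_gradient_bound[OF df.weak_grad_cmult[OF w] _ x _ \<phi> st])
         (use le Fc in \<open>auto elim!: eventually_mono intro!: continuous_intros\<close>)
    ultimately show ?thesis by linarith
  qed
  have pos: "\<bar>F (\<phi>(x := t)) - F (\<phi>(x := s))\<bar> \<le> \<bar>t - s\<bar>" if "0 < s" "0 < t" for s t
    using mono[of s t] mono[of t s] that by (cases s t rule: linorder_cases) (auto simp: abs_minus_commute)
  define c where "c n = 1 / real (Suc n)" for n
  have c: "c \<longlonglongrightarrow> 0" "\<And>n. c n > 0" unfolding c_def by (rule LIMSEQ_Suc[OF lim_1_over_n]) auto
  have Fl: "(\<lambda>n. F (\<phi>(x := r + c n))) \<longlonglongrightarrow> F (\<phi>(x := r + 0))" if "r \<ge> 0" for r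
  proof (rule continuous_on_tendsto_compose[where s="{0..}" and f="\<lambda>t. F (\<phi>(x := r + t))"])
    have "continuous_on {0..} (\<lambda>t. \<phi>(x := r + t))"
      by (rule continuous_on_compose2[OF upd_continuous[of UNIV \<phi> x]]) (auto intro!: continuous_intros)
    then show "continuous_on {0..} (\<lambda>t. F (\<phi>(x := r + t)))"
      by (rule continuous_on_compose2[OF Fc]) (use X_upd[OF \<phi> x] that in auto)
  qed (use c in \<open>auto intro: less_imp_le always_eventually\<close>)
  have "(\<lambda>n. \<bar>F (\<phi>(x := t + c n)) - F (\<phi>(x := s + c n))\<bar>) \<longlonglongrightarrow> \<bar>F (\<phi>(x := t + 0)) - F (\<phi>(x := s + 0))\<bar>"
    by (intro tendsto_intros Fl st)
  moreover have "\<bar>F (\<phi>(x := t + c n)) - F (\<phi>(x := s + c n))\<bar> \<le> \<bar>t - s\<bar>" for n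
    using pos[of "s + c n" "t + c n"] st c(2)[of n] by simp
  ultimately show ?thesis using LIMSEQ_le_const2 by fastforce
qed

text \<open>Coordinates are exchanged one at a time: \<open>P A\<close> agrees with
  \<open>\<phi>\<close> on \<open>A\<close> and with \<open>\<psi>\<close> elsewhere, which keeps it
  in the orthant.\<close>

lemma lipschitz_l1:
  assumes w: "weak_grad F h" and Fc: "continuous_on X F" and le: "\<And>x. x \<in> L \<Longrightarrow> AE \<phi> in M. \<bar>h x \<phi>\<bar> \<le> 1"
    and \<phi>: "\<phi> \<in> X" and \<psi>: "\<psi> \<in> X"
  shows "\<bar>F \<phi> - F \<psi>\<bar> \<le> (\<Sum>x\<in>L. \<bar>\<phi> x - \<psi> x\<bar>)"
proof -
  define P where "P A y = (if y \<in> A then \<phi> y else \<psi> y)" for A y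
  have "A \<subseteq> L \<Longrightarrow> \<bar>F (P A) - F \<psi>\<bar> \<le> (\<Sum>x\<in>A. \<bar>\<phi> x - \<psi> x\<bar>)" if "finite A" for A
    using that
  proof (induction A rule: finite_induct)
    case empty
    have "P {} = \<psi>" by (simp add: P_def fun_eq_iff)
    then show ?case by simp
  next
    case (insert x A)
    have PX: "P A \<in> X" using \<phi> \<psi> insert.prems by (auto simp: P_def X_def PiE_def Pi_def extensional_def)
    have "P (insert x A) = (P A)(x := \<phi> x)" "P A = (P A)(x := \<psi> x)" using insert.hyps by (auto simp: P_def fun_eq_iff)
    then have "\<bar>F (P (insert x A)) - F (P A)\<bar> \<le> \<bar>\<phi> x - \<psi> x\<bar>"
      using lipschitz_coordinate[OF w Fc _ le PX, of x "\<psi> x" "\<phi> x"] X_nonneg[OF \<phi>] X_nonneg[OF \<psi>] insert.prems by auto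
    then show ?case using insert by simp
  qed
  from this[OF finL] have "\<bar>F (P L) - F \<psi>\<bar> \<le> (\<Sum>x\<in>L. \<bar>\<phi> x - \<psi> x\<bar>)" by simp
  moreover have "P L = \<phi>" using \<phi> \<psi> by (auto simp: P_def X_def PiE_def extensional_def fun_eq_iff)
  ultimately show ?thesis by simp
qed

lemma intrinsic_le_l1:
  assumes \<phi>: "\<phi> \<in> X" and \<psi>: "\<psi> \<in> X"
  shows "dist_E \<phi> \<psi> \<le> ereal (\<Sum>x\<in>L. \<bar>\<phi> x - \<psi> x\<bar>)"
  unfolding intrinsic_metric_def
proof (rule Sup_least)
  fix r assume "r \<in> {ereal (f \<phi> - f \<psi>) |f. f \<in> Dom \<inter> Cc T \<and>
        (\<exists>\<nu>. energy_measure T M Dom En f \<nu> \<and> absolutely_continuous M \<nu> \<and> (AE z in M. RN_deriv M \<nu> z \<le> 2))}"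
  then obtain F \<nu> where F: "r = ereal (F \<phi> - F \<psi>)" "F \<in> Dom" "F \<in> Cc T" "energy_measure T M Dom En F \<nu>"
    "absolutely_continuous M \<nu>" "AE z in M. RN_deriv M \<nu> z \<le> 2" by blast
  obtain h where w: "weak_grad F h" using F(2) unfolding df.Dom_iff by blast
  note b = energy_bound_imp_gradient_bound[OF w F(3-6)]
  have "AE \<phi> in M. \<bar>h x \<phi>\<bar> \<le> 1" if "x \<in> L" for x
    using b
  proof eventually_elim
    case (elim \<phi>)
    have "(h x \<phi>)\<^sup>2 \<le> (\<Sum>x\<in>L. (h x \<phi>)\<^sup>2)" using that finL by (intro member_le_sum) auto
    then show ?case using elim by (simp add: abs_square_le_1[symmetric])
  qed
  then have "\<bar>F \<phi> - F \<psi>\<bar> \<le> (\<Sum>x\<in>L. \<bar>\<phi> x - \<psi> x\<bar>)"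
    using F(3) by (intro lipschitz_l1[OF w _ _ \<phi> \<psi>]) (auto simp: Cc_iff)
  then show "r \<le> ereal (\<Sum>x\<in>L. \<bar>\<phi> x - \<psi> x\<bar>)" by (simp add: F(1))
qed

text \<open>One direction is \<open>intrinsic_ball_subset\<close>. For the other, an intrinsic ball
  contains the \<open>l\<^sup>1\<close> ball of the same radius, and the latter is open.\<close>

theorem is_strongly_regular: "strongly_regular T M Dom En"
  unfolding strongly_regular_def
proof (intro conjI allI is_regular iffI)
  fix U assume "openin T U"
  then show "U \<subseteq> topspace T" "\<forall>\<phi>\<in>U. \<exists>e>0. \<forall>\<psi>\<in>topspace T. dist_E \<phi> \<psi> < ereal e \<longrightarrow> \<psi> \<in> U"
    using openin_subset intrinsic_ball_subset by blast+
next
  fix U assume U: "U \<subseteq> topspace T \<and> (\<forall>\<phi>\<in>U. \<exists>e>0. \<forall>\<psi>\<in>topspace T. dist_E \<phi> \<psi> < ereal e \<longrightarrow> \<psi> \<in> U)"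
  show "openin T U"
  proof (subst openin_subopen, intro ballI)
    fix \<phi> assume \<phi>: "\<phi> \<in> U"
    then have \<phi>X: "\<phi> \<in> X" using U unfolding topspace_T by blast
    obtain e where e: "e > 0" "\<forall>\<psi>\<in>topspace T. dist_E \<phi> \<psi> < ereal e \<longrightarrow> \<psi> \<in> U" using U \<phi> by blast
    let ?V = "X \<inter> (\<lambda>\<psi>. \<Sum>x\<in>L. \<bar>\<phi> x - \<psi> x\<bar>) -` {..<e}"
    have "openin T ?V" unfolding T_eq
      by (intro continuous_openin_preimage_gen continuous_intros coord_continuous open_lessThan)
    moreover have "\<phi> \<in> ?V" using e(1) \<phi>X by simp
    moreover have "?V \<subseteq> U"
    proof
      fix \<psi> assume \<psi>: "\<psi> \<in> ?V"
      then have "dist_E \<phi> \<psi> \<le> ereal (\<Sum>x\<in>L. \<bar>\<phi> x - \<psi> x\<bar>)" by (intro intrinsic_le_l1[OF \<phi>X]) simp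
      also have "\<dots> < ereal e" using \<psi> by simp
      finally show "\<psi> \<in> U" using e(2) \<psi> unfolding topspace_T by blast
    qed
    ultimately show "\<exists>V. openin T V \<and> \<phi> \<in> V \<and> V \<subseteq> U" by blast
  qed
qed

end


section \<open>The dynamical wetting model\<close>

lemma finite_int_box: "finite {x :: int ^ 'd. \<forall>i. x $ i \<in> {a..b}}"
proof -
  have "{x :: int ^ 'd. \<forall>i. x $ i \<in> {a..b}} = vec_lambda ` (\<Pi>\<^sub>E i\<in>UNIV. {a..b})"
    by (auto simp: image_iff intro!: bexI[of _ "vec_nth _"])
  then show ?thesis by (simp add: finite_PiE)
qed

lemma finite_lattice_box: "finite (lattice_box N :: (int ^ 'd) set)"
  using finite_int_box[of 1 "int N"] by (simp add: lattice_box_def)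

lemma adjacent_sym: "adjacent x y \<longleftrightarrow> adjacent y x"
proof -
  have eq: "(\<chi> i. real_of_int (x $ i - y $ i)) = - (\<chi> i. real_of_int (y $ i - x $ i))" by (simp add: vec_eq_iff)
  show ?thesis unfolding adjacent_def by (subst eq) (simp only: norm_minus_cancel)
qed

lemma adjacent_component: "adjacent x y \<Longrightarrow> \<bar>x $ i - y $ i\<bar> \<le> 1"
proof -
  assume "adjacent x y"
  then have "\<bar>real_of_int (x $ i - y $ i)\<bar> \<le> 1"
    unfolding adjacent_def using component_le_norm_cart[of "\<chi> i. real_of_int (x $ i - y $ i)" i] by simp
  then show ?thesis by linarith
qed

lemma finite_box_closure: "finite (box_closure N :: (int ^ 'd::finite) set)"
proof (rule finite_subset[OF _ finite_int_box[of 0 "int N + 1"]])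
  have "x $ i \<in> {0..int N + 1}" if "y \<in> lattice_box N" "adjacent x y" for x y :: "int ^ 'd" and i
  proof -
    have "1 \<le> y $ i" "y $ i \<le> int N" using that(1) by (auto simp: lattice_box_def)
    then show ?thesis using adjacent_component[OF that(2), of i] by auto
  qed
  moreover have "x $ i \<in> {0..int N + 1}" if "x \<in> lattice_box N" for x :: "int ^ 'd" and i
  proof -
    have "1 \<le> x $ i" "x $ i \<le> int N" using that by (auto simp: lattice_box_def)
    then show ?thesis by auto
  qed
  ultimately show "(box_closure N :: (int ^ 'd) set) \<subseteq> {x. \<forall>i. x $ i \<in> {0..int N + 1}}"
    unfolding box_closure_def box_boundary_def by blast
qed

text \<open>The neighbour \<open>x - e\<^sub>i\<close>: lowering one fixed coordinate gives every
  site of the box one predecessor, in the box or on its boundary, and the resulting bonds contain no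
  cycle.\<close>

definition pred_site :: "'d::finite \<Rightarrow> int ^ 'd \<Rightarrow> int ^ 'd" where
  "pred_site i x = (\<chi> j. if j = i then x $ j - 1 else x $ j)"

lemma adjacent_pred: "adjacent x (pred_site i x)"
proof -
  have "(\<chi> j. real_of_int (x $ j - pred_site i x $ j)) = axis i 1"
    by (simp add: vec_eq_iff pred_site_def axis_def)
  then show ?thesis by (simp add: adjacent_def norm_axis_1)
qed

lemma pred_site_closure: "x \<in> lattice_box N \<Longrightarrow> pred_site i x \<in> box_closure N"
  using adjacent_pred[of x i] by (auto simp: box_closure_def box_boundary_def adjacent_sym[of x])

lemma pred_site_component: "pred_site i x $ i = x $ i - 1"
  by (simp add: pred_site_def)

text \<open>Integrating out a site with maximal \<open>i\<close>-th coordinate removes its factor from the product over the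
  bonds \<open>{x, x - e\<^sub>i}\<close>, since no other of these bonds contains it.\<close>

lemma bond_product_integral_le:
  fixes w :: "real \<Rightarrow> real" and i :: "'d::finite"
  assumes [measurable]: "w \<in> borel_measurable borel"
    and C: "\<And>c. (\<integral>\<^sup>+t. ennreal (w (t - c)) \<partial>site_measure \<beta>) \<le> C" and w0: "\<And>t. 0 \<le> w t"
    and A: "finite A"
  shows "(\<integral>\<^sup>+\<phi>. (\<Prod>x\<in>A. ennreal (w (\<phi> x - (if pred_site i x \<in> A then \<phi> (pred_site i x) else 0))))
     \<partial>(\<Pi>\<^sub>M x\<in>A. site_measure \<beta>)) \<le> C ^ card A"
  using A
proof (induction "card A" arbitrary: A)
  case 0
  then have "A = {}" by simp
  then show ?case by (simp add: PiM_empty)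
next
  case (Suc n)
  interpret product_sigma_finite "\<lambda>_ :: int ^ 'd. site_measure \<beta>"
    using sigma_finite_site by (simp add: product_sigma_finite_def)
  let ?S = "\<lambda>_ :: int ^ 'd. site_measure \<beta>"
  have ne: "A \<noteq> {}" using Suc.hyps(2) by auto
  have "Max ((\<lambda>y. y $ i) ` A) \<in> (\<lambda>y. y $ i) ` A" using Suc.prems ne by (intro Max_in) auto
  then obtain z where z0: "z \<in> A" "Max ((\<lambda>y. y $ i) ` A) = z $ i" by (rule imageE)
  have z: "z \<in> A" "\<And>y. y \<in> A \<Longrightarrow> y $ i \<le> z $ i"
    using z0(1) Suc.prems unfolding z0(2)[symmetric] by auto
  define B where "B = A - {z}"
  have B: "A = insert z B" "z \<notin> B" "finite B" "card B = n" using z(1) Suc by (auto simp: B_def)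
  have np: "pred_site i y \<noteq> z" if "y \<in> A" for y
    using z(2)[OF that] pred_site_component[of i y] by auto
  define f where "f D \<phi> = (\<Prod>x\<in>D. ennreal (w (\<phi> x - (if pred_site i x \<in> D then \<phi> (pred_site i x) else 0))))" for D \<phi>
  have m [measurable]: "f D \<in> borel_measurable (\<Pi>\<^sub>M x\<in>D. site_measure \<beta>)" for D
  proof -
    have c: "(\<lambda>\<phi>. \<phi> x) \<in> borel_measurable (\<Pi>\<^sub>M x\<in>D. site_measure \<beta>)" if "x \<in> D" for x
      using measurable_compose[OF measurable_component_singleton[OF that] measurable_site[of "\<lambda>t. t"]] by simp
    show ?thesis unfolding f_def[abs_def]
    proof (rule borel_measurable_prod_ennreal)
      fix x assume x: "x \<in> D"
      show "(\<lambda>\<phi>. ennreal (w (\<phi> x - (if pred_site i x \<in> D then \<phi> (pred_site i x) else 0)))) \<in> borel_measurable (\<Pi>\<^sub>M x\<in>D. site_measure \<beta>)"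
        using c[OF x] c[of "pred_site i x"] by (cases "pred_site i x \<in> D") (simp_all, measurable)
    qed
  qed
  have "(\<integral>\<^sup>+\<phi>. f A \<phi> \<partial>(\<Pi>\<^sub>M x\<in>A. site_measure \<beta>)) = (\<integral>\<^sup>+\<phi>. (\<integral>\<^sup>+t. f A (\<phi>(z := t)) \<partial>site_measure \<beta>) \<partial>(\<Pi>\<^sub>M x\<in>B. site_measure \<beta>))"
    unfolding B(1) using m[of "insert z B"] by (intro product_nn_integral_insert B) auto
  also have "\<dots> \<le> (\<integral>\<^sup>+\<phi>. f B \<phi> * C \<partial>(\<Pi>\<^sub>M x\<in>B. site_measure \<beta>))"
  proof (rule nn_integral_mono)
    fix \<phi> :: "int ^ 'd \<Rightarrow> real"
    \<comment> \<open>The value at the predecessor enters as a translation, and \<open>C\<close>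
      bounds the integral for every translation.\<close>
    define c where "c = (if pred_site i z \<in> A then \<phi> (pred_site i z) else 0)"
    have "f A (\<phi>(z := t)) = ennreal (w (t - c)) * f B \<phi>" for t
    proof -
      have "f A (\<phi>(z := t)) = ennreal (w (t - c)) * (\<Prod>x\<in>B. ennreal (w ((\<phi>(z := t)) x - (if pred_site i x \<in> A then (\<phi>(z := t)) (pred_site i x) else 0))))"
        unfolding f_def B(1) using B(2,3) np[OF z(1)] by (simp add: c_def B(1))
      also have "(\<Prod>x\<in>B. ennreal (w ((\<phi>(z := t)) x - (if pred_site i x \<in> A then (\<phi>(z := t)) (pred_site i x) else 0)))) = f B \<phi>"
        unfolding f_def using B(1,2) np by (intro prod.cong) auto
      finally show ?thesis .
    qed
    then have "(\<integral>\<^sup>+t. f A (\<phi>(z := t)) \<partial>site_measure \<beta>) = (\<integral>\<^sup>+t. ennreal (w (t - c)) \<partial>site_measure \<beta>) * f B \<phi>"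
      by (simp add: nn_integral_multc measurable_site)
    also have "\<dots> \<le> C * f B \<phi>" by (rule mult_right_mono[OF C]) simp
    finally show "(\<integral>\<^sup>+t. f A (\<phi>(z := t)) \<partial>site_measure \<beta>) \<le> f B \<phi> * C" by (simp add: mult.commute)
  qed
  also have "\<dots> = (\<integral>\<^sup>+\<phi>. f B \<phi> \<partial>(\<Pi>\<^sub>M x\<in>B. site_measure \<beta>)) * C" by (rule nn_integral_multc) (rule m)
  also have "\<dots> \<le> C ^ n * C"
    using Suc.hyps(1)[OF B(4)[symmetric] B(3)] unfolding f_def B(4) by (rule mult_right_mono) simp
  finally show ?case unfolding f_def using Suc.hyps(2) by (simp add: mult.commute flip: Suc.hyps(2))
qed

text \<open>\<open>d_ty\<close> fixes the dimension, so that constants such as \<open>Z\<close>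
  depend on no free type variable.\<close>

locale wetting =
  fixes N :: nat and \<beta> b :: real and V :: "real \<Rightarrow> real" and d_ty :: "'d::finite itself"
  assumes \<beta>: "\<beta> > 0" and V_ge: "\<And>r. V r \<ge> - b" and V_cont: "continuous_on UNIV V"
    and V_sym: "\<And>r. V (- r) = V r" and V_int: "integrable lborel (\<lambda>r. exp (- V r))"
begin

abbreviation "LB \<equiv> lattice_box N :: (int ^ 'd) set"

sublocale orthant LB by standard (rule finite_lattice_box)

lemma X_eq: "X = interfaces N"
  by (simp add: X_def interfaces_def)

lemma T_interface: "interface_topology N = T"
  by (simp add: interface_topology_def)

lemma R_eq: "reference_measure \<beta> N = R \<beta>"
  by (simp add: reference_measure_def R_def)

lemma extend0_continuous: "continuous_on X (\<lambda>\<phi>. extend0 N \<phi> x)"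
  unfolding extend0_def by (cases "x \<in> LB") (auto intro: coord_continuous)

lemma hamiltonian_continuous: "continuous_on X (hamiltonian V N)"
  unfolding hamiltonian_def[abs_def] split_beta
  by (intro continuous_intros continuous_on_compose2[OF V_cont] extend0_continuous) auto

text \<open>Ordered pairs carry the weight 1/2, so a bond taken in both orientations contributes its
  full \<open>V\<close>. The bonds from a site to its predecessor are kept; all others are bounded
  through \<open>V \<ge> - b\<close>.\<close>

lemma exp_hamiltonian_le:
  "exp (- hamiltonian V N \<phi>) \<le> exp (\<bar>b\<bar> * real (card {(x, y :: int ^ 'd). x \<in> box_closure N \<and> y \<in> box_closure N \<and> adjacent x y})) *
     (\<Prod>x\<in>LB. exp (- V (\<phi> x - (if pred_site i x \<in> LB then \<phi> (pred_site i x) else 0))))"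
proof -
  let ?P = "{(x, y :: int ^ 'd). x \<in> box_closure N \<and> y \<in> box_closure N \<and> adjacent x y}"
  let ?v = "\<lambda>(x, y). V (extend0 N \<phi> x - extend0 N \<phi> y)"
  \<comment> \<open>The two orientations of the bond from \<open>x\<close> to its predecessor;
    symmetry of \<open>V\<close> gives them equal sums.\<close>
  let ?f = "\<lambda>x. (x, pred_site i x)" and ?g = "\<lambda>x. (pred_site i x, x)"
  have fP: "finite ?P" by (rule finite_subset[OF _ finite_cartesian_product[OF finite_box_closure finite_box_closure]]) auto
  have sub: "?f ` LB \<union> ?g ` LB \<subseteq> ?P"
    using pred_site_closure adjacent_pred adjacent_sym by (auto simp: box_closure_def) blast+
  have disj: "?f ` LB \<inter> ?g ` LB = {}"
  proof -
    have "x = pred_site i y \<Longrightarrow> pred_site i x = y \<Longrightarrow> False" for x y :: "int ^ 'd"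
      using pred_site_component[of i x] pred_site_component[of i y] by auto
    then show ?thesis by auto
  qed
  have fin: "finite (?f ` LB)" "finite (?g ` LB)" using finite_lattice_box by auto
  have s1: "(\<Sum>p\<in>?f ` LB. ?v p) = (\<Sum>x\<in>LB. V (extend0 N \<phi> x - extend0 N \<phi> (pred_site i x)))"
    by (subst sum.reindex) (auto simp: inj_on_def)
  have s2: "(\<Sum>p\<in>?g ` LB. ?v p) = (\<Sum>x\<in>LB. V (extend0 N \<phi> x - extend0 N \<phi> (pred_site i x)))"
  proof -
    have "(\<Sum>p\<in>?g ` LB. ?v p) = (\<Sum>x\<in>LB. V (- (extend0 N \<phi> x - extend0 N \<phi> (pred_site i x))))"
      by (subst sum.reindex) (auto simp: inj_on_def)
    then show ?thesis by (simp only: V_sym)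
  qed
  have "(\<Sum>p\<in>?P. ?v p) = (\<Sum>p\<in>?P - (?f ` LB \<union> ?g ` LB). ?v p) + (\<Sum>p\<in>?f ` LB \<union> ?g ` LB. ?v p)"
    by (rule sum.subset_diff[OF sub fP])
  also have "(\<Sum>p\<in>?f ` LB \<union> ?g ` LB. ?v p) = 2 * (\<Sum>x\<in>LB. V (extend0 N \<phi> x - extend0 N \<phi> (pred_site i x)))"
    using sum.union_disjoint[OF fin disj, of ?v] s1 s2 by simp
  finally have eq: "hamiltonian V N \<phi> = (\<Sum>p\<in>?P - (?f ` LB \<union> ?g ` LB). ?v p) / 2 + (\<Sum>x\<in>LB. V (extend0 N \<phi> x - extend0 N \<phi> (pred_site i x)))"
    by (simp add: hamiltonian_def)
  have "- (\<Sum>p\<in>?P - (?f ` LB \<union> ?g ` LB). ?v p) \<le> (\<Sum>p\<in>?P - (?f ` LB \<union> ?g ` LB). \<bar>b\<bar>)"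
    unfolding sum_negf[symmetric]
  proof (rule sum_mono)
    show "- ?v p \<le> \<bar>b\<bar>" for p using V_ge[of "extend0 N \<phi> (fst p) - extend0 N \<phi> (snd p)"] by (simp add: split_beta)
  qed
  also have "\<dots> \<le> (\<Sum>p\<in>?P. \<bar>b\<bar>)" using fP by (intro sum_mono2) auto
  also have "\<dots> = \<bar>b\<bar> * real (card ?P)" by simp
  finally have A: "- (\<Sum>p\<in>?P - (?f ` LB \<union> ?g ` LB). ?v p) / 2 \<le> \<bar>b\<bar> * real (card ?P)"
    using mult_nonneg_nonneg[OF abs_ge_zero[of b] of_nat_0_le_iff[of "card ?P"]] by linarith
  have "- hamiltonian V N \<phi> \<le> \<bar>b\<bar> * real (card ?P) + (\<Sum>x\<in>LB. - V (extend0 N \<phi> x - extend0 N \<phi> (pred_site i x)))"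
    unfolding eq sum_negf using A by simp
  then have "exp (- hamiltonian V N \<phi>) \<le> exp (\<bar>b\<bar> * real (card ?P) + (\<Sum>x\<in>LB. - V (extend0 N \<phi> x - extend0 N \<phi> (pred_site i x))))"
    by simp
  also have "\<dots> = exp (\<bar>b\<bar> * real (card ?P)) * (\<Prod>x\<in>LB. exp (- V (extend0 N \<phi> x - extend0 N \<phi> (pred_site i x))))"
    by (simp add: exp_add exp_sum finite_lattice_box)
  also have "(\<Prod>x\<in>LB. exp (- V (extend0 N \<phi> x - extend0 N \<phi> (pred_site i x)))) =
     (\<Prod>x\<in>LB. exp (- V (\<phi> x - (if pred_site i x \<in> LB then \<phi> (pred_site i x) else 0))))"
    by (intro prod.cong) (auto simp: extend0_def)
  finally show ?thesis .
qed

section \<open>The partition function and the normalised density\<close>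

definition Z where "Z = (\<integral>\<^sup>+\<phi>. ennreal (exp (- hamiltonian V N \<phi>)) \<partial>R \<beta>)"

lemma exp_hamiltonian_measurable: "(\<lambda>\<phi>. exp (- hamiltonian V N \<phi>)) \<in> borel_measurable (R \<beta>)"
  by (intro continuous_measurable[OF sets_R] continuous_intros hamiltonian_continuous)

lemma Z_finite: "Z < \<infinity>"
proof -
  fix i :: 'd
  let ?w = "\<lambda>t. exp (- V t)"
  define K where "K = exp (\<bar>b\<bar> * real (card {(x, y :: int ^ 'd). x \<in> box_closure N \<and> y \<in> box_closure N \<and> adjacent x y}))"
  have [measurable]: "V \<in> borel_measurable borel" using V_cont by (rule borel_measurable_continuous_onI)
  \<comment> \<open>The atom contributes at most \<open>\<beta> * exp b\<close>, the Lebesgue part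
    the translation invariant integral of \<open>exp (- V t)\<close>.\<close>
  define C where "C = ennreal \<beta> * ennreal (exp b) + (\<integral>\<^sup>+t. ennreal (?w t) \<partial>lborel)"
  have "(\<integral>\<^sup>+t. ennreal (?w t) \<partial>lborel) = ennreal (\<integral>t. ?w t \<partial>lborel)"
    by (rule nn_integral_eq_integral[OF V_int]) simp
  then have Cfin: "C < \<infinity>" by (simp add: C_def ennreal_mult[symmetric] ennreal_plus[symmetric] \<beta> less_imp_le del: ennreal_plus)
  have C: "(\<integral>\<^sup>+t. ennreal (?w (t - c)) \<partial>site_measure \<beta>) \<le> C" for c
  proof -
    have "(\<integral>\<^sup>+t. ennreal (?w (t - c)) \<partial>site_measure \<beta>) \<le> ennreal \<beta> * ennreal (?w (0 - c)) + (\<integral>\<^sup>+t. ennreal (?w (t - c)) \<partial>lborel)"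
      by (rule nn_integral_site_le) measurable
    also have "(\<integral>\<^sup>+t. ennreal (?w (t - c)) \<partial>lborel) = (\<integral>\<^sup>+t. ennreal (?w t) \<partial>lborel)"
      using nn_integral_real_affine[of "\<lambda>t. ennreal (?w t)" 1 "- c"] by simp
    also have "ennreal \<beta> * ennreal (?w (0 - c)) \<le> ennreal \<beta> * ennreal (exp b)"
      using V_ge[of "0 - c"] by (intro mult_left_mono ennreal_leI) auto
    finally show ?thesis unfolding C_def by (simp add: add_right_mono)
  qed
  have "Z \<le> (\<integral>\<^sup>+\<phi>. ennreal K * (\<Prod>x\<in>LB. ennreal (?w (\<phi> x - (if pred_site i x \<in> LB then \<phi> (pred_site i x) else 0)))) \<partial>R \<beta>)"
    unfolding Z_def
  proof (rule nn_integral_mono)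
    fix \<phi>
    show "ennreal (exp (- hamiltonian V N \<phi>)) \<le> ennreal K * (\<Prod>x\<in>LB. ennreal (?w (\<phi> x - (if pred_site i x \<in> LB then \<phi> (pred_site i x) else 0))))"
      using ennreal_leI[OF exp_hamiltonian_le[of \<phi> i]] by (simp add: K_def prod_ennreal ennreal_mult prod_nonneg)
  qed
  also have "\<dots> = ennreal K * (\<integral>\<^sup>+\<phi>. (\<Prod>x\<in>LB. ennreal (?w (\<phi> x - (if pred_site i x \<in> LB then \<phi> (pred_site i x) else 0)))) \<partial>R \<beta>)"
  proof (rule nn_integral_cmult, rule borel_measurable_prod_ennreal)
    fix x assume "x \<in> LB"
    have "continuous_on X (\<lambda>\<phi>. ?w (\<phi> x - (if pred_site i x \<in> LB then \<phi> (pred_site i x) else 0)))"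
      by (intro continuous_intros continuous_on_compose2[OF V_cont]; cases "pred_site i x \<in> LB"; simp add: coord_continuous continuous_on_diff)
    from continuous_measurable[OF sets_R this]
    show "(\<lambda>\<phi>. ennreal (?w (\<phi> x - (if pred_site i x \<in> LB then \<phi> (pred_site i x) else 0)))) \<in> borel_measurable (R \<beta>)"
      by (rule measurable_compose) simp
  qed
  also have "\<dots> \<le> ennreal K * C ^ card LB"
    unfolding R_def by (intro mult_left_mono bond_product_integral_le C finite_lattice_box) auto
  also have "\<dots> < \<infinity>" using Cfin by (simp add: ennreal_mult_less_top power_less_top_ennreal)
  finally show ?thesis .
qed

text \<open>The integrand vanishes nowhere, and \<open>R \<beta>\<close> is not the zero measure,
  since the box around the origin has positive mass.\<close>

lemma Z_pos: "Z > 0"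
proof -
  have "Z \<noteq> 0"
  proof
    assume "Z = 0"
    then have "AE \<phi> in R \<beta>. ennreal (exp (- hamiltonian V N \<phi>)) = 0"
      unfolding Z_def using exp_hamiltonian_measurable by (subst (asm) nn_integral_0_iff_AE) auto
    then have "AE \<phi> in R \<beta>. False" by eventually_elim simp
    then have "emeasure (R \<beta>) X = 0" using AE_iff_null_sets[of X "R \<beta>"] sets.top[of "R \<beta>"] by (auto simp: space_R eventually_mono)
    moreover have "rbox (\<lambda>_. -1) (\<lambda>_. 1) \<noteq> {}"
    proof -
      have "(\<lambda>x\<in>LB. 0) \<in> rbox (\<lambda>_. -1) (\<lambda>_. 1)" by (auto simp: rbox_def X_def)
      then show ?thesis by blast
    qed
    then have "0 < emeasure (R \<beta>) (rbox (\<lambda>_. -1) (\<lambda>_. 1))" by (rule R_rbox_pos[OF \<beta>])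
    moreover have "emeasure (R \<beta>) (rbox (\<lambda>_. -1) (\<lambda>_. 1)) \<le> emeasure (R \<beta>) X"
      using sets.top[of "R \<beta>"] by (intro emeasure_mono) (auto simp: space_R rbox_def)
    ultimately show False by simp
  qed
  then show ?thesis by (simp add: zero_less_iff_neq_zero)
qed

definition \<rho> where "\<rho> \<phi> = exp (- hamiltonian V N \<phi>) / enn2real Z" for \<phi> :: "'d interface"

lemma Z_real: "Z = ennreal (enn2real Z)" "enn2real Z > 0"
  using Z_finite Z_pos by (auto simp: enn2real_positive_iff)

lemma \<rho>_eq: "ennreal (exp (- hamiltonian V N \<phi>)) / Z = ennreal (\<rho> \<phi>)"
  using Z_real by (simp add: \<rho>_def) (metis divide_ennreal exp_ge_zero)

sublocale om: orthant_measure LB \<beta> \<rho>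
proof
  show "\<beta> > 0" by (rule \<beta>)
  show "continuous_on X \<rho>" unfolding \<rho>_def[abs_def]
    using Z_real(2) by (intro continuous_intros hamiltonian_continuous) auto
  show "\<rho> \<phi> > 0" for \<phi> using Z_real(2) by (simp add: \<rho>_def)
  have "(\<integral>\<^sup>+\<phi>. ennreal (\<rho> \<phi>) \<partial>R \<beta>) = Z / Z"
    unfolding \<rho>_eq[symmetric] using exp_hamiltonian_measurable by (subst nn_integral_divide) (auto simp: Z_def)
  also have "\<dots> = 1" using Z_finite Z_pos by (intro ennreal_divide_self) auto
  finally show "(\<integral>\<^sup>+\<phi>. ennreal (\<rho> \<phi>) \<partial>R \<beta>) < \<infinity>" by simp
qed

lemma M_eq: "wetting_measure V \<beta> N = om.M"
  unfolding wetting_measure_def Let_def R_eq om.M_def \<rho>_eq[symmetric] Z_def ..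

section \<open>Test functions and form of the model\<close>

lemma G_pd: "om.G x F \<phi> = (if \<phi> x > 0 then pd x F \<phi> else 0)"
  by (simp add: om.G_def pd_def)

text \<open>\<open>Cc2\<close> speaks of derivatives in the open orthant with continuous extensions,
  \<open>C2c\<close> of derivatives wherever the coordinate in question is positive. The passage to
  the faces in the other coordinates is \<open>pdx_extend\<close>, applied once for each
  order.\<close>

lemma Cc2_eq: "Cc2 N = C2c"
proof (intro equalityI subsetI)
  fix F :: "'d interface \<Rightarrow> real" assume F: "F \<in> C2c"
  have d: "((\<lambda>t. H (\<phi>(x := t))) has_real_derivative h \<phi>) (at (\<phi> x))" "pd x H \<phi> = h \<phi>"
    if "pdx x H h" "\<phi> \<in> X" "\<phi> x > 0" for x H h \<phi>
  proof -
    show "((\<lambda>t. H (\<phi>(x := t))) has_real_derivative h \<phi>) (at (\<phi> x))" using that by (auto simp: pdx_def)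
    then show "pd x H \<phi> = h \<phi>" by (simp add: pd_def DERIV_imp_deriv)
  qed
  have Om: "\<phi> \<in> X" "\<phi> x > 0" if "\<phi> \<in> Omega N LB" "x \<in> LB" for \<phi> x
    using that by (auto simp: Omega_def X_eq)
  show "F \<in> Cc2 N" unfolding Cc2_def T_interface continuous_map_T
  proof (intro CollectI conjI ballI C2c_Cc[OF F])
    fix x assume x: "x \<in> LB"
    obtain g where g: "pdx x F g" "Ck 1 g" using C2c_Ck[OF F] x by (auto simp: numeral_2_eq_2)
    show "(\<lambda>t. F (\<phi>(x := t))) differentiable at (\<phi> x)" if "\<phi> \<in> Omega N LB" for \<phi>
      using d(1)[OF g(1) Om[OF that x]] unfolding real_differentiable_def by blast
    show "\<exists>g. continuous_on X g \<and> (\<forall>\<phi>\<in>Omega N LB. g \<phi> = pd x F \<phi>)"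
      using Ck_continuous[OF g(2)] d(2)[OF g(1)] Om x by (intro exI[of _ g]) auto
    fix y assume y: "y \<in> LB"
    obtain h where h: "pdx y g h" "continuous_on X h" using g(2) y by auto
    have d2: "((\<lambda>t. pd x F (\<phi>(y := t))) has_real_derivative h \<phi>) (at (\<phi> y))" if \<phi>: "\<phi> \<in> Omega N LB" for \<phi>
    proof (rule pdx_cong_line[OF h(1) y Om(1)[OF \<phi> y] Om(2)[OF \<phi> y]])
      fix t :: real assume "t > 0"
      then show "pd x F (\<phi>(y := t)) = g (\<phi>(y := t))"
        using X_upd[OF Om(1)[OF \<phi> y] y, of t] Om(2)[OF \<phi> x] by (intro d(2)[OF g(1)]) auto
    qed
    show "(\<lambda>t. pd x F (\<phi>(y := t))) differentiable at (\<phi> y)" if "\<phi> \<in> Omega N LB" for \<phi>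
      using d2[OF that] unfolding real_differentiable_def by blast
    show "\<exists>g. continuous_on X g \<and> (\<forall>\<phi>\<in>Omega N LB. g \<phi> = pd y (pd x F) \<phi>)"
      using h(2) DERIV_imp_deriv[OF d2] by (intro exI[of _ h]) (auto simp: pd_def[of y])
  qed
next
  fix F :: "'d interface \<Rightarrow> real" assume F: "F \<in> Cc2 N"
  have Om: "\<phi> \<in> Omega N LB" if "\<phi> \<in> X" "\<forall>x\<in>LB. \<phi> x > 0" for \<phi>
    using that by (auto simp: Omega_def X_eq)
  have pdI: "((\<lambda>t. H (\<phi>(x := t))) has_real_derivative pd x H \<phi>) (at (\<phi> x))"
    if "(\<lambda>t. H (\<phi>(x := t))) differentiable at (\<phi> x)" for H :: "'d interface \<Rightarrow> real" and x \<phi>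
    using that by (simp add: pd_def DERIV_deriv_iff_real_differentiable)
  have FC: "F \<in> Cc T" and Fc: "continuous_on X F" using F by (auto simp: Cc2_def T_interface Cc_iff)
  have "\<exists>g. pdx x F g \<and> Ck 1 g" if x: "x \<in> LB" for x
  proof -
    obtain g where g: "continuous_on X g" "\<forall>\<phi>\<in>Omega N LB. g \<phi> = pd x F \<phi>"
      using F x unfolding Cc2_def T_interface continuous_map_T by blast
    have dF: "(\<lambda>t. F (\<phi>(x := t))) differentiable at (\<phi> x)" if "\<phi> \<in> Omega N LB" for \<phi>
      using F x that unfolding Cc2_def by blast
    have p: "pdx x F g"
    proof (rule pdx_extend[OF Fc g(1) x])
      fix \<phi> assume \<phi>: "\<phi> \<in> X" "\<forall>x\<in>LB. \<phi> x > 0"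
      show "((\<lambda>t. F (\<phi>(x := t))) has_real_derivative g \<phi>) (at (\<phi> x))"
        using pdI[where H = F and x = x and \<phi> = \<phi>, OF dF[OF Om[OF \<phi>]]] g(2) Om[OF \<phi>] by simp
    qed
    have "\<exists>h. pdx y g h \<and> continuous_on X h" if y: "y \<in> LB" for y
    proof -
      obtain h where h: "continuous_on X h" "\<forall>\<phi>\<in>Omega N LB. h \<phi> = pd y (pd x F) \<phi>"
        using F x y unfolding Cc2_def T_interface continuous_map_T by blast
      have dF2: "(\<lambda>t. pd x F (\<phi>(y := t))) differentiable at (\<phi> y)" if "\<phi> \<in> Omega N LB" for \<phi>
        using F x y that unfolding Cc2_def by blast
      have "pdx y g h"
      proof (rule pdx_extend[OF g(1) h(1) y])
        fix \<phi> assume \<phi>: "\<phi> \<in> X" "\<forall>x\<in>LB. \<phi> x > 0"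
        have "((\<lambda>t. pd x F (\<phi>(y := t))) has_real_derivative h \<phi>) (at (\<phi> y))"
          using pdI[where H = "pd x F" and x = y and \<phi> = \<phi>, OF dF2[OF Om[OF \<phi>]]] h(2) Om[OF \<phi>] by simp
        \<comment> \<open>\<open>g\<close> is known to equal \<open>pd x F\<close> in the open
          orthant, so the two are compared on the open half-line \<open>t > 0\<close>.\<close>
        then show "((\<lambda>t. g (\<phi>(y := t))) has_real_derivative h \<phi>) (at (\<phi> y))"
        proof (rule has_field_derivative_transform_within_open[where S="{0<..}"])
          fix t :: real assume "t \<in> {0<..}"
          then have "\<phi>(y := t) \<in> Omega N LB" using X_upd[OF \<phi>(1) y, of t] \<phi>(2) by (intro Om) auto
          then show "pd x F (\<phi>(y := t)) = g (\<phi>(y := t))" using g(2) by simp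
        qed (use \<phi>(2) y in auto)
      qed
      then show ?thesis using h(1) by blast
    qed
    then show ?thesis using p g(1) by auto
  qed
  then show "F \<in> C2c" using FC Fc by (simp add: C2c_def numeral_2_eq_2)
qed

lemma Omega_measurable: "B \<subseteq> LB \<Longrightarrow> Omega N B \<in> sets om.M"
proof -
  assume B: "B \<subseteq> LB"
  have "Omega N B = {\<phi> \<in> space om.M. (\<forall>x\<in>B. \<phi> x > 0) \<and> (\<forall>x\<in>LB - B. \<phi> x = 0)}"
    by (auto simp: Omega_def om.space_M X_eq)
  also have "\<dots> \<in> sets om.M"
    using B finite_subset[OF B finite_lattice_box] finite_lattice_box
    by (intro sets.sets_Collect_conj sets.sets_Collect_finite_All' sets.sets_Collect_finite_All) 
       (auto intro!: borel_measurable_less borel_measurable_eq)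
  finally show ?thesis .
qed

text \<open>The sets \<open>Omega N B\<close> partition the space, and \<open>om.G x F\<close>
  vanishes on those with \<open>x\<close> outside \<open>B\<close>, so for each \<open>x\<close> the
  sum over \<open>B\<close> is an integral over the whole space.\<close>

lemma wetting_form_eq:
  assumes F: "F \<in> C2c" and H: "H \<in> C2c"
  shows "wetting_form V \<beta> N F H = (\<Sum>x\<in>LB. l2_inner om.M (om.G x F) (om.G x H))"
proof -
  let ?f = "\<lambda>x \<phi>. om.G x F \<phi> * om.G x H \<phi>"
  have i: "integrable om.M (?f x)" if "x \<in> LB" for x
    by (rule L2_mult_integrable[OF om.G_L2[OF F that] om.G_L2[OF H that]])
  have iB: "integrable om.M (\<lambda>\<phi>. indicator (Omega N B) \<phi> * ?f x \<phi>)" if "B \<subseteq> LB" "x \<in> LB" for B x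
    using integrable_mult_indicator[OF Omega_measurable[OF that(1)] i[OF that(2)]] by simp
  have t: "(\<integral>\<phi>. pd x F \<phi> * pd x H \<phi> \<partial>restrict_space om.M (Omega N B)) = (\<integral>\<phi>. indicator (Omega N B) \<phi> * ?f x \<phi> \<partial>om.M)"
    if "B \<subseteq> LB" "x \<in> B" for B x
  proof -
    have "(\<integral>\<phi>. pd x F \<phi> * pd x H \<phi> \<partial>restrict_space om.M (Omega N B)) = (\<integral>\<phi>. indicator (Omega N B) \<phi> *\<^sub>R (pd x F \<phi> * pd x H \<phi>) \<partial>om.M)"
      using Omega_measurable[OF that(1)] by (intro integral_restrict_space) auto
    also have "\<dots> = (\<integral>\<phi>. indicator (Omega N B) \<phi> * ?f x \<phi> \<partial>om.M)"
      using that(2) by (intro Bochner_Integration.integral_cong) (auto simp: indicator_def G_pd Omega_def)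
    finally show ?thesis .
  qed
  have "wetting_form V \<beta> N F H = (\<Sum>B\<in>Pow LB - {{}}. \<Sum>x\<in>B. (\<integral>\<phi>. indicator (Omega N B) \<phi> * ?f x \<phi> \<partial>om.M))"
    unfolding wetting_form_def M_eq by (intro sum.cong refl t) auto
  also have "\<dots> = (\<Sum>B\<in>Pow LB. \<Sum>x\<in>B. (\<integral>\<phi>. indicator (Omega N B) \<phi> * ?f x \<phi> \<partial>om.M))"
    using finite_lattice_box by (intro sum.mono_neutral_left) auto
  also have "\<dots> = (\<Sum>B\<in>Pow LB. \<Sum>x\<in>LB. (\<integral>\<phi>. indicator (Omega N B) \<phi> * ?f x \<phi> \<partial>om.M))"
  proof (rule sum.cong[OF refl], rule sum.mono_neutral_left[OF finite_lattice_box _ ballI])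
    fix B x assume B: "B \<in> Pow LB" "x \<in> LB - B"
    have "(\<lambda>\<phi>. indicator (Omega N B) \<phi> * ?f x \<phi>) = (\<lambda>\<phi>. 0)"
      using B by (auto simp: fun_eq_iff indicator_def Omega_def om.G_def)
    then show "(\<integral>\<phi>. indicator (Omega N B) \<phi> * ?f x \<phi> \<partial>om.M) = 0" by simp
  qed auto
  also have "\<dots> = (\<Sum>x\<in>LB. \<Sum>B\<in>Pow LB. (\<integral>\<phi>. indicator (Omega N B) \<phi> * ?f x \<phi> \<partial>om.M))"
    by (rule sum.swap)
  also have "\<dots> = (\<Sum>x\<in>LB. l2_inner om.M (om.G x F) (om.G x H))"
  proof (intro sum.cong refl)
    fix x assume x: "x \<in> LB"
    have "(\<Sum>B\<in>Pow LB. (\<integral>\<phi>. indicator (Omega N B) \<phi> * ?f x \<phi> \<partial>om.M)) = (\<integral>\<phi>. (\<Sum>B\<in>Pow LB. indicator (Omega N B) \<phi> * ?f x \<phi>) \<partial>om.M)"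
      by (rule Bochner_Integration.integral_sum[symmetric]) (use iB x in auto)
    also have "\<dots> = (\<integral>\<phi>. ?f x \<phi> \<partial>om.M)"
    proof (intro Bochner_Integration.integral_cong refl)
      fix \<phi> assume "\<phi> \<in> space om.M"
      then have \<phi>: "\<phi> \<in> X" by (simp add: om.space_M)
      \<comment> \<open>The positive coordinates of \<open>\<phi>\<close> determine the one part of
        the partition that contains it.\<close>
      let ?B = "{y \<in> LB. \<phi> y > 0}"
      have "indicator (Omega N B) \<phi> = (if B = ?B then 1 else (0::real))" if "B \<in> Pow LB" for B
      proof -
        have "\<phi> \<in> Omega N B \<longleftrightarrow> B = ?B"
        proof
          assume "\<phi> \<in> Omega N B"
          then have "\<forall>y\<in>B. \<phi> y > 0" "\<forall>y\<in>LB - B. \<phi> y = 0" by (auto simp: Omega_def)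
          then show "B = ?B" using that by (intro equalityI subsetI CollectI conjI) (auto, force)
        next
          assume B: "B = ?B"
          have "\<phi> y = 0" if "y \<in> LB - ?B" for y
            using X_nonneg[OF \<phi>, of y] that by auto
          then show "\<phi> \<in> Omega N B" unfolding B Omega_def using \<phi> by (simp add: X_eq)
        qed
        then show ?thesis by (simp add: indicator_def)
      qed
      then have "(\<Sum>B\<in>Pow LB. indicator (Omega N B) \<phi> * ?f x \<phi>) = (\<Sum>B\<in>Pow LB. if B = ?B then ?f x \<phi> else 0)"
        by (intro sum.cong) auto
      also have "\<dots> = ?f x \<phi>" using finite_lattice_box by (subst sum.delta) auto
      finally show "(\<Sum>B\<in>Pow LB. indicator (Omega N B) \<phi> * ?f x \<phi>) = ?f x \<phi>" .
    qed
    finally show "(\<Sum>B\<in>Pow LB. (\<integral>\<phi>. indicator (Omega N B) \<phi> * ?f x \<phi> \<partial>om.M)) = l2_inner om.M (om.G x F) (om.G x H)"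
      by (simp add: l2_inner_def)
  qed
  finally show ?thesis .
qed

sublocale orthant_form LB \<beta> \<rho> "wetting_form V \<beta> N"
  by standard (rule wetting_form_eq)

end

theorem theorem6p6:
  fixes N :: nat and \<beta> b :: real and V :: "real \<Rightarrow> real"
    and \<mu> :: "'d::finite interface measure"
    and T :: "'d interface topology"
    and D0 D :: "('d interface \<Rightarrow> real) set"
    and E0 E :: "'d interface form"
  assumes "N \<ge> 1" and "\<beta> > 0" and "b \<ge> 0"
    and "\<And>r. V r \<ge> - b"
    and "V C1_differentiable_on UNIV"
    and "\<And>r. V (- r) = V r"
    and "integrable lborel (\<lambda>r. exp (- V r))"
    and mu: "\<mu> = wetting_measure V \<beta> N"
    and deriv_L2: "\<And>x. x \<in> lattice_box N \<Longrightarrow> interaction_deriv V N x \<in> L2 \<mu>"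
    and T: "T = interface_topology N"
    and D0: "D0 = Cc2 N"
    and E0: "E0 = wetting_form V \<beta> N"
    and D: "D = closure_domain \<mu> D0 E0"
    and E: "E = closure_form \<mu> D0 E0"
  shows "densely_defined \<mu> D0 \<and> bilinear_form \<mu> D0 E0 \<and> symmetric_form D0 E0 \<and>
         positive_definite_form D0 E0 \<and> closable \<mu> D0 E0 \<and>
         symmetric_Dirichlet_form \<mu> D E \<and> recurrent \<mu> D E \<and> conservative \<mu> D E \<and>
         strongly_local T \<mu> D E \<and> strongly_regular T \<mu> D E"
proof -
  interpret w: wetting N \<beta> b V "TYPE('d)"
  proof
    show "continuous_on UNIV V"
      using \<open>V C1_differentiable_on UNIV\<close> by (rule C1_differentiable_imp_continuous_on)
  qed (use assms in auto)
  have eqs: "\<mu> = w.om.M" "D0 = w.C2c" "T = product_topology (\<lambda>_. top_of_set {0..}) (lattice_box N)"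
    by (simp_all add: mu D0 T w.M_eq w.Cc2_eq w.T_interface)
  show ?thesis
    unfolding D E E0 eqs
    using w.df.dense_D0 w.df.bilinear_E0 w.df.symmetric_E0 w.df.positive_E0 w.df.closable_E0
      w.df.Dirichlet_En w.dn.is_recurrent w.dn.is_conservative w.is_strongly_local w.is_strongly_regular
    by blast
qed

end
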